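(* Let $g$, $g_q$ ($q\ge1$ an integer) and $f$ be the gap density functions $$g(t)=\frac{d}{dt}m_\Omega(R^{-1}(0,t)),\qquad g_q(t)=\frac{d}{dt}m_q(R^{-1}(0,t)),\qquad f(t)=\frac{d}{dt}m_{\mathcal{W}}(\mathcal{R}^{-1}(0,t)).$$ Then: 1. For any affine lattice in $\Omega$ that is generic for $m_\Omega$, the proportion of gaps larger than $t$, namely $\int_t^\infty g(x)\,dx$, satisfies $$t^{-2}\ll\int_t^\infty g(x)\,dx\ll t^{-1}.$$ 2. There is support at zero for any affine lattice in $\Omega$ that is generic for $m_\Omega$: for every $\varepsilon>0$, $\int_0^\varepsilon g(x)\,dx>0$. 3. For any affine lattice in $\Omega$ that is generic for a torsion measure $m_q$, the proportion of gaps larger than $t$ satisfies $$\int_t^\infty g_q(x)\,dx\asymp t^{-2}.$$ 4. For any doubled slit torus in $\mathcal{W}$ that is generic for $m_{\mathcal{W}}$, the proportion of gaps of saddle connections larger than $t$ decays quadratically: $$\int_t^\infty f(x)\,dx\sim t^{-2}.$$ 5. There is support at zero for any doubled slit torus in $\mathcal{W}$ that is generic for $m_{\mathcal{W}}$: for every $\varepsilon>0$, $\int_0^\varepsilon f(x)\,dx>0$.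
   Context: Asymptotic notation as $t\to\infty$: $F\sim G$ means $F/G$ tends to a positive constant; $F\ll G$ means there is $c>0$ with $|F(t)|\le c|G(t)|$ for all large $t$; $F\asymp G$ means that for large $t$ the ratio $F/G$ is bounded between two positive constants. Affine lattices: $(h,v):=h\mathbb{Z}^2+v$, $h\in SL_2(\mathbb{R})$, $v\in\mathbb{R}^2$; $AX_2=(SL_2(\mathbb{R})\ltimes\mathbb{R}^2)/(SL_2(\mathbb{Z})\ltimes\mathbb{Z}^2)$ is the space of affine lattices, with the linear action of $SL_2(\mathbb{R})$. Set $$h_u=\begin{pmatrix}1&0\\-u&1\end{pmatrix},\quad p_{a,b}=\begin{pmatrix}a&b\\0&a^{-1}\end{pmatrix},\quad \Delta=\{(a,b):0<a\le1,\ 1-a<b\le1\}.$$ $\Omega\subset AX_2$ is the set of affine lattices containing a vector $(x,0)$ with $0<x\le1$. Off a lower dimensional set its elements are $(h_sp_{a,b},(\alpha,0)^T)$ with $(a,b)\in\Delta$, $0\le s<(ab)^{-1}$, $0<\alpha\le1$, giving coordinates $(a,b,s,\alpha)$. $R(\Lambda)=\min\{u>0:h_u\Lambda\in\Omega\}$ is the first return time and $T(\Lambda)=h_{R(\Lambda)}\Lambda$ the return map. $m_\Omega$ is the probability measure on $\Omega$ proportional to $ds\,db\,da\,d\alpha$. For an integer $q\ge1$, the torsion measure $m_q$ is the probability measure proportional to the push-forward of $da\,db$ on $\Delta$ under $(a,b)\mapsto(p_{a,b},(a/q,0)^T)\in\Omega$. Doubled slit tori: take two identical copies of a unit-area flat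 torus $\mathbb{R}^2/h\mathbb{Z}^2$, cut both along the same straight slit joining $0$ to a distinct point $v+h\mathbb{Z}^2$, and glue each side of the slit in one copy to the opposite side in the other. $\mathcal{E}$ is the space of all such translation surfaces. Forgetting the slit gives a degree-four map $\Pi:\mathcal{E}\to AX_2$, $\Pi(\omega)=(h,v)$ (four oriented trajectories between the marked points, one for each corner of the fundamental parallelogram spanned by the columns of $h$, are considered as slits). $\Lambda_\omega$ is the set of holonomy vectors of oriented saddle connections of $\omega$ (a saddle connection is a flat geodesic segment between singular points with no singular point in its interior); under the standing assumption that $v$ has irrational slope, $\Lambda_\omega=h\mathbb{Z}^2_{\mathrm{prim}}\cup(h\mathbb{Z}^2+v)\cup(-h\mathbb{Z}^2-v)$, with $h\mathbb{Z}^2_{\mathrm{prim}}$ the image under $h$ of the primitive integer vectors. $\mathcal{W}=\{\omega\in\mathcal{E}:\Lambda_\omega\text{ contains some }(x,0)\text{ with }0<x\le1\}$; $\mathcal{R}(\omega)=\min\{u>0:h_u\omega\in\mathcal{W}\}$ and $\mathcal{T}(\omega)=h_{\mathcal{R}(\omega)}\omega$. Up to measure zero $\mathcal{W}=\mathcal{W}_{sl}\cup\mathcal{W}_{sa}$, where $\omega\in\mathcal{W}_{sl}$ iff $\Pi(\omega)=(p_{a,b},v)$ with $(a,b)\in\Delta$, and $\omega\in\mathcal{W}_{sa}$ iff $\Pi(\omega)\in\Omega$. $m_{\mathcal{W}}$ is the probability measure on $\mathcal{W}$ proportional to the sum of the measures $$F\mapsto 4\int_\Omega F(a,b,s,\alpha)\,ds\,db\,da\,d\alpha\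 \text{ on }\mathcal{W}_{sa},\qquad F\mapsto4\iint_{(a,b)\in\Delta}\int_{v\in\mathbb{R}^2/p_{a,b}\mathbb{Z}^2}F(a,b,v)\,dv\,db\,da\ \text{ on }\mathcal{W}_{sl},$$ where $4$ reflects the degree of $\Pi$. Gaps: for $L=\Lambda$ (an affine lattice) or $L=\Lambda_\omega$, let $0<s_1<s_2<\cdots$ be the slopes $y/x$ of the vectors $(x,y)\in L$ with $0<x\le1$, $y>0$, and $s_0=0$; the gaps are $s_i-s_{i-1}$, and $\mathcal{G}^N_V(L)=\{s_i-s_{i-1}:1\le i\le N\}$. The proportion of gaps in $I$ is $\lim_{N\to\infty}|\mathcal{G}^N_V(L)\cap I|/N$. A point is generic for $\mu$ (one of $m_\Omega,m_q,m_{\mathcal{W}}$) if its Birkhoff averages under the return map converge to the $\mu$-averages; in particular the proportion of gaps in $I$ is then $\mu(R^{-1}(I))$ (respectively $\mu(\mathcal{R}^{-1}(I))$). *)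

theory Defs
  imports "HOL-Analysis.Analysis" "HOL-Library.Landau_Symbols"
begin

section \<open>Affine lattices\<close>

definition lattice :: "real^2^2 \<Rightarrow> (real^2) set" where
  "lattice h = {h *v z | z. \<forall>i. z $ i \<in> \<int>}"

definition affine_lattice :: "real^2^2 \<Rightarrow> real^2 \<Rightarrow> (real^2) set" where
  "affine_lattice h v = {z + v | z. z \<in> lattice h}"

definition AX2 :: "(real^2) set set" where
  "AX2 = {affine_lattice h v | h v. det h = 1}"

definition hmat :: "real \<Rightarrow> real^2^2" where
  "hmat u = vector [vector [1, 0], vector [- u, 1]]"

definition pmat :: "real \<Rightarrow> real \<Rightarrow> real^2^2" where
  "pmat a b = vector [vector [a, b], vector [0, 1 / a]]"

definition Delta :: "(real \<times> real) set" where
  "Delta = {(a, b). 0 < a \<and> a \<le> 1 \<and> 1 - a < b \<and> b \<le> 1}"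

definition short_horizontal :: "(real^2) set \<Rightarrow> bool" where
  "short_horizontal S \<longleftrightarrow> (\<exists>x. 0 < x \<and> x \<le> 1 \<and> vector [x, 0] \<in> S)"

definition Omega :: "(real^2) set set" where
  "Omega = {\<Lambda> \<in> AX2. short_horizontal \<Lambda>}"

definition act_AX2 :: "real^2^2 \<Rightarrow> (real^2) set \<Rightarrow> (real^2) set" where
  "act_AX2 A \<Lambda> = (\<lambda>x. A *v x) ` \<Lambda>"

definition R_Omega :: "(real^2) set \<Rightarrow> real" where
  "R_Omega \<Lambda> = (LEAST u. u > 0 \<and> act_AX2 (hmat u) \<Lambda> \<in> Omega)"

definition T_Omega :: "(real^2) set \<Rightarrow> (real^2) set" where
  "T_Omega \<Lambda> = act_AX2 (hmat (R_Omega \<Lambda>)) \<Lambda>"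

text \<open>Topology and Borel structure on \<open>Omega\<close> are those of the quotient of
  \<open>SL\<^sub>2(\<real>) \<times> \<real>\<^sup>2\<close>, tested on preimages under \<open>(h, v) \<mapsto> affine_lattice h v\<close>.\<close>

definition Omega_lift :: "(real^2) set set \<Rightarrow> ((real^2^2) \<times> (real^2)) set" where
  "Omega_lift A = {(h, v). det h = 1 \<and> affine_lattice h v \<in> A}"

definition Omega_borel :: "(real^2) set measure" where
  "Omega_borel = sigma Omega {A. A \<subseteq> Omega \<and> Omega_lift A \<in> sets borel}"

definition Omega_test :: "((real^2) set \<Rightarrow> real) set" where
  "Omega_test = {\<phi>. bounded (\<phi> ` Omega) \<and>
     continuous_on (Omega_lift Omega) (\<lambda>(h, v). \<phi> (affine_lattice h v))}"

definition Omega_coords :: "(real \<times> real \<times> real \<times> real) set" where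
  "Omega_coords = {(a, b, s, \<alpha>). (a, b) \<in> Delta \<and> 0 \<le> s \<and> s < 1 / (a * b) \<and> 0 < \<alpha> \<and> \<alpha> \<le> 1}"

definition m_Omega :: "(real^2) set measure" where
  "m_Omega = distr (uniform_measure (restrict_space lborel Omega_coords) Omega_coords) Omega_borel
     (\<lambda>(a, b, s, \<alpha>). affine_lattice (hmat s ** pmat a b) (vector [\<alpha>, 0]))"

definition m_tor :: "nat \<Rightarrow> (real^2) set measure" where
  "m_tor q = distr (uniform_measure (restrict_space lborel Delta) Delta) Omega_borel
     (\<lambda>(a, b). affine_lattice (pmat a b) (vector [a / real q, 0]))"

section \<open>Doubled slit tori\<close>

text \<open>The slit is the image in \<open>\<real>\<^sup>2 / h\<int>\<^sup>2\<close> of the segment from \<open>0\<close> to \<open>w\<close>; it has to be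
  embedded, which includes that its end points are distinct.\<close>

definition is_slit :: "real^2^2 \<Rightarrow> real^2 \<Rightarrow> bool" where
  "is_slit h w \<longleftrightarrow>
     (\<forall>r\<in>{0..1}. \<forall>s\<in>{0..1}. r \<noteq> s \<longrightarrow> r *\<^sub>R w - s *\<^sub>R w \<notin> lattice h)"

definition open_slit :: "real^2^2 \<Rightarrow> real^2 \<Rightarrow> (real^2) set" where
  "open_slit h w = {r *\<^sub>R w + z | r z. 0 < r \<and> r < 1 \<and> z \<in> lattice h}"

definition marked :: "real^2^2 \<Rightarrow> real^2 \<Rightarrow> (real^2) set" where
  "marked h w = lattice h \<union> affine_lattice h w"

text \<open>The surface obtained from two copies of the torus, labelled by \<open>bool\<close>, cut along the slit
  and reglued crosswise. A nonsingular point over the torus point \<open>x\<close> is \<open>(x, i)\<close>, where a point of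
  the open slit is labelled by the copy to which its left side (with respect to the direction \<open>w\<close>)
  belongs; the right side at this point then lies in the other copy. Over each of \<open>0\<close> and \<open>w\<close> there
  is a single point, the singularities. A straight segment \<open>t \<mapsto> p + t x\<close> in the surface
  carries a label \<open>\<sigma> t\<close> which is locally constant, except for the change of copy on the right
  side of the slit. A saddle connection is such a segment whose end points, but no interior points,
  are singular; its holonomy vector is \<open>x\<close>.\<close>

definition saddle_holonomy :: "real^2^2 \<Rightarrow> real^2 \<Rightarrow> real^2 \<Rightarrow> bool" where
  "saddle_holonomy h w x \<longleftrightarrow>
     (\<exists>p \<in> {0, w}. \<exists>\<sigma> :: real \<Rightarrow> bool.
        p + x \<in> marked h w \<and>
        (\<forall>t \<in> {0<..<1}. p + t *\<^sub>R x \<notin> marked h w) \<and>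
        (\<forall>t \<in> {0<..<1}. \<forall>\<^sub>F t' in at t.
            \<sigma> t' = (if p + t *\<^sub>R x \<in> open_slit h w \<and> det (vector [w, (t' - t) *\<^sub>R x]) < 0
                    then \<not> \<sigma> t else \<sigma> t)))"

text \<open>The surface is a double cover of the torus branched over \<open>0\<close> and \<open>w\<close>. Slits \<open>w\<close> and \<open>w'\<close> on the
  same torus with the same end points give the same cover iff \<open>w - w' \<in> 2 h\<int>\<^sup>2\<close>, so the surface
  is encoded by the lattice and the class of \<open>w\<close> modulo \<open>2 h\<int>\<^sup>2\<close>.\<close>

type_synonym surface = "(real^2) set \<times> (real^2) set"

definition slit_torus :: "real^2^2 \<Rightarrow> real^2 \<Rightarrow> surface" where
  "slit_torus h w = (lattice h, {w + 2 *\<^sub>R z | z. z \<in> lattice h})"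

definition E_space :: "surface set" where
  "E_space = {slit_torus h w | h w. det h = 1 \<and> is_slit h w}"

definition holonomy :: "surface \<Rightarrow> (real^2) set" where
  "holonomy \<omega> = {x. \<exists>h w. det h = 1 \<and> is_slit h w \<and> \<omega> = slit_torus h w \<and> saddle_holonomy h w x}"

definition W_space :: "surface set" where
  "W_space = {\<omega> \<in> E_space. short_horizontal (holonomy \<omega>)}"

definition act_E :: "real^2^2 \<Rightarrow> surface \<Rightarrow> surface" where
  "act_E A \<omega> = ((\<lambda>x. A *v x) ` fst \<omega>, (\<lambda>x. A *v x) ` snd \<omega>)"

definition R_W :: "surface \<Rightarrow> real" where
  "R_W \<omega> = (LEAST u. u > 0 \<and> act_E (hmat u) \<omega> \<in> W_space)"

definition T_W :: "surface \<Rightarrow> surface" where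
  "T_W \<omega> = act_E (hmat (R_W \<omega>)) \<omega>"

definition W_lift :: "surface set \<Rightarrow> ((real^2^2) \<times> (real^2)) set" where
  "W_lift A = {(h, w). det h = 1 \<and> slit_torus h w \<in> A}"

definition W_test :: "(surface \<Rightarrow> real) set" where
  "W_test = {\<phi>. bounded (\<phi> ` W_space) \<and>
     continuous_on (W_lift W_space) (\<lambda>(h, w). \<phi> (slit_torus h w))}"

text \<open>The four surfaces over the affine lattice \<open>(h, v)\<close> are given by the slits joining the
  corners \<open>h e\<close> of the fundamental parallelogram to \<open>v\<close>.\<close>

definition corners :: "(real^2) set" where
  "corners = {e. \<forall>i. e $ i \<in> {0, 1}}"

definition sa_mass :: "surface set \<Rightarrow> ennreal" where
  "sa_mass A = (\<Sum>e\<in>corners. emeasure lborel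
     {(a, b, s, \<alpha>) \<in> Omega_coords.
        let h = hmat s ** pmat a b in slit_torus h (vector [\<alpha>, 0] - h *v e) \<in> A})"

text \<open>Here \<open>v = pmat a b *v (x, y)\<close> with \<open>(x, y) \<in> [0, 1)\<^sup>2\<close> parametrises
  \<open>\<real>\<^sup>2 / pmat a b \<int>\<^sup>2\<close>, and \<open>dv = dx dy\<close> since the determinant is \<open>1\<close>.\<close>

definition sl_mass :: "surface set \<Rightarrow> ennreal" where
  "sl_mass A = (\<Sum>e\<in>corners. emeasure lborel
     {(a, b, x, y). (a, b) \<in> Delta \<and> x \<in> {0..<1::real} \<and> y \<in> {0..<1::real} \<and>
        slit_torus (pmat a b) (pmat a b *v vector [x, y] - pmat a b *v e) \<in> A})"

definition m_W :: "surface measure" where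
  "m_W = measure_of W_space {A. A \<subseteq> W_space \<and> W_lift A \<in> sets borel}
     (\<lambda>A. (sa_mass A + sl_mass A) / (sa_mass W_space + sl_mass W_space))"

section \<open>Generic points, gaps and gap densities\<close>

text \<open>Birkhoff averages are required to converge for the bounded continuous observables \<open>C\<close> and for
  the indicator functions of preimages of intervals under the return time \<open>R\<close>. The latter need not
  follow from the former, as \<open>R\<close> may be discontinuous on a set of positive \<open>\<mu>\<close>-measure.\<close>

definition generic ::
    "'a measure \<Rightarrow> ('a \<Rightarrow> real) set \<Rightarrow> ('a \<Rightarrow> real) \<Rightarrow> ('a \<Rightarrow> 'a) \<Rightarrow> 'a \<Rightarrow> bool" where
  "generic \<mu> C R T x \<longleftrightarrow>
     (\<forall>\<phi> \<in> C \<union> {\<lambda>y. indicator I (R y) | I. is_interval I}.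
        (\<lambda>N. (\<Sum>i<N. \<phi> ((T ^^ i) x)) / real N) \<longlonglongrightarrow> (\<integral>y. \<phi> y \<partial>\<mu>))"

definition slopes :: "(real^2) set \<Rightarrow> real set" where
  "slopes L = {z $ 2 / z $ 1 | z. z \<in> L \<and> 0 < z $ 1 \<and> z $ 1 \<le> 1 \<and> z $ 2 > 0}"

primrec slope_seq :: "(real^2) set \<Rightarrow> nat \<Rightarrow> real" where
  "slope_seq L 0 = 0"
| "slope_seq L (Suc n) = (LEAST s. s \<in> slopes L \<and> s > slope_seq L n)"

definition gap_proportion :: "(real^2) set \<Rightarrow> real set \<Rightarrow> real \<Rightarrow> bool" where
  "gap_proportion L I p \<longleftrightarrow>
     (\<lambda>N. real (card {i \<in> {1..N}. slope_seq L i - slope_seq L (i - 1) \<in> I}) / real N) \<longlonglongrightarrow> p"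

definition gap_density :: "'a measure \<Rightarrow> ('a \<Rightarrow> real) \<Rightarrow> real \<Rightarrow> real" where
  "gap_density \<mu> R = deriv (\<lambda>t. measure \<mu> {x \<in> space \<mu>. R x \<in> {0<..<t}})"

definition tail :: "(real \<Rightarrow> real) \<Rightarrow> real \<Rightarrow> real" where
  "tail g t = (LINT x:{t<..}|lborel. g x)"

text \<open>\<open>F / G\<close> is eventually bounded between two positive constants, respectively tends to
  a positive constant (not necessarily \<open>1\<close>).\<close>

definition comparable :: "(real \<Rightarrow> real) \<Rightarrow> (real \<Rightarrow> real) \<Rightarrow> bool" where
  "comparable F G \<longleftrightarrow>
     (\<exists>c>0. \<exists>C>0. \<forall>\<^sub>F t in at_top. c \<le> F t / G t \<and> F t / G t \<le> C)"

definition asymptotic :: "(real \<Rightarrow> real) \<Rightarrow> (real \<Rightarrow> real) \<Rightarrow> bool" where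
  "asymptotic F G \<longleftrightarrow> (\<exists>c>0. ((\<lambda>t. F t / G t) \<longlongrightarrow> c) at_top)"

end

theory Submission imports Defs "HOL-Analysis.Kronecker_Approximation_Theorem" begin

text \<open>
  Gaps are return times. The shear \<open>hmat u\<close> lowers every slope by \<open>u\<close>, so the first return
  time of a lattice or surface is its smallest slope, and the return times along its orbit are the
  successive gaps (\<open>gap_eq_return_time\<close>). For a generic point the proportion of gaps in an interval is
  therefore the measure of the set where the return time lies in this interval. To express it by the
  gap density, which is a pointwise derivative, the law of the return time has to be absolutely
  continuous: in suitable coordinates every slope is, for fixed values of the remaining coordinates, a
  nonconstant Moebius function or a reflection of a single one, so it avoids a given null set almost surely
  (\<open>null_sets_strip_slopes_sa\<close>, \<open>null_sets_strip_slopes_sl\<close>), and Lebesgue's differentiation theorem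
  does the rest (\<open>set_integral_gap_density\<close>).

  For a doubled slit torus the holonomy vectors may be replaced by all differences of singular points,
  that is by the lattice \<open>L\<close> and the two affine lattices \<open>L + v\<close> and \<open>L - v\<close>: a difference is a
  multiple, by a factor at least \<open>1\<close>, of a holonomy vector in the same direction
  (\<open>slopes_holonomy\<close>). Almost all surfaces have irrational slits, so almost all coordinates do
  describe a surface.

  As a result the tail of each density at \<open>t\<close> is the normalised volume of a set of coordinates: those for
  which the triangle \<open>0 < x \<le> 1\<close>, \<open>0 < y \<le> t x\<close> contains no point of the affine lattice, respectively
  no point of the lattice and of its two translates (\<open>tail_eqs\<close>). The complement of this set contains a
  nonempty open set for every \<open>t > 0\<close>, which gives support at zero.

  For large \<open>t\<close> the triangle has large area. A lattice whose translate misses it has \<open>(a, b)\<close> near one of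
  the corners \<open>(0, 1)\<close> and \<open>(1, 0)\<close> of \<open>Delta\<close>, unless \<open>\<alpha>\<close> lies in one of two bands of width
  \<open>4 / t\<close>. The volumes of the bands and of the cusps at the corners give the upper bound of order
  \<open>1 / t\<close> for affine lattices (\<open>measure_sa_clear_upper\<close>), and an explicit box in a cusp gives the lower
  bound (\<open>measure_sa_clear_lower\<close>). The torsion measures have only two coordinates, and the region is
  contained in, and contains, boxes of volume of order \<open>1 / t\<^sup>2\<close> (\<open>measure_tor_bounds\<close>).

  For slit tori the lattice itself has to miss the triangle too, which excludes the bands and forces
  \<open>(a, b)\<close> into a neighbourhood of a corner of size of order \<open>1 / t\<close>. In the blown-up coordinates
  \<open>a = A / t\<close>, \<open>b = 1 - \<theta> a\<close>, and similarly at the other corner, the Jacobian is \<open>1 / t\<^sup>2\<close> up to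
  a weight independent of \<open>t\<close>, the regions stay bounded, and membership of almost every point becomes
  constant as \<open>t \<rightarrow> \<infinity>\<close>. By dominated convergence \<open>t\<^sup>2\<close> times the volume converges to a sum of
  weighted volumes of explicit limit regions (\<open>tendsto_sa_clear\<close>, \<open>tendsto_sl_clear\<close>), one of which
  is positive.
\<close>

section \<open>Densities of absolutely continuous laws\<close>

text \<open>\<open>deriv f x\<close> is a Hilbert choice, and the choice from an unsatisfiable predicate is one fixed
  value.\<close>

lemma deriv_default_constant:
  assumes "\<not> f differentiable (at x)" "\<not> f differentiable (at y)"
  shows "deriv f x = deriv (f::real\<Rightarrow>real) y"
proof -
  have "(f has_field_derivative D) (at z) = False" if "\<not> f differentiable (at z)" for D z
    using that real_differentiable_def by blast
  then show ?thesis using assms unfolding deriv_def by simp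
qed

text \<open>Difference quotients of a continuous function are continuous in the increment away from \<open>0\<close>, so the
  Cauchy criterion for their convergence may be tested on rational increments. This writes the set
  of points of differentiability as a countable combination of Borel sets.\<close>

lemma differentiable_iff_quotients_Cauchy_rat:
  fixes f :: "real \<Rightarrow> real"
  assumes cont: "continuous_on UNIV f"
  shows "f differentiable (at x) \<longleftrightarrow>
    (\<forall>k::nat. \<exists>n::nat. \<forall>r s::rat. 0 < \<bar>real_of_rat r\<bar> \<and> \<bar>real_of_rat r\<bar> < 1 / Suc n
         \<and> 0 < \<bar>real_of_rat s\<bar> \<and> \<bar>real_of_rat s\<bar> < 1 / Suc n \<longrightarrow>
       \<bar>(f (x + of_rat r) - f x) / of_rat r - (f (x + of_rat s) - f x) / of_rat s\<bar> \<le> 1 / Suc k)" (is "_ \<longleftrightarrow> ?Q")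
proof -
  let ?C = "\<forall>k::nat. \<exists>n::nat. \<forall>r\<in>\<rat>. \<forall>s\<in>\<rat>. 0 < \<bar>r\<bar> \<and> \<bar>r\<bar> < 1 / Suc n \<and> 0 < \<bar>s\<bar> \<and> \<bar>s\<bar> < 1 / Suc n \<longrightarrow>
       \<bar>(f (x + r) - f x) / r - (f (x + s) - f x) / s\<bar> \<le> 1 / Suc k"
  have "?Q \<longleftrightarrow> ?C" 
  proof -
    have "(\<forall>r\<in>\<rat>. P r) \<longleftrightarrow> (\<forall>r. P (real_of_rat r))" for P
      by (metis Rats_cases Rats_of_rat)
    then show ?thesis by (simp only:)
  qed
  moreover have "f differentiable (at x) \<longleftrightarrow> ?C"
  proof
    assume "f differentiable (at x)"
    then obtain D where "DERIV f x :> D" using real_differentiable_def by blast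
    then have lim: "((\<lambda>h. (f (x + h) - f x) / h) \<longlongrightarrow> D) (at 0)" by (simp add: DERIV_def)
    show ?C
    proof
      fix k :: nat
      define e where "e = 1 / real (Suc k)"
      have e: "e > 0" unfolding e_def by simp
      have "\<forall>\<^sub>F h in at 0. dist ((f (x + h) - f x) / h) D < e / 2"
        using lim by (rule tendstoD) (use e in simp)
      then obtain d where d: "d > 0" "\<And>h. h \<noteq> 0 \<Longrightarrow> \<bar>h\<bar> < d \<Longrightarrow> dist ((f (x + h) - f x) / h) D < e / 2"
        unfolding eventually_at by (auto simp: dist_real_def)
      obtain n :: nat where n: "1 / Suc n < d" using d(1) nat_approx_posE by blast
      have "\<bar>(f (x + r) - f x) / r - (f (x + s) - f x) / s\<bar> \<le> 1 / Suc k"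
        if "0 < \<bar>r\<bar> \<and> \<bar>r\<bar> < 1 / Suc n \<and> 0 < \<bar>s\<bar> \<and> \<bar>s\<bar> < 1 / Suc n" for r s
      proof -
        have "dist ((f (x + r) - f x) / r) D < e / 2" "dist ((f (x + s) - f x) / s) D < e / 2"
          using that n d(2) by auto
        then show ?thesis unfolding dist_real_def e_def[symmetric] by linarith
      qed
      then show "\<exists>n::nat. \<forall>r\<in>\<rat>. \<forall>s\<in>\<rat>. 0 < \<bar>r\<bar> \<and> \<bar>r\<bar> < 1 / Suc n \<and> 0 < \<bar>s\<bar> \<and> \<bar>s\<bar> < 1 / Suc n \<longrightarrow>
         \<bar>(f (x + r) - f x) / r - (f (x + s) - f x) / s\<bar> \<le> 1 / Suc k" by blast
    qed
  next
    assume C: ?C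
    define q where "q h = (f (x + h) - f x) / h" for h
    have qcont: "isCont q h" if "h \<noteq> 0" for h
      unfolding q_def
    proof -
      have "continuous_on UNIV (\<lambda>h. f (x + h))"
        by (intro continuous_on_compose2[OF cont] continuous_intros) auto
      then have "isCont (\<lambda>h. f (x + h)) h" by (simp add: continuous_on_eq_continuous_at)
      then show "isCont (\<lambda>h. (f (x + h) - f x) / h) h" using that by (intro continuous_intros) auto
    qed
    have real: "\<exists>n::nat. \<forall>r s. 0 < \<bar>r\<bar> \<and> \<bar>r\<bar> < 1 / Suc n \<and> 0 < \<bar>s\<bar> \<and> \<bar>s\<bar> < 1 / Suc n \<longrightarrow>
         \<bar>q r - q s\<bar> \<le> 1 / Suc k" for k
    proof -
      obtain n :: nat where n: "\<And>r s. r\<in>\<rat> \<Longrightarrow> s\<in>\<rat> \<Longrightarrow> 0 < \<bar>r\<bar> \<and> \<bar>r\<bar> < 1 / Suc n \<and> 0 < \<bar>s\<bar> \<and> \<bar>s\<bar> < 1 / Suc n \<Longrightarrow>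
         \<bar>q r - q s\<bar> \<le> 1 / Suc k" using C unfolding q_def by meson
      define U where "U = {h. 0 < \<bar>h\<bar> \<and> \<bar>h\<bar> < 1 / Suc n}"
      have Uopen: "open U" unfolding U_def
        by (intro open_Collect_conj open_Collect_less continuous_intros)
      have "\<bar>q r - q s\<bar> \<le> 1 / Suc k" if "r \<in> U" "s \<in> U" for r s
      proof (rule ccontr)
        assume neg: "\<not> \<bar>q r - q s\<bar> \<le> 1 / Suc k"
        \<comment> \<open>a violation at one pair of increments persists on an open set of pairs, hence occurs at a rational pair\<close>
        define V where "V = {p\<in>U \<times> U. \<bar>q (fst p) - q (snd p)\<bar> > 1 / Suc k}"
        have "continuous_on (U \<times> U) (\<lambda>p. \<bar>q (fst p) - q (snd p)\<bar>)"
        proof -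
          have cq: "continuous_on U q" using qcont unfolding U_def
            by (auto intro!: continuous_at_imp_continuous_on)
          show ?thesis
            by (intro continuous_intros continuous_on_compose2[OF cq]) auto
        qed
        then have "open ((U \<times> U) \<inter> (\<lambda>p. \<bar>q (fst p) - q (snd p)\<bar>) -` {1 / Suc k<..})"
          by (rule continuous_open_preimage) (auto intro: open_Times Uopen)
        moreover have "V = (U \<times> U) \<inter> (\<lambda>p. \<bar>q (fst p) - q (snd p)\<bar>) -` {1 / Suc k<..}"
          unfolding V_def by auto
        ultimately have "open V" by simp
        moreover have "(r, s) \<in> V" using that neg unfolding V_def by auto
        ultimately obtain A B where AB: "open A" "open B" "r \<in> A" "s \<in> B" "A \<times> B \<subseteq> V"
          using open_prod_elim[of V "(r, s)"] by (metis mem_Sigma_iff)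
        have "\<exists>q\<in>\<rat>. q \<in> S" if S: "open S" "y \<in> S" for S and y :: real
        proof -
          obtain e where "e > 0" "ball y e \<subseteq> S" using S open_contains_ball by blast
          moreover obtain z where "z \<in> \<rat>" "y < z" "z < y + e" using Rats_dense_in_real[of y "y + e"] \<open>e>0\<close> by auto
          ultimately show ?thesis by (intro bexI[of _ z]) (auto simp: subset_iff dist_real_def)
        qed
        then obtain r' s' where "r' \<in> \<rat>" "r' \<in> A" "s' \<in> \<rat>" "s' \<in> B" using AB by meson
        moreover from this have "(r', s') \<in> V" using AB by auto
        ultimately show False using n[of r' s'] unfolding V_def U_def by auto
      qed
      then show ?thesis unfolding U_def by blast
    qed
    have cl: "Cauchy (\<lambda>n. q (1 / Suc n))"
    proof (rule metric_CauchyI)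
      fix e :: real assume "e > 0"
      then obtain k :: nat where k: "1 / Suc k < e" using nat_approx_posE by blast
      obtain n :: nat where n: "\<And>r s. 0 < \<bar>r\<bar> \<and> \<bar>r\<bar> < 1 / Suc n \<and> 0 < \<bar>s\<bar> \<and> \<bar>s\<bar> < 1 / Suc n \<Longrightarrow> \<bar>q r - q s\<bar> \<le> 1 / Suc k"
        using real by blast
      have "dist (q (1 / Suc i)) (q (1 / Suc j)) < e" if "i \<ge> Suc n" "j \<ge> Suc n" for i j
      proof -
        have "1 / real (Suc i) < 1 / Suc n" "1 / real (Suc j) < 1 / Suc n" using that by (auto simp: field_simps)
        then have "\<bar>q (1 / Suc i) - q (1 / Suc j)\<bar> \<le> 1 / Suc k" by (intro n) auto
        then show ?thesis using k by (simp add: dist_real_def)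
      qed
      then show "\<exists>M. \<forall>m\<ge>M. \<forall>n\<ge>M. dist (q (1 / real (Suc m))) (q (1 / real (Suc n))) < e" by blast
    qed
    then obtain D where D: "(\<lambda>n. q (1 / Suc n)) \<longlonglongrightarrow> D" using Cauchy_convergent convergent_def by blast
    have "(q \<longlongrightarrow> D) (at 0)"
    proof (rule tendstoI)
      fix e :: real assume "e > 0"
      then obtain k :: nat where k: "1 / Suc k < e" using nat_approx_posE by blast
      obtain n :: nat where n: "\<And>r s. 0 < \<bar>r\<bar> \<and> \<bar>r\<bar> < 1 / Suc n \<and> 0 < \<bar>s\<bar> \<and> \<bar>s\<bar> < 1 / Suc n \<Longrightarrow> \<bar>q r - q s\<bar> \<le> 1 / Suc k"
        using real by blast
      have "dist (q h) D < e" if h: "h \<noteq> 0" "\<bar>h\<bar> < 1 / Suc n" for h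
      proof -
        have "\<forall>\<^sub>F i in sequentially. \<bar>q h - q (1 / Suc i)\<bar> \<le> 1 / Suc k"
          using eventually_ge_at_top[of "Suc n"]
        proof eventually_elim
          case (elim i)
          then have "1 / real (Suc i) < 1 / Suc n" by (auto simp: field_simps)
          then show ?case using h by (intro n) auto
        qed
        moreover have "(\<lambda>i. \<bar>q h - q (1 / Suc i)\<bar>) \<longlonglongrightarrow> \<bar>q h - D\<bar>" by (intro tendsto_intros D)
        ultimately have "\<bar>q h - D\<bar> \<le> 1 / Suc k" using tendsto_upperbound by (metis trivial_limit_sequentially)
        then show ?thesis using k by (simp add: dist_real_def)
      qed
      then have "\<forall>\<^sub>F h in at 0. h \<noteq> 0 \<longrightarrow> \<bar>h\<bar> < 1 / Suc n \<longrightarrow> dist (q h) D < e" by simp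
      moreover have "\<forall>\<^sub>F h in at 0. h \<noteq> 0 \<and> \<bar>h\<bar> < 1 / Suc n" unfolding eventually_at
        by (intro exI[of _ "1 / Suc n"]) (simp add: dist_real_def)
      ultimately show "\<forall>\<^sub>F h in at 0. dist (q h) D < e" by eventually_elim simp
    qed
    then show "f differentiable (at x)" unfolding real_differentiable_def DERIV_def q_def by blast
  qed
  ultimately show ?thesis by (simp only:)
qed

text \<open>On the Borel set of points of differentiability the derivative is a limit of difference quotients,
  elsewhere it is the default value of the choice.\<close>

lemma borel_measurable_deriv:
  fixes f :: "real \<Rightarrow> real"
  assumes cont: "continuous_on UNIV f"
  shows "deriv f \<in> borel_measurable borel"
proof -
  have [measurable]: "f \<in> borel_measurable borel" using cont by (rule borel_measurable_continuous_onI)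
  define D where "D = {x. f differentiable (at x)}"
  have D[measurable]: "D \<in> sets borel"
    unfolding D_def differentiable_iff_quotients_Cauchy_rat[OF cont] by measurable
  define c where "c = deriv f (SOME x. x \<notin> D)"
  define F where "F x = lim (\<lambda>n. (f (x + 1 / Suc n) - f x) / (1 / Suc n))" for x
  have [measurable]: "F \<in> borel_measurable borel" unfolding F_def by measurable
  have "deriv f = (\<lambda>x. if x \<in> D then F x else c)"
  proof
    fix x
    show "deriv f x = (if x \<in> D then F x else c)"
    proof (cases "x \<in> D")
      case True
      then have "DERIV f x :> deriv f x" unfolding D_def
        using DERIV_deriv_iff_real_differentiable by blast
      then have "((\<lambda>h. (f (x + h) - f x) / h) \<longlongrightarrow> deriv f x) (at 0)" by (simp add: DERIV_def)
      moreover have "filterlim (\<lambda>n. 1 / real (Suc n)) (at 0) sequentially"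
        unfolding filterlim_at by (intro conjI LIMSEQ_Suc lim_1_over_n) simp
      ultimately have "(\<lambda>n. (f (x + 1 / Suc n) - f x) / (1 / Suc n)) \<longlonglongrightarrow> deriv f x"
        by (rule filterlim_compose)
      then show ?thesis using True unfolding F_def by (simp add: limI)
    next
      case False
      then have "(SOME x. x \<notin> D) \<notin> D" by (rule someI)
      then have "deriv f x = c" using False unfolding c_def
        by (intro deriv_default_constant) (simp_all add: D_def)
      then show ?thesis using False by simp
    qed
  qed
  then show ?thesis by simp
qed

lemma AE_lborel_if_negligible:
  assumes "negligible N" "\<And>x. x \<notin> N \<Longrightarrow> P x"
  shows "AE x in lborel. P x"
proof -
  have "N \<in> null_sets lebesgue" using assms(1) negligible_iff_null_sets by blast
  then obtain N' where "N' \<in> null_sets lborel" "N \<subseteq> N'" unfolding null_sets_completion_iff2 by blast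
  then show ?thesis using assms(2) by (intro AE_I'[of N']) auto
qed

lemma integral_lessThan_diff:
  fixes f :: "real \<Rightarrow> real"
  assumes "integrable lborel f" "x \<le> y"
  shows "(LINT u:{..<y}|lborel. f u) - (LINT u:{..<x}|lborel. f u) = integral {x..y} f"
proof -
  have i: "set_integrable lborel A f" if "A \<in> sets lborel" for A
    unfolding set_integrable_def using that assms(1) by (rule integrable_mult_indicator)
  have "(LINT u:{..<y}|lborel. f u) = (LINT u:{..<x} \<union> {x..<y}|lborel. f u)"
    using assms(2) by (intro arg_cong[of _ _ "\<lambda>A. LINT u:A|lborel. f u"]) auto
  also have "\<dots> = (LINT u:{..<x}|lborel. f u) + (LINT u:{x..<y}|lborel. f u)"
    by (intro set_integral_Un i) auto
  also have "(LINT u:{x..<y}|lborel. f u) = (LINT u:{x..y}|lborel. f u)"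
    unfolding set_lebesgue_integral_def using assms(1)
    by (intro integral_cong_AE AE_I'[of "{y}"]) (auto simp: indicator_def)
  also have "\<dots> = integral {x..y} f"
    by (intro set_borel_integral_eq_integral i) auto
  finally show ?thesis by simp
qed

text \<open>The one-sided form of Lebesgue's differentiation theorem.\<close>

lemma eventually_averages_close:
  fixes f :: "real \<Rightarrow> real"
  assumes "integrable lborel f"
  obtains N where "negligible N"
    "\<And>x e. x \<notin> N \<Longrightarrow> 0 < e \<Longrightarrow> \<exists>d>0. \<forall>h. 0 < h \<and> h < d \<longrightarrow> \<bar>integral {x..x + h} f / h - f x\<bar> < e"
proof -
  have "f integrable_on cbox a b" for a b
    using assms by (intro set_borel_integral_eq_integral(1)) (auto simp: set_integrable_def intro!: integrable_mult_indicator simp del: real_scaleR_def)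
  from integrable_ccontinuous_explicit[OF this] obtain N where
    "negligible N" "\<And>x e. x \<notin> N \<Longrightarrow> 0 < e \<Longrightarrow> \<exists>d>0. \<forall>h. 0 < h \<and> h < d \<longrightarrow>
      norm (integral (cbox x (x + h *\<^sub>R One)) f /\<^sub>R h ^ DIM(real) - f x) < e" by metis
  then show ?thesis by (intro that[of N]) (simp_all add: divide_inverse mult.commute)
qed

text \<open>Averages over intervals to the left of a point are averages to the right for the reflected
  function; both one-sided statements together give the derivative of the indefinite integral.\<close>

lemma AE_has_derivative_indefinite_integral:
  fixes f :: "real \<Rightarrow> real"
  assumes f: "integrable lborel f"
  shows "AE x in lborel. ((\<lambda>t. LINT u:{..<t}|lborel. f u) has_real_derivative f x) (at x)"
proof -
  let ?F = "\<lambda>t. LINT u:{..<t}|lborel. f u"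
  have f': "integrable lborel (\<lambda>x. f (- x))"
    using lborel_integrable_real_affine[OF f, of "-1" 0] by simp
  obtain N where N: "negligible N"
    "\<And>x e. x \<notin> N \<Longrightarrow> 0 < e \<Longrightarrow> \<exists>d>0. \<forall>h. 0 < h \<and> h < d \<longrightarrow> \<bar>integral {x..x + h} f / h - f x\<bar> < e"
    by (rule eventually_averages_close[OF f]) metis
  obtain M where M: "negligible M"
    "\<And>x e. x \<notin> M \<Longrightarrow> 0 < e \<Longrightarrow> \<exists>d>0. \<forall>h. 0 < h \<and> h < d \<longrightarrow> \<bar>integral {x..x + h} (\<lambda>x. f (- x)) / h - f (- x)\<bar> < e"
    by (rule eventually_averages_close[OF f']) metis
  have "negligible (uminus ` M)" 
    by (intro negligible_differentiable_image_negligible M(1)) (auto intro!: derivative_intros)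
  then have "negligible (N \<union> uminus ` M)" using N(1) by (rule negligible_Un[rotated])
  then show ?thesis
  proof (rule AE_lborel_if_negligible)
    fix x assume x: "x \<notin> N \<union> uminus ` M"
    then have x': "- x \<notin> M" by force
    have "((\<lambda>h. (?F (x + h) - ?F x) / h) \<longlongrightarrow> f x) (at 0)"
    proof (rule tendstoI)
      fix e :: real assume e: "e > 0"
      obtain d1 where d1: "d1 > 0" "\<And>h. 0 < h \<and> h < d1 \<Longrightarrow> \<bar>integral {x..x + h} f / h - f x\<bar> < e"
        using N(2)[OF _ e, of x] x by blast
      obtain d2 where d2: "d2 > 0" "\<And>h. 0 < h \<and> h < d2 \<Longrightarrow> \<bar>integral {-x..-x + h} (\<lambda>x. f (- x)) / h - f x\<bar> < e"
        using M(2)[OF x' e] by auto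
      have "dist ((?F (x + h) - ?F x) / h) (f x) < e" if h: "h \<noteq> 0" "\<bar>h\<bar> < min d1 d2" for h
      proof (cases "h > 0")
        case True
        then show ?thesis using d1(2)[of h] h integral_lessThan_diff[OF f, of x "x + h"]
          by (simp add: dist_real_def)
      next
        case False
        define k where "k = - h"
        have k: "0 < k" "k < d2" using False h unfolding k_def by auto
        have "integral {-x..-(x - k)} (\<lambda>x. f (- x)) = integral {x - k..x} f"
          using Henstock_Kurzweil_Integration.integral_reflect_real[of x "x - k" f] by simp
        then have "\<bar>integral {x - k..x} f / k - f x\<bar> < e" using d2(2)[of k] k by (simp add: algebra_simps)
        moreover have "?F x - ?F (x - k) = integral {x - k..x} f"
          using k by (intro integral_lessThan_diff[OF f]) simp
        moreover have "(?F (x + h) - ?F x) / h = (?F x - ?F (x - k)) / k"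
          using k unfolding k_def by (simp add: field_simps)
        ultimately show ?thesis by (simp add: dist_real_def)
      qed
      then show "\<forall>\<^sub>F h in at 0. dist ((?F (x + h) - ?F x) / h) (f x) < e"
        using d1(1) d2(1) unfolding eventually_at by (intro exI[of _ "min d1 d2"]) (simp add: dist_real_def)
    qed
    then show "(?F has_real_derivative f x) (at x)" by (simp add: DERIV_def)
  qed
qed

lemma continuous_on_indefinite_integral:
  fixes f :: "real \<Rightarrow> real"
  assumes f: "integrable lborel f"
  shows "continuous_on UNIV (\<lambda>t. LINT u:{..<t}|lborel. f u)"
proof -
  let ?F = "\<lambda>t. LINT u:{..<t}|lborel. f u"
  have "isCont ?F x" for x
  proof -
    have "f integrable_on {x - 1..x + 1}"
      using assms by (intro set_borel_integral_eq_integral(1)) (auto simp: set_integrable_def intro!: integrable_mult_indicator simp del: real_scaleR_def)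
    then have "continuous_on {x - 1..x + 1} (\<lambda>t. ?F (x - 1) + integral {x - 1..t} f)"
      by (intro continuous_intros indefinite_integral_continuous_1)
    moreover have "?F (x - 1) + integral {x - 1..t} f = ?F t" if "t \<in> {x - 1..x + 1}" for t
      using integral_lessThan_diff[OF f, of "x - 1" t] that by simp
    ultimately have "continuous_on {x - 1..x + 1} ?F"
      using continuous_on_cong[of "{x - 1..x + 1}" "{x - 1..x + 1}" "\<lambda>t. ?F (x - 1) + integral {x - 1..t} f" ?F] by blast
    then show ?thesis by (rule continuous_on_interior) simp
  qed
  then show ?thesis by (simp add: continuous_on_eq_continuous_at)
qed

text \<open>Without a singular part of the law, the derivative of the distribution function agrees almost
  everywhere with the Radon-Nikodym density. The derivative has to be Borel measurable for this:
  the integral with respect to \<open>lborel\<close> of a function that is not measurable is \<open>0\<close>.\<close>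

lemma set_integral_gap_density:
  assumes fin: "finite_measure \<mu>" and R[measurable]: "R \<in> borel_measurable \<mu>"
    and pos: "\<And>x. x \<in> space \<mu> \<Longrightarrow> R x > 0"
    and ac: "\<And>N. N \<in> null_sets lborel \<Longrightarrow> emeasure \<mu> {x \<in> space \<mu>. R x \<in> N} = 0"
    and B: "B \<in> sets borel"
  shows "(LINT x:B|lborel. gap_density \<mu> R x) = measure \<mu> {x \<in> space \<mu>. R x \<in> B}"
proof -
  interpret finite_measure \<mu> by fact
  define \<nu> where "\<nu> = distr \<mu> borel R"
  have fin\<nu>: "finite_measure \<nu>" unfolding \<nu>_def by (rule finite_measure_distr) simp
  then interpret \<nu>: finite_measure \<nu> .
  have \<nu>: "emeasure \<nu> A = emeasure \<mu> {x \<in> space \<mu>. R x \<in> A}" if "A \<in> sets borel" for A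
    using that unfolding \<nu>_def by (simp add: emeasure_distr vimage_def Int_def conj_commute)
  have sets: "sets \<nu> = sets lborel" unfolding \<nu>_def by simp
  have abs: "absolutely_continuous lborel \<nu>"
    unfolding absolutely_continuous_def
  proof
    fix N :: "real set" assume N: "N \<in> null_sets lborel"
    then have "N \<in> sets borel" using null_setsD2 by fastforce
    then show "N \<in> null_sets \<nu>" using \<nu>[of N] ac[OF N] sets by (intro null_setsI) simp_all
  qed
  obtain D where D[measurable]: "D \<in> borel_measurable lborel"
    and DRN: "AE x in lborel. RN_deriv lborel \<nu> x = ennreal (D x)" and D0: "\<And>x. 0 \<le> D x"
    using sigma_finite_measure.real_RN_deriv[OF sigma_finite_lborel fin\<nu> abs sets] by metis
  have "density lborel (\<lambda>x. ennreal (D x)) = density lborel (RN_deriv lborel \<nu>)"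
    using DRN by (intro density_cong) auto
  also have "\<dots> = \<nu>" using abs sets by (rule sigma_finite_measure.density_RN_deriv[OF sigma_finite_lborel])
  finally have dens: "\<nu> = density lborel (\<lambda>x. ennreal (D x))" by simp
  have "(\<integral>\<^sup>+x. ennreal (D x) \<partial>lborel) = emeasure \<nu> UNIV"
    unfolding dens by (subst emeasure_density) auto
  also have "\<dots> < \<infinity>" using \<nu>.emeasure_finite[of UNIV] by (simp add: less_top[symmetric])
  finally have Dint: "integrable lborel D"
    using D0 by (intro integrableI_nonneg) auto
  have meas: "(LINT x:A|lborel. D x) = measure \<nu> A" if A: "A \<in> sets borel" for A
  proof -
    have "emeasure \<nu> A = (\<integral>\<^sup>+x. ennreal (indicator A x *\<^sub>R D x) \<partial>lborel)"
      unfolding dens using A by (subst emeasure_density) (auto intro!: nn_integral_cong simp: indicator_def)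
    then show ?thesis unfolding measure_def set_lebesgue_integral_def
      using A D0 by (subst integral_eq_nn_integral) auto
  qed
  have "measure \<mu> {x \<in> space \<mu>. R x \<in> {0<..<t}} = (LINT u:{..<t}|lborel. D u)" for t
  proof -
    have "{x \<in> space \<mu>. R x \<in> {0<..<t}} = {x \<in> space \<mu>. R x \<in> {..<t}}" using pos by auto
    then show ?thesis using meas[of "{..<t}"] \<nu>[of "{..<t}"] by (simp add: measure_def)
  qed
  then have g: "gap_density \<mu> R = deriv (\<lambda>t. LINT u:{..<t}|lborel. D u)"
    unfolding gap_density_def by simp
  have [measurable]: "gap_density \<mu> R \<in> borel_measurable borel"
    unfolding g by (intro borel_measurable_deriv continuous_on_indefinite_integral Dint)
  have "AE x in lborel. gap_density \<mu> R x = D x"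
    using AE_has_derivative_indefinite_integral[OF Dint] unfolding g
    by eventually_elim (rule DERIV_imp_deriv)
  then have "(LINT x:B|lborel. gap_density \<mu> R x) = (LINT x:B|lborel. D x)"
    unfolding set_lebesgue_integral_def using B by (intro integral_cong_AE) auto
  also have "\<dots> = measure \<nu> B" using B by (rule meas)
  also have "\<dots> = measure \<mu> {x \<in> space \<mu>. R x \<in> B}" using \<nu>[OF B] by (simp add: measure_def)
  finally show ?thesis .
qed

section \<open>Vectors of planar lattices\<close>

lemma mat2_mult_vec: "((A::real^2^2) *v x) $ 1 = A $ 1 $ 1 * x $ 1 + A $ 1 $ 2 * x $ 2"
    "(A *v x) $ 2 = A $ 2 $ 1 * x $ 1 + A $ 2 $ 2 * x $ 2"
  by (simp_all add: matrix_vector_mult_def sum_2)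

lemma hmat_mult_vec: "(hmat u *v z) $ 1 = z $ 1" "(hmat u *v z) $ 2 = z $ 2 - u * z $ 1"
  by (simp_all add: mat2_mult_vec hmat_def)

lemma det_hmat: "det (hmat u) = 1"
  by (simp add: det_2 hmat_def)

lemma vec2_eq_iff: "(x::real^2) = y \<longleftrightarrow> x $ 1 = y $ 1 \<and> x $ 2 = y $ 2"
  by (simp add: vec_eq_iff forall_2)

lemma mem_affine_lattice_iff:
  "z \<in> affine_lattice h v \<longleftrightarrow> (\<exists>m n::int. z = h *v vector [of_int m, of_int n] + v)"
proof
  assume "z \<in> affine_lattice h v"
  then obtain y where y: "\<forall>i. y $ i \<in> \<int>" "z = h *v y + v"
    unfolding affine_lattice_def lattice_def by auto
  obtain m n where "y $ 1 = of_int m" "y $ 2 = of_int n" using y(1) by (metis Ints_cases)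
  then have "y = vector [of_int m, of_int n]" by (simp add: vec2_eq_iff)
  then show "\<exists>m n::int. z = h *v vector [of_int m, of_int n] + v" using y(2) by blast
next
  assume "\<exists>m n::int. z = h *v vector [of_int m, of_int n] + v"
  then obtain m n :: int where "z = h *v vector [of_int m, of_int n] + v" by blast
  moreover have "\<forall>i. (vector [of_int m, of_int n] :: real^2) $ i \<in> \<int>" by (simp add: forall_2)
  ultimately show "z \<in> affine_lattice h v" unfolding affine_lattice_def lattice_def by blast
qed

lemma affine_lattice_0: "affine_lattice h 0 = lattice h"
  unfolding affine_lattice_def by auto

lemma mem_lattice_iff: "z \<in> lattice h \<longleftrightarrow> (\<exists>m n::int. z = h *v vector [of_int m, of_int n])"
  using mem_affine_lattice_iff[of z h 0] by (simp add: affine_lattice_0)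

lemma mem_affine_lattice_diff: "z \<in> affine_lattice h v \<longleftrightarrow> z - v \<in> lattice h"
  unfolding affine_lattice_def by (auto intro: exI[of _ "z - v"])

lemma lattice_zero: "0 \<in> lattice h"
  unfolding lattice_def by (auto intro!: exI[of _ 0])

lemma lattice_add:
  assumes "x \<in> lattice h" "y \<in> lattice h" shows "x + y \<in> lattice h"
proof -
  obtain z z' where z: "\<forall>i. z $ i \<in> \<int>" "x = h *v z" "\<forall>i. z' $ i \<in> \<int>" "y = h *v z'"
    using assms unfolding lattice_def by auto
  then have "x + y = h *v (z + z')" by (simp add: matrix_vector_right_distrib)
  then show ?thesis using z unfolding lattice_def by auto
qed

lemma lattice_uminus:
  assumes "x \<in> lattice h" shows "- x \<in> lattice h"
proof -
  obtain z where z: "\<forall>i. z $ i \<in> \<int>" "x = h *v z" using assms unfolding lattice_def by auto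
  have "- x = h *v (- z)" unfolding z(2) by (simp add: vec2_eq_iff mat2_mult_vec)
  then show ?thesis using z(1) unfolding lattice_def by auto
qed

lemma lattice_diff: "x \<in> lattice h \<Longrightarrow> y \<in> lattice h \<Longrightarrow> x - y \<in> lattice h"
  using lattice_add[of x h "- y"] lattice_uminus[of y h] by simp

lemma affine_lattice_eq_if_mem:
  assumes "c \<in> affine_lattice h v" shows "affine_lattice h v = affine_lattice h c"
proof -
  have c: "c - v \<in> lattice h" using assms by (simp add: mem_affine_lattice_diff)
  have "z - v \<in> lattice h \<longleftrightarrow> z - c \<in> lattice h" for z
    using lattice_diff[OF _ c, of "z - v"] lattice_add[OF _ c, of "z - c"] by auto
  then show ?thesis unfolding set_eq_iff mem_affine_lattice_diff by blast
qed

lemma lattice_scale_nat: "x \<in> lattice h \<Longrightarrow> real k *\<^sub>R x \<in> lattice h"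
  by (induction k) (auto simp: lattice_zero algebra_simps intro: lattice_add)

lemma matrix_image_affine_lattice:
  "(\<lambda>x. A *v x) ` affine_lattice h v = affine_lattice (A ** h) (A *v v)"
proof -
  have "A *v (h *v k + v) = A ** h *v k + A *v v" for k
    by (simp add: matrix_vector_right_distrib matrix_vector_mul_assoc)
  then show ?thesis unfolding set_eq_iff image_iff Bex_def mem_affine_lattice_iff by metis
qed

lemma matrix_image_lattice: "(\<lambda>x. A *v x) ` lattice h = lattice (A ** h)"
  using matrix_image_affine_lattice[of A h 0] by (simp add: affine_lattice_0)

lemma inverse_coordinates:
  fixes h :: "real^2^2"
  assumes "det h = 1" "z = h *v x"
  shows "x $ 1 = h $ 2 $ 2 * z $ 1 - h $ 1 $ 2 * z $ 2" "x $ 2 = h $ 1 $ 1 * z $ 2 - h $ 2 $ 1 * z $ 1"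
proof -
  have d: "h $ 1 $ 1 * h $ 2 $ 2 - h $ 1 $ 2 * h $ 2 $ 1 = 1" using assms(1) by (simp add: det_2)
  have "h $ 2 $ 2 * z $ 1 - h $ 1 $ 2 * z $ 2 = (h $ 1 $ 1 * h $ 2 $ 2 - h $ 1 $ 2 * h $ 2 $ 1) * x $ 1"
    unfolding assms(2) mat2_mult_vec by algebra
  then show "x $ 1 = h $ 2 $ 2 * z $ 1 - h $ 1 $ 2 * z $ 2" using d by simp
  have "h $ 1 $ 1 * z $ 2 - h $ 2 $ 1 * z $ 1 = (h $ 1 $ 1 * h $ 2 $ 2 - h $ 1 $ 2 * h $ 2 $ 1) * x $ 2"
    unfolding assms(2) mat2_mult_vec by algebra
  then show "x $ 2 = h $ 1 $ 1 * z $ 2 - h $ 2 $ 1 * z $ 1" using d by simp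
qed

text \<open>The inverse matrix bounds the integer coordinates of a short lattice vector.\<close>

lemma finite_lattice_Int_bounded:
  assumes "det h = 1"
  shows "finite {z \<in> lattice h. \<bar>z $ 1\<bar> \<le> K \<and> \<bar>z $ 2\<bar> \<le> K}"
proof -
  define C where "C = (\<bar>h$1$1\<bar> + \<bar>h$1$2\<bar> + \<bar>h$2$1\<bar> + \<bar>h$2$2\<bar>) * K"
  define N where "N = \<lceil>C\<rceil>"
  have "{z \<in> lattice h. \<bar>z $ 1\<bar> \<le> K \<and> \<bar>z $ 2\<bar> \<le> K}
     \<subseteq> (\<lambda>(m::int, n::int). h *v vector [of_int m, of_int n]) ` ({-N..N} \<times> {-N..N})"
  proof
    fix z assume z: "z \<in> {z \<in> lattice h. \<bar>z $ 1\<bar> \<le> K \<and> \<bar>z $ 2\<bar> \<le> K}"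
    then obtain m n :: int where mn: "z = h *v vector [of_int m, of_int n]"
      unfolding mem_lattice_iff by blast
    have K: "\<bar>z $ 1\<bar> \<le> K" "\<bar>z $ 2\<bar> \<le> K" "K \<ge> 0" using z by auto
    have e: "of_int m = h $ 2 $ 2 * z $ 1 - h $ 1 $ 2 * z $ 2" "of_int n = h $ 1 $ 1 * z $ 2 - h $ 2 $ 1 * z $ 1"
      using inverse_coordinates[OF assms mn] by simp_all
    have b: "\<bar>x * z $ i\<bar> \<le> \<bar>x\<bar> * K" for x i
    proof -
      have "\<bar>z $ i\<bar> \<le> K" using K exhaust_2[of i] by auto
      then show ?thesis by (simp add: abs_mult mult_left_mono)
    qed
    have nn: "0 \<le> \<bar>x\<bar> * K" for x using K by simp
    have "\<bar>real_of_int m\<bar> \<le> \<bar>h $ 2 $ 2\<bar> * K + \<bar>h $ 1 $ 2\<bar> * K"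
      using b[of "h $ 2 $ 2" 1] b[of "h $ 1 $ 2" 2] e(1) by linarith
    then have "\<bar>real_of_int m\<bar> \<le> C"
      using nn[of "h$1$1"] nn[of "h$2$1"] unfolding C_def by (simp add: distrib_right)
    moreover have "\<bar>real_of_int n\<bar> \<le> \<bar>h $ 1 $ 1\<bar> * K + \<bar>h $ 2 $ 1\<bar> * K"
      using b[of "h $ 1 $ 1" 2] b[of "h $ 2 $ 1" 1] e(2) by linarith
    then have "\<bar>real_of_int n\<bar> \<le> C"
      using nn[of "h$1$2"] nn[of "h$2$2"] unfolding C_def by (simp add: distrib_right)
    ultimately have "\<bar>m\<bar> \<le> N" "\<bar>n\<bar> \<le> N" unfolding N_def by linarith+
    then have "(m, n) \<in> {-N..N} \<times> {-N..N}" by auto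
    then show "z \<in> (\<lambda>(m::int, n::int). h *v vector [of_int m, of_int n]) ` ({-N..N} \<times> {-N..N})"
      using mn by force
  qed
  then show ?thesis by (rule finite_subset) simp
qed

lemma finite_affine_lattice_Int_bounded:
  assumes "det h = 1"
  shows "finite {z \<in> affine_lattice h v. \<bar>z $ 1\<bar> \<le> K \<and> \<bar>z $ 2\<bar> \<le> K}"
proof -
  let ?K = "K + \<bar>v $ 1\<bar> + \<bar>v $ 2\<bar>"
  have "{z \<in> affine_lattice h v. \<bar>z $ 1\<bar> \<le> K \<and> \<bar>z $ 2\<bar> \<le> K}
      \<subseteq> (\<lambda>z. z + v) ` {z \<in> lattice h. \<bar>z $ 1\<bar> \<le> ?K \<and> \<bar>z $ 2\<bar> \<le> ?K}"
  proof
    fix z assume z: "z \<in> {z \<in> affine_lattice h v. \<bar>z $ 1\<bar> \<le> K \<and> \<bar>z $ 2\<bar> \<le> K}"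
    then have "z - v \<in> {z \<in> lattice h. \<bar>z $ 1\<bar> \<le> ?K \<and> \<bar>z $ 2\<bar> \<le> ?K}"
      by (auto simp: mem_affine_lattice_diff)
    then show "z \<in> (\<lambda>z. z + v) ` {z \<in> lattice h. \<bar>z $ 1\<bar> \<le> ?K \<and> \<bar>z $ 2\<bar> \<le> ?K}"
      by (intro image_eqI[of _ _ "z - v"]) auto
  qed
  then show ?thesis using finite_lattice_Int_bounded[OF assms] by (blast intro: finite_subset)
qed

text \<open>Up to the factor \<open>h $ 1 $ 1\<close>, the first coordinate of a lattice vector is the error of a rational
  approximation to the quotient of the entries of the first row of \<open>h\<close>, which is small for suitable
  vectors by Dirichlet's theorem.\<close>

lemma lattice_short_first_coordinate:
  assumes "det h = 1" "\<delta> > 0"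
  shows "\<exists>z\<in>lattice h. z \<noteq> 0 \<and> \<bar>z $ 1\<bar> < \<delta>"
proof -
  have d: "h $ 1 $ 1 * h $ 2 $ 2 - h $ 1 $ 2 * h $ 2 $ 1 = 1" using assms(1) by (simp add: det_2)
  have nz: "h *v vector [of_int m, of_int n] \<noteq> 0" if "m \<noteq> 0 \<or> n \<noteq> 0" for m n :: int
    using inverse_coordinates[OF assms(1), of "h *v vector [of_int m, of_int n]" "vector [of_int m, of_int n]"] that
    by auto
  show ?thesis
  proof (cases "h $ 1 $ 1 = 0")
    case True
    have "h *v vector [of_int 1, of_int 0] \<in> lattice h" unfolding mem_lattice_iff by blast
    moreover have "(h *v vector [of_int 1, of_int 0]) $ 1 = 0" using True by (simp add: mat2_mult_vec)
    ultimately show ?thesis using nz[of 1 0] assms(2) by (intro bexI) auto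
  next
    case False
    obtain N :: nat where N: "real N > \<bar>h $ 1 $ 1\<bar> / \<delta>" using reals_Archimedean2 by blast
    then have N0: "N > 0" using assms(2) False
      by (metis abs_ge_zero divide_nonneg_pos gr0I not_less of_nat_0)
    obtain p q where pq: "0 < q" "\<bar>of_int q * (h $ 1 $ 2 / h $ 1 $ 1) - of_int p\<bar> < 1 / N"
      using Dirichlet_approx[OF N0] by metis
    let ?z = "h *v vector [of_int (- p), of_int q]"
    have "?z $ 1 = h $ 1 $ 1 * (of_int q * (h $ 1 $ 2 / h $ 1 $ 1) - of_int p)"
      using False by (simp add: mat2_mult_vec field_simps)
    then have "\<bar>?z $ 1\<bar> = \<bar>h $ 1 $ 1\<bar> * \<bar>of_int q * (h $ 1 $ 2 / h $ 1 $ 1) - of_int p\<bar>"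
      by (simp add: abs_mult)
    also have "\<dots> < \<bar>h $ 1 $ 1\<bar> * (1 / N)" using pq(2) False by (intro mult_strict_left_mono) auto
    also have "\<dots> < \<delta>" using N N0 assms(2) by (simp add: field_simps)
    finally have "\<bar>?z $ 1\<bar> < \<delta>" .
    moreover have "?z \<in> lattice h" unfolding mem_lattice_iff by blast
    ultimately show ?thesis using nz[of "-p" q] pq(1) by (intro bexI[of _ ?z]) auto
  qed
qed

text \<open>If no nonzero lattice vector is vertical, vectors with ever smaller first coordinate are
  pairwise different, and as only finitely many of them are short their second coordinates are
  unbounded.\<close>

lemma lattice_steep:
  assumes "det h = 1" "\<delta> > 0"
  shows "\<exists>z\<in>lattice h. \<bar>z $ 1\<bar> < \<delta> \<and> z $ 2 > K"
proof (cases "\<exists>z\<in>lattice h. z \<noteq> 0 \<and> z $ 1 = 0")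
  case True
  then obtain z where z: "z \<in> lattice h" "z $ 1 = 0" "z $ 2 \<noteq> 0" by (auto simp: vec2_eq_iff)
  obtain y where y: "y \<in> lattice h" "y $ 1 = 0" "y $ 2 > 0"
    using z lattice_uminus[OF z(1)] by (cases "z $ 2 > 0") force+
  obtain k :: nat where "real k * y $ 2 > K" using ex_less_of_nat_mult[OF y(3)] by blast
  then show ?thesis using y assms(2) by (intro bexI[of _ "real k *\<^sub>R y"] lattice_scale_nat) auto
next
  case False
  define S where "S = {z \<in> lattice h. \<bar>z $ 1\<bar> \<le> \<bar>K\<bar> + 1 \<and> \<bar>z $ 2\<bar> \<le> \<bar>K\<bar> + 1} - {0}"
  have fin: "finite S" unfolding S_def using finite_lattice_Int_bounded[OF assms(1)] by blast
  \<comment> \<open>smaller than all first coordinates of the nonzero vectors that are short in both coordinates\<close>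
  define e where "e = Min (insert 1 (insert \<delta> ((\<lambda>z. \<bar>z $ 1\<bar>) ` S)))"
  have e0: "e > 0" unfolding e_def using fin assms(2) False by (auto simp: S_def)
  obtain z where z: "z \<in> lattice h" "z \<noteq> 0" "\<bar>z $ 1\<bar> < e"
    using lattice_short_first_coordinate[OF assms(1) e0] by blast
  have e1: "e \<le> 1" "e \<le> \<delta>" unfolding e_def using fin by (intro Min_le; simp)+
  have "z \<notin> S"
  proof
    assume "z \<in> S"
    then have "e \<le> \<bar>z $ 1\<bar>" unfolding e_def using fin by (intro Min_le) auto
    then show False using z(3) by simp
  qed
  then have "\<bar>z $ 2\<bar> > \<bar>K\<bar>" using z e1 unfolding S_def by auto
  then show ?thesis using z e1 lattice_uminus[OF z(1)]
    by (cases "z $ 2 > 0") (force intro: bexI[of _ z], force intro: bexI[of _ "- z"])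
qed

text \<open>Steep vectors of small first coordinate come with an uncontrolled sign; one of them is added
  to a fixed vector pointing to the left.\<close>

lemma lattice_steep_left:
  assumes "det h = 1" "x0 > 0"
  shows "\<exists>z\<in>lattice h. - x0 < z $ 1 \<and> z $ 1 \<le> 0 \<and> z $ 2 > K"
proof (cases "\<exists>z\<in>lattice h. z $ 1 = 0 \<and> z $ 2 > 0")
  case True
  then obtain y where y: "y \<in> lattice h" "y $ 1 = 0" "y $ 2 > 0" by blast
  obtain k :: nat where "real k * y $ 2 > K" using ex_less_of_nat_mult[OF y(3)] by blast
  then show ?thesis using y assms(2) by (intro bexI[of _ "real k *\<^sub>R y"] lattice_scale_nat) auto
next
  case False
  obtain e where e: "e \<in> lattice h" "\<bar>e $ 1\<bar> < x0" "e $ 2 > 0" using lattice_steep[OF assms, of 0] by blast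
  then have "e $ 1 \<noteq> 0" using False by auto
  \<comment> \<open>\<open>d\<close> points to the left, and adding a vector with first coordinate below \<open>- d $ 1\<close> keeps it so\<close>
  then obtain d where d: "d \<in> lattice h" "- x0 < d $ 1" "d $ 1 < 0"
    using e lattice_uminus[OF e(1)] by (cases "e $ 1 < 0") force+
  obtain z where z: "z \<in> lattice h" "\<bar>z $ 1\<bar> < min (- d $ 1) (x0 + d $ 1)" "z $ 2 > K + \<bar>d $ 2\<bar>"
    using lattice_steep[OF assms(1), of "min (- d $ 1) (x0 + d $ 1)"] d by auto
  show ?thesis using z d by (intro bexI[of _ "d + z"] lattice_add) auto
qed

section \<open>Slopes and return times\<close>

lemma slopes_pos: "s \<in> slopes L \<Longrightarrow> s > 0"
  unfolding slopes_def by auto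

text \<open>The positive elements of such a set can be listed increasingly without end.\<close>

definition slope_spectrum :: "real set \<Rightarrow> bool" where
  "slope_spectrum A \<longleftrightarrow> (\<forall>M. finite (A \<inter> {0<..M})) \<and> (\<forall>M. \<exists>s\<in>A. s > M)"

lemma slope_spectrum_Least:
  assumes A: "slope_spectrum A" and "M \<ge> 0"
  defines "s \<equiv> (LEAST s. s \<in> A \<and> s > M)"
  shows "s \<in> A" "s > M" "\<And>r. r \<in> A \<Longrightarrow> r > M \<Longrightarrow> s \<le> r"
proof -
  obtain s0 where s0: "s0 \<in> A" "s0 > M" using A unfolding slope_spectrum_def by blast
  define F where "F = A \<inter> {0<..s0} \<inter> {M<..}"
  have F: "finite F" "s0 \<in> F" using A s0 assms(2) unfolding slope_spectrum_def F_def by auto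
  have m: "Min F \<in> F" using F by (intro Min_in) auto
  have le: "Min F \<le> r" if "r \<in> A" "r > M" for r
  proof (cases "r \<le> s0")
    case True
    then show ?thesis using that F assms(2) unfolding F_def by (intro Min_le) auto
  next
    case False
    then show ?thesis using Min_le[OF F(1), OF F(2)] by simp
  qed
  have "s = Min F" unfolding s_def using m le by (intro Least_equality) (auto simp: F_def)
  then show "s \<in> A" "s > M" "\<And>r. r \<in> A \<Longrightarrow> r > M \<Longrightarrow> s \<le> r" using m le by (auto simp: F_def)
qed

text \<open>The shear keeps the first coordinate of a vector and lowers its slope by \<open>u\<close>.\<close>

lemma slopes_hmat_image:
  assumes "u \<ge> 0"
  shows "slopes ((\<lambda>z. hmat u *v z) ` S) = {s - u |s. s \<in> slopes S \<and> s > u}"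
proof -
  have "s \<in> slopes ((\<lambda>z. hmat u *v z) ` S) \<longleftrightarrow> s > 0 \<and> s + u \<in> slopes S" for s
  proof
    assume "s \<in> slopes ((\<lambda>z. hmat u *v z) ` S)"
    then obtain z where z: "z \<in> S" "0 < z $ 1" "z $ 1 \<le> 1" "z $ 2 - u * z $ 1 > 0" "s = (z $ 2 - u * z $ 1) / z $ 1"
      unfolding slopes_def by (auto simp: hmat_mult_vec)
    moreover have "z $ 2 > 0" using z assms mult_nonneg_nonneg[of u "z $ 1"] by linarith
    moreover have "s > 0" "s + u = z $ 2 / z $ 1" using z by (simp, simp add: diff_divide_distrib)
    ultimately show "s > 0 \<and> s + u \<in> slopes S" unfolding slopes_def by blast
  next
    assume "s > 0 \<and> s + u \<in> slopes S"
    then obtain z where z: "s > 0" "z \<in> S" "0 < z $ 1" "z $ 1 \<le> 1" "s + u = z $ 2 / z $ 1"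
      unfolding slopes_def by auto
    then have "s = (z $ 2 - u * z $ 1) / z $ 1" by (simp add: field_simps)
    moreover from this z have "z $ 2 - u * z $ 1 > 0" by (simp add: zero_less_divide_iff)
    ultimately show "s \<in> slopes ((\<lambda>z. hmat u *v z) ` S)" using z unfolding slopes_def
      by (auto simp: hmat_mult_vec intro!: exI[of _ "hmat u *v z"])
  qed
  moreover have "s > 0 \<and> s + u \<in> slopes S \<longleftrightarrow> (\<exists>r. s = r - u \<and> r \<in> slopes S \<and> r > u)" for s
    by (intro iffI) (auto intro!: exI[of _ "s + u"])
  ultimately show ?thesis by (simp only: set_eq_iff mem_Collect_eq) simp
qed

lemma short_horizontal_hmat_image:
  assumes "u > 0"
  shows "short_horizontal ((\<lambda>z. hmat u *v z) ` S) \<longleftrightarrow> u \<in> slopes S"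
proof
  assume "short_horizontal ((\<lambda>z. hmat u *v z) ` S)"
  then obtain x z where z: "0 < x" "x \<le> 1" "z \<in> S" "vector [x, 0] = hmat u *v z"
    unfolding short_horizontal_def by auto
  then have "x = z $ 1" "0 = z $ 2 - u * z $ 1" by (simp_all add: vec2_eq_iff hmat_mult_vec)
  then show "u \<in> slopes S" using z assms unfolding slopes_def by (auto intro!: exI[of _ z])
next
  assume "u \<in> slopes S"
  then obtain z where z: "z \<in> S" "0 < z $ 1" "z $ 1 \<le> 1" "u = z $ 2 / z $ 1"
    unfolding slopes_def by auto
  then have "vector [z $ 1, 0] = hmat u *v z" by (simp add: vec2_eq_iff hmat_mult_vec)
  then show "short_horizontal ((\<lambda>z. hmat u *v z) ` S)" using z unfolding short_horizontal_def
    by (metis imageI)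
qed

lemma slope_seq_cong: "slopes L = slopes L' \<Longrightarrow> slope_seq L n = slope_seq L' n"
  by (induction n) simp_all

lemma shift_slopes_twice:
  fixes a b :: real
  assumes "a < b"
  shows "{s - (b - a) |s. s \<in> {r - a |r. r \<in> A \<and> r > a} \<and> s > b - a} = {s - b |s. s \<in> A \<and> s > b}"
proof (intro set_eqI iffI)
  fix x assume "x \<in> {s - b |s. s \<in> A \<and> s > b}"
  then obtain s where "x = (s - a) - (b - a)" "s \<in> A" "s > b" by auto
  then show "x \<in> {s - (b - a) |s. s \<in> {r - a |r. r \<in> A \<and> r > a} \<and> s > b - a}"
    using assms by (intro CollectI exI[of _ "s - a"]) auto
qed auto

text \<open>The shear by the first return time turns the slopes beyond the first one into the slopes of the
  image, reduced by the return time; hence the gaps are the return times along the orbit.\<close>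

lemma gap_eq_return_time:
  assumes spec: "\<And>x. x \<in> X \<Longrightarrow> slope_spectrum (slopes (hol x))"
    and R: "\<And>x. x \<in> X \<Longrightarrow> R x = (LEAST u. u \<in> slopes (hol x) \<and> u > 0)"
    and T: "\<And>x. x \<in> X \<Longrightarrow> T x \<in> X" "\<And>x. x \<in> X \<Longrightarrow> slopes (hol (T x)) = {s - R x |s. s \<in> slopes (hol x) \<and> s > R x}"
    and x: "x \<in> X"
  shows "slope_seq (hol x) (Suc n) - slope_seq (hol x) n = R ((T ^^ n) x)"
proof -
  let ?A = "slopes (hol x)" and ?s = "slope_seq (hol x)"
  have A: "slope_spectrum ?A" using spec x .
  have s0: "?s n \<ge> 0" for n
  proof (induction n)
    case (Suc n)
    then show ?case using slope_spectrum_Least(2)[OF A, of "?s n"] by simp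
  qed simp
  have step: "R y = ?s (Suc n) - ?s n"
    if "y \<in> X" "slopes (hol y) = {s - ?s n |s. s \<in> ?A \<and> s > ?s n}" for y n
  proof -
    note L = slope_spectrum_Least[OF A s0[of n], folded slope_seq.simps(2)]
    have "(LEAST u. u \<in> slopes (hol y) \<and> u > 0) = ?s (Suc n) - ?s n"
      unfolding that(2) using L by (intro Least_equality) auto
    then show ?thesis using R[OF that(1)] by simp
  qed
  have "(T ^^ n) x \<in> X \<and> slopes (hol ((T ^^ n) x)) = {s - ?s n |s. s \<in> ?A \<and> s > ?s n}" for n
  proof (induction n)
    case 0
    then show ?case using x slopes_pos by auto
  next
    case (Suc n)
    let ?y = "(T ^^ n) x"
    have y: "?y \<in> X" "slopes (hol ?y) = {s - ?s n |s. s \<in> ?A \<and> s > ?s n}" using Suc by auto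
    have "R ?y = ?s (Suc n) - ?s n" using step[OF y] .
    moreover have "?s (Suc n) > ?s n" using slope_spectrum_Least(2)[OF A s0[of n]] by simp
    ultimately have "slopes (hol (T ?y)) = {s - ?s (Suc n) |s. s \<in> ?A \<and> s > ?s (Suc n)}"
      unfolding T(2)[OF y(1)] y(2) by (simp only: shift_slopes_twice)
    then show ?case using T(1)[OF y(1)] by (simp del: slope_seq.simps)
  qed
  then show ?thesis using step by metis
qed

text \<open>The indicator functions of preimages of intervals under the return time are among the observables
  in the definition of genericity, and their Birkhoff sums count gaps.\<close>

lemma generic_imp_gap_proportion:
  assumes gap: "\<And>n. slope_seq L (Suc n) - slope_seq L n = R ((T ^^ n) x)"
    and gen: "generic \<mu> C R T x" and I: "is_interval I"
    and meas: "{y \<in> space \<mu>. R y \<in> I} \<in> sets \<mu>"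
  shows "gap_proportion L I (measure \<mu> {y \<in> space \<mu>. R y \<in> I})"
proof -
  have "(\<integral>y. indicator I (R y) \<partial>\<mu>) = (\<integral>y. indicator {y \<in> space \<mu>. R y \<in> I} y \<partial>\<mu> :: real)"
    by (intro Bochner_Integration.integral_cong) (auto simp: indicator_def)
  also have "\<dots> = measure \<mu> {y \<in> space \<mu>. R y \<in> I}" 
    by (simp add: Collect_conj_eq[symmetric] Int_def conj_ac cong: conj_cong)
  finally have int: "(\<integral>y. indicator I (R y) \<partial>\<mu>) = measure \<mu> {y \<in> space \<mu>. R y \<in> I}" .
  have "(\<lambda>N. (\<Sum>i<N. indicator I (R ((T ^^ i) x))) / real N) \<longlonglongrightarrow> (\<integral>y. indicator I (R y) \<partial>\<mu>)"
    using gen I unfolding generic_def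
    by (intro bspec[of _ _ "\<lambda>y. indicator I (R y)", where P = "\<lambda>\<phi>. (\<lambda>N. (\<Sum>i<N. \<phi> ((T ^^ i) x)) / real N) \<longlonglongrightarrow> (\<integral>y. \<phi> y \<partial>\<mu>)"]) auto
  moreover have "(\<Sum>i<N. indicator I (R ((T ^^ i) x))) =
      real (card {i \<in> {1..N}. slope_seq L i - slope_seq L (i - 1) \<in> I})" for N
  proof -
    have "{i \<in> {1..N}. slope_seq L i - slope_seq L (i - 1) \<in> I} = Suc ` {i \<in> {..<N}. R ((T ^^ i) x) \<in> I}"
    proof (intro set_eqI iffI)
      fix i assume "i \<in> {i \<in> {1..N}. slope_seq L i - slope_seq L (i - 1) \<in> I}"
      moreover from this obtain j where "i = Suc j" by (cases i) auto
      ultimately show "i \<in> Suc ` {i \<in> {..<N}. R ((T ^^ i) x) \<in> I}" using gap[of j] by auto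
    qed (use gap in auto)
    then have "card {i \<in> {1..N}. slope_seq L i - slope_seq L (i - 1) \<in> I} = card {i \<in> {..<N}. R ((T ^^ i) x) \<in> I}"
      by (simp add: card_image)
    also have "real \<dots> = (\<Sum>i<N. indicator I (R ((T ^^ i) x)))"
      by (simp add: indicator_def sum.If_cases Int_def)
    finally show ?thesis by simp
  qed
  ultimately show ?thesis unfolding gap_proportion_def int by simp
qed

section \<open>Return times of affine lattices\<close>

lemma AX2_hmat_image:
  assumes "\<Lambda> \<in> AX2" shows "act_AX2 (hmat u) \<Lambda> \<in> AX2"
proof -
  obtain h v where "\<Lambda> = affine_lattice h v" "det h = 1" using assms unfolding AX2_def by auto
  moreover have "det (hmat u ** h) = 1" using \<open>det h = 1\<close> by (simp add: det_mul det_hmat)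
  ultimately show ?thesis unfolding AX2_def act_AX2_def by (auto simp: matrix_image_affine_lattice)
qed

lemma finite_slopes_affine_lattice:
  assumes "det h = 1"
  shows "finite (slopes (affine_lattice h v) \<inter> {0<..M})"
proof -
  let ?K = "max 1 M"
  have "slopes (affine_lattice h v) \<inter> {0<..M}
      \<subseteq> (\<lambda>z. z $ 2 / z $ 1) ` {z \<in> affine_lattice h v. \<bar>z $ 1\<bar> \<le> ?K \<and> \<bar>z $ 2\<bar> \<le> ?K}"
  proof
    fix s assume "s \<in> slopes (affine_lattice h v) \<inter> {0<..M}"
    then obtain z where z: "z \<in> affine_lattice h v" "s = z $ 2 / z $ 1" "0 < z $ 1" "z $ 1 \<le> 1" "z $ 2 > 0" "s \<le> M"
      unfolding slopes_def by auto
    then have "z $ 2 \<le> M * z $ 1" by (simp add: divide_le_eq)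
    also have "\<dots> \<le> M * 1" using z by (intro mult_left_mono) (auto intro: order_trans[of 0 s])
    finally show "s \<in> (\<lambda>z. z $ 2 / z $ 1) ` {z \<in> affine_lattice h v. \<bar>z $ 1\<bar> \<le> ?K \<and> \<bar>z $ 2\<bar> \<le> ?K}"
      using z by (intro image_eqI[of _ _ z]) auto
  qed
  then show ?thesis by (rule finite_subset) (intro finite_imageI finite_affine_lattice_Int_bounded[OF assms])
qed

text \<open>Steep lattice vectors pointing to the left are added to a short horizontal vector.\<close>

lemma slopes_affine_lattice_unbounded:
  assumes "det h = 1" "short_horizontal (affine_lattice h v)"
  shows "\<exists>s\<in>slopes (affine_lattice h v). s > M"
proof -
  obtain x where x: "0 < x" "x \<le> 1" "vector [x, 0] \<in> affine_lattice h v"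
    using assms(2) unfolding short_horizontal_def by blast
  obtain z where z: "z \<in> lattice h" "- x < z $ 1" "z $ 1 \<le> 0" "z $ 2 > \<bar>M\<bar>"
    using lattice_steep_left[OF assms(1) x(1)] by blast
  have "z + vector [x, 0] \<in> affine_lattice h v"
    unfolding affine_lattice_eq_if_mem[OF x(3)] using z(1) by (simp add: mem_affine_lattice_diff)
  moreover have "z $ 2 / (z $ 1 + x) > M"
  proof -
    have "M * (z $ 1 + x) \<le> \<bar>M\<bar> * 1" using z x by (intro mult_mono) auto
    then show ?thesis using z x by (simp add: less_divide_eq)
  qed
  ultimately show ?thesis using z x unfolding slopes_def
    by (intro bexI[of _ "z $ 2 / (z $ 1 + x)"]) (auto intro!: exI[of _ "z + vector [x, 0]"])
qed

lemma slope_spectrum_Omega: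
  assumes "\<Lambda> \<in> Omega" shows "slope_spectrum (slopes \<Lambda>)"
proof -
  obtain h v where "\<Lambda> = affine_lattice h v" "det h = 1" "short_horizontal (affine_lattice h v)"
    using assms unfolding Omega_def AX2_def by auto
  then show ?thesis unfolding slope_spectrum_def
    using finite_slopes_affine_lattice slopes_affine_lattice_unbounded by simp
qed

lemma R_Omega_eq_Least:
  assumes "\<Lambda> \<in> Omega" shows "R_Omega \<Lambda> = (LEAST u. u \<in> slopes \<Lambda> \<and> u > 0)"
proof -
  have "u > 0 \<and> act_AX2 (hmat u) \<Lambda> \<in> Omega \<longleftrightarrow> u \<in> slopes \<Lambda> \<and> u > 0" for u
  proof -
    have "\<Lambda> \<in> AX2" using assms by (simp add: Omega_def)
    then have "act_AX2 (hmat u) \<Lambda> \<in> Omega \<longleftrightarrow> short_horizontal ((\<lambda>x. hmat u *v x) ` \<Lambda>)"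
      using AX2_hmat_image[of \<Lambda> u] unfolding Omega_def by (simp add: act_AX2_def)
    then show ?thesis using short_horizontal_hmat_image[of u \<Lambda>] by blast
  qed
  then show ?thesis unfolding R_Omega_def by (simp only:)
qed

lemma R_Omega_Least:
  assumes "\<Lambda> \<in> Omega"
  shows "R_Omega \<Lambda> \<in> slopes \<Lambda>" "R_Omega \<Lambda> > 0" "\<And>s. s \<in> slopes \<Lambda> \<Longrightarrow> R_Omega \<Lambda> \<le> s"
proof -
  note least = slope_spectrum_Least[OF slope_spectrum_Omega[OF assms] order_refl, folded R_Omega_eq_Least[OF assms]]
  show "R_Omega \<Lambda> \<in> slopes \<Lambda>" "R_Omega \<Lambda> > 0" by (fact least(1), fact least(2))
  show "R_Omega \<Lambda> \<le> s" if "s \<in> slopes \<Lambda>" for s using least(3)[OF that slopes_pos[OF that]] .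
qed

lemma R_Omega_less_iff:
  assumes "\<Lambda> \<in> Omega" shows "R_Omega \<Lambda> < t \<longleftrightarrow> (\<exists>s\<in>slopes \<Lambda>. s < t)"
proof
  assume "\<exists>s\<in>slopes \<Lambda>. s < t"
  then obtain s where "s \<in> slopes \<Lambda>" "s < t" by blast
  then show "R_Omega \<Lambda> < t" using R_Omega_Least(3)[OF assms, of s] by simp
next
  assume "R_Omega \<Lambda> < t"
  then show "\<exists>s\<in>slopes \<Lambda>. s < t" using R_Omega_Least(1)[OF assms] by (rule bexI)
qed

lemma T_Omega_in_Omega:
  assumes "\<Lambda> \<in> Omega" shows "T_Omega \<Lambda> \<in> Omega"
proof -
  have "T_Omega \<Lambda> \<in> AX2" using assms AX2_hmat_image unfolding T_Omega_def Omega_def by simp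
  moreover have "short_horizontal (T_Omega \<Lambda>)" unfolding T_Omega_def act_AX2_def
    using short_horizontal_hmat_image R_Omega_Least(1,2)[OF assms] by simp
  ultimately show ?thesis by (simp add: Omega_def)
qed

lemma gaps_Omega:
  assumes "\<Lambda> \<in> Omega"
  shows "slope_seq \<Lambda> (Suc n) - slope_seq \<Lambda> n = R_Omega ((T_Omega ^^ n) \<Lambda>)"
proof (rule gap_eq_return_time[where X = Omega and hol = "\<lambda>x. x"])
  fix x assume x: "x \<in> Omega"
  show "slopes (T_Omega x) = {s - R_Omega x |s. s \<in> slopes x \<and> s > R_Omega x}"
    unfolding T_Omega_def act_AX2_def
    using R_Omega_Least(2)[OF x] by (intro slopes_hmat_image) simp
qed (use assms slope_spectrum_Omega R_Omega_eq_Least T_Omega_in_Omega in auto)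

section \<open>Holonomy vectors of doubled slit tori\<close>

text \<open>The differences of singular points over the torus: the lattice and the affine lattices through the
  slit vector and its negative. In contrast to holonomy vectors they may have singular points in
  their interior.\<close>

definition sing_diffs :: "surface \<Rightarrow> (real^2) set" where
  "sing_diffs \<omega> = fst \<omega> \<union> {c + z |c z. c \<in> snd \<omega> \<and> z \<in> fst \<omega>} \<union> {z - c |c z. c \<in> snd \<omega> \<and> z \<in> fst \<omega>}"

lemma sing_diffs_slit_torus:
  "sing_diffs (slit_torus h w) = affine_lattice h 0 \<union> affine_lattice h w \<union> affine_lattice h (- w)"
proof -
  let ?c = "snd (slit_torus h w)" and ?l = "fst (slit_torus h w)"
  have c: "c \<in> ?c \<longleftrightarrow> (\<exists>y\<in>lattice h. c = w + 2 *\<^sub>R y)" for c unfolding slit_torus_def by auto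
  have l: "?l = lattice h" unfolding slit_torus_def by simp
  have w: "w \<in> ?c" unfolding c using lattice_zero by force
  have "(\<exists>c\<in>?c. \<exists>z\<in>?l. x = c + z) \<longleftrightarrow> x - w \<in> lattice h" for x
  proof
    assume "\<exists>c\<in>?c. \<exists>z\<in>?l. x = c + z"
    then obtain y z where "y \<in> lattice h" "z \<in> lattice h" "x = w + 2 *\<^sub>R y + z" by (auto simp: c l)
    then show "x - w \<in> lattice h" using lattice_add[of "y + y" h z] lattice_add[of y h y] by (simp add: scaleR_2)
  next
    assume "x - w \<in> lattice h"
    then have "x - w \<in> ?l" "x = w + (x - w)" unfolding l by simp_all
    then show "\<exists>c\<in>?c. \<exists>z\<in>?l. x = c + z" using w by blast
  qed
  moreover have "(\<exists>c\<in>?c. \<exists>z\<in>?l. x = z - c) \<longleftrightarrow> x + w \<in> lattice h" for x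
  proof
    assume "\<exists>c\<in>?c. \<exists>z\<in>?l. x = z - c"
    then obtain y z where "y \<in> lattice h" "z \<in> lattice h" "x = z - (w + 2 *\<^sub>R y)" by (auto simp: c l)
    then show "x + w \<in> lattice h" using lattice_diff[of z h "y + y"] lattice_add[of y h y] by (simp add: scaleR_2)
  next
    assume "x + w \<in> lattice h"
    then have "x + w \<in> ?l" "x = x + w - w" unfolding l by simp_all
    then show "\<exists>c\<in>?c. \<exists>z\<in>?l. x = z - c" using w by blast
  qed
  ultimately have "x \<in> sing_diffs (slit_torus h w) \<longleftrightarrow> x \<in> lattice h \<or> x - w \<in> lattice h \<or> x + w \<in> lattice h" for x
    unfolding sing_diffs_def Un_iff mem_Collect_eq l by blast
  then show ?thesis unfolding set_eq_iff Un_iff mem_affine_lattice_diff by simp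
qed

lemma marked_eq: "marked h w = affine_lattice h 0 \<union> affine_lattice h w"
  unfolding marked_def by (simp add: affine_lattice_0)

lemma saddle_holonomy_in_sing_diffs:
  assumes "saddle_holonomy h w x" shows "x \<in> sing_diffs (slit_torus h w)"
proof -
  obtain p where p: "p \<in> {0, w}" "p + x \<in> marked h w" using assms unfolding saddle_holonomy_def by blast
  then show ?thesis unfolding sing_diffs_slit_torus marked_eq mem_affine_lattice_diff Un_iff
    by (auto simp: add.commute)
qed

text \<open>Along a segment that meets the slit in finitely many points the label is the parity of the
  number of crossings. The label at the crossing itself is the one to the left of the slit, so the
  crossing counts from then on or only afterwards, depending on the direction of the crossing.\<close>

lemma labelling_exists:
  assumes fin: "finite C"
  shows "\<exists>\<sigma> :: real \<Rightarrow> bool. \<forall>t. \<forall>\<^sub>F t' in at t.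
    \<sigma> t' = (if t \<in> C \<and> (t' - t) * d < 0 then \<not> \<sigma> t else \<sigma> t)"
proof -
  have ev: "\<forall>\<^sub>F t' in at t. \<forall>c\<in>C - {t}. (c < t' \<longleftrightarrow> c < t) \<and> (c \<le> t' \<longleftrightarrow> c < t)" for t :: real
  proof -
    have "\<forall>\<^sub>F t' in at t. (c < t' \<longleftrightarrow> c < t) \<and> (c \<le> t' \<longleftrightarrow> c < t)" if "c \<noteq> t" for c
    proof (cases "c < t")
      case True
      then have "\<forall>\<^sub>F t' in at t. c < t'" by (intro order_tendstoD(1)[OF tendsto_ident_at])
      then show ?thesis by eventually_elim (use True in auto)
    next
      case False
      then have "\<forall>\<^sub>F t' in at t. t' < c" using that by (intro order_tendstoD(2)[OF tendsto_ident_at]) auto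
      then show ?thesis by eventually_elim (use False in auto)
    qed
    then show ?thesis using fin by (intro eventually_ball_finite) auto
  qed
  consider "d = 0" | "d > 0" | "d < 0" by linarith
  then show ?thesis
  proof cases
    case 1
    then show ?thesis by (intro exI[of _ "\<lambda>_. True"]) auto
  next
    case 2
    define \<sigma> where "\<sigma> t = odd (card {c\<in>C. c \<le> t})" for t
    have "\<forall>\<^sub>F t' in at t. \<sigma> t' = (if t \<in> C \<and> (t' - t) * d < 0 then \<not> \<sigma> t else \<sigma> t)" for t
      using ev[of t] eventually_neq_at_within[of t t UNIV]
    proof eventually_elim
      case (elim t')
      show ?case
      proof (cases "t \<in> C \<and> t' < t")
        case True
        have "c \<le> t \<longleftrightarrow> c = t \<or> c \<le> t'" if "c \<in> C" for c
          using True elim(1)[rule_format, of c] elim(2) that by (smt (verit) Diff_iff singletonD)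
        then have "{c\<in>C. c \<le> t} = insert t {c\<in>C. c \<le> t'}" "t \<notin> {c\<in>C. c \<le> t'}" using True by auto
        then show ?thesis using True 2 fin unfolding \<sigma>_def by (simp add: mult_less_0_iff)
      next
        case False
        have "c \<le> t \<longleftrightarrow> c \<le> t'" if "c \<in> C" for c
          using False elim(1)[rule_format, of c] elim(2) that by (smt (verit) Diff_iff singletonD)
        then have "{c\<in>C. c \<le> t} = {c\<in>C. c \<le> t'}" by blast
        then show ?thesis using False 2 unfolding \<sigma>_def by (simp add: mult_less_0_iff)
      qed
    qed
    then show ?thesis by blast
  next
    case 3
    define \<sigma> where "\<sigma> t = odd (card {c\<in>C. c < t})" for t
    have "\<forall>\<^sub>F t' in at t. \<sigma> t' = (if t \<in> C \<and> (t' - t) * d < 0 then \<not> \<sigma> t else \<sigma> t)" for t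
      using ev[of t] eventually_neq_at_within[of t t UNIV]
    proof eventually_elim
      case (elim t')
      show ?case
      proof (cases "t \<in> C \<and> t' > t")
        case True
        have "c < t' \<longleftrightarrow> c = t \<or> c < t" if "c \<in> C" for c
          using True elim(1)[rule_format, of c] elim(2) that by (smt (verit) Diff_iff singletonD)
        then have "{c\<in>C. c < t'} = insert t {c\<in>C. c < t}" "t \<notin> {c\<in>C. c < t}" using True by auto
        then show ?thesis using True 3 fin unfolding \<sigma>_def by (simp add: mult_less_0_iff)
      next
        case False
        have "c < t \<longleftrightarrow> c < t'" if "c \<in> C" for c
          using False elim(1)[rule_format, of c] elim(2) that by (smt (verit) Diff_iff singletonD)
        then have "{c\<in>C. c < t} = {c\<in>C. c < t'}" by blast
        then show ?thesis using False 3 unfolding \<sigma>_def by (simp add: mult_less_0_iff)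
      qed
    qed
    then show ?thesis by blast
  qed
qed

lemma finite_lattice_Int_norm:
  assumes "det h = 1"
  shows "finite {z \<in> affine_lattice h v. norm z \<le> K}"
proof -
  have "{z \<in> affine_lattice h v. norm z \<le> K} \<subseteq> {z \<in> affine_lattice h v. \<bar>z $ 1\<bar> \<le> K \<and> \<bar>z $ 2\<bar> \<le> K}"
    using component_le_norm_cart order_trans by blast
  then show ?thesis using finite_affine_lattice_Int_bounded[OF assms] by (rule finite_subset)
qed

text \<open>A crossing is determined by the lattice point \<open>p + t x - r w\<close> to which it belongs, because \<open>x\<close>
  and \<open>w\<close> are linearly independent, and these lattice points are bounded.\<close>

lemma finite_slit_crossings:
  assumes "det h = 1" "det (vector [w, x]) \<noteq> 0"
  shows "finite {t \<in> {0<..<1}. p + t *\<^sub>R x \<in> open_slit h w}"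
proof -
  let ?C = "{t \<in> {0<..<1}. p + t *\<^sub>R x \<in> open_slit h w}"
  have "\<forall>t\<in>?C. \<exists>r. p + t *\<^sub>R x - r *\<^sub>R w \<in> lattice h \<and> 0 < r \<and> r < 1"
    unfolding open_slit_def by force
  then obtain r where "\<forall>t\<in>?C. p + t *\<^sub>R x - r t *\<^sub>R w \<in> lattice h \<and> 0 < r t \<and> r t < 1"
    unfolding bchoice_iff by (rule exE)
  then have r: "p + t *\<^sub>R x - r t *\<^sub>R w \<in> lattice h \<and> 0 < r t \<and> r t < 1" if "t \<in> ?C" for t using that by (rule bspec)
  let ?f = "\<lambda>t. p + t *\<^sub>R x - r t *\<^sub>R w"
  have inj: "inj_on ?f ?C"
  proof
    fix t t' assume t: "t \<in> ?C" "t' \<in> ?C" "?f t = ?f t'"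
    then have "(t - t') *\<^sub>R x = (r t - r t') *\<^sub>R w" by (simp add: algebra_simps)
    then have "(t - t') * x $ 1 = (r t - r t') * w $ 1" "(t - t') * x $ 2 = (r t - r t') * w $ 2"
      by (metis vector_scaleR_component real_scaleR_def)+
    then have "(t - t') * (x $ 2 * w $ 1 - x $ 1 * w $ 2) = 0" by algebra
    moreover have "x $ 2 * w $ 1 - x $ 1 * w $ 2 \<noteq> 0" using assms(2) by (simp add: det_2 mult.commute)
    ultimately show "t = t'" by simp
  qed
  have "?f ` ?C \<subseteq> {z \<in> affine_lattice h 0. norm z \<le> norm p + norm x + norm w}"
  proof
    fix y assume "y \<in> ?f ` ?C"
    then obtain t where t: "t \<in> ?C" "y = ?f t" by blast
    have "norm y \<le> norm p + norm (t *\<^sub>R x) + norm (r t *\<^sub>R w)"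
      unfolding t(2) by (meson norm_triangle_ineq norm_triangle_ineq4 add_mono order_refl order_trans)
    also have "\<dots> \<le> norm p + norm x + norm w"
      using t r[OF t(1)] by (intro add_mono) (auto simp: mult_left_le_one_le)
    finally show "y \<in> {z \<in> affine_lattice h 0. norm z \<le> norm p + norm x + norm w}"
      using r[OF t(1)] t by (simp add: affine_lattice_0)
  qed
  then have "finite (?f ` ?C)" by (rule finite_subset) (rule finite_lattice_Int_norm[OF assms(1)])
  then show ?thesis using inj by (rule finite_imageD)
qed

text \<open>Only the labelling has to be supplied. A segment parallel to the slit never changes the copy, as then
  the determinant in the crossing condition vanishes.\<close>

lemma saddle_holonomyI:
  assumes h: "det h = 1" and p: "p \<in> {0, w}" "p + x \<in> marked h w"
    and first: "\<And>t. t \<in> {0<..<1} \<Longrightarrow> p + t *\<^sub>R x \<notin> marked h w"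
  shows "saddle_holonomy h w x"
proof -
  define d where "d = det (vector [w, x] :: real^2^2)"
  define C where "C = (if d = 0 then {} else {t \<in> {0<..<1}. p + t *\<^sub>R x \<in> open_slit h w})"
  have "finite C" unfolding C_def d_def using finite_slit_crossings[OF h] by auto
  from labelling_exists[OF this, of d] obtain \<sigma> :: "real \<Rightarrow> bool" where \<sigma>: "\<forall>t. \<forall>\<^sub>F t' in at t.
      \<sigma> t' = (if t \<in> C \<and> (t' - t) * d < 0 then \<not> \<sigma> t else \<sigma> t)"
    by (rule exE)
  have det: "det (vector [w, r *\<^sub>R x] :: real^2^2) = r * d" for r
    unfolding d_def by (simp add: det_2 algebra_simps)
  have "\<forall>\<^sub>F t' in at t. \<sigma> t' = (if p + t *\<^sub>R x \<in> open_slit h w \<and> det (vector [w, (t' - t) *\<^sub>R x]) < 0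
                    then \<not> \<sigma> t else \<sigma> t)" if "t \<in> {0<..<1}" for t
    using spec[OF \<sigma>, of t] by eventually_elim (use that in \<open>auto simp: det C_def split: if_splits\<close>)
  then show ?thesis unfolding saddle_holonomy_def using p first by blast
qed

text \<open>A segment between singular points is cut by the first singular point on it into a saddle
  connection and a rest.\<close>

lemma saddle_holonomy_on_segment:
  assumes h: "det h = 1" and x: "x \<in> sing_diffs (slit_torus h w)" "x \<noteq> 0"
  shows "\<exists>r\<in>{0<..1}. saddle_holonomy h w (r *\<^sub>R x)"
proof -
  obtain p where p: "p \<in> {0, w}" "p + x \<in> marked h w"
  proof (cases "x \<in> affine_lattice h (- w)")
    case True
    then have "w + x \<in> marked h w" unfolding marked_eq by (simp add: mem_affine_lattice_diff add.commute)
    then show ?thesis using that by blast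
  next
    case False
    then have "0 + x \<in> marked h w" using x(1) unfolding marked_eq sing_diffs_slit_torus by auto
    then show ?thesis using that by blast
  qed
  define H where "H = {r \<in> {0<..1}. p + r *\<^sub>R x \<in> marked h w}"
  have "finite ((\<lambda>r. p + r *\<^sub>R x) ` H)"
  proof (rule finite_subset)
    show "(\<lambda>r. p + r *\<^sub>R x) ` H \<subseteq> {z \<in> affine_lattice h 0. norm z \<le> norm p + norm x}
        \<union> {z \<in> affine_lattice h w. norm z \<le> norm p + norm x}"
    proof
      fix y assume "y \<in> (\<lambda>r. p + r *\<^sub>R x) ` H"
      then obtain r where r: "r \<in> {0<..1}" "y = p + r *\<^sub>R x" "y \<in> marked h w" unfolding H_def by auto
      have "norm y \<le> norm p + norm (r *\<^sub>R x)" unfolding r(2) by (rule norm_triangle_ineq)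
      also have "\<dots> \<le> norm p + norm x" using r(1) by (auto simp: mult_left_le_one_le)
      finally show "y \<in> {z \<in> affine_lattice h 0. norm z \<le> norm p + norm x}
        \<union> {z \<in> affine_lattice h w. norm z \<le> norm p + norm x}" using r(3) unfolding marked_eq by auto
    qed
  qed (use finite_lattice_Int_norm[OF h] in auto)
  moreover have "inj_on (\<lambda>r. p + r *\<^sub>R x) H" using x(2) by (auto simp: inj_on_def)
  ultimately have fin: "finite H" using finite_imageD by blast
  have "1 \<in> H" using p unfolding H_def by simp
  define r where "r = Min H"
  have r: "r \<in> H" unfolding r_def using fin \<open>1 \<in> H\<close> by (intro Min_in) auto
  have "p + t *\<^sub>R (r *\<^sub>R x) \<notin> marked h w" if t: "t \<in> {0<..<1}" for t
  proof
    assume m: "p + t *\<^sub>R (r *\<^sub>R x) \<in> marked h w"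
    have "t * r < 1 * r" using t r unfolding H_def by (intro mult_strict_right_mono) auto
    moreover have "t * r > 0" "r \<le> 1" using t r unfolding H_def by auto
    ultimately have "t * r \<in> H" "t * r < r" using m unfolding H_def by auto
    then show False using Min_le[OF fin, of "t * r"] unfolding r_def by simp
  qed
  then have "saddle_holonomy h w (r *\<^sub>R x)"
    using r p(1) unfolding H_def by (intro saddle_holonomyI[OF h, of p]) auto
  then show ?thesis using r unfolding H_def by blast
qed

lemma holonomy_subset_sing_diffs: "holonomy \<omega> \<subseteq> sing_diffs \<omega>"
  unfolding holonomy_def using saddle_holonomy_in_sing_diffs by blast

lemma sing_diffs_on_segment:
  assumes "\<omega> \<in> E_space" "x \<in> sing_diffs \<omega>" "x \<noteq> 0"
  shows "\<exists>r\<in>{0<..1}. r *\<^sub>R x \<in> holonomy \<omega>"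
  using assms saddle_holonomy_on_segment unfolding holonomy_def E_space_def by blast

text \<open>Passing from the holonomy vectors to all differences of singular points only adds vectors that
  are longer than a holonomy vector in the same direction. So neither the slopes nor the existence
  of short horizontal vectors is affected, even if the slit has rational direction.\<close>

lemma slopes_holonomy:
  assumes "\<omega> \<in> E_space" shows "slopes (holonomy \<omega>) = slopes (sing_diffs \<omega>)"
proof
  show "slopes (holonomy \<omega>) \<subseteq> slopes (sing_diffs \<omega>)" using holonomy_subset_sing_diffs unfolding slopes_def by blast
  show "slopes (sing_diffs \<omega>) \<subseteq> slopes (holonomy \<omega>)"
  proof
    fix s assume "s \<in> slopes (sing_diffs \<omega>)"
    then obtain z where z: "z \<in> sing_diffs \<omega>" "s = z $ 2 / z $ 1" "0 < z $ 1" "z $ 1 \<le> 1" "z $ 2 > 0"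
      unfolding slopes_def by auto
    then obtain r where r: "r \<in> {0<..1}" "r *\<^sub>R z \<in> holonomy \<omega>"
      using sing_diffs_on_segment[OF assms z(1)] by force
    have "r * z $ 1 \<le> 1" using r(1) z by (simp add: mult_le_one)
    then show "s \<in> slopes (holonomy \<omega>)" using z r unfolding slopes_def
      by (auto intro!: exI[of _ "r *\<^sub>R z"])
  qed
qed

lemma short_horizontal_holonomy:
  assumes "\<omega> \<in> E_space" shows "short_horizontal (holonomy \<omega>) \<longleftrightarrow> short_horizontal (sing_diffs \<omega>)"
proof
  assume "short_horizontal (sing_diffs \<omega>)"
  then obtain x where x: "0 < x" "x \<le> 1" "vector [x, 0] \<in> sing_diffs \<omega>" unfolding short_horizontal_def by blast
  then have "(vector [x, 0] :: real^2) \<noteq> 0" by (simp add: vec2_eq_iff)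
  then obtain r where r: "r \<in> {0<..1}" "r *\<^sub>R vector [x, 0] \<in> holonomy \<omega>"
    using sing_diffs_on_segment[OF assms x(3)] by blast
  moreover have "r *\<^sub>R vector [x, 0] = (vector [r * x, 0] :: real^2)" by (simp add: vec2_eq_iff)
  moreover have "0 < r * x" "r * x \<le> 1" using r(1) x by (auto intro: mult_le_one)
  ultimately show "short_horizontal (holonomy \<omega>)" unfolding short_horizontal_def by metis
next
  assume "short_horizontal (holonomy \<omega>)"
  then show "short_horizontal (sing_diffs \<omega>)"
    using holonomy_subset_sing_diffs[of \<omega>] unfolding short_horizontal_def by blast
qed

lemma mem_W_space_iff: "\<omega> \<in> W_space \<longleftrightarrow> \<omega> \<in> E_space \<and> short_horizontal (sing_diffs \<omega>)"
  unfolding W_space_def mem_Collect_eq using short_horizontal_holonomy[of \<omega>] by blast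

lemma act_slit_torus: "act_E A (slit_torus h w) = slit_torus (A ** h) (A *v w)"
proof -
  have "(\<lambda>x. A *v x) ` {w + 2 *\<^sub>R z |z. z \<in> lattice h} = {A *v w + 2 *\<^sub>R z |z. z \<in> (\<lambda>x. A *v x) ` lattice h}"
    unfolding setcompr_eq_image Collect_mem_eq image_image
    by (simp add: matrix_vector_right_distrib matrix_vector_mult_scaleR)
  then show ?thesis unfolding act_E_def slit_torus_def by (simp add: matrix_image_lattice)
qed

lemma is_slit_hmat:
  assumes "is_slit h w" shows "is_slit (hmat u ** h) (hmat u *v w)"
proof -
  have "r *\<^sub>R (hmat u *v w) - s *\<^sub>R (hmat u *v w) \<in> lattice (hmat u ** h)
      \<longleftrightarrow> r *\<^sub>R w - s *\<^sub>R w \<in> lattice h" for r s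
  proof -
    have "inj (\<lambda>x. hmat u *v x)" by (auto simp: inj_def vec2_eq_iff hmat_mult_vec)
    moreover have "r *\<^sub>R (hmat u *v w) - s *\<^sub>R (hmat u *v w) = hmat u *v (r *\<^sub>R w - s *\<^sub>R w)"
      by (simp add: matrix_vector_mult_diff_distrib matrix_vector_mult_scaleR)
    ultimately show ?thesis unfolding matrix_image_lattice[symmetric] by (metis inj_image_mem_iff)
  qed
  then show ?thesis using assms unfolding is_slit_def by blast
qed

lemma E_space_hmat:
  assumes "\<omega> \<in> E_space" shows "act_E (hmat u) \<omega> \<in> E_space"
proof -
  obtain h w where "\<omega> = slit_torus h w" "det h = 1" "is_slit h w" using assms unfolding E_space_def by auto
  moreover from this have "det (hmat u ** h) = 1" by (simp add: det_mul det_hmat)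
  ultimately show ?thesis unfolding E_space_def using is_slit_hmat act_slit_torus by blast
qed

lemma sing_diffs_hmat:
  assumes "\<omega> \<in> E_space" shows "sing_diffs (act_E (hmat u) \<omega>) = (\<lambda>x. hmat u *v x) ` sing_diffs \<omega>"
proof -
  obtain h w where \<omega>: "\<omega> = slit_torus h w" using assms unfolding E_space_def by auto
  have "hmat u *v (- w) = - (hmat u *v w)" by (simp add: vec2_eq_iff hmat_mult_vec)
  then show ?thesis unfolding \<omega> act_slit_torus sing_diffs_slit_torus image_Un matrix_image_affine_lattice by simp
qed

lemma slope_spectrum_W:
  assumes "\<omega> \<in> W_space" shows "slope_spectrum (slopes (sing_diffs \<omega>))"
proof -
  obtain h w where \<omega>: "\<omega> = slit_torus h w" "det h = 1" and sh: "short_horizontal (sing_diffs \<omega>)"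
    using assms unfolding mem_W_space_iff E_space_def by auto
  have U: "slopes (sing_diffs \<omega>) = slopes (affine_lattice h 0) \<union> slopes (affine_lattice h w) \<union> slopes (affine_lattice h (- w))"
    unfolding \<omega> sing_diffs_slit_torus slopes_def by blast
  have "finite (slopes (sing_diffs \<omega>) \<inter> {0<..M})" for M
    unfolding U Int_Un_distrib2 using finite_slopes_affine_lattice[OF \<omega>(2)] by blast
  moreover obtain v where "short_horizontal (affine_lattice h v)" "slopes (affine_lattice h v) \<subseteq> slopes (sing_diffs \<omega>)"
    using sh unfolding U unfolding \<omega> sing_diffs_slit_torus short_horizontal_def by blast
  then have "\<exists>s\<in>slopes (sing_diffs \<omega>). s > M" for M
    using slopes_affine_lattice_unbounded[OF \<omega>(2)] by blast
  ultimately show ?thesis unfolding slope_spectrum_def by blast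
qed

lemma R_W_eq_Least:
  assumes "\<omega> \<in> W_space" shows "R_W \<omega> = (LEAST u. u \<in> slopes (sing_diffs \<omega>) \<and> u > 0)"
proof -
  have E: "\<omega> \<in> E_space" using assms by (simp add: mem_W_space_iff)
  have "u > 0 \<and> act_E (hmat u) \<omega> \<in> W_space \<longleftrightarrow> u \<in> slopes (sing_diffs \<omega>) \<and> u > 0" for u
    using E_space_hmat[OF E, of u] short_horizontal_hmat_image[of u "sing_diffs \<omega>"]
    unfolding mem_W_space_iff sing_diffs_hmat[OF E] by blast
  then show ?thesis unfolding R_W_def by (simp only:)
qed

lemma R_W_Least:
  assumes "\<omega> \<in> W_space"
  shows "R_W \<omega> \<in> slopes (sing_diffs \<omega>)" "R_W \<omega> > 0" "\<And>s. s \<in> slopes (sing_diffs \<omega>) \<Longrightarrow> R_W \<omega> \<le> s"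
proof -
  note least = slope_spectrum_Least[OF slope_spectrum_W[OF assms] order_refl, folded R_W_eq_Least[OF assms]]
  show "R_W \<omega> \<in> slopes (sing_diffs \<omega>)" "R_W \<omega> > 0" by (fact least(1), fact least(2))
  show "R_W \<omega> \<le> s" if "s \<in> slopes (sing_diffs \<omega>)" for s using least(3)[OF that slopes_pos[OF that]] .
qed

lemma R_W_less_iff:
  assumes "\<omega> \<in> W_space" shows "R_W \<omega> < t \<longleftrightarrow> (\<exists>s\<in>slopes (sing_diffs \<omega>). s < t)"
proof
  assume "\<exists>s\<in>slopes (sing_diffs \<omega>). s < t"
  then obtain s where "s \<in> slopes (sing_diffs \<omega>)" "s < t" by blast
  then show "R_W \<omega> < t" using R_W_Least(3)[OF assms, of s] by simp
next
  assume "R_W \<omega> < t"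
  then show "\<exists>s\<in>slopes (sing_diffs \<omega>). s < t" using R_W_Least(1)[OF assms] by (rule bexI)
qed

lemma T_W_in_W_space:
  assumes "\<omega> \<in> W_space" shows "T_W \<omega> \<in> W_space"
proof -
  have E: "\<omega> \<in> E_space" using assms by (simp add: mem_W_space_iff)
  have "short_horizontal (sing_diffs (T_W \<omega>))"
    unfolding T_W_def sing_diffs_hmat[OF E] short_horizontal_hmat_image[OF R_W_Least(2)[OF assms]]
    by (rule R_W_Least(1)[OF assms])
  moreover have "T_W \<omega> \<in> E_space" unfolding T_W_def by (rule E_space_hmat[OF E])
  ultimately show ?thesis by (simp add: mem_W_space_iff)
qed

lemma gaps_W:
  assumes "\<omega> \<in> W_space"
  shows "slope_seq (holonomy \<omega>) (Suc n) - slope_seq (holonomy \<omega>) n = R_W ((T_W ^^ n) \<omega>)"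
proof -
  have "slope_seq (sing_diffs \<omega>) (Suc n) - slope_seq (sing_diffs \<omega>) n = R_W ((T_W ^^ n) \<omega>)"
  proof (rule gap_eq_return_time[where X = W_space])
    fix x assume x: "x \<in> W_space"
    then have "x \<in> E_space" by (simp add: mem_W_space_iff)
    then show "slopes (sing_diffs (T_W x)) = {s - R_W x |s. s \<in> slopes (sing_diffs x) \<and> s > R_W x}"
      unfolding T_W_def using slopes_hmat_image[of "R_W x" "sing_diffs x"] R_W_Least(2)[OF x]
      by (simp only: sing_diffs_hmat less_imp_le)
    show "slope_spectrum (slopes (sing_diffs x))" by (rule slope_spectrum_W[OF x])
    show "R_W x = (LEAST u. u \<in> slopes (sing_diffs x) \<and> u > 0)" by (rule R_W_eq_Least[OF x])
    show "T_W x \<in> W_space" by (rule T_W_in_W_space[OF x])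
  qed (rule assms)
  moreover have "slopes (holonomy \<omega>) = slopes (sing_diffs \<omega>)"
    using assms by (intro slopes_holonomy) (simp add: mem_W_space_iff)
  ultimately show ?thesis using slope_seq_cong by metis
qed

section \<open>Borel structures\<close>

lemma measurable_pair_components[measurable]:
  "fst \<in> borel_measurable (borel :: ('a::second_countable_topology \<times> 'b::second_countable_topology) measure)"
  "snd \<in> borel_measurable (borel :: ('a::second_countable_topology \<times> 'b::second_countable_topology) measure)"
  by (intro borel_measurable_continuous_onI continuous_intros)+

lemma measurable_vec_nth[measurable]:
  "(\<lambda>x::'a::euclidean_space^'n. x $ i) \<in> borel_measurable borel"
  by (intro borel_measurable_continuous_onI continuous_intros)

lemma borel_measurable_vecI:
  fixes f :: "'a \<Rightarrow> 'b::euclidean_space^'n"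
  assumes "\<And>i. (\<lambda>x. f x $ i) \<in> borel_measurable M"
  shows "f \<in> borel_measurable M"
proof (subst borel_measurable_euclidean_space, rule ballI)
  fix b :: "'b^'n" assume "b \<in> Basis"
  then obtain i c where "b = axis i c" unfolding Basis_vec_def by auto
  then have "(\<lambda>x. f x \<bullet> b) = (\<lambda>x. f x $ i \<bullet> c)" by (simp add: inner_axis)
  then show "(\<lambda>x. f x \<bullet> b) \<in> borel_measurable M" using assms[of i] by simp
qed

lemma borel_measurable_vec2:
  fixes f g :: "'a \<Rightarrow> 'b::euclidean_space"
  assumes "f \<in> borel_measurable M" "g \<in> borel_measurable M"
  shows "(\<lambda>x. vector [f x, g x] :: 'b^2) \<in> borel_measurable M"
proof (rule borel_measurable_vecI)
  fix i :: 2
  show "(\<lambda>x. (vector [f x, g x] :: 'b^2) $ i) \<in> borel_measurable M"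
    using exhaust_2[of i] assms by auto
qed

text \<open>Slopes range over integer pairs, so that conditions on them are countable combinations of
  conditions on \<open>h\<close> and \<open>v\<close>.\<close>

lemma slopes_affine_lattice_iff:
  "s \<in> slopes (affine_lattice h v) \<longleftrightarrow> (\<exists>m n::int.
     let x = h $ 1 $ 1 * of_int m + h $ 1 $ 2 * of_int n + v $ 1;
         y = h $ 2 $ 1 * of_int m + h $ 2 $ 2 * of_int n + v $ 2
     in 0 < x \<and> x \<le> 1 \<and> y > 0 \<and> s = y / x)"
proof -
  have "s \<in> slopes (affine_lattice h v) \<longleftrightarrow> (\<exists>m n::int. let z = h *v vector [of_int m, of_int n] + v
      in 0 < z $ 1 \<and> z $ 1 \<le> 1 \<and> z $ 2 > 0 \<and> s = z $ 2 / z $ 1)"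
    unfolding slopes_def mem_Collect_eq mem_affine_lattice_iff Let_def by blast
  then show ?thesis by (simp add: mat2_mult_vec Let_def)
qed

lemma short_horizontal_affine_lattice_iff:
  "short_horizontal (affine_lattice h v) \<longleftrightarrow> (\<exists>m n::int.
     let x = h $ 1 $ 1 * of_int m + h $ 1 $ 2 * of_int n + v $ 1;
         y = h $ 2 $ 1 * of_int m + h $ 2 $ 2 * of_int n + v $ 2
     in 0 < x \<and> x \<le> 1 \<and> y = 0)"
  unfolding short_horizontal_def mem_affine_lattice_iff Let_def
  by (auto simp: mat2_mult_vec vec2_eq_iff)

lemma pred_slope_less[measurable]:
  assumes [measurable]: "h \<in> borel_measurable M" "v \<in> borel_measurable M"
  shows "Measurable.pred M (\<lambda>p. \<exists>s\<in>slopes (affine_lattice (h p) (v p)). s < t)"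
proof -
  have "(\<exists>s\<in>slopes (affine_lattice (h p) (v p)). s < t) \<longleftrightarrow> (\<exists>m n::int.
     let x = h p $ 1 $ 1 * of_int m + h p $ 1 $ 2 * of_int n + v p $ 1;
         y = h p $ 2 $ 1 * of_int m + h p $ 2 $ 2 * of_int n + v p $ 2
     in 0 < x \<and> x \<le> 1 \<and> y > 0 \<and> y / x < t)" for p
    unfolding Bex_def slopes_affine_lattice_iff Let_def by blast
  then show ?thesis unfolding Let_def by simp measurable
qed

lemma pred_short_horizontal[measurable]:
  assumes [measurable]: "h \<in> borel_measurable M" "v \<in> borel_measurable M"
  shows "Measurable.pred M (\<lambda>p. short_horizontal (affine_lattice (h p) (v p)))"
  unfolding short_horizontal_affine_lattice_iff Let_def by measurable

lemma pred_det_eq_1[measurable]: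
  assumes [measurable]: "h \<in> borel_measurable M"
  shows "Measurable.pred M (\<lambda>p. det (h p :: real^2^2) = 1)"
  unfolding det_2 by measurable

lemma affine_lattice_in_Omega_iff:
  "det h = 1 \<Longrightarrow> affine_lattice h v \<in> Omega \<longleftrightarrow> short_horizontal (affine_lattice h v)"
  unfolding Omega_def AX2_def by auto

lemma space_Omega_borel: "space Omega_borel = Omega"
  unfolding Omega_borel_def by (rule space_measure_of) auto

lemma borel_measurable_R_Omega: "R_Omega \<in> borel_measurable Omega_borel"
proof (rule borel_measurableI_less)
  fix t :: real
  let ?A = "{\<Lambda> \<in> Omega. R_Omega \<Lambda> < t}"
  have "Omega_lift ?A = {p. det (fst p) = 1 \<and> short_horizontal (affine_lattice (fst p) (snd p))
      \<and> (\<exists>s\<in>slopes (affine_lattice (fst p) (snd p)). s < t)}"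
    unfolding Omega_lift_def by (auto simp: affine_lattice_in_Omega_iff R_Omega_less_iff)
  also have "\<dots> \<in> sets borel" by measurable
  finally have "?A \<in> sets Omega_borel" unfolding Omega_borel_def by (auto intro!: in_measure_of)
  then show "{x \<in> space Omega_borel. R_Omega x < t} \<in> sets Omega_borel" by (simp add: space_Omega_borel)
qed

text \<open>The Borel structure of \<open>Omega\<close> is defined by preimages in \<open>(h, v)\<close>, so a parametrisation is
  measurable as soon as \<open>h\<close> and \<open>v\<close> are.\<close>

lemma emeasure_distr_uniform_Omega:
  fixes C :: "'a::euclidean_space set"
  assumes C: "C \<in> sets borel"
    and h: "h \<in> borel_measurable borel" and v: "v \<in> borel_measurable borel"
    and det: "\<And>p. p \<in> C \<Longrightarrow> det (h p) = 1"
    and sh: "\<And>p. p \<in> C \<Longrightarrow> short_horizontal (affine_lattice (h p) (v p))"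
    and A: "A \<in> sets Omega_borel"
  defines "\<mu> \<equiv> distr (uniform_measure (restrict_space lborel C) C) Omega_borel (\<lambda>p. affine_lattice (h p) (v p))"
  shows "{p \<in> C. affine_lattice (h p) (v p) \<in> A} \<in> sets borel"
    "emeasure \<mu> A = emeasure lborel {p \<in> C. affine_lattice (h p) (v p) \<in> A} / emeasure lborel C"
proof -
  let ?\<Phi> = "\<lambda>p. affine_lattice (h p) (v p)" and ?N = "restrict_space lborel C"
  have space: "space ?N = C" using C by (simp add: space_restrict_space)
  have \<Phi>: "?\<Phi> \<in> measurable ?N Omega_borel" unfolding Omega_borel_def
  proof (rule measurable_measure_of)
    show "?\<Phi> \<in> space ?N \<rightarrow> Omega" using det sh by (auto simp: space affine_lattice_in_Omega_iff)
    fix B assume "B \<in> {A. A \<subseteq> Omega \<and> Omega_lift A \<in> sets borel}"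
    then have B: "Omega_lift B \<in> sets borel" by simp
    have [measurable]: "(\<lambda>p. (h p, v p)) \<in> borel_measurable borel" using h v by measurable
    have "?\<Phi> -` B \<inter> C = (\<lambda>p. (h p, v p)) -` Omega_lift B \<inter> C"
      using det unfolding Omega_lift_def by auto
    also have "\<dots> \<in> sets borel" using measurable_sets_borel[OF \<open>(\<lambda>p. (h p, v p)) \<in> borel_measurable borel\<close> B] C by auto
    finally show "?\<Phi> -` B \<inter> space ?N \<in> sets ?N"
      using C unfolding space by (subst sets_restrict_space_iff) auto
  qed auto
  have pre: "{p \<in> C. ?\<Phi> p \<in> A} = ?\<Phi> -` A \<inter> space ?N" unfolding space by auto
  have sN: "{p \<in> C. ?\<Phi> p \<in> A} \<in> sets ?N" unfolding pre using \<Phi> A by (rule measurable_sets)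
  then show "{p \<in> C. ?\<Phi> p \<in> A} \<in> sets borel" using C by (subst (asm) sets_restrict_space_iff) auto
  have CN: "C \<in> sets ?N" using C by (subst sets_restrict_space_iff) auto
  have "emeasure \<mu> A = emeasure (uniform_measure ?N C) {p \<in> C. ?\<Phi> p \<in> A}"
  proof -
    have "?\<Phi> \<in> measurable (uniform_measure ?N C) Omega_borel"
      using \<Phi> measurable_cong_sets[OF sets_uniform_measure refl] by blast
    then show ?thesis unfolding \<mu>_def pre using A by (subst emeasure_distr) simp_all
  qed
  also have "\<dots> = emeasure ?N (C \<inter> {p \<in> C. ?\<Phi> p \<in> A}) / emeasure ?N C"
    using CN sN by (rule emeasure_uniform_measure)
  also have "C \<inter> {p \<in> C. ?\<Phi> p \<in> A} = {p \<in> C. ?\<Phi> p \<in> A}" by auto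
  also have "emeasure ?N \<dots> = emeasure lborel {p \<in> C. ?\<Phi> p \<in> A}" using C by (subst emeasure_restrict_space) auto
  also have "emeasure ?N C = emeasure lborel C" using C by (subst emeasure_restrict_space) auto
  finally show "emeasure \<mu> A = emeasure lborel {p \<in> C. ?\<Phi> p \<in> A} / emeasure lborel C" .
qed

section \<open>The space of slit tori\<close>

lemma slit_torus_eq_iff:
  "slit_torus h w = slit_torus h' w' \<longleftrightarrow> lattice h = lattice h' \<and> (\<exists>z\<in>lattice h. w' = w + 2 *\<^sub>R z)"
proof
  assume e: "slit_torus h w = slit_torus h' w'"
  then have l: "lattice h = lattice h'" unfolding slit_torus_def by simp
  have "w' \<in> snd (slit_torus h' w')" unfolding slit_torus_def using lattice_zero[of h'] by force
  then have "w' \<in> snd (slit_torus h w)" using e by simp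
  then show "lattice h = lattice h' \<and> (\<exists>z\<in>lattice h. w' = w + 2 *\<^sub>R z)" using l unfolding slit_torus_def by auto
next
  assume "lattice h = lattice h' \<and> (\<exists>z\<in>lattice h. w' = w + 2 *\<^sub>R z)"
  then obtain z where z: "lattice h = lattice h'" "z \<in> lattice h" "w' = w + 2 *\<^sub>R z" by blast
  have "(\<exists>y\<in>lattice h. x = w + 2 *\<^sub>R y) \<longleftrightarrow> (\<exists>y\<in>lattice h. x = w + 2 *\<^sub>R z + 2 *\<^sub>R y)" for x
  proof
    assume "\<exists>y\<in>lattice h. x = w + 2 *\<^sub>R y"
    then obtain y where "y \<in> lattice h" "x = w + 2 *\<^sub>R y" by blast
    then show "\<exists>y\<in>lattice h. x = w + 2 *\<^sub>R z + 2 *\<^sub>R y" using lattice_diff[OF _ z(2), of y]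
      by (intro bexI[of _ "y - z"]) (simp_all add: algebra_simps)
  next
    assume "\<exists>y\<in>lattice h. x = w + 2 *\<^sub>R z + 2 *\<^sub>R y"
    then obtain y where "y \<in> lattice h" "x = w + 2 *\<^sub>R z + 2 *\<^sub>R y" by blast
    then show "\<exists>y\<in>lattice h. x = w + 2 *\<^sub>R y" using lattice_add[OF _ z(2), of y]
      by (intro bexI[of _ "y + z"]) (simp_all add: algebra_simps)
  qed
  then have "{w + 2 *\<^sub>R y |y. y \<in> lattice h} = {w' + 2 *\<^sub>R y |y. y \<in> lattice h}"
    unfolding z(3) by blast
  then show "slit_torus h w = slit_torus h' w'" unfolding slit_torus_def z(1) by simp
qed

lemma is_slit_cong: "lattice h = lattice h' \<Longrightarrow> is_slit h w \<longleftrightarrow> is_slit h' w"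
  unfolding is_slit_def by simp

text \<open>A pair \<open>(h, w)\<close> encodes a surface if some representative of the class of \<open>w\<close> modulo
  \<open>2 h\<int>\<^sup>2\<close> is a slit; \<open>w\<close> itself may fail to be embedded.\<close>

lemma slit_torus_in_E_space_iff:
  assumes "det h = 1"
  shows "slit_torus h w \<in> E_space \<longleftrightarrow> (\<exists>z\<in>lattice h. is_slit h (w + 2 *\<^sub>R z))"
proof
  assume "slit_torus h w \<in> E_space"
  then obtain h' w' where "slit_torus h w = slit_torus h' w'" "is_slit h' w'" unfolding E_space_def by auto
  then show "\<exists>z\<in>lattice h. is_slit h (w + 2 *\<^sub>R z)" unfolding slit_torus_eq_iff using is_slit_cong by blast
next
  assume "\<exists>z\<in>lattice h. is_slit h (w + 2 *\<^sub>R z)"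
  then obtain z where "z \<in> lattice h" "is_slit h (w + 2 *\<^sub>R z)" by blast
  moreover from this have "slit_torus h w = slit_torus h (w + 2 *\<^sub>R z)" unfolding slit_torus_eq_iff by blast
  ultimately show "slit_torus h w \<in> E_space" unfolding E_space_def using assms by blast
qed

text \<open>The condition on a slit, that no point of it other than its start is a lattice point, is made
  explicit for a single lattice point: the lattice point is parallel to the slit, points into its
  direction and is not longer.\<close>

lemma on_ray_iff:
  fixes w l :: "real^2"
  shows "(\<exists>t. 0 < t \<and> t \<le> 1 \<and> t *\<^sub>R w = l) \<longleftrightarrow>
    (w $ 1 = 0 \<and> w $ 2 = 0 \<and> l $ 1 = 0 \<and> l $ 2 = 0) \<or>
    (w $ 1 * l $ 2 = w $ 2 * l $ 1 \<and> 0 < w $ 1 * l $ 1 + w $ 2 * l $ 2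
      \<and> w $ 1 * l $ 1 + w $ 2 * l $ 2 \<le> w $ 1 * w $ 1 + w $ 2 * w $ 2)" (is "?L \<longleftrightarrow> ?R")
proof
  assume ?L
  then obtain t where t: "0 < t" "t \<le> 1" "l = t *\<^sub>R w" by blast
  define q where "q = w $ 1 * w $ 1 + w $ 2 * w $ 2"
  have q: "q \<ge> 0" "q = 0 \<longleftrightarrow> w $ 1 = 0 \<and> w $ 2 = 0" unfolding q_def by (auto simp: sum_squares_eq_zero_iff)
  have "w $ 1 * l $ 1 + w $ 2 * l $ 2 = t * q" unfolding t(3) q_def by (simp add: algebra_simps)
  moreover have "t * q \<le> q" using t q by (simp add: mult_left_le_one_le)
  ultimately show ?R using q t unfolding q_def[symmetric] by (cases "q = 0") (auto simp: algebra_simps)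
next
  assume ?R
  then show ?L
  proof
    assume "w $ 1 = 0 \<and> w $ 2 = 0 \<and> l $ 1 = 0 \<and> l $ 2 = 0"
    then show ?L by (intro exI[of _ 1]) (simp add: vec2_eq_iff)
  next
    assume R: "w $ 1 * l $ 2 = w $ 2 * l $ 1 \<and> 0 < w $ 1 * l $ 1 + w $ 2 * l $ 2
      \<and> w $ 1 * l $ 1 + w $ 2 * l $ 2 \<le> w $ 1 * w $ 1 + w $ 2 * w $ 2"
    define q p where "q = w $ 1 * w $ 1 + w $ 2 * w $ 2" and "p = w $ 1 * l $ 1 + w $ 2 * l $ 2"
    have pq: "0 < p" "p \<le> q" using R unfolding p_def q_def by auto
    have "p * w $ 1 = q * l $ 1" "p * w $ 2 = q * l $ 2" using R unfolding p_def q_def by algebra+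
    then have "(p / q) *\<^sub>R w = l" using pq by (simp add: vec2_eq_iff field_simps)
    then show ?L using pq by (intro exI[of _ "p / q"]) auto
  qed
qed

lemma is_slit_iff: "is_slit h w \<longleftrightarrow> (\<forall>l\<in>lattice h. \<not> (\<exists>t. 0 < t \<and> t \<le> 1 \<and> t *\<^sub>R w = l))"
proof
  assume s: "is_slit h w"
  have "t *\<^sub>R w \<notin> lattice h" if "0 < t" "t \<le> 1" for t
  proof -
    have "t *\<^sub>R w - 0 *\<^sub>R w \<notin> lattice h" using that
      by (intro s[unfolded is_slit_def, rule_format]) auto
    then show ?thesis by simp
  qed
  then show "\<forall>l\<in>lattice h. \<not> (\<exists>t. 0 < t \<and> t \<le> 1 \<and> t *\<^sub>R w = l)" by blast
next
  assume A: "\<forall>l\<in>lattice h. \<not> (\<exists>t. 0 < t \<and> t \<le> 1 \<and> t *\<^sub>R w = l)"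
  show "is_slit h w" unfolding is_slit_def
  proof (intro ballI impI notI)
    fix r s :: real assume rs: "r \<in> {0..1}" "s \<in> {0..1}" "r \<noteq> s" "r *\<^sub>R w - s *\<^sub>R w \<in> lattice h"
    show False
    proof (cases "r > s")
      case True
      have "(r - s) *\<^sub>R w \<in> lattice h" using rs(4) by (simp add: algebra_simps)
      moreover have "0 < r - s" "r - s \<le> 1" using True rs by auto
      ultimately show False using A by blast
    next
      case False
      have "(s - r) *\<^sub>R w \<in> lattice h" using lattice_uminus[OF rs(4)] by (simp add: algebra_simps)
      moreover have "0 < s - r" "s - r \<le> 1" using False rs by auto
      ultimately show False using A by blast
    qed
  qed
qed

lemma pred_is_slit:
  assumes [measurable]: "h \<in> borel_measurable M" "w \<in> borel_measurable M"
  shows "Measurable.pred M (\<lambda>p. is_slit (h p) (w p))"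
proof -
  have e: "is_slit (h p) (w p) \<longleftrightarrow> (\<forall>m n::int. \<not> (\<exists>t. 0 < t \<and> t \<le> 1 \<and> t *\<^sub>R w p = h p *v vector [of_int m, of_int n]))" for p
    unfolding is_slit_iff Ball_def mem_lattice_iff by blast
  have ray: "Measurable.pred M (\<lambda>p. \<not> ((w1 p = 0 \<and> w2 p = 0 \<and> l1 p = 0 \<and> l2 p = 0) \<or>
    (w1 p * l2 p = w2 p * l1 p \<and> 0 < w1 p * l1 p + w2 p * l2 p
      \<and> w1 p * l1 p + w2 p * l2 p \<le> w1 p * w1 p + w2 p * w2 p)))"
    if [measurable]: "w1 \<in> borel_measurable M" "w2 \<in> borel_measurable M" "l1 \<in> borel_measurable M" "l2 \<in> borel_measurable M"
    for w1 w2 l1 l2 :: "'a \<Rightarrow> real"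
    by measurable
  have hm: "(\<lambda>p. (h p *v vector [of_int m, of_int n]) $ i) \<in> borel_measurable M" for m n :: int and i
    using exhaust_2[of i] by (auto simp: mat2_mult_vec)
  show ?thesis unfolding e on_ray_iff by (intro pred_intros_countable ray hm) measurable
qed

lemma pred_in_E_space:
  assumes [measurable]: "h \<in> borel_measurable M" "w \<in> borel_measurable M"
  shows "Measurable.pred M (\<lambda>p. det (h p) = 1 \<and> slit_torus (h p) (w p) \<in> E_space)"
proof -
  have e: "det (h p) = 1 \<and> slit_torus (h p) (w p) \<in> E_space \<longleftrightarrow>
      det (h p) = 1 \<and> (\<exists>m n::int. is_slit (h p) (w p + 2 *\<^sub>R (h p *v vector [of_int m, of_int n])))" for p
    using slit_torus_in_E_space_iff[of "h p" "w p"] unfolding Bex_def mem_lattice_iff by blast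
  have [measurable]: "(\<lambda>p. w p + 2 *\<^sub>R (h p *v vector [of_int m, of_int n])) \<in> borel_measurable M" for m n :: int
  proof (rule borel_measurable_vecI)
    fix i :: 2
    show "(\<lambda>p. (w p + 2 *\<^sub>R (h p *v vector [of_int m, of_int n])) $ i) \<in> borel_measurable M"
      using exhaust_2[of i] by (auto simp: mat2_mult_vec)
  qed
  have [measurable]: "Measurable.pred M (\<lambda>p. is_slit (h p) (w p + 2 *\<^sub>R (h p *v vector [of_int m, of_int n])))" for m n :: int
    by (rule pred_is_slit) measurable
  show ?thesis unfolding e by measurable
qed

lemma slopes_Un: "slopes (A \<union> B) = slopes A \<union> slopes B"
  unfolding slopes_def by blast

lemma short_horizontal_Un: "short_horizontal (A \<union> B) \<longleftrightarrow> short_horizontal A \<or> short_horizontal B"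
  unfolding short_horizontal_def by blast

definition W_sets :: "surface set set" where
  "W_sets = {A. A \<subseteq> W_space \<and> W_lift A \<in> sets borel}"

lemma W_lift_W_space_Int_R_less:
  "W_lift {\<omega> \<in> W_space. R_W \<omega> < t} \<in> sets borel" (is "?A \<in> _")
  "W_lift W_space \<in> sets borel" (is "?B \<in> _")
proof -
  have E: "{p. det (fst p) = 1 \<and> slit_torus (fst p) (snd p) \<in> E_space} \<in> sets borel"
    using pred_in_E_space[of fst borel snd] unfolding pred_def by (auto simp: space_borel)
  have "?B = {p. det (fst p) = 1 \<and> slit_torus (fst p) (snd p) \<in> E_space} \<inter> {p.
     short_horizontal (affine_lattice (fst p) 0) \<or> short_horizontal (affine_lattice (fst p) (snd p)) \<or> short_horizontal (affine_lattice (fst p) (- snd p))}"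
    unfolding W_lift_def mem_W_space_iff sing_diffs_slit_torus short_horizontal_Un by auto
  moreover have "{p :: (real^2^2) \<times> (real^2). short_horizontal (affine_lattice (fst p) 0)
      \<or> short_horizontal (affine_lattice (fst p) (snd p)) \<or> short_horizontal (affine_lattice (fst p) (- snd p))} \<in> sets borel"
    by measurable
  ultimately show B: "?B \<in> sets borel" using E by auto
  have "?A = ?B \<inter> {p. (\<exists>s\<in>slopes (affine_lattice (fst p) 0). s < t)
     \<or> (\<exists>s\<in>slopes (affine_lattice (fst p) (snd p)). s < t) \<or> (\<exists>s\<in>slopes (affine_lattice (fst p) (- snd p)). s < t)}"
    unfolding W_lift_def by (auto simp: R_W_less_iff sing_diffs_slit_torus slopes_Un)
  moreover have "{p :: (real^2^2) \<times> (real^2). (\<exists>s\<in>slopes (affine_lattice (fst p) 0). s < t)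
     \<or> (\<exists>s\<in>slopes (affine_lattice (fst p) (snd p)). s < t) \<or> (\<exists>s\<in>slopes (affine_lattice (fst p) (- snd p)). s < t)} \<in> sets borel"
    by measurable
  ultimately show "?A \<in> sets borel" using B by auto
qed

lemma sigma_algebra_W_sets: "sigma_algebra W_space W_sets"
  unfolding sigma_algebra_iff2
proof (intro conjI ballI allI impI)
  show "W_sets \<subseteq> Pow W_space" unfolding W_sets_def by blast
  show "{} \<in> W_sets" unfolding W_sets_def W_lift_def by simp
  fix A assume A: "A \<in> W_sets"
  have "W_lift (W_space - A) = W_lift W_space - W_lift A" unfolding W_lift_def by auto
  then show "W_space - A \<in> W_sets" using A W_lift_W_space_Int_R_less(2) unfolding W_sets_def by auto
next
  fix A :: "nat \<Rightarrow> surface set" assume A: "range A \<subseteq> W_sets"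
  have "W_lift (\<Union> (range A)) = (\<Union>i. W_lift (A i))" unfolding W_lift_def by auto
  moreover have "W_lift (A i) \<in> sets borel" for i using A unfolding W_sets_def by auto
  ultimately show "\<Union> (range A) \<in> W_sets" using A unfolding W_sets_def by auto
qed

definition sa_param :: "real^2 \<Rightarrow> real \<times> real \<times> real \<times> real \<Rightarrow> surface" where
  "sa_param e = (\<lambda>(a, b, s, \<alpha>). let h = hmat s ** pmat a b in slit_torus h (vector [\<alpha>, 0] - h *v e))"

definition sl_param :: "real^2 \<Rightarrow> real \<times> real \<times> real \<times> real \<Rightarrow> surface" where
  "sl_param e = (\<lambda>(a, b, x, y). slit_torus (pmat a b) (pmat a b *v vector [x, y] - pmat a b *v e))"

definition sl_coords :: "(real \<times> real \<times> real \<times> real) set" where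
  "sl_coords = {(a, b, x, y). (a, b) \<in> Delta \<and> x \<in> {0..<1} \<and> y \<in> {0..<1}}"

lemma sa_mass_eq: "sa_mass A = (\<Sum>e\<in>corners. emeasure lborel {p \<in> Omega_coords. sa_param e p \<in> A})"
  unfolding sa_mass_def sa_param_def
  by (intro sum.cong refl arg_cong[of _ _ "emeasure lborel"]) (auto simp: Let_def)

lemma sl_mass_eq: "sl_mass A = (\<Sum>e\<in>corners. emeasure lborel {p \<in> sl_coords. sl_param e p \<in> A})"
  unfolding sl_mass_def sl_param_def sl_coords_def
  by (intro sum.cong refl arg_cong[of _ _ "emeasure lborel"]) auto

lemma hp_entries: "(hmat s ** pmat a b) $ 1 $ 1 = a" "(hmat s ** pmat a b) $ 1 $ 2 = b"
    "(hmat s ** pmat a b) $ 2 $ 1 = - (s * a)" "(hmat s ** pmat a b) $ 2 $ 2 = 1 / a - s * b"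
  by (simp_all add: matrix_matrix_mult_def sum_2 hmat_def pmat_def)

lemma pmat_entries: "pmat a b $ 1 $ 1 = a" "pmat a b $ 1 $ 2 = b"
    "pmat a b $ 2 $ 1 = 0" "pmat a b $ 2 $ 2 = 1 / a"
  by (simp_all add: pmat_def)

lemma det_hp: "a \<noteq> 0 \<Longrightarrow> det (hmat s ** pmat a b) = 1"
  unfolding det_2 hp_entries by (simp add: field_simps)

lemma det_pmat: "a \<noteq> 0 \<Longrightarrow> det (pmat a b) = 1"
  unfolding det_2 pmat_entries by (simp add: field_simps)

lemma borel_measurable_mat2:
  fixes f :: "'a \<Rightarrow> real^2^2"
  assumes "(\<lambda>x. f x $ 1 $ 1) \<in> borel_measurable M" "(\<lambda>x. f x $ 1 $ 2) \<in> borel_measurable M"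
    "(\<lambda>x. f x $ 2 $ 1) \<in> borel_measurable M" "(\<lambda>x. f x $ 2 $ 2) \<in> borel_measurable M"
  shows "f \<in> borel_measurable M"
proof (intro borel_measurable_vecI)
  fix i j :: 2
  show "(\<lambda>x. f x $ i $ j) \<in> borel_measurable M" using assms exhaust_2[of i] exhaust_2[of j] by auto
qed

lemma borel_measurable_hp:
  assumes [measurable]: "a \<in> borel_measurable M" "b \<in> borel_measurable M" "s \<in> borel_measurable M"
  shows "(\<lambda>p. hmat (s p) ** pmat (a p) (b p)) \<in> borel_measurable M"
  by (rule borel_measurable_mat2; unfold hp_entries; measurable)

lemma borel_measurable_pmat:
  assumes [measurable]: "a \<in> borel_measurable M" "b \<in> borel_measurable M"
  shows "(\<lambda>p. pmat (a p) (b p)) \<in> borel_measurable M"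
  by (rule borel_measurable_mat2; unfold pmat_entries; measurable)

lemma borel_measurable_mat_mult_vec:
  fixes h :: "'a \<Rightarrow> real^2^2"
  assumes [measurable]: "h \<in> borel_measurable M" "v \<in> borel_measurable M"
  shows "(\<lambda>p. h p *v v p) \<in> borel_measurable M"
proof (rule borel_measurable_vecI)
  fix i :: 2
  show "(\<lambda>p. (h p *v v p) $ i) \<in> borel_measurable M" using exhaust_2[of i] by (auto simp: mat2_mult_vec)
qed

lemma sets_Delta_coords: "Delta \<in> sets borel" "Omega_coords \<in> sets borel" "sl_coords \<in> sets borel"
proof -
  have "Delta = {p. 0 < fst p \<and> fst p \<le> 1 \<and> 1 - fst p < snd p \<and> snd p \<le> 1}" unfolding Delta_def by auto
  also have "\<dots> \<in> sets borel" by measurable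
  finally show "Delta \<in> sets borel" .
  have "Omega_coords = {p. 0 < fst p \<and> fst p \<le> 1 \<and> 1 - fst p < fst (snd p) \<and> fst (snd p) \<le> 1 \<and>
      0 \<le> fst (snd (snd p)) \<and> fst (snd (snd p)) < 1 / (fst p * fst (snd p)) \<and> 0 < snd (snd (snd p)) \<and> snd (snd (snd p)) \<le> 1}"
    unfolding Omega_coords_def Delta_def by auto
  also have "\<dots> \<in> sets borel" by measurable
  finally show "Omega_coords \<in> sets borel" .
  have "sl_coords = {p. 0 < fst p \<and> fst p \<le> 1 \<and> 1 - fst p < fst (snd p) \<and> fst (snd p) \<le> 1 \<and>
      0 \<le> fst (snd (snd p)) \<and> fst (snd (snd p)) < 1 \<and> 0 \<le> snd (snd (snd p)) \<and> snd (snd (snd p)) < 1}"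
    unfolding sl_coords_def Delta_def by auto
  also have "\<dots> \<in> sets borel" by measurable
  finally show "sl_coords \<in> sets borel" .
qed

lemma sets_slit_torus_vimage:
  fixes C :: "'a::euclidean_space set"
  assumes "C \<in> sets borel" "h \<in> borel_measurable borel" "w \<in> borel_measurable borel"
    "\<And>p. p \<in> C \<Longrightarrow> det (h p) = 1" "A \<in> W_sets"
  shows "{p \<in> C. slit_torus (h p) (w p) \<in> A} \<in> sets borel"
proof -
  have [measurable]: "(\<lambda>p. (h p, w p)) \<in> borel_measurable borel" using assms(2,3) by measurable
  have "{p \<in> C. slit_torus (h p) (w p) \<in> A} = (\<lambda>p. (h p, w p)) -` W_lift A \<inter> C"
    using assms(4) unfolding W_lift_def by auto
  moreover have "W_lift A \<in> sets borel" using assms(5) unfolding W_sets_def by simp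
  ultimately show ?thesis using measurable_sets_borel[OF \<open>(\<lambda>p. (h p, w p)) \<in> borel_measurable borel\<close>, of "W_lift A"] assms(1) by auto
qed

lemma sets_sa_param: "A \<in> W_sets \<Longrightarrow> {p \<in> Omega_coords. sa_param e p \<in> A} \<in> sets borel"
proof -
  assume A: "A \<in> W_sets"
  let ?h = "\<lambda>p::real\<times>real\<times>real\<times>real. hmat (fst (snd (snd p))) ** pmat (fst p) (fst (snd p))"
  let ?w = "\<lambda>p. vector [snd (snd (snd p)), 0] - ?h p *v e"
  have "?h \<in> borel_measurable borel" by (rule borel_measurable_hp) measurable
  moreover from this have "?w \<in> borel_measurable borel"
    by (intro borel_measurable_diff borel_measurable_vec2 borel_measurable_mat_mult_vec) auto
  moreover have "det (?h p) = 1" if "p \<in> Omega_coords" for p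
    using that unfolding Omega_coords_def Delta_def by (intro det_hp) auto
  ultimately have "{p \<in> Omega_coords. slit_torus (?h p) (?w p) \<in> A} \<in> sets borel"
    by (intro sets_slit_torus_vimage sets_Delta_coords A)
  then show ?thesis unfolding sa_param_def by (simp add: case_prod_beta Let_def)
qed

lemma sets_sl_param: "A \<in> W_sets \<Longrightarrow> {p \<in> sl_coords. sl_param e p \<in> A} \<in> sets borel"
proof -
  assume A: "A \<in> W_sets"
  let ?h = "\<lambda>p::real\<times>real\<times>real\<times>real. pmat (fst p) (fst (snd p))"
  let ?w = "\<lambda>p. ?h p *v vector [fst (snd (snd p)), snd (snd (snd p))] - ?h p *v e"
  have "?h \<in> borel_measurable borel" by (rule borel_measurable_pmat) measurable
  moreover from this have "?w \<in> borel_measurable borel"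
    by (intro borel_measurable_diff borel_measurable_mat_mult_vec borel_measurable_vec2) auto
  moreover have "det (?h p) = 1" if "p \<in> sl_coords" for p
    using that unfolding sl_coords_def Delta_def by (intro det_pmat) auto
  ultimately have "{p \<in> sl_coords. slit_torus (?h p) (?w p) \<in> A} \<in> sets borel"
    by (intro sets_slit_torus_vimage sets_Delta_coords A)
  then show ?thesis unfolding sl_param_def by (simp add: case_prod_beta)
qed

lemma suminf_emeasure_vimage:
  assumes "\<And>i::nat. {p \<in> C. f p \<in> A i} \<in> sets M" "disjoint_family A"
  shows "(\<Sum>i. emeasure M {p \<in> C. f p \<in> A i}) = emeasure M {p \<in> C. f p \<in> (\<Union>i. A i)}"
proof -
  have "disjoint_family (\<lambda>i. {p \<in> C. f p \<in> A i})" using assms(2) unfolding disjoint_family_on_def by blast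
  then have "(\<Sum>i. emeasure M {p \<in> C. f p \<in> A i}) = emeasure M (\<Union>i. {p \<in> C. f p \<in> A i})"
    using assms(1) by (intro suminf_emeasure) auto
  also have "(\<Union>i. {p \<in> C. f p \<in> A i}) = {p \<in> C. f p \<in> (\<Union>i. A i)}" by blast
  finally show ?thesis .
qed

lemma m_W_space_sets: "space m_W = W_space" "sets m_W = W_sets"
proof -
  show "space m_W = W_space" unfolding m_W_def by (rule space_measure_of) auto
  show "sets m_W = W_sets" unfolding m_W_def W_sets_def[symmetric]
    by (rule sigma_algebra.sets_measure_of_eq[OF sigma_algebra_W_sets])
qed

text \<open>The normalised mass is countably additive, so it is the value of the measure that it generates.\<close>

lemma emeasure_m_W:
  assumes A: "A \<in> W_sets"
  shows "emeasure m_W A = (sa_mass A + sl_mass A) / (sa_mass W_space + sl_mass W_space)"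
  unfolding m_W_def W_sets_def[symmetric]
proof (rule emeasure_measure_of_sigma[OF sigma_algebra_W_sets _ _ A])
  let ?T = "sa_mass W_space + sl_mass W_space"
  show "positive W_sets (\<lambda>A. (sa_mass A + sl_mass A) / ?T)"
    unfolding positive_def sa_mass_eq sl_mass_eq by simp
  show "countably_additive W_sets (\<lambda>A. (sa_mass A + sl_mass A) / ?T)"
  proof (rule countably_additiveI)
    fix A :: "nat \<Rightarrow> surface set"
    assume A: "range A \<subseteq> W_sets" "disjoint_family A"
    have "(\<Sum>i. sa_mass (A i)) = (\<Sum>e\<in>corners. \<Sum>i. emeasure lborel {p \<in> Omega_coords. sa_param e p \<in> A i})"
      unfolding sa_mass_eq by (rule suminf_sum) simp
    also have "\<dots> = sa_mass (\<Union>i. A i)" unfolding sa_mass_eq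
      using A sets_sa_param by (intro sum.cong refl suminf_emeasure_vimage) auto
    finally have 1: "(\<Sum>i. sa_mass (A i)) = sa_mass (\<Union>i. A i)" .
    have "(\<Sum>i. sl_mass (A i)) = (\<Sum>e\<in>corners. \<Sum>i. emeasure lborel {p \<in> sl_coords. sl_param e p \<in> A i})"
      unfolding sl_mass_eq by (rule suminf_sum) simp
    also have "\<dots> = sl_mass (\<Union>i. A i)" unfolding sl_mass_eq
      using A sets_sl_param by (intro sum.cong refl suminf_emeasure_vimage) auto
    finally have 2: "(\<Sum>i. sl_mass (A i)) = sl_mass (\<Union>i. A i)" .
    have "(\<Sum>i. (sa_mass (A i) + sl_mass (A i)) / ?T) = (\<Sum>i. sa_mass (A i) + sl_mass (A i)) / ?T"
      unfolding divide_ennreal_def by (rule ennreal_suminf_multc)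
    also have "(\<Sum>i. sa_mass (A i) + sl_mass (A i)) = (\<Sum>i. sa_mass (A i)) + (\<Sum>i. sl_mass (A i))"
      by (rule suminf_add[symmetric]) auto
    finally show "(\<Sum>i. (sa_mass (A i) + sl_mass (A i)) / ?T) = (sa_mass (\<Union>i. A i) + sl_mass (\<Union>i. A i)) / ?T"
      unfolding 1 2 .
  qed
qed

lemma borel_measurable_R_W: "R_W \<in> borel_measurable m_W"
proof (rule borel_measurableI_less)
  fix t :: real
  show "{x \<in> space m_W. R_W x < t} \<in> sets m_W"
    unfolding m_W_space_sets using W_lift_W_space_Int_R_less(1)[of t] unfolding W_sets_def by auto
qed

section \<open>Null sets and scaling in coordinates\<close>

lemma sets_lborel_pair:
  "sets ((lborel :: 'a::euclidean_space measure) \<Otimes>\<^sub>M (lborel :: 'b::euclidean_space measure)) = sets borel"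
  unfolding lborel_prod by (rule sets_lborel)

lemma nn_integral_lborel_pair:
  fixes f :: "'a::euclidean_space \<times> 'b::euclidean_space \<Rightarrow> ennreal"
  assumes "f \<in> borel_measurable borel"
  shows "(\<integral>\<^sup>+p. f p \<partial>lborel) = (\<integral>\<^sup>+x. \<integral>\<^sup>+y. f (x, y) \<partial>lborel \<partial>lborel)"
proof -
  have "f \<in> borel_measurable (lborel \<Otimes>\<^sub>M lborel)"
    using assms measurable_cong_sets[OF sets_lborel_pair refl] by blast
  then show ?thesis unfolding lborel_prod[symmetric] by (rule lborel.nn_integral_fst[symmetric])
qed

lemma nn_integral_lborel_triple:
  fixes f :: "'a::euclidean_space \<times> 'b::euclidean_space \<times> 'c::euclidean_space \<Rightarrow> ennreal"
  assumes f[measurable]: "f \<in> borel_measurable borel"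
  shows "(\<integral>\<^sup>+p. f p \<partial>lborel) = (\<integral>\<^sup>+x. \<integral>\<^sup>+y. \<integral>\<^sup>+z. f (x, y, z) \<partial>lborel \<partial>lborel \<partial>lborel)"
proof -
  have "(\<integral>\<^sup>+q. f (x, q) \<partial>lborel) = (\<integral>\<^sup>+y. \<integral>\<^sup>+z. f (x, y, z) \<partial>lborel \<partial>lborel)" for x
    by (rule nn_integral_lborel_pair) measurable
  then show ?thesis using nn_integral_lborel_pair[OF f] by simp
qed

lemma slice_sets_borel:
  fixes S :: "('a::second_countable_topology \<times> 'b::second_countable_topology) set"
  assumes "S \<in> sets borel" shows "{y. (x, y) \<in> S} \<in> sets borel" "{x. (x, y) \<in> S} \<in> sets borel"
proof -
  have "(\<lambda>y. (x, y)) \<in> borel_measurable borel" "(\<lambda>x. (x, y)) \<in> borel_measurable borel"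
    by (rule borel_measurable_continuous_onI, rule continuous_on_Pair, rule continuous_on_const, rule continuous_on_id,
        rule borel_measurable_continuous_onI, rule continuous_on_Pair, rule continuous_on_id, rule continuous_on_const)
  from measurable_sets_borel[OF this(1) assms] measurable_sets_borel[OF this(2) assms]
  show "{y. (x, y) \<in> S} \<in> sets borel" "{x. (x, y) \<in> S} \<in> sets borel" by (simp_all add: vimage_def)
qed

lemma null_sets_lborel_pair:
  fixes S :: "('a::euclidean_space \<times> 'b::euclidean_space) set"
  assumes S: "S \<in> sets borel" and null: "AE x in lborel. {y. (x, y) \<in> S} \<in> null_sets lborel"
  shows "S \<in> null_sets lborel"
proof -
  have "emeasure lborel S = (\<integral>\<^sup>+p. indicator S p \<partial>lborel)" using S by simp
  also have "\<dots> = (\<integral>\<^sup>+x. \<integral>\<^sup>+y. indicator S (x, y) \<partial>lborel \<partial>lborel)"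
    by (intro nn_integral_lborel_pair borel_measurable_indicator S)
  also have "\<dots> = (\<integral>\<^sup>+x. emeasure lborel {y. (x, y) \<in> S} \<partial>(lborel::'a measure))"
  proof (rule nn_integral_cong)
    fix x :: 'a
    have "(\<integral>\<^sup>+y. indicator S (x, y) \<partial>lborel) = (\<integral>\<^sup>+y. indicator {y. (x, y) \<in> S} y \<partial>lborel)"
      by (intro nn_integral_cong) (simp add: indicator_def)
    then show "(\<integral>\<^sup>+y. indicator S (x, y) \<partial>lborel) = emeasure lborel {y. (x, y) \<in> S}"
      using slice_sets_borel[OF S] by simp
  qed
  also have "\<dots> = (\<integral>\<^sup>+x. 0 \<partial>(lborel::'a measure))"
    using null by (intro nn_integral_cong_AE) (auto simp: null_setsD1)
  finally show ?thesis using S by (simp add: null_sets_def)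
qed

lemma null_sets_lborel_pair_swap:
  fixes S :: "('a::euclidean_space \<times> 'b::euclidean_space) set"
  assumes S: "S \<in> sets borel" and null: "\<And>y. {x. (x, y) \<in> S} \<in> null_sets lborel"
  shows "S \<in> null_sets lborel"
proof -
  have S': "S \<in> sets (lborel \<Otimes>\<^sub>M lborel)" using S by (simp only: sets_lborel_pair)
  have "emeasure lborel S = (\<integral>\<^sup>+y. emeasure lborel ((\<lambda>x. (x, y)) -` S) \<partial>lborel)"
    unfolding lborel_prod[symmetric] using S' by (rule lborel_pair.emeasure_pair_measure_alt2)
  also have "\<dots> = 0" using null by (simp add: vimage_def null_setsD1)
  finally show ?thesis using S by (simp add: null_sets_def)
qed

lemma null_sets_lborel_if_negligible:
  fixes S :: "'a::euclidean_space set"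
  assumes "S \<in> sets borel" "negligible S" shows "S \<in> null_sets lborel"
  using assms by (simp add: negligible_iff_null_sets null_sets_completion_iff)

lemma negligible_if_null_sets_lborel: "N \<in> null_sets lborel \<Longrightarrow> negligible N"
  by (simp add: negligible_iff_null_sets null_sets_completionI)

text \<open>The inverse of a Moebius function is differentiable, and differentiable images of null sets are
  null sets.\<close>

lemma null_sets_moebius_vimage:
  fixes A B Y :: real
  assumes N: "N \<in> null_sets lborel" and "Y \<noteq> 0" "B \<noteq> 0"
  shows "{x. A + B * x \<noteq> 0 \<and> Y / (A + B * x) \<in> N} \<in> null_sets lborel"
proof (rule null_sets_lborel_if_negligible)
  have [measurable]: "N \<in> sets borel" using null_setsD2[OF N] by simp
  show "{x. A + B * x \<noteq> 0 \<and> Y / (A + B * x) \<in> N} \<in> sets borel" by measurable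
  have "negligible ((\<lambda>c. (Y / c - A) / B) ` (N - {0}))"
    using negligible_if_null_sets_lborel[OF N]
    by (intro negligible_differentiable_image_negligible)
      (auto intro!: derivative_intros negligible_diff simp: differentiable_on_def assms(3)
        intro: differentiable_divide)
  moreover have "{x. A + B * x \<noteq> 0 \<and> Y / (A + B * x) \<in> N} \<subseteq> (\<lambda>c. (Y / c - A) / B) ` (N - {0})"
  proof
    fix x assume x: "x \<in> {x. A + B * x \<noteq> 0 \<and> Y / (A + B * x) \<in> N}"
    then have "x = (Y / (Y / (A + B * x)) - A) / B" using assms(2,3) by simp
    moreover have "Y / (A + B * x) \<in> N - {0}" using x assms(2) by simp
    ultimately show "x \<in> (\<lambda>c. (Y / c - A) / B) ` (N - {0})" by (rule image_eqI)
  qed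
  ultimately show "negligible {x. A + B * x \<noteq> 0 \<and> Y / (A + B * x) \<in> N}" by (rule negligible_subset)
qed

lemma null_sets_reflect_vimage:
  fixes c :: real
  assumes N: "N \<in> null_sets lborel" shows "{x. c - x \<in> N} \<in> null_sets lborel"
proof (rule null_sets_lborel_if_negligible)
  have [measurable]: "N \<in> sets borel" using null_setsD2[OF N] by simp
  show "{x. c - x \<in> N} \<in> sets borel" by measurable
  have "negligible ((\<lambda>u. c - u) ` N)"
    using negligible_if_null_sets_lborel[OF N]
    by (intro negligible_differentiable_image_negligible) (auto intro!: derivative_intros)
  moreover have "{x. c - x \<in> N} \<subseteq> (\<lambda>u. c - u) ` N" by force
  ultimately show "negligible {x. c - x \<in> N}" by (rule negligible_subset)
qed

text \<open>The substitution \<open>a = A / t\<close>, \<open>b = 1 - \<theta> a\<close> blows up the corner \<open>(0, 1)\<close> of \<open>Delta\<close>; the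
  condition \<open>1 - a < b \<le> 1\<close> becomes \<open>0 \<le> \<theta> < 1\<close>. Its Jacobian is \<open>A / t\<^sup>2\<close>.\<close>

lemma nn_integral_scale_shear:
  fixes f :: "real \<times> real \<times> 'c::euclidean_space \<Rightarrow> ennreal"
  assumes f[measurable]: "f \<in> borel_measurable borel" and t: "t > 0"
    and zero: "\<And>p. fst p \<le> 0 \<Longrightarrow> f p = 0"
  shows "(\<integral>\<^sup>+p. f p \<partial>lborel) = (\<integral>\<^sup>+q. ennreal (fst q / t\<^sup>2) *
    f (fst q / t, 1 - fst (snd q) * (fst q / t), snd (snd q)) \<partial>lborel)"
proof -
  define F where "F a b = (\<integral>\<^sup>+r. f (a, b, r) \<partial>lborel)" for a b
  have Fm: "(\<lambda>p. F (fst p) (snd p)) \<in> borel_measurable borel"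
    unfolding F_def borel_prod[symmetric] by measurable
  then have F[measurable]: "(\<lambda>x. F (g x) (h x)) \<in> borel_measurable M"
    if "g \<in> borel_measurable M" "h \<in> borel_measurable M" for g h and M :: "'z measure"
    using measurable_compose[of "\<lambda>x. (g x, h x)" M borel "\<lambda>p. F (fst p) (snd p)"] that by simp
  have "(\<integral>\<^sup>+p. f p \<partial>lborel) = (\<integral>\<^sup>+a. \<integral>\<^sup>+b. F a b \<partial>lborel \<partial>lborel)"
  proof -
    have "(\<integral>\<^sup>+p. f p \<partial>lborel) = (\<integral>\<^sup>+a. \<integral>\<^sup>+q. f (a, q) \<partial>lborel \<partial>lborel)"
      by (rule nn_integral_lborel_pair) measurable
    also have "\<dots> = (\<integral>\<^sup>+a. \<integral>\<^sup>+b. F a b \<partial>lborel \<partial>lborel)"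
      unfolding F_def by (intro nn_integral_cong nn_integral_lborel_pair) measurable
    finally show ?thesis .
  qed
  also have "\<dots> = ennreal (1 / t) * (\<integral>\<^sup>+a. \<integral>\<^sup>+b. F (a / t) b \<partial>lborel \<partial>lborel)"
    using t nn_integral_real_affine[of "\<lambda>a. \<integral>\<^sup>+b. F a b \<partial>lborel" "1 / t" 0] by simp
  also have "\<dots> = (\<integral>\<^sup>+a. ennreal (1 / t) * (\<integral>\<^sup>+b. F (a / t) b \<partial>lborel) \<partial>lborel)"
    by (rule nn_integral_cmult[symmetric]) measurable
  also have "\<dots> = (\<integral>\<^sup>+a. \<integral>\<^sup>+b. \<integral>\<^sup>+r. ennreal (a / t\<^sup>2) * f (a / t, 1 - b * (a / t), r) \<partial>lborel \<partial>lborel \<partial>lborel)"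
  proof (rule nn_integral_cong)
    fix a :: real
    show "ennreal (1 / t) * (\<integral>\<^sup>+b. F (a / t) b \<partial>lborel) =
      (\<integral>\<^sup>+b. \<integral>\<^sup>+r. ennreal (a / t\<^sup>2) * f (a / t, 1 - b * (a / t), r) \<partial>lborel \<partial>lborel)"
    proof (cases "a > 0")
      case False
      then have "a / t \<le> 0" using t by (simp add: divide_le_0_iff)
      then show ?thesis unfolding F_def by (simp add: zero)
    next
      case True
      have "(\<integral>\<^sup>+b. F (a / t) b \<partial>lborel) = ennreal (a / t) * (\<integral>\<^sup>+b. F (a / t) (1 - b * (a / t)) \<partial>lborel)"
        using nn_integral_real_affine[of "F (a / t)" "- (a / t)" 1] True t by (simp add: mult.commute)
      then have "ennreal (1 / t) * (\<integral>\<^sup>+b. F (a / t) b \<partial>lborel)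
          = ennreal (1 / t) * ennreal (a / t) * (\<integral>\<^sup>+b. F (a / t) (1 - b * (a / t)) \<partial>lborel)"
        by (simp add: mult.assoc)
      also have "ennreal (1 / t) * ennreal (a / t) = ennreal (a / t\<^sup>2)"
        using True t by (simp add: ennreal_mult[symmetric] power2_eq_square)
      also have "ennreal (a / t\<^sup>2) * (\<integral>\<^sup>+b. F (a / t) (1 - b * (a / t)) \<partial>lborel)
          = (\<integral>\<^sup>+b. ennreal (a / t\<^sup>2) * F (a / t) (1 - b * (a / t)) \<partial>lborel)"
        by (rule nn_integral_cmult[symmetric]) measurable
      also have "\<dots> = (\<integral>\<^sup>+b. \<integral>\<^sup>+r. ennreal (a / t\<^sup>2) * f (a / t, 1 - b * (a / t), r) \<partial>lborel \<partial>lborel)"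
        unfolding F_def by (intro nn_integral_cong nn_integral_cmult[symmetric]) measurable
      finally show ?thesis .
    qed
  qed
  also have "\<dots> = (\<integral>\<^sup>+a. \<integral>\<^sup>+q. ennreal (a / t\<^sup>2) * f (a / t, 1 - fst q * (a / t), snd q) \<partial>lborel \<partial>lborel)"
  proof (rule nn_integral_cong)
    fix a :: real
    show "(\<integral>\<^sup>+b. \<integral>\<^sup>+r. ennreal (a / t\<^sup>2) * f (a / t, 1 - b * (a / t), r) \<partial>lborel \<partial>lborel) =
      (\<integral>\<^sup>+q. ennreal (a / t\<^sup>2) * f (a / t, 1 - fst q * (a / t), snd q) \<partial>lborel)"
      using nn_integral_lborel_pair[of "\<lambda>q. ennreal (a / t\<^sup>2) * f (a / t, 1 - fst q * (a / t), snd q)"] by simp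
  qed
  also have "\<dots> = (\<integral>\<^sup>+q. ennreal (fst q / t\<^sup>2) * f (fst q / t, 1 - fst (snd q) * (fst q / t), snd (snd q)) \<partial>lborel)"
    using nn_integral_lborel_pair[of "\<lambda>q. ennreal (fst q / t\<^sup>2) * f (fst q / t, 1 - fst (snd q) * (fst q / t), snd (snd q))"] by simp
  finally show ?thesis .
qed

lemma nn_integral_scale_pair:
  fixes f :: "real \<times> real \<Rightarrow> ennreal"
  assumes f[measurable]: "f \<in> borel_measurable borel" and c: "c > 0" "d > 0"
  shows "(\<integral>\<^sup>+p. f p \<partial>lborel) = ennreal (c * d) * (\<integral>\<^sup>+q. f (c * fst q, d * snd q) \<partial>lborel)"
proof -
  have "(\<integral>\<^sup>+p. f p \<partial>lborel) = (\<integral>\<^sup>+x. \<integral>\<^sup>+y. f (x, y) \<partial>lborel \<partial>lborel)"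
    by (rule nn_integral_lborel_pair) measurable
  also have "\<dots> = ennreal c * (\<integral>\<^sup>+x. \<integral>\<^sup>+y. f (c * x, y) \<partial>lborel \<partial>lborel)"
    using c nn_integral_real_affine[of "\<lambda>x. \<integral>\<^sup>+y. f (x, y) \<partial>lborel" c 0] by simp
  also have "(\<integral>\<^sup>+x. \<integral>\<^sup>+y. f (c * x, y) \<partial>lborel \<partial>lborel) = (\<integral>\<^sup>+x. ennreal d * (\<integral>\<^sup>+y. f (c * x, d * y) \<partial>lborel) \<partial>lborel)"
    using c nn_integral_real_affine[of "\<lambda>y. f (c * x, y)" d 0 for x] by simp
  also have "\<dots> = ennreal d * (\<integral>\<^sup>+x. \<integral>\<^sup>+y. f (c * x, d * y) \<partial>lborel \<partial>lborel)"
    by (rule nn_integral_cmult) measurable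
  also have "(\<integral>\<^sup>+x. \<integral>\<^sup>+y. f (c * x, d * y) \<partial>lborel \<partial>lborel) = (\<integral>\<^sup>+q. f (c * fst q, d * snd q) \<partial>lborel)"
    using nn_integral_lborel_pair[of "\<lambda>q. f (c * fst q, d * snd q)"] by simp
  finally show ?thesis using c by (simp add: ennreal_mult mult.assoc)
qed

text \<open>In the corner \<open>(0, 1)\<close> of \<open>Delta\<close> the range of \<open>b\<close> has length \<open>a\<close> and that of \<open>s\<close> has length of
  order \<open>1 / a\<close>. With \<open>\<sigma> = s a\<close> in place of \<open>s\<close>, and \<open>\<alpha>\<close> scaled like \<open>a\<close>, the
  Jacobian becomes the constant \<open>1 / t\<^sup>2\<close>.\<close>

definition scaling :: "real \<Rightarrow> real \<times> real \<times> real \<times> real \<Rightarrow> real \<times> real \<times> real \<times> real" where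
  "scaling t q = (fst q / t, 1 - fst (snd q) * (fst q / t),
     fst (snd (snd q)) * (t / fst q), snd (snd (snd q)) / t)"

lemma measurable_scaling[measurable]: "scaling t \<in> borel_measurable borel"
  unfolding scaling_def by measurable

lemma nn_integral_scaling:
  fixes f :: "real \<times> real \<times> real \<times> real \<Rightarrow> ennreal"
  assumes f[measurable]: "f \<in> borel_measurable borel" and t: "t > 0"
    and zero: "\<And>p. fst p \<le> 0 \<Longrightarrow> f p = 0"
  shows "(\<integral>\<^sup>+p. f p \<partial>lborel) = ennreal (1 / t\<^sup>2) * (\<integral>\<^sup>+q. f (scaling t q) \<partial>lborel)"
proof -
  let ?g = "\<lambda>a b r. f (a / t, 1 - b * (a / t), r)"
  have "(\<integral>\<^sup>+p. f p \<partial>lborel) = (\<integral>\<^sup>+q. ennreal (fst q / t\<^sup>2) * ?g (fst q) (fst (snd q)) (snd (snd q)) \<partial>lborel)"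
    by (rule nn_integral_scale_shear[OF f t zero])
  also have "\<dots> = (\<integral>\<^sup>+a. \<integral>\<^sup>+b. \<integral>\<^sup>+r. ennreal (a / t\<^sup>2) * ?g a b r \<partial>lborel \<partial>lborel \<partial>lborel)"
    using nn_integral_lborel_triple[of "\<lambda>q. ennreal (fst q / t\<^sup>2) * ?g (fst q) (fst (snd q)) (snd (snd q))"] by simp
  also have "\<dots> = (\<integral>\<^sup>+a. \<integral>\<^sup>+b. \<integral>\<^sup>+r. ennreal (1 / t\<^sup>2) * ?g a b (t / a * fst r, 1 / t * snd r) \<partial>lborel \<partial>lborel \<partial>lborel)"
  proof (rule nn_integral_cong, rule nn_integral_cong)
    fix a b :: real
    show "(\<integral>\<^sup>+r. ennreal (a / t\<^sup>2) * ?g a b r \<partial>lborel) = (\<integral>\<^sup>+r. ennreal (1 / t\<^sup>2) * ?g a b (t / a * fst r, 1 / t * snd r) \<partial>lborel)"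
    proof (cases "a > 0")
      case False
      then have "a / t \<le> 0" using t by (simp add: divide_le_0_iff)
      then show ?thesis by (simp add: zero)
    next
      case True
      have "(\<integral>\<^sup>+r. ennreal (a / t\<^sup>2) * ?g a b r \<partial>lborel) = ennreal (a / t\<^sup>2) * (\<integral>\<^sup>+r. ?g a b r \<partial>lborel)"
        by (rule nn_integral_cmult) measurable
      also have "(\<integral>\<^sup>+r. ?g a b r \<partial>lborel) = ennreal (t / a * (1 / t)) * (\<integral>\<^sup>+r. ?g a b (t / a * fst r, 1 / t * snd r) \<partial>lborel)"
        using True t by (intro nn_integral_scale_pair) auto
      also have "ennreal (a / t\<^sup>2) * (ennreal (t / a * (1 / t)) * (\<integral>\<^sup>+r. ?g a b (t / a * fst r, 1 / t * snd r) \<partial>lborel))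
         = ennreal (1 / t\<^sup>2) * (\<integral>\<^sup>+r. ?g a b (t / a * fst r, 1 / t * snd r) \<partial>lborel)"
        using True t by (simp add: mult.assoc[symmetric] ennreal_mult[symmetric])
      also have "\<dots> = (\<integral>\<^sup>+r. ennreal (1 / t\<^sup>2) * ?g a b (t / a * fst r, 1 / t * snd r) \<partial>lborel)"
        by (rule nn_integral_cmult[symmetric]) measurable
      finally show ?thesis .
    qed
  qed
  also have "\<dots> = (\<integral>\<^sup>+q. ennreal (1 / t\<^sup>2) * f (scaling t q) \<partial>lborel)"
    unfolding scaling_def
    using nn_integral_lborel_triple[of "\<lambda>q. ennreal (1 / t\<^sup>2) * ?g (fst q) (fst (snd q)) (t / fst q * fst (snd (snd q)), 1 / t * snd (snd (snd q)))"]
    by (simp add: mult.commute)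
  also have "\<dots> = ennreal (1 / t\<^sup>2) * (\<integral>\<^sup>+q. f (scaling t q) \<partial>lborel)"
    by (rule nn_integral_cmult) measurable
  finally show ?thesis .
qed

lemma emeasure_scaling:
  assumes E: "E \<in> sets borel" "\<And>p. p \<in> E \<Longrightarrow> fst p > 0" and t: "t > 0"
  shows "emeasure lborel E = ennreal (1 / t\<^sup>2) * emeasure lborel {q. scaling t q \<in> E}"
proof -
  have S: "{q. scaling t q \<in> E} \<in> sets borel"
    using measurable_sets_borel[OF measurable_scaling E(1)] by (simp add: vimage_def)
  have z: "indicator E p = (0::ennreal)" if "fst p \<le> 0" for p
    using E(2)[of p] that by (cases "p \<in> E") simp_all
  have "emeasure lborel E = (\<integral>\<^sup>+p. indicator E p \<partial>lborel)" using E by simp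
  also have "\<dots> = ennreal (1 / t\<^sup>2) * (\<integral>\<^sup>+q. indicator E (scaling t q) \<partial>lborel)"
    using t z by (intro nn_integral_scaling borel_measurable_indicator E(1))
  also have "(\<integral>\<^sup>+q. indicator E (scaling t q) \<partial>lborel) = (\<integral>\<^sup>+q. indicator {q. scaling t q \<in> E} q \<partial>lborel)"
    by (intro nn_integral_cong) (simp add: indicator_def)
  also have "\<dots> = emeasure lborel {q. scaling t q \<in> E}" using S by simp
  finally show ?thesis .
qed

text \<open>The coordinate region is symmetric in \<open>a\<close> and \<open>b\<close>, which transports the scaling to the other
  corner \<open>(1, 0)\<close>.\<close>

definition swap_ab :: "real \<times> real \<times> 'c \<Rightarrow> real \<times> real \<times> 'c" where
  "swap_ab p = (fst (snd p), fst p, snd (snd p))"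

lemma measurable_swap_ab[measurable]: "swap_ab \<in> borel_measurable (borel :: (real \<times> real \<times> 'c::second_countable_topology) measure)"
  unfolding swap_ab_def by measurable

lemma nn_integral_swap_ab:
  fixes f :: "real \<times> real \<times> 'c::euclidean_space \<Rightarrow> ennreal"
  assumes f[measurable]: "f \<in> borel_measurable borel"
  shows "(\<integral>\<^sup>+p. f p \<partial>lborel) = (\<integral>\<^sup>+p. f (swap_ab p) \<partial>lborel)"
proof -
  define F where "F a b = (\<integral>\<^sup>+r. f (a, b, r) \<partial>lborel)" for a b
  have Fm: "(\<lambda>p. F (fst p) (snd p)) \<in> borel_measurable borel"
    unfolding F_def borel_prod[symmetric] by measurable
  have Fm2: "(\<lambda>(a, b). F a b) \<in> borel_measurable (lborel \<Otimes>\<^sub>M lborel)"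
    using Fm measurable_cong_sets[OF sets_lborel_pair refl] unfolding case_prod_beta' by blast
  have "(\<integral>\<^sup>+p. f p \<partial>lborel) = (\<integral>\<^sup>+a. \<integral>\<^sup>+b. F a b \<partial>lborel \<partial>lborel)"
    unfolding F_def by (rule nn_integral_lborel_triple) measurable
  also have "\<dots> = (\<integral>\<^sup>+b. \<integral>\<^sup>+a. F a b \<partial>lborel \<partial>lborel)"
    using lborel_pair.Fubini'[OF Fm2] by simp
  also have "\<dots> = (\<integral>\<^sup>+p. f (swap_ab p) \<partial>lborel)"
    unfolding F_def using nn_integral_lborel_triple[of "\<lambda>p. f (swap_ab p)"] by (simp add: swap_ab_def)
  finally show ?thesis .
qed

lemma emeasure_swap_ab:
  fixes E :: "(real \<times> real \<times> 'c::euclidean_space) set"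
  assumes E: "E \<in> sets borel"
  shows "emeasure lborel E = emeasure lborel {p. swap_ab p \<in> E}"
proof -
  have S: "{q. swap_ab q \<in> E} \<in> sets borel"
    using measurable_sets_borel[OF measurable_swap_ab E] by (simp add: vimage_def)
  have "emeasure lborel E = (\<integral>\<^sup>+p. indicator E p \<partial>lborel)" using E by simp
  also have "\<dots> = (\<integral>\<^sup>+q. indicator E (swap_ab q) \<partial>lborel)"
    by (intro nn_integral_swap_ab borel_measurable_indicator E)
  also have "\<dots> = (\<integral>\<^sup>+q. indicator {q. swap_ab q \<in> E} q \<partial>lborel)"
    by (intro nn_integral_cong) (simp add: indicator_def)
  also have "\<dots> = emeasure lborel {q. swap_ab q \<in> E}" using S by simp
  finally show ?thesis .
qed

section \<open>Return times in coordinates\<close>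

definition in_strip :: "real \<times> real \<Rightarrow> bool" where
  "in_strip z \<longleftrightarrow> 0 < fst z \<and> fst z \<le> 1 \<and> 0 < snd z"

definition strip_slopes :: "(int \<Rightarrow> int \<Rightarrow> real \<times> real) \<Rightarrow> real set" where
  "strip_slopes P = {snd (P m n) / fst (P m n) |m n. in_strip (P m n)}"

text \<open>No point lies in the triangle \<open>0 < x \<le> 1\<close>, \<open>0 < y \<le> t x\<close>, whose area is \<open>t / 2\<close>.\<close>

definition clear :: "real \<Rightarrow> (int \<Rightarrow> int \<Rightarrow> real \<times> real) \<Rightarrow> bool" where
  "clear t P \<longleftrightarrow> (\<forall>m n. in_strip (P m n) \<longrightarrow> t * fst (P m n) < snd (P m n))"

text \<open>The points of the lattice of \<open>hmat s ** pmat a b\<close> translated by \<open>(k \<alpha>, 0)\<close>. The value \<open>k = 1\<close>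
  gives the affine lattice with coordinates \<open>(a, b, s, \<alpha>)\<close>; on a slit torus \<open>k = 0\<close> and
  \<open>k = - 1\<close> occur as well.\<close>

definition sa_pt :: "real \<Rightarrow> real \<times> real \<times> real \<times> real \<Rightarrow> int \<Rightarrow> int \<Rightarrow> real \<times> real" where
  "sa_pt k p m n = (k * snd (snd (snd p)) + (fst p * m + fst (snd p) * n),
     n / fst p - fst (snd (snd p)) * (fst p * m + fst (snd p) * n))"

text \<open>The points of the lattice of \<open>pmat a b\<close> translated by \<open>k\<close> times the vector with lattice coordinates
  \<open>(x, y)\<close>. Torsion measures live on \<open>(x, y) = (1 / q, 0)\<close>.\<close>

definition sl_pt :: "real \<Rightarrow> real \<times> real \<times> real \<times> real \<Rightarrow> int \<Rightarrow> int \<Rightarrow> real \<times> real" where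
  "sl_pt k p m n = (fst p * (m + k * fst (snd (snd p))) + fst (snd p) * (n + k * snd (snd (snd p))),
     (n + k * snd (snd (snd p))) / fst p)"

lemma clear_iff: "clear t P \<longleftrightarrow> (\<forall>u\<in>strip_slopes P. t < u)"
proof -
  have "t * fst z < snd z \<longleftrightarrow> t < snd z / fst z" if "in_strip z" for z
    using that by (simp add: in_strip_def less_divide_eq)
  then show ?thesis unfolding clear_def strip_slopes_def by blast
qed

lemma slopes_sa:
  "slopes (affine_lattice (hmat s ** pmat a b) (vector [k * \<alpha>, 0])) = strip_slopes (sa_pt k (a, b, s, \<alpha>))"
  unfolding set_eq_iff slopes_affine_lattice_iff strip_slopes_def mem_Collect_eq hp_entries vector_2 Let_def
    in_strip_def sa_pt_def
  by (auto simp: algebra_simps)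

lemma slopes_sl:
  "slopes (affine_lattice (pmat a b) (pmat a b *v vector [k * x, k * y])) = strip_slopes (sl_pt k (a, b, x, y))"
  unfolding set_eq_iff slopes_affine_lattice_iff strip_slopes_def mem_Collect_eq pmat_entries mat2_mult_vec vector_2 Let_def
    in_strip_def sl_pt_def
  by (auto simp: algebra_simps add_divide_distrib)

lemma measurable_sa_pt[measurable]:
  "(\<lambda>p. fst (sa_pt k p m n)) \<in> borel_measurable borel" "(\<lambda>p. snd (sa_pt k p m n)) \<in> borel_measurable borel"
  unfolding sa_pt_def fst_conv snd_conv by measurable

lemma measurable_sl_pt[measurable]:
  "(\<lambda>p. fst (sl_pt k p m n)) \<in> borel_measurable borel" "(\<lambda>p. snd (sl_pt k p m n)) \<in> borel_measurable borel"
  unfolding sl_pt_def fst_conv snd_conv by measurable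

lemma sets_clear:
  assumes [measurable]: "\<And>m n. (\<lambda>p. fst (P p m n)) \<in> borel_measurable borel" "\<And>m n. (\<lambda>p. snd (P p m n)) \<in> borel_measurable borel"
  shows "{p. clear t (P p)} \<in> sets borel"
  unfolding clear_def in_strip_def by measurable

lemma sets_strip_slopes:
  assumes [measurable]: "\<And>m n. (\<lambda>p. fst (P p m n)) \<in> borel_measurable borel" "\<And>m n. (\<lambda>p. snd (P p m n)) \<in> borel_measurable borel"
    "N \<in> sets borel"
  shows "{p. \<exists>u\<in>strip_slopes (P p). u \<in> N} \<in> sets borel"
proof -
  have "{p. \<exists>u\<in>strip_slopes (P p). u \<in> N} = {p. \<exists>m n. in_strip (P p m n) \<and> snd (P p m n) / fst (P p m n) \<in> N}"
    unfolding strip_slopes_def by blast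
  also have "\<dots> \<in> sets borel" unfolding in_strip_def by measurable
  finally show ?thesis .
qed

lemma null_sets_strip_slopesI:
  fixes P :: "'a::euclidean_space \<Rightarrow> int \<Rightarrow> int \<Rightarrow> real \<times> real"
  assumes "\<And>m n. {p. in_strip (P p m n) \<and> snd (P p m n) / fst (P p m n) \<in> N} \<in> null_sets lborel"
  shows "{p. \<exists>u\<in>strip_slopes (P p). u \<in> N} \<in> null_sets lborel"
proof -
  have "{p. \<exists>u\<in>strip_slopes (P p). u \<in> N} = (\<Union>m. \<Union>n. {p. in_strip (P p m n) \<and> snd (P p m n) / fst (P p m n) \<in> N})"
    unfolding strip_slopes_def by blast
  then show ?thesis using assms by (simp add: null_sets_UN)
qed

lemma null_sets_subset_Collect:
  assumes "A \<in> null_sets lborel" "{x. P x} \<in> sets borel" "\<And>x. P x \<Longrightarrow> x \<in> A"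
  shows "{x. P x} \<in> null_sets lborel"
  using assms by (intro null_sets_subset[of A lborel "{x. P x}"]) auto

text \<open>For fixed values of the other coordinates a slope is a nonconstant Moebius function of
  \<open>\<alpha>\<close>, as a point moves horizontally with \<open>\<alpha>\<close>; a slope of the lattice itself is a constant
  minus \<open>s\<close>.\<close>

lemma null_sets_strip_slopes_sa:
  assumes N: "N \<in> null_sets lborel"
  shows "{p. \<exists>u\<in>strip_slopes (sa_pt k p). u \<in> N} \<in> null_sets lborel"
proof (rule null_sets_strip_slopesI)
  fix m n :: int
  have [measurable]: "N \<in> sets borel" using null_setsD2[OF N] by simp
  let ?S = "{p. in_strip (sa_pt k p m n) \<and> snd (sa_pt k p m n) / fst (sa_pt k p m n) \<in> N}"
  have S: "?S \<in> sets borel" unfolding in_strip_def by measurable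
  note S1 = slice_sets_borel(1)[OF S]
  have S2: "{q. (b, q) \<in> {q. (a, q) \<in> ?S}} \<in> sets borel" for a b by (rule slice_sets_borel(1)[OF S1])
  have main: "{q. (b, q) \<in> {q. (a, q) \<in> ?S}} \<in> null_sets lborel" for a b
  proof (cases "k = 0")
    case False
    show ?thesis
    proof (rule null_sets_lborel_pair[OF S2 AE_I2])
      fix s :: real
      let ?Y = "n / a - s * (a * m + b * n)"
      have "{\<alpha>. in_strip (sa_pt k (a, b, s, \<alpha>) m n) \<and> snd (sa_pt k (a, b, s, \<alpha>) m n) / fst (sa_pt k (a, b, s, \<alpha>) m n) \<in> N} \<in> null_sets lborel"
      proof (cases "?Y > 0")
        case True
        then show ?thesis
          using False slice_sets_borel(1)[OF S2[where a = a and b = b], of s]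
          by (intro null_sets_subset_Collect[OF null_sets_moebius_vimage[OF N, of ?Y k "a * m + b * n"]])
            (auto simp: in_strip_def sa_pt_def add.commute)
      qed (simp add: in_strip_def sa_pt_def)
      then show "{y. (s, y) \<in> {q. (b, q) \<in> {q. (a, q) \<in> ?S}}} \<in> null_sets lborel" by simp
    qed
  next
    case True
    show ?thesis
    proof (rule null_sets_lborel_pair_swap[OF S2])
      fix \<alpha> :: real
      let ?x = "a * m + b * n"
      have "{s. in_strip (sa_pt k (a, b, s, \<alpha>) m n) \<and> snd (sa_pt k (a, b, s, \<alpha>) m n) / fst (sa_pt k (a, b, s, \<alpha>) m n) \<in> N} \<in> null_sets lborel"
        using True slice_sets_borel(2)[OF S2[where a = a and b = b], of \<alpha>]
        by (intro null_sets_subset_Collect[OF null_sets_reflect_vimage[OF N, of "n / a / ?x"]])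
          (auto simp: in_strip_def sa_pt_def diff_divide_distrib)
      then show "{x. (x, \<alpha>) \<in> {q. (b, q) \<in> {q. (a, q) \<in> ?S}}} \<in> null_sets lborel" by simp
    qed
  qed
  show "?S \<in> null_sets lborel"
    by (rule null_sets_lborel_pair[OF S AE_I2], rule null_sets_lborel_pair[OF S1 AE_I2], rule main)
qed

text \<open>Here the points move horizontally with \<open>b\<close>, with a speed proportional to their positive height.\<close>

lemma null_sets_strip_slopes_sl_slice:
  assumes N: "N \<in> null_sets lborel"
  shows "{b. in_strip (sl_pt k (a, b, x, y) m n) \<and> snd (sl_pt k (a, b, x, y) m n) / fst (sl_pt k (a, b, x, y) m n) \<in> N} \<in> null_sets lborel"
proof (cases "(n + k * y) / a > 0")
  case True
  have [measurable]: "N \<in> sets borel" using null_setsD2[OF N] by simp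
  have "{b. in_strip (sl_pt k (a, b, x, y) m n) \<and> snd (sl_pt k (a, b, x, y) m n) / fst (sl_pt k (a, b, x, y) m n) \<in> N} \<in> sets borel"
    unfolding in_strip_def sl_pt_def fst_conv snd_conv by measurable
  then show ?thesis using True
    by (intro null_sets_subset_Collect[OF null_sets_moebius_vimage[OF N, of "(n + k * y) / a" "n + k * y" "a * (m + k * x)"]])
      (auto simp: in_strip_def sl_pt_def mult.commute)
qed (simp add: in_strip_def sl_pt_def)

lemma null_sets_strip_slopes_sl:
  assumes N: "N \<in> null_sets lborel"
  shows "{p. \<exists>u\<in>strip_slopes (sl_pt k p). u \<in> N} \<in> null_sets lborel"
proof (rule null_sets_strip_slopesI)
  fix m n :: int
  have [measurable]: "N \<in> sets borel" using null_setsD2[OF N] by simp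
  let ?S = "{p. in_strip (sl_pt k p m n) \<and> snd (sl_pt k p m n) / fst (sl_pt k p m n) \<in> N}"
  have S: "?S \<in> sets borel" unfolding in_strip_def by measurable
  show "?S \<in> null_sets lborel"
  proof (rule null_sets_lborel_pair[OF S AE_I2], rule null_sets_lborel_pair_swap[OF slice_sets_borel(1)[OF S]])
    fix a :: real and q :: "real \<times> real"
    show "{b. (b, q) \<in> {q. (a, q) \<in> ?S}} \<in> null_sets lborel"
      using null_sets_strip_slopes_sl_slice[OF N, of k a "fst q" "snd q" m n] by simp
  qed
qed

lemma null_sets_strip_slopes_torsion:
  assumes N: "N \<in> null_sets lborel"
  shows "{p. \<exists>u\<in>strip_slopes (sl_pt k (fst p, snd p, x, y)). u \<in> N} \<in> null_sets lborel"
proof (rule null_sets_strip_slopesI)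
  fix m n :: int
  have [measurable]: "N \<in> sets borel" using null_setsD2[OF N] by simp
  let ?S = "{p. in_strip (sl_pt k (fst p, snd p, x, y) m n) \<and>
    snd (sl_pt k (fst p, snd p, x, y) m n) / fst (sl_pt k (fst p, snd p, x, y) m n) \<in> N}"
  have S: "?S \<in> sets borel" unfolding in_strip_def sl_pt_def fst_conv snd_conv by measurable
  show "?S \<in> null_sets lborel"
    using null_sets_strip_slopes_sl_slice[OF N]
    by (intro null_sets_lborel_pair[OF S AE_I2]) simp
qed

section \<open>Almost every slit is embedded\<close>

text \<open>A segment from \<open>0\<close> of irrational direction meets the lattice only in \<open>0\<close>.\<close>

lemma is_slit_irrational:
  assumes h: "det h = 1" and irr: "\<And>m n::int. m \<noteq> 0 \<or> n \<noteq> 0 \<Longrightarrow> \<xi> $ 1 * of_int n \<noteq> \<xi> $ 2 * of_int m"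
  shows "is_slit h (h *v \<xi>)"
  unfolding is_slit_iff
proof (intro ballI notI)
  fix l assume "l \<in> lattice h" "\<exists>t. 0 < t \<and> t \<le> 1 \<and> t *\<^sub>R (h *v \<xi>) = l"
  then obtain t and m n :: int where t: "0 < t" "t *\<^sub>R (h *v \<xi>) = h *v vector [of_int m, of_int n]"
    unfolding mem_lattice_iff by blast
  then have "h *v (t *\<^sub>R \<xi>) = h *v vector [of_int m, of_int n]" by (simp add: matrix_vector_mult_scaleR)
  then have e: "t * \<xi> $ 1 = of_int m" "t * \<xi> $ 2 = of_int n"
    using inverse_coordinates[OF h refl, of "t *\<^sub>R \<xi>"] inverse_coordinates[OF h refl, of "vector [of_int m, of_int n]"]
    by simp_all
  show False
  proof (cases "m = 0 \<and> n = 0")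
    case True
    then have "\<xi> $ 1 = 0" "\<xi> $ 2 = 0" using e t(1) by auto
    then show False using irr[of 1 0] by simp
  next
    case False
    have "t * (\<xi> $ 1 * n) = t * (\<xi> $ 2 * m)" using e by (metis mult.assoc mult.commute)
    then show False using irr[of m n] False t(1) by simp
  qed
qed

lemma null_sets_linear_eq: "c \<noteq> 0 \<Longrightarrow> {x::real. x * c = d} \<in> null_sets lborel"
  by (rule finite_imp_null_set_lborel, rule finite_subset[of _ "{d / c}"]) (auto simp: field_simps)

text \<open>The coordinates of \<open>(\<alpha>, 0)\<close> with respect to the columns of the matrix are linear in \<open>\<alpha>\<close>. A
  rational relation between them, shifted by the corner \<open>(c, d)\<close>, is a linear equation for
  \<open>\<alpha>\<close>, with a nonzero coefficient for all but at most one value of \<open>s\<close>.\<close>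

lemma null_sets_sa_rational:
  assumes mn: "m \<noteq> 0 \<or> n \<noteq> (0::int)"
  shows "{p. fst p > 0 \<and> (snd (snd (snd p)) * (1 / fst p - fst (snd p) * fst (snd (snd p))) - c) * n
     = (fst p * fst (snd (snd p)) * snd (snd (snd p)) - d) * of_int m} \<in> null_sets lborel" (is "?S \<in> _")
proof -
  define F G where "F = (\<lambda>p::real\<times>real\<times>real\<times>real. (snd (snd (snd p)) * (1 / fst p - fst (snd p) * fst (snd (snd p))) - c) * n)"
    and "G = (\<lambda>p::real\<times>real\<times>real\<times>real. (fst p * fst (snd (snd p)) * snd (snd (snd p)) - d) * of_int m)"
  have [measurable]: "F \<in> borel_measurable borel" "G \<in> borel_measurable borel" unfolding F_def G_def by measurable
  have "?S = {p. fst p > 0 \<and> F p = G p}" unfolding F_def G_def by simp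
  also have "\<dots> \<in> sets borel" by measurable
  finally have S: "?S \<in> sets borel" .
  note S1 = slice_sets_borel(1)[OF S]
  have S2: "{q. (b, q) \<in> {q. (a, q) \<in> ?S}} \<in> sets borel" for a b by (rule slice_sets_borel(1)[OF S1])
  have main: "{q. (b, q) \<in> {q. (a, q) \<in> ?S}} \<in> null_sets lborel" for a b
  proof (cases "a > 0")
    case True
    let ?D = "b * n + a * m"
    have "{s. n / a - s * ?D = 0} \<in> null_sets lborel"
    proof (cases "?D = 0")
      case True
      then have "n \<noteq> 0" using mn \<open>a > 0\<close> by auto
      then show ?thesis using True \<open>a > 0\<close> by simp
    next
      case False
      then have "{s. n / a - s * ?D = 0} = {s. s * ?D = n / a}" by auto
      then show ?thesis using null_sets_linear_eq[OF False, of "n / a"] by simp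
    qed
    then have ae: "AE s in lborel. n / a - s * ?D \<noteq> 0" by (rule AE_I') auto
    show ?thesis
    proof (rule null_sets_lborel_pair[OF S2], rule AE_mp[OF ae AE_I2], intro impI)
      fix s assume K: "n / a - s * ?D \<noteq> 0"
      have e: "(\<alpha> * (1 / a - b * s) - c) * n = (a * s * \<alpha> - d) * m \<longleftrightarrow> \<alpha> * (n / a - s * ?D) = c * n - d * m" for \<alpha>
        by (simp add: algebra_simps)
      show "{y. (s, y) \<in> {q. (b, q) \<in> {q. (a, q) \<in> ?S}}} \<in> null_sets lborel"
        using null_sets_linear_eq[OF K, of "c * n - d * m"] True by (simp add: e)
    qed
  qed simp
  show "?S \<in> null_sets lborel"
    by (rule null_sets_lborel_pair[OF S AE_I2], rule null_sets_lborel_pair[OF S1 AE_I2], rule main)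
qed

lemma null_sets_sl_rational:
  assumes mn: "m \<noteq> 0 \<or> n \<noteq> (0::int)"
  shows "{p::real\<times>real\<times>real\<times>real. (fst (snd (snd p)) - c) * n = (snd (snd (snd p)) - d) * of_int m} \<in> null_sets lborel" (is "?S \<in> _")
proof -
  have S: "?S \<in> sets borel" by measurable
  note S1 = slice_sets_borel(1)[OF S]
  have S2: "{q. (b, q) \<in> {q. (a, q) \<in> ?S}} \<in> sets borel" for a b by (rule slice_sets_borel(1)[OF S1])
  have "{x. x = c} \<in> null_sets lborel" by (rule finite_imp_null_set_lborel) simp
  then have ae: "AE x in lborel. x \<noteq> c" by (rule AE_I') auto
  have main: "{q. (b, q) \<in> {q. (a, q) \<in> ?S}} \<in> null_sets lborel" for a b
  proof (rule null_sets_lborel_pair[OF S2], rule AE_mp[OF ae AE_I2], intro impI)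
    fix x assume x: "x \<noteq> c"
    show "{y. (x, y) \<in> {q. (b, q) \<in> {q. (a, q) \<in> ?S}}} \<in> null_sets lborel"
    proof (cases "m = 0")
      case True
      then show ?thesis using mn x by simp
    next
      case False
      have e: "(x - c) * n = (y - d) * m \<longleftrightarrow> y * m = (x - c) * n + d * m" for y by (auto simp: algebra_simps)
      show ?thesis using null_sets_linear_eq[of "of_int m" "(x - c) * n + d * m"] False by (simp add: e)
    qed
  qed
  show "?S \<in> null_sets lborel"
    by (rule null_sets_lborel_pair[OF S AE_I2], rule null_sets_lborel_pair[OF S1 AE_I2], rule main)
qed

lemma slit_torus_in_E_space_irrational:
  assumes h: "det h = 1" and irr: "\<And>m n::int. m \<noteq> 0 \<or> n \<noteq> 0 \<Longrightarrow> \<xi> $ 1 * of_int n \<noteq> \<xi> $ 2 * of_int m"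
  shows "slit_torus h (h *v \<xi>) \<in> E_space"
  using h is_slit_irrational[OF assms] unfolding E_space_def by blast

lemma AE_sa_param_E_space: "AE p in lborel. p \<in> Omega_coords \<longrightarrow> sa_param e p \<in> E_space"
proof -
  define bad where "bad m n p \<longleftrightarrow> fst p > 0 \<and> (snd (snd (snd p)) * (1 / fst p - fst (snd p) * fst (snd (snd p))) - e $ 1) * n
     = (fst p * fst (snd (snd p)) * snd (snd (snd p)) - e $ 2) * of_int m" for m n :: int and p :: "real \<times> real \<times> real \<times> real"
  have "AE p in lborel. (m \<noteq> 0 \<or> n \<noteq> 0) \<longrightarrow> \<not> bad m n p" for m n
    proof (cases "m \<noteq> 0 \<or> n \<noteq> 0")
      case True
      show ?thesis by (rule AE_I'[OF null_sets_sa_rational[OF True, of "e $ 1" "e $ 2"]]) (auto simp: bad_def)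
    qed simp
  then have "AE p in lborel. \<forall>m n. (m \<noteq> 0 \<or> n \<noteq> 0) \<longrightarrow> \<not> bad m n p" by (simp add: AE_all_countable)
  then show ?thesis
  proof eventually_elim
    case (elim p)
    note bad = this[unfolded bad_def]
    show ?case
    proof
    assume p: "p \<in> Omega_coords"
    obtain a b s \<alpha> where pe: "p = (a, b, s, \<alpha>)" by (cases p)
    then have a: "a > 0" using p unfolding Omega_coords_def Delta_def by simp
    let ?h = "hmat s ** pmat a b" and ?\<xi> = "vector [\<alpha> * (1 / a - b * s) - e $ 1, a * s * \<alpha> - e $ 2] :: real^2"
    have "vector [\<alpha>, 0] - ?h *v e = ?h *v ?\<xi>"
      using a by (simp add: vec2_eq_iff mat2_mult_vec hp_entries field_simps)
    moreover have "slit_torus ?h (?h *v ?\<xi>) \<in> E_space"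
      using det_hp[of a s b] a bad unfolding pe by (intro slit_torus_in_E_space_irrational) auto
    ultimately show "sa_param e p \<in> E_space" unfolding pe sa_param_def by (simp add: Let_def)
    qed
  qed
qed

lemma AE_sl_param_E_space: "AE p in lborel. p \<in> sl_coords \<longrightarrow> sl_param e p \<in> E_space"
proof -
  define bad where "bad m n p \<longleftrightarrow> (fst (snd (snd p)) - e $ 1) * n = (snd (snd (snd p)) - e $ 2) * of_int m" for m n :: int and p :: "real \<times> real \<times> real \<times> real"
  have "AE p in lborel. (m \<noteq> 0 \<or> n \<noteq> 0) \<longrightarrow> \<not> bad m n p" for m n
    proof (cases "m \<noteq> 0 \<or> n \<noteq> 0")
      case True
      show ?thesis by (rule AE_I'[OF null_sets_sl_rational[OF True, of "e $ 1" "e $ 2"]]) (auto simp: bad_def)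
    qed simp
  then have "AE p in lborel. \<forall>m n. (m \<noteq> 0 \<or> n \<noteq> 0) \<longrightarrow> \<not> bad m n p" by (simp add: AE_all_countable)
  then show ?thesis
  proof eventually_elim
    case (elim p)
    note bad = this[unfolded bad_def]
    show ?case
    proof
    assume p: "p \<in> sl_coords"
    obtain a b x y where pe: "p = (a, b, x, y)" by (cases p)
    then have a: "a > 0" using p unfolding sl_coords_def Delta_def by simp
    let ?h = "pmat a b" and ?\<xi> = "vector [x - e $ 1, y - e $ 2] :: real^2"
    have "?h *v vector [x, y] - ?h *v e = ?h *v ?\<xi>"
      by (simp add: vec2_eq_iff mat2_mult_vec algebra_simps diff_divide_distrib)
    moreover have "slit_torus ?h (?h *v ?\<xi>) \<in> E_space"
      using det_pmat[of a b] a bad unfolding pe by (intro slit_torus_in_E_space_irrational) auto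
    ultimately show "sl_param e p \<in> E_space" unfolding pe sl_param_def by simp
    qed
  qed
qed

text \<open>The four slits over one affine lattice have the same differences of singular points, so the
  return time does not see the corner.\<close>

lemma affine_lattice_corner:
  assumes "e \<in> corners"
  shows "affine_lattice h (v - h *v e) = affine_lattice h v" "affine_lattice h (- (v - h *v e)) = affine_lattice h (- v)"
proof -
  have "\<forall>i. e $ i \<in> \<int>" using assms unfolding corners_def by (metis (mono_tags) Ints_0 Ints_1 empty_iff insert_iff mem_Collect_eq)
  then have e: "h *v e \<in> lattice h" unfolding lattice_def by blast
  then have "v \<in> affine_lattice h (v - h *v e)" by (simp add: mem_affine_lattice_diff)
  then show "affine_lattice h (v - h *v e) = affine_lattice h v" by (rule affine_lattice_eq_if_mem)
  have "- v \<in> affine_lattice h (- (v - h *v e))" using lattice_uminus[OF e] by (simp add: mem_affine_lattice_diff)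
  then show "affine_lattice h (- (v - h *v e)) = affine_lattice h (- v)" by (rule affine_lattice_eq_if_mem)
qed

lemma slopes_sa_param:
  assumes "e \<in> corners"
  shows "slopes (sing_diffs (sa_param e p)) =
    strip_slopes (sa_pt 0 p) \<union> strip_slopes (sa_pt 1 p) \<union> strip_slopes (sa_pt (-1) p)"
proof -
  obtain a b s \<alpha> where p: "p = (a, b, s, \<alpha>)" by (cases p)
  have v: "0 = (vector [0 * \<alpha>, 0] :: real^2)" "vector [\<alpha>, 0] = (vector [1 * \<alpha>, 0] :: real^2)"
    "- vector [\<alpha>, 0] = (vector [(-1) * \<alpha>, 0] :: real^2)" by (simp_all add: vec2_eq_iff)
  show ?thesis
    unfolding p sa_param_def case_prod_conv Let_def sing_diffs_slit_torus affine_lattice_corner[OF assms] slopes_Un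
      slopes_sa[symmetric] v(1) v(3)[symmetric] v(2)[symmetric] by simp
qed

lemma slopes_sl_param:
  assumes "e \<in> corners"
  shows "slopes (sing_diffs (sl_param e p)) =
    strip_slopes (sl_pt 0 p) \<union> strip_slopes (sl_pt 1 p) \<union> strip_slopes (sl_pt (-1) p)"
proof -
  obtain a b x y where p: "p = (a, b, x, y)" by (cases p)
  have v: "0 = pmat a b *v (vector [0 * x, 0 * y] :: real^2)" "pmat a b *v vector [x, y] = pmat a b *v (vector [1 * x, 1 * y] :: real^2)"
    "- (pmat a b *v vector [x, y]) = pmat a b *v (vector [(-1) * x, (-1) * y] :: real^2)"
    by (simp_all add: vec2_eq_iff mat2_mult_vec)
  show ?thesis
    unfolding p sl_param_def case_prod_conv Let_def sing_diffs_slit_torus affine_lattice_corner[OF assms] slopes_Un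
      slopes_sl[symmetric] v(1) v(3)[symmetric] v(2)[symmetric] by simp
qed

text \<open>The short horizontal vector is \<open>(\<alpha>, 0)\<close>.\<close>

lemma sa_param_in_W_space:
  assumes "e \<in> corners" "p \<in> Omega_coords" "sa_param e p \<in> E_space" shows "sa_param e p \<in> W_space"
proof -
  obtain a b s \<alpha> where p: "p = (a, b, s, \<alpha>)" by (cases p)
  have \<alpha>: "0 < \<alpha>" "\<alpha> \<le> 1" using assms(2) unfolding p Omega_coords_def by auto
  have "vector [\<alpha>, 0] \<in> affine_lattice (hmat s ** pmat a b) (vector [\<alpha>, 0])"
    by (simp add: mem_affine_lattice_diff lattice_zero)
  then have "short_horizontal (affine_lattice (hmat s ** pmat a b) (vector [\<alpha>, 0]))"
    using \<alpha> unfolding short_horizontal_def by blast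
  then show ?thesis using assms(3)
    unfolding mem_W_space_iff p sa_param_def case_prod_conv Let_def sing_diffs_slit_torus
      affine_lattice_corner[OF assms(1)] short_horizontal_Un by blast
qed

text \<open>The short horizontal vector is the first column \<open>(a, 0)\<close> of the matrix.\<close>

lemma sl_param_in_W_space:
  assumes "e \<in> corners" "p \<in> sl_coords" "sl_param e p \<in> E_space" shows "sl_param e p \<in> W_space"
proof -
  obtain a b x y where p: "p = (a, b, x, y)" by (cases p)
  have a: "0 < a" "a \<le> 1" using assms(2) unfolding p sl_coords_def Delta_def by auto
  have "vector [a, 0] = pmat a b *v vector [of_int 1, of_int 0] + 0"
    by (simp add: vec2_eq_iff mat2_mult_vec pmat_entries)
  then have "vector [a, 0] \<in> affine_lattice (pmat a b) 0" unfolding mem_affine_lattice_iff by blast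
  then have "short_horizontal (affine_lattice (pmat a b) 0)" using a unfolding short_horizontal_def by blast
  then show ?thesis using assms(3)
    unfolding mem_W_space_iff p sl_param_def case_prod_conv Let_def sing_diffs_slit_torus
      affine_lattice_corner[OF assms(1)] short_horizontal_Un by blast
qed

section \<open>The laws of the return times\<close>

lemma emeasure_lborel_Times:
  fixes A :: "'a::euclidean_space set" and B :: "'b::euclidean_space set"
  assumes "A \<in> sets borel" "B \<in> sets borel"
  shows "emeasure lborel (A \<times> B) = emeasure lborel A * emeasure lborel B"
  unfolding lborel_prod[symmetric] using assms by (intro lborel.emeasure_pair_measure_Times) auto

lemma emeasure_open_pos:
  fixes U :: "'a::euclidean_space set"
  assumes "open U" "x \<in> U" "U \<subseteq> A" "A \<in> sets borel"
  shows "emeasure lborel A > 0"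
proof -
  have "U \<notin> null_sets lborel" using assms(1,2) open_not_negligible negligible_if_null_sets_lborel by blast
  then have "emeasure lborel U \<noteq> 0" using assms(1) by (auto simp: null_sets_def)
  moreover have "emeasure lborel U \<le> emeasure lborel A" using assms by (intro emeasure_mono) auto
  ultimately show ?thesis by (metis le_zero_eq not_gr_zero)
qed

lemma scaling_Omega_coords:
  assumes "t > 0" "scaling t q \<in> Omega_coords" "fst (scaling t q) \<le> 1 / 2"
  shows "q \<in> {0..t / 2} \<times> {0..1} \<times> {0..2} \<times> {0..t}" "fst q > 0"
proof -
  obtain A \<theta> \<sigma> \<beta> where q: "q = (A, \<theta>, \<sigma>, \<beta>)" by (cases q)
  define a b where "a = A / t" and "b = 1 - \<theta> * a"
  have c: "0 < a" "a \<le> 1 / 2" "1 - a < b" "b \<le> 1" "0 \<le> \<sigma> * (t / A)" "\<sigma> * (t / A) < 1 / (a * b)" "0 < \<beta> / t" "\<beta> / t \<le> 1"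
    using assms(2,3) unfolding q scaling_def Omega_coords_def Delta_def a_def b_def by simp_all
  have A: "A > 0" using c(1) assms(1) unfolding a_def by (simp add: zero_less_divide_iff)
  have b2: "b > 1 / 2" using c by linarith
  have s: "\<sigma> * (t / A) = \<sigma> / a" unfolding a_def by simp
  have "\<theta> \<ge> 0" using c(1,4) unfolding b_def by (simp add: zero_le_mult_iff)
  moreover have "\<theta> * a < 1 * a" using c(3) unfolding b_def by linarith
  then have "\<theta> < 1" using c(1) mult_less_cancel_right_pos by blast
  moreover have "\<sigma> \<ge> 0" using c(1,5) unfolding s by (simp add: zero_le_divide_iff)
  moreover have "\<sigma> < 1 / b" using c(1,6) b2 unfolding s by (simp add: field_simps)
  then have "\<sigma> \<le> 2" using order.strict_trans[of \<sigma> "1 / b" 2] b2 by (simp add: divide_less_eq)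
  moreover have "A \<le> t / 2" using c(2) assms(1) unfolding a_def by (simp add: field_simps)
  moreover have "0 < \<beta>" "\<beta> \<le> t" using c(7,8) assms(1) by (simp_all add: zero_less_divide_iff divide_le_eq)
  ultimately show "q \<in> {0..t / 2} \<times> {0..1} \<times> {0..2} \<times> {0..t}" "fst q > 0" using A unfolding q by auto
qed

text \<open>The range of \<open>s\<close> is unbounded near \<open>a = 0\<close>, but in the blown-up coordinates for \<open>t = 1\<close> it becomes
  \<open>0 \<le> \<sigma> < 1 / b\<close>.\<close>

lemma emeasure_Omega_coords_cusp_le:
  assumes E: "E \<in> sets borel" "E \<subseteq> Omega_coords" and c: "c \<ge> 0" "\<And>p. p \<in> E \<Longrightarrow> fst p \<le> 1 / 2 \<and> fst p \<le> c"
  shows "emeasure lborel E \<le> ennreal (2 * c)"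
proof -
  let ?K = "{0..c} \<times> {0..1} \<times> {0..2} \<times> {0..1::real} :: (real \<times> real \<times> real \<times> real) set"
  have "emeasure lborel E = ennreal (1 / 1\<^sup>2) * emeasure lborel {q. scaling 1 q \<in> E}"
  proof (rule emeasure_scaling[OF E(1)])
    show "fst p > 0" if "p \<in> E" for p using that E(2) unfolding Omega_coords_def Delta_def by auto
  qed simp
  also have "\<dots> \<le> emeasure lborel ?K"
  proof -
    have "{q. scaling 1 q \<in> E} \<subseteq> ?K"
    proof
      fix q assume q: "q \<in> {q. scaling 1 q \<in> E}"
      then have "q \<in> {0..1 / 2} \<times> {0..1} \<times> {0..2} \<times> {0..1}" "fst q > 0"
        using scaling_Omega_coords[of 1 q] E(2) c(2) by auto
      moreover have "fst q \<le> c" using c(2)[of "scaling 1 q"] q by (simp add: scaling_def)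
      ultimately show "q \<in> ?K" by auto
    qed
    moreover have "?K \<in> sets borel" by (intro borel_closed closed_Times) auto
    ultimately show ?thesis by (simp add: emeasure_mono)
  qed
  also have "\<dots> = ennreal c * 2"
    using c(1) by (simp add: emeasure_lborel_Times borel_closed closed_Times)
  also have "\<dots> = ennreal (2 * c)" using ennreal_mult[OF c(1), of 2] by (simp add: mult.commute)
  finally show ?thesis .
qed

lemma swap_ab_Omega_coords: "swap_ab p \<in> Omega_coords \<longleftrightarrow> p \<in> Omega_coords"
  unfolding swap_ab_def Omega_coords_def Delta_def by (cases p) (auto simp: mult.commute)

lemma emeasure_Omega_coords_cusp_le':
  assumes E: "E \<in> sets borel" "E \<subseteq> Omega_coords" and c: "c \<ge> 0" "\<And>p. p \<in> E \<Longrightarrow> fst (snd p) \<le> 1 / 2 \<and> fst (snd p) \<le> c"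
  shows "emeasure lborel E \<le> ennreal (2 * c)"
proof -
  have "{p. swap_ab p \<in> E} \<in> sets borel"
    using measurable_sets_borel[OF measurable_swap_ab E(1)] by (simp add: vimage_def)
  moreover have "{p. swap_ab p \<in> E} \<subseteq> Omega_coords" using E(2) swap_ab_Omega_coords by blast
  moreover have "fst p \<le> 1 / 2 \<and> fst p \<le> c" if "p \<in> {p. swap_ab p \<in> E}" for p
    using c(2)[of "swap_ab p"] that by (simp add: swap_ab_def)
  ultimately have "emeasure lborel {p. swap_ab p \<in> E} \<le> ennreal (2 * c)"
    using c(1) by (intro emeasure_Omega_coords_cusp_le)
  then show ?thesis using emeasure_swap_ab[OF E(1)] by simp
qed

lemma Omega_coords_bulk:
  assumes "(a, b, s, \<alpha>) \<in> Omega_coords" "a > 1 / 2" "b > 1 / 2"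
  shows "a \<in> {0..1}" "b \<in> {0..1}" "s \<in> {0..4}" "\<alpha> \<in> {0..1}"
proof -
  have c: "a \<le> 1" "b \<le> 1" "0 \<le> s" "s < 1 / (a * b)" "0 < \<alpha>" "\<alpha> \<le> 1"
    using assms(1) unfolding Omega_coords_def Delta_def by auto
  have "1 / 2 * (1 / 2) < a * b" using assms by (intro mult_strict_mono) auto
  then have "1 / (a * b) < 4" by (simp add: divide_less_eq)
  then show "a \<in> {0..1}" "b \<in> {0..1}" "s \<in> {0..4}" "\<alpha> \<in> {0..1}" using c assms by auto
qed

lemma emeasure_Omega_coords_finite: "emeasure lborel Omega_coords < \<infinity>"
proof -
  let ?E1 = "{p \<in> Omega_coords. fst p \<le> 1 / 2}" and ?E2 = "{p \<in> Omega_coords. fst (snd p) \<le> 1 / 2}"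
  let ?K = "{0..1} \<times> {0..1} \<times> {0..4} \<times> {0..1::real} :: (real \<times> real \<times> real \<times> real) set"
  have S: "?E1 \<in> sets borel" "?E2 \<in> sets borel" "?K \<in> sets borel"
  proof -
    have [measurable]: "Omega_coords \<in> sets borel" by (rule sets_Delta_coords)
    show "?E1 \<in> sets borel" "?E2 \<in> sets borel" by measurable
    show "?K \<in> sets borel" by (intro borel_closed closed_Times) auto
  qed
  have "Omega_coords \<subseteq> ?E1 \<union> ?E2 \<union> ?K"
  proof
    fix p assume p: "p \<in> Omega_coords"
    obtain a b s \<alpha> where "p = (a, b, s, \<alpha>)" by (cases p)
    then show "p \<in> ?E1 \<union> ?E2 \<union> ?K" using p Omega_coords_bulk[of a b s \<alpha>] by force
  qed
  then have "emeasure lborel Omega_coords \<le> emeasure lborel (?E1 \<union> ?E2 \<union> ?K)"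
    using S by (intro emeasure_mono) auto
  also have "\<dots> \<le> emeasure lborel ?E1 + emeasure lborel ?E2 + emeasure lborel ?K"
    using S by (intro order_trans[OF emeasure_subadditive add_mono[OF emeasure_subadditive order_refl]]) auto
  also have "\<dots> < \<infinity>"
  proof -
    have "emeasure lborel ?E1 \<le> ennreal (2 * (1 / 2))"
      by (rule emeasure_Omega_coords_cusp_le[OF S(1)]) auto
    moreover have "emeasure lborel ?E2 \<le> ennreal (2 * (1 / 2))"
      by (rule emeasure_Omega_coords_cusp_le'[OF S(2)]) auto
    moreover have "emeasure lborel ?K < \<infinity>"
      by (intro emeasure_bounded_finite bounded_Times) auto
    ultimately show ?thesis by (auto simp: less_top[symmetric] top_unique)
  qed
  finally show ?thesis .
qed

lemma bounded_coords: "bounded Delta" "bounded sl_coords"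
proof -
  have "Delta \<subseteq> {0..1} \<times> {0..1}" unfolding Delta_def by auto
  then show "bounded Delta" by (rule bounded_subset[rotated]) (auto intro: bounded_Times)
  have "sl_coords \<subseteq> {0..1} \<times> {0..1} \<times> {0..1} \<times> {0..1}" unfolding sl_coords_def Delta_def by auto
  then show "bounded sl_coords" by (rule bounded_subset[rotated]) (auto intro!: bounded_Times)
qed

lemma emeasure_coords_finite: "emeasure lborel Delta < \<infinity>" "emeasure lborel sl_coords < \<infinity>"
  using bounded_coords emeasure_bounded_finite by auto

text \<open>The lattice vector \<open>(b, 1 / a - s b)\<close> has slope \<open>1 / (a b) - s\<close>. Where this is small and
  \<open>\<alpha> + b < 1\<close>, adding it to \<open>(\<alpha>, 0)\<close> yields an early return.\<close>

lemma emeasure_early_return_pos: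
  assumes t: "t > 0"
  shows "emeasure lborel {p \<in> Omega_coords. \<not> clear t (sa_pt 1 p)} > 0"
proof -
  define \<delta> where "\<delta> = min t 1"
  have d: "0 < \<delta>" "\<delta> \<le> 1" "\<delta> \<le> t" using t unfolding \<delta>_def by auto
  let ?a = "\<lambda>p::real\<times>real\<times>real\<times>real. fst p" and ?b = "\<lambda>p::real\<times>real\<times>real\<times>real. fst (snd p)"
    and ?s = "\<lambda>p::real\<times>real\<times>real\<times>real. fst (snd (snd p))" and ?al = "\<lambda>p::real\<times>real\<times>real\<times>real. snd (snd (snd p))"
  \<comment> \<open>the last two conditions say that the slope \<open>1 / (a b) - s\<close> lies between \<open>0\<close> and \<open>\<delta>\<close>\<close>
  let ?U = "{p. 0 < ?a p \<and> ?a p < 1 \<and> 0 < ?b p \<and> 1 < ?a p + ?b p \<and> ?b p + ?al p < 1 \<and> 0 < ?s p \<and> 0 < ?al p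
    \<and> ?s p * (?a p * ?b p) < 1 \<and> 1 < (\<delta> + ?s p) * (?a p * ?b p)}"
  show ?thesis
  proof (rule emeasure_open_pos)
    show "open ?U" by (intro open_Collect_conj open_Collect_less continuous_intros)
    show "(3 / 4, 1 / 2, 8 / 3 - \<delta> / 2, 1 / 4) \<in> ?U" using d by simp
    show "?U \<subseteq> {p \<in> Omega_coords. \<not> clear t (sa_pt 1 p)}"
    proof
      fix p assume "p \<in> ?U"
      moreover obtain a b s \<alpha> where p: "p = (a, b, s, \<alpha>)" by (cases p)
      ultimately have u: "0 < a" "a < 1" "0 < b" "1 < a + b" "b + \<alpha> < 1" "0 < s" "0 < \<alpha>" "s * (a * b) < 1" "1 < (\<delta> + s) * (a * b)"
        by auto
      have ab: "a * b > 0" using u by simp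
      have s: "s < 1 / (a * b)" using u(8) ab by (simp add: less_divide_eq)
      have C: "p \<in> Omega_coords" unfolding p Omega_coords_def Delta_def using u s by auto
      have y: "sa_pt 1 p 0 1 = (\<alpha> + b, 1 / a - s * b)" unfolding p sa_pt_def by simp
      have "1 / a - s * b = (1 - s * (a * b)) / a" "(\<delta> * b - (1 / a - s * b)) = ((\<delta> + s) * (a * b) - 1) / a"
        using u(1) by (simp_all add: field_simps)
      moreover have "(1 - s * (a * b)) / a > 0" "((\<delta> + s) * (a * b) - 1) / a > 0" using u by simp_all
      ultimately have y2: "1 / a - s * b > 0" "1 / a - s * b < \<delta> * b" by linarith+
      have "\<delta> * b \<le> t * (\<alpha> + b)" using d u by (intro mult_mono) auto
      then have "\<not> t * fst (sa_pt 1 p 0 1) < snd (sa_pt 1 p 0 1)" using y2 unfolding y by simp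
      moreover have "in_strip (sa_pt 1 p 0 1)" unfolding y in_strip_def using u y2 by simp
      ultimately show "p \<in> {p \<in> Omega_coords. \<not> clear t (sa_pt 1 p)}" using C unfolding clear_def by blast
    qed
    have [measurable]: "Omega_coords \<in> sets borel" "{p. clear t (sa_pt 1 p)} \<in> sets borel"
      by (rule sets_Delta_coords, rule sets_clear) measurable
    have "{p \<in> Omega_coords. \<not> clear t (sa_pt 1 p)} = Omega_coords - {p. clear t (sa_pt 1 p)}" by auto
    also have "\<dots> \<in> sets borel" by measurable
    finally show "{p \<in> Omega_coords. \<not> clear t (sa_pt 1 p)} \<in> sets borel" .
  qed
qed

lemma emeasure_Omega_coords_pos: "emeasure lborel Omega_coords > 0"
proof -
  have "emeasure lborel {p \<in> Omega_coords. \<not> clear 1 (sa_pt 1 p)} \<le> emeasure lborel Omega_coords"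
    using sets_Delta_coords by (intro emeasure_mono) auto
  then show ?thesis using emeasure_early_return_pos[of 1] by (simp add: less_le_trans)
qed

lemma emeasure_Delta_pos: "emeasure lborel Delta > 0"
proof (rule emeasure_open_pos)
  let ?U = "{p::real\<times>real. 0 < fst p \<and> fst p < 1 \<and> 1 < fst p + snd p \<and> snd p < 1}"
  show "open ?U" by (intro open_Collect_conj open_Collect_less continuous_intros)
  show "(3 / 4, 3 / 4) \<in> ?U" by simp
  show "?U \<subseteq> Delta" unfolding Delta_def by auto
qed (rule sets_Delta_coords)

subsection \<open>Affine lattices\<close>

lemma slopes_affine_coords: 
  "slopes (affine_lattice (hmat (fst (snd (snd p))) ** pmat (fst p) (fst (snd p))) (vector [snd (snd (snd p)), 0]))
    = strip_slopes (sa_pt 1 p)"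
  using slopes_sa[of "fst (snd (snd p))" "fst p" "fst (snd p)" 1 "snd (snd (snd p))"] by simp

lemma slopes_torsion_coords: 
  "slopes (affine_lattice (pmat (fst p) (snd p)) (vector [fst p / real q, 0]))
    = strip_slopes (sl_pt 1 (fst p, snd p, 1 / real q, 0))"
proof -
  have "vector [fst p / real q, 0] = pmat (fst p) (snd p) *v (vector [1 * (1 / real q), 1 * 0] :: real^2)"
    by (simp add: vec2_eq_iff mat2_mult_vec pmat_entries)
  then show ?thesis using slopes_sl[of "fst p" "snd p" 1 "1 / real q" 0] by simp
qed

lemma short_horizontal_at: "0 < x \<Longrightarrow> x \<le> 1 \<Longrightarrow> short_horizontal (affine_lattice h (vector [x, 0]))"
  unfolding short_horizontal_def
  by (intro exI[of _ x]) (simp add: mem_affine_lattice_diff lattice_zero)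

lemma R_Omega_greater_iff:
  assumes "\<Lambda> \<in> Omega" "slopes \<Lambda> = strip_slopes P"
  shows "t < R_Omega \<Lambda> \<longleftrightarrow> clear t P"
proof
  assume "t < R_Omega \<Lambda>"
  then show "clear t P" unfolding clear_iff assms(2)[symmetric] using R_Omega_Least(3)[OF assms(1)] by (blast intro: less_le_trans)
next
  assume "clear t P"
  then show "t < R_Omega \<Lambda>" unfolding clear_iff assms(2)[symmetric] using R_Omega_Least(1)[OF assms(1)] by blast
qed

text \<open>Both \<open>m_Omega\<close> and \<open>m_tor q\<close> are images of normalised Lebesgue measure on a set \<open>C\<close> of
  parameters. Absolute continuity holds because the return time is one of the slopes.\<close>

lemma law_R_Omega:
  fixes C :: "'a::euclidean_space set" and h :: "'a \<Rightarrow> real^2^2"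
  assumes C: "C \<in> sets borel" "emeasure lborel C > 0" "emeasure lborel C < \<infinity>"
    and h: "h \<in> borel_measurable borel" and v: "v \<in> borel_measurable borel"
    and det: "\<And>p. p \<in> C \<Longrightarrow> det (h p) = 1"
    and sh: "\<And>p. p \<in> C \<Longrightarrow> short_horizontal (affine_lattice (h p) (v p))"
    and sl: "\<And>p. slopes (affine_lattice (h p) (v p)) = strip_slopes (P p)"
    and null: "\<And>N. N \<in> null_sets lborel \<Longrightarrow> {p. \<exists>u\<in>strip_slopes (P p). u \<in> N} \<in> null_sets lborel"
  defines "\<mu> \<equiv> distr (uniform_measure (restrict_space lborel C) C) Omega_borel (\<lambda>p. affine_lattice (h p) (v p))"
  shows "\<And>B. B \<in> sets borel \<Longrightarrow> (LINT x:B|lborel. gap_density \<mu> R_Omega x) = measure \<mu> {x \<in> space \<mu>. R_Omega x \<in> B}"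
    "measure \<mu> {x \<in> space \<mu>. R_Omega x \<in> {t<..}} = measure lborel {p \<in> C. clear t (P p)} / measure lborel C"
    "measure \<mu> (space \<mu>) = 1" "finite_measure \<mu>" "R_Omega \<in> borel_measurable \<mu>"
proof -
  let ?\<Phi> = "\<lambda>p. affine_lattice (h p) (v p)"
  have sp: "space \<mu> = Omega" "sets \<mu> = sets Omega_borel" unfolding \<mu>_def by (simp_all add: space_Omega_borel)
  have \<Phi>: "?\<Phi> p \<in> Omega" if "p \<in> C" for p using det sh that by (simp add: affine_lattice_in_Omega_iff)
  note em = emeasure_distr_uniform_Omega[OF C(1) h v det sh, folded \<mu>_def]
  show R: "R_Omega \<in> borel_measurable \<mu>"
    using borel_measurable_R_Omega measurable_cong_sets[OF sp(2) refl] by blast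
  have set: "{x \<in> space \<mu>. R_Omega x \<in> B} \<in> sets Omega_borel" if "B \<in> sets borel" for B
    using measurable_sets[OF R that] sp by (simp add: vimage_def Int_def conj_commute)
  have law: "emeasure \<mu> {x \<in> space \<mu>. R_Omega x \<in> B} = emeasure lborel {p \<in> C. R_Omega (?\<Phi> p) \<in> B} / emeasure lborel C"
    "{p \<in> C. R_Omega (?\<Phi> p) \<in> B} \<in> sets borel" if "B \<in> sets borel" for B
  proof -
    have e: "{p \<in> C. ?\<Phi> p \<in> {x \<in> space \<mu>. R_Omega x \<in> B}} = {p \<in> C. R_Omega (?\<Phi> p) \<in> B}"
      using \<Phi> unfolding sp(1) by auto
    show "emeasure \<mu> {x \<in> space \<mu>. R_Omega x \<in> B} = emeasure lborel {p \<in> C. R_Omega (?\<Phi> p) \<in> B} / emeasure lborel C"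
      "{p \<in> C. R_Omega (?\<Phi> p) \<in> B} \<in> sets borel"
      using em[OF _ _ set[OF that]] unfolding e by auto
  qed
  have prob: "emeasure \<mu> (space \<mu>) = 1"
  proof -
    have "emeasure \<mu> (space \<mu>) = emeasure lborel C / emeasure lborel C" using law(1)[of UNIV] by simp
    then show ?thesis using C by (simp add: ennreal_divide_self)
  qed
  then show "measure \<mu> (space \<mu>) = 1" by (simp add: measure_def)
  show fin: "finite_measure \<mu>" by (rule finite_measureI) (simp add: prob)
  show "(LINT x:B|lborel. gap_density \<mu> R_Omega x) = measure \<mu> {x \<in> space \<mu>. R_Omega x \<in> B}" if "B \<in> sets borel" for B
  proof (rule set_integral_gap_density[OF fin R _ _ that])
    show "R_Omega x > 0" if "x \<in> space \<mu>" for x using R_Omega_Least(2)[of x] that by (simp add: sp)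
    fix N :: "real set" assume N: "N \<in> null_sets lborel"
    then have NB: "N \<in> sets borel" using null_setsD2 by fastforce
    have "{p \<in> C. R_Omega (?\<Phi> p) \<in> N} \<subseteq> {p. \<exists>u\<in>strip_slopes (P p). u \<in> N}"
    proof
      fix p assume p: "p \<in> {p \<in> C. R_Omega (?\<Phi> p) \<in> N}"
      then have "R_Omega (?\<Phi> p) \<in> strip_slopes (P p)" using R_Omega_Least(1)[OF \<Phi>, of p] sl by simp
      then show "p \<in> {p. \<exists>u\<in>strip_slopes (P p). u \<in> N}" using p by (intro CollectI bexI[of _ "R_Omega (?\<Phi> p)"]) auto
    qed
    then have "{p \<in> C. R_Omega (?\<Phi> p) \<in> N} \<in> null_sets lborel"
      using law(2)[OF NB] by (intro null_sets_subset[OF null[OF N]]) auto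
    then have "emeasure lborel {p \<in> C. R_Omega (?\<Phi> p) \<in> N} = 0" by (rule null_setsD1)
    then show "emeasure \<mu> {x \<in> space \<mu>. R_Omega x \<in> N} = 0" using law(1)[OF NB] by simp
  qed
  have "{p \<in> C. R_Omega (?\<Phi> p) \<in> {t<..}} = {p \<in> C. clear t (P p)}"
    using R_Omega_greater_iff[OF \<Phi> sl] by auto
  then have "emeasure \<mu> {x \<in> space \<mu>. R_Omega x \<in> {t<..}} = emeasure lborel {p \<in> C. clear t (P p)} / emeasure lborel C"
    using law(1)[of "{t<..}"] by simp
  also have "\<dots> = ennreal (measure lborel {p \<in> C. clear t (P p)}) / ennreal (measure lborel C)"
  proof -
    have "emeasure lborel {p \<in> C. clear t (P p)} \<le> emeasure lborel C" using C by (intro emeasure_mono) auto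
    then have "emeasure lborel {p \<in> C. clear t (P p)} \<noteq> \<infinity>" using C(3) by (auto simp: top_unique)
    then show ?thesis using C(3) by (simp add: emeasure_eq_ennreal_measure)
  qed
  also have "\<dots> = ennreal (measure lborel {p \<in> C. clear t (P p)} / measure lborel C)"
    using C by (intro divide_ennreal) (auto simp: measure_def enn2real_positive_iff)
  finally show "measure \<mu> {x \<in> space \<mu>. R_Omega x \<in> {t<..}} = measure lborel {p \<in> C. clear t (P p)} / measure lborel C"
    by (simp add: measure_def)
qed

lemma m_Omega_eq: "m_Omega = distr (uniform_measure (restrict_space lborel Omega_coords) Omega_coords) Omega_borel
    (\<lambda>p. affine_lattice (hmat (fst (snd (snd p))) ** pmat (fst p) (fst (snd p))) (vector [snd (snd (snd p)), 0]))"
  unfolding m_Omega_def by (simp add: case_prod_beta')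

lemma m_tor_eq: "m_tor q = distr (uniform_measure (restrict_space lborel Delta) Delta) Omega_borel
    (\<lambda>p. affine_lattice (pmat (fst p) (snd p)) (vector [fst p / real q, 0]))"
  unfolding m_tor_def by (simp add: case_prod_beta')

lemma law_m_Omega:
  shows "B \<in> sets borel \<Longrightarrow> (LINT x:B|lborel. gap_density m_Omega R_Omega x) = measure m_Omega {x \<in> space m_Omega. R_Omega x \<in> B}"
    "measure m_Omega {x \<in> space m_Omega. R_Omega x \<in> {t<..}}
      = measure lborel {p \<in> Omega_coords. clear t (sa_pt 1 p)} / measure lborel Omega_coords"
    "measure m_Omega (space m_Omega) = 1" "finite_measure m_Omega" "R_Omega \<in> borel_measurable m_Omega"
proof -
  let ?h = "\<lambda>p::real\<times>real\<times>real\<times>real. hmat (fst (snd (snd p))) ** pmat (fst p) (fst (snd p))"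
  let ?v = "\<lambda>p::real\<times>real\<times>real\<times>real. vector [snd (snd (snd p)), 0] :: real^2"
  have h: "?h \<in> borel_measurable borel" by (rule borel_measurable_hp) measurable
  have v: "?v \<in> borel_measurable borel" by (rule borel_measurable_vec2) measurable
  have det: "det (?h p) = 1" if "p \<in> Omega_coords" for p
    using that unfolding Omega_coords_def Delta_def by (intro det_hp) auto
  have sh: "short_horizontal (affine_lattice (?h p) (?v p))" if "p \<in> Omega_coords" for p
    using that unfolding Omega_coords_def by (intro short_horizontal_at) auto
  note law = law_R_Omega[OF sets_Delta_coords(2) emeasure_Omega_coords_pos emeasure_Omega_coords_finite h v det sh
      slopes_affine_coords null_sets_strip_slopes_sa]
  show "(LINT x:B|lborel. gap_density m_Omega R_Omega x) = measure m_Omega {x \<in> space m_Omega. R_Omega x \<in> B}"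
    if "B \<in> sets borel" unfolding m_Omega_eq by (rule law(1); (assumption | rule that)?)
  show "measure m_Omega {x \<in> space m_Omega. R_Omega x \<in> {t<..}}
      = measure lborel {p \<in> Omega_coords. clear t (sa_pt 1 p)} / measure lborel Omega_coords" unfolding m_Omega_eq by (rule law(2); assumption?)
  show "measure m_Omega (space m_Omega) = 1" unfolding m_Omega_eq by (rule law(3); assumption?)
  show "finite_measure m_Omega" unfolding m_Omega_eq by (rule law(4); assumption?)
  show "R_Omega \<in> borel_measurable m_Omega" unfolding m_Omega_eq by (rule law(5); assumption?)
qed

lemma law_m_tor:
  assumes q: "q \<ge> 1"
  shows "B \<in> sets borel \<Longrightarrow> (LINT x:B|lborel. gap_density (m_tor q) R_Omega x) = measure (m_tor q) {x \<in> space (m_tor q). R_Omega x \<in> B}"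
    "measure (m_tor q) {x \<in> space (m_tor q). R_Omega x \<in> {t<..}}
      = measure lborel {p \<in> Delta. clear t (sl_pt 1 (fst p, snd p, 1 / real q, 0))} / measure lborel Delta"
    "R_Omega \<in> borel_measurable (m_tor q)"
proof -
  let ?h = "\<lambda>p::real\<times>real. pmat (fst p) (snd p)"
  let ?v = "\<lambda>p::real\<times>real. vector [fst p / real q, 0] :: real^2"
  have h: "?h \<in> borel_measurable borel" by (rule borel_measurable_pmat) measurable
  have v: "?v \<in> borel_measurable borel" by (rule borel_measurable_vec2) measurable
  have det: "det (?h p) = 1" if "p \<in> Delta" for p
    using that unfolding Delta_def by (intro det_pmat) auto
  have sh: "short_horizontal (affine_lattice (?h p) (?v p))" if "p \<in> Delta" for p
  proof (rule short_horizontal_at)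
    have "0 < fst p" "fst p \<le> 1" using that unfolding Delta_def by auto
    then show "0 < fst p / real q" "fst p / real q \<le> 1" using q by (auto simp: divide_le_eq)
  qed
  note law = law_R_Omega[OF sets_Delta_coords(1) emeasure_Delta_pos emeasure_coords_finite(1) h v det sh
      slopes_torsion_coords null_sets_strip_slopes_torsion]
  show "(LINT x:B|lborel. gap_density (m_tor q) R_Omega x) = measure (m_tor q) {x \<in> space (m_tor q). R_Omega x \<in> B}"
    if "B \<in> sets borel" unfolding m_tor_eq by (rule law(1); (assumption | rule that)?)
  show "measure (m_tor q) {x \<in> space (m_tor q). R_Omega x \<in> {t<..}}
      = measure lborel {p \<in> Delta. clear t (sl_pt 1 (fst p, snd p, 1 / real q, 0))} / measure lborel Delta" unfolding m_tor_eq by (rule law(2); assumption?)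
  show "R_Omega \<in> borel_measurable (m_tor q)" unfolding m_tor_eq by (rule law(5); assumption?)
qed

text \<open>The sets where the return time is less than \<open>e\<close> and where it exceeds \<open>e / 2\<close> cover the space.\<close>

lemma support_at_zero:
  fixes R :: "'a \<Rightarrow> real"
  assumes fin: "finite_measure \<mu>" and one: "measure \<mu> (space \<mu>) = 1" and R[measurable]: "R \<in> borel_measurable \<mu>"
    and pos: "\<And>x. x \<in> space \<mu> \<Longrightarrow> R x > 0" and e: "e > 0"
    and less: "measure \<mu> {x \<in> space \<mu>. R x \<in> {e / 2<..}} < 1"
  shows "measure \<mu> {x \<in> space \<mu>. R x \<in> {0<..<e}} > 0"
proof -
  interpret finite_measure \<mu> by fact
  have "measure \<mu> (space \<mu>) \<le> measure \<mu> ({x \<in> space \<mu>. R x \<in> {0<..<e}} \<union> {x \<in> space \<mu>. R x \<in> {e / 2<..}})"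
  proof (rule finite_measure_mono)
    show "space \<mu> \<subseteq> {x \<in> space \<mu>. R x \<in> {0<..<e}} \<union> {x \<in> space \<mu>. R x \<in> {e / 2<..}}"
    proof
      fix x assume x: "x \<in> space \<mu>"
      show "x \<in> {x \<in> space \<mu>. R x \<in> {0<..<e}} \<union> {x \<in> space \<mu>. R x \<in> {e / 2<..}}"
        using x pos[OF x] e by (cases "R x < e") auto
    qed
  qed measurable
  also have "\<dots> \<le> measure \<mu> {x \<in> space \<mu>. R x \<in> {0<..<e}} + measure \<mu> {x \<in> space \<mu>. R x \<in> {e / 2<..}}"
    by (rule measure_Un_le) measurable
  finally show ?thesis using one less by linarith
qed

lemma measure_Omega_clear_less:
  assumes "t > 0"
  shows "measure lborel {p \<in> Omega_coords. clear t (sa_pt 1 p)} < measure lborel Omega_coords"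
proof -
  have [measurable]: "Omega_coords \<in> sets borel" "{p. clear t (sa_pt 1 p)} \<in> sets borel"
    by (rule sets_Delta_coords, rule sets_clear) measurable
  have "{p \<in> Omega_coords. clear t (sa_pt 1 p)} = Omega_coords \<inter> {p. clear t (sa_pt 1 p)}" by auto
  also have "\<dots> \<in> sets borel" by measurable
  finally have S1: "{p \<in> Omega_coords. clear t (sa_pt 1 p)} \<in> sets borel" .
  have e: "{p \<in> Omega_coords. \<not> clear t (sa_pt 1 p)} = Omega_coords - {p \<in> Omega_coords. clear t (sa_pt 1 p)}" by auto
  have "measure lborel {p \<in> Omega_coords. \<not> clear t (sa_pt 1 p)}
      = measure lborel Omega_coords - measure lborel {p \<in> Omega_coords. clear t (sa_pt 1 p)}"
    unfolding e using S1 sets_Delta_coords(2) emeasure_Omega_coords_finite by (intro measure_Diff) (auto simp: top_unique)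
  moreover have "measure lborel {p \<in> Omega_coords. \<not> clear t (sa_pt 1 p)} > 0"
  proof -
    have "emeasure lborel {p \<in> Omega_coords. \<not> clear t (sa_pt 1 p)} \<le> emeasure lborel Omega_coords"
      using sets_Delta_coords(2) by (intro emeasure_mono) auto
    then have "emeasure lborel {p \<in> Omega_coords. \<not> clear t (sa_pt 1 p)} < \<infinity>" using emeasure_Omega_coords_finite by (rule le_less_trans)
    then show ?thesis using emeasure_early_return_pos[OF assms] by (simp add: measure_def enn2real_positive_iff)
  qed
  ultimately show ?thesis by simp
qed

subsection \<open>Doubled slit tori\<close>

text \<open>On a slit torus the lattice and the translates by \<open>v\<close> and \<open>- v\<close> all have to miss the triangle.\<close>

definition clear3 :: "real \<Rightarrow> (real \<Rightarrow> int \<Rightarrow> int \<Rightarrow> real \<times> real) \<Rightarrow> bool" where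
  "clear3 t P \<longleftrightarrow> clear t (P 0) \<and> clear t (P 1) \<and> clear t (P (-1))"

lemma sets_clear3: "{p. clear3 t (\<lambda>k. sa_pt k p)} \<in> sets borel" "{p. clear3 t (\<lambda>k. sl_pt k p)} \<in> sets borel"
proof -
  have [measurable]: "{p. clear t (sa_pt k p)} \<in> sets borel" "{p. clear t (sl_pt k p)} \<in> sets borel" for k
    by (rule sets_clear; measurable)+
  have "{p. clear3 t (\<lambda>k. sa_pt k p)} = {p. clear t (sa_pt 0 p)} \<inter> {p. clear t (sa_pt 1 p)} \<inter> {p. clear t (sa_pt (-1) p)}"
    "{p. clear3 t (\<lambda>k. sl_pt k p)} = {p. clear t (sl_pt 0 p)} \<inter> {p. clear t (sl_pt 1 p)} \<inter> {p. clear t (sl_pt (-1) p)}"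
    unfolding clear3_def by auto
  then show "{p. clear3 t (\<lambda>k. sa_pt k p)} \<in> sets borel" "{p. clear3 t (\<lambda>k. sl_pt k p)} \<in> sets borel" by simp_all
qed

lemma sets_clear3_coords:
  "{p \<in> Omega_coords. clear3 t (\<lambda>k. sa_pt k p)} \<in> sets borel" "{p \<in> sl_coords. clear3 t (\<lambda>k. sl_pt k p)} \<in> sets borel"
proof -
  have "{p \<in> Omega_coords. clear3 t (\<lambda>k. sa_pt k p)} = Omega_coords \<inter> {p. clear3 t (\<lambda>k. sa_pt k p)}"
    "{p \<in> sl_coords. clear3 t (\<lambda>k. sl_pt k p)} = sl_coords \<inter> {p. clear3 t (\<lambda>k. sl_pt k p)}" by auto
  then show "{p \<in> Omega_coords. clear3 t (\<lambda>k. sa_pt k p)} \<in> sets borel" "{p \<in> sl_coords. clear3 t (\<lambda>k. sl_pt k p)} \<in> sets borel"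
    using sets_clear3 sets_Delta_coords by simp_all
qed

lemma R_W_greater_iff:
  assumes "\<omega> \<in> W_space" "slopes (sing_diffs \<omega>) = strip_slopes (P 0) \<union> strip_slopes (P 1) \<union> strip_slopes (P (-1))"
  shows "t < R_W \<omega> \<longleftrightarrow> clear3 t P"
proof -
  have "t < R_W \<omega> \<longleftrightarrow> (\<forall>u\<in>slopes (sing_diffs \<omega>). t < u)"
  proof
    assume t: "t < R_W \<omega>"
    show "\<forall>u\<in>slopes (sing_diffs \<omega>). t < u" using less_le_trans[OF t R_W_Least(3)[OF assms(1)]] by (rule ballI)
  next
    assume "\<forall>u\<in>slopes (sing_diffs \<omega>). t < u"
    then show "t < R_W \<omega>" using R_W_Least(1)[OF assms(1)] by (rule bspec)
  qed
  then show ?thesis unfolding assms(2) clear3_def clear_iff by (simp add: ball_Un conj_assoc)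
qed

lemma corners: "finite corners" "corners \<noteq> {}"
proof -
  have "corners \<subseteq> (\<lambda>(x, y). vector [x, y]) ` ({0, 1} \<times> {0, 1})"
  proof
    fix e assume "e \<in> corners"
    then have "e $ 1 \<in> {0, 1}" "e $ 2 \<in> {0, 1}" unfolding corners_def by blast+
    then have "(e $ 1, e $ 2) \<in> {0, 1} \<times> {0, 1}" by blast
    then show "e \<in> (\<lambda>(x, y). vector [x, y]) ` ({0, 1} \<times> {0, 1})"
      by (rule image_eqI[rotated]) (simp add: vec2_eq_iff)
  qed
  then show "finite corners" by (rule finite_subset) simp
  have "0 \<in> corners" unfolding corners_def by simp
  then show "corners \<noteq> {}" by blast
qed

lemma R_W_sets: "B \<in> sets borel \<Longrightarrow> {x \<in> W_space. R_W x \<in> B} \<in> W_sets"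
  using measurable_sets[OF borel_measurable_R_W, of B] by (simp add: m_W_space_sets vimage_def Int_def conj_commute)

lemma W_space_in_W_sets: "W_space \<in> W_sets"
  using R_W_sets[of UNIV] by simp

lemma emeasure_sa_W_space:
  assumes e: "e \<in> corners"
  shows "emeasure lborel {p \<in> Omega_coords. sa_param e p \<in> W_space} = emeasure lborel Omega_coords"
proof (rule emeasure_eq_AE)
  show "AE p in lborel. (p \<in> {p \<in> Omega_coords. sa_param e p \<in> W_space}) = (p \<in> Omega_coords)"
    using AE_sa_param_E_space[of e] by eventually_elim (use sa_param_in_W_space[OF e] in blast)
qed (use sets_sa_param[OF W_space_in_W_sets] sets_Delta_coords in auto)

lemma emeasure_sl_W_space:
  assumes e: "e \<in> corners"
  shows "emeasure lborel {p \<in> sl_coords. sl_param e p \<in> W_space} = emeasure lborel sl_coords"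
proof (rule emeasure_eq_AE)
  show "AE p in lborel. (p \<in> {p \<in> sl_coords. sl_param e p \<in> W_space}) = (p \<in> sl_coords)"
    using AE_sl_param_E_space[of e] by eventually_elim (use sl_param_in_W_space[OF e] in blast)
qed (use sets_sl_param[OF W_space_in_W_sets] sets_Delta_coords in auto)

text \<open>Almost all coordinates describe a surface, so the condition on the surface may be dropped.\<close>

lemma emeasure_sa_R_W_greater:
  assumes e: "e \<in> corners"
  shows "emeasure lborel {p \<in> Omega_coords. sa_param e p \<in> {x \<in> W_space. R_W x \<in> {t<..}}}
    = emeasure lborel {p \<in> Omega_coords. clear3 t (\<lambda>k. sa_pt k p)}"
proof (rule emeasure_eq_AE)
  show "AE p in lborel. (p \<in> {p \<in> Omega_coords. sa_param e p \<in> {x \<in> W_space. R_W x \<in> {t<..}}})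
      = (p \<in> {p \<in> Omega_coords. clear3 t (\<lambda>k. sa_pt k p)})"
    using AE_sa_param_E_space[of e]
  proof eventually_elim
    case (elim p)
    show ?case
    proof (cases "p \<in> Omega_coords")
      case True
      then have W: "sa_param e p \<in> W_space" using elim sa_param_in_W_space[OF e] by blast
      have "t < R_W (sa_param e p) \<longleftrightarrow> clear3 t (\<lambda>k. sa_pt k p)"
        by (rule R_W_greater_iff[OF W]) (rule slopes_sa_param[OF e])
      then show ?thesis using True W by simp
    qed simp
  qed
qed (use sets_sa_param[OF R_W_sets[of "{t<..}"]] sets_clear3_coords in auto)

lemma emeasure_sl_R_W_greater:
  assumes e: "e \<in> corners"
  shows "emeasure lborel {p \<in> sl_coords. sl_param e p \<in> {x \<in> W_space. R_W x \<in> {t<..}}}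
    = emeasure lborel {p \<in> sl_coords. clear3 t (\<lambda>k. sl_pt k p)}"
proof (rule emeasure_eq_AE)
  show "AE p in lborel. (p \<in> {p \<in> sl_coords. sl_param e p \<in> {x \<in> W_space. R_W x \<in> {t<..}}})
      = (p \<in> {p \<in> sl_coords. clear3 t (\<lambda>k. sl_pt k p)})"
    using AE_sl_param_E_space[of e]
  proof eventually_elim
    case (elim p)
    show ?case
    proof (cases "p \<in> sl_coords")
      case True
      then have W: "sl_param e p \<in> W_space" using elim sl_param_in_W_space[OF e] by blast
      have "t < R_W (sl_param e p) \<longleftrightarrow> clear3 t (\<lambda>k. sl_pt k p)"
        by (rule R_W_greater_iff[OF W]) (rule slopes_sl_param[OF e])
      then show ?thesis using True W by simp
    qed simp
  qed
qed (use sets_sl_param[OF R_W_sets[of "{t<..}"]] sets_clear3_coords in auto)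

lemma mass_W_space:
  "sa_mass W_space + sl_mass W_space = of_nat (card corners) * (emeasure lborel Omega_coords + emeasure lborel sl_coords)"
  unfolding sa_mass_eq sl_mass_eq using emeasure_sa_W_space emeasure_sl_W_space by (simp add: distrib_left)

text \<open>All corners contribute the same volume; their number cancels in the normalised measure.\<close>

lemma mass_R_W_greater:
  "sa_mass {x \<in> W_space. R_W x \<in> {t<..}} + sl_mass {x \<in> W_space. R_W x \<in> {t<..}} = of_nat (card corners) *
    (emeasure lborel {p \<in> Omega_coords. clear3 t (\<lambda>k. sa_pt k p)} + emeasure lborel {p \<in> sl_coords. clear3 t (\<lambda>k. sl_pt k p)})"
  unfolding sa_mass_eq sl_mass_eq using emeasure_sa_R_W_greater emeasure_sl_R_W_greater
  by (simp add: distrib_left del: mem_Collect_eq greaterThan_iff)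

text \<open>The mass of \<open>m_W\<close> is a sum of Lebesgue measures of sets of coordinates over the corners, and in each
  of them the return time is one of the slopes.\<close>

lemma law_m_W:
  shows "B \<in> sets borel \<Longrightarrow> (LINT x:B|lborel. gap_density m_W R_W x) = measure m_W {x \<in> space m_W. R_W x \<in> B}"
    "measure m_W {x \<in> space m_W. R_W x \<in> {t<..}}
      = (measure lborel {p \<in> Omega_coords. clear3 t (\<lambda>k. sa_pt k p)} + measure lborel {p \<in> sl_coords. clear3 t (\<lambda>k. sl_pt k p)})
        / (measure lborel Omega_coords + measure lborel sl_coords)"
    "measure m_W (space m_W) = 1" "finite_measure m_W"
proof -
  let ?T = "sa_mass W_space + sl_mass W_space"
  have fin: "emeasure lborel {p \<in> Omega_coords. P p} = ennreal (measure lborel {p \<in> Omega_coords. P p})"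
    "emeasure lborel {p \<in> sl_coords. Q p} = ennreal (measure lborel {p \<in> sl_coords. Q p})" for P Q
  proof -
    have "emeasure lborel {p \<in> Omega_coords. P p} \<le> emeasure lborel Omega_coords"
      "emeasure lborel {p \<in> sl_coords. Q p} \<le> emeasure lborel sl_coords"
      using sets_Delta_coords by (auto intro!: emeasure_mono)
    then show "emeasure lborel {p \<in> Omega_coords. P p} = ennreal (measure lborel {p \<in> Omega_coords. P p})"
      "emeasure lborel {p \<in> sl_coords. Q p} = ennreal (measure lborel {p \<in> sl_coords. Q p})"
      using emeasure_Omega_coords_finite emeasure_coords_finite(2)
      by (auto intro!: emeasure_eq_ennreal_measure simp: top_unique)
  qed
  have C: "emeasure lborel Omega_coords = ennreal (measure lborel Omega_coords)" "emeasure lborel sl_coords = ennreal (measure lborel sl_coords)"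
    using fin(1)[of "\<lambda>_. True"] fin(2)[of "\<lambda>_. True"] by simp_all
  have Opos: "measure lborel Omega_coords > 0"
    using emeasure_Omega_coords_pos emeasure_Omega_coords_finite by (simp add: measure_def enn2real_positive_iff)
  define k where "k = real (card corners)"
  have k: "k > 0" "of_nat (card corners) = ennreal k"
    using corners unfolding k_def by (simp_all add: card_gt_0_iff ennreal_of_nat_eq_real_of_nat)
  have T: "?T = ennreal (k * (measure lborel Omega_coords + measure lborel sl_coords))"
    unfolding mass_W_space C k(2) using k(1) by (simp add: ennreal_mult[symmetric] ennreal_plus[symmetric] del: ennreal_plus)
  have Tpos: "k * (measure lborel Omega_coords + measure lborel sl_coords) > 0"
    using k(1) Opos measure_nonneg[of lborel sl_coords] by (intro mult_pos_pos) linarith+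
  have one: "emeasure m_W (space m_W) = 1"
  proof -
    have "emeasure m_W (space m_W) = ?T / ?T" unfolding m_W_space_sets by (rule emeasure_m_W[OF W_space_in_W_sets])
    also have "\<dots> = 1" unfolding T using Tpos by (intro ennreal_divide_self) auto
    finally show ?thesis .
  qed
  then show "measure m_W (space m_W) = 1" by (simp add: measure_def)
  show finite: "finite_measure m_W" by (rule finite_measureI) (simp add: one)
  show "(LINT x:B|lborel. gap_density m_W R_W x) = measure m_W {x \<in> space m_W. R_W x \<in> B}" if "B \<in> sets borel"
  proof (rule set_integral_gap_density[OF finite borel_measurable_R_W _ _ that])
    show "R_W x > 0" if "x \<in> space m_W" for x using R_W_Least(2)[of x] that by (simp add: m_W_space_sets)
    fix N :: "real set" assume N: "N \<in> null_sets lborel"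
    then have NB: "N \<in> sets borel" using null_setsD2 by fastforce
    let ?A = "{x \<in> W_space. R_W x \<in> N}"
    have A: "?A \<in> W_sets" by (rule R_W_sets[OF NB])
    have "{p \<in> Omega_coords. sa_param e p \<in> ?A} \<in> null_sets lborel" if e: "e \<in> corners" for e
    proof (rule null_sets_subset)
      show "(\<Union>k\<in>{0, 1, -1}. {p. \<exists>u\<in>strip_slopes (sa_pt k p). u \<in> N}) \<in> null_sets lborel"
        using null_sets_strip_slopes_sa[OF N] by (intro null_sets_UN') auto
      show "{p \<in> Omega_coords. sa_param e p \<in> ?A} \<in> sets lborel" using sets_sa_param[OF A] by simp
      show "{p \<in> Omega_coords. sa_param e p \<in> ?A} \<subseteq> (\<Union>k\<in>{0, 1, -1}. {p. \<exists>u\<in>strip_slopes (sa_pt k p). u \<in> N})"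
      proof
        fix p assume "p \<in> {p \<in> Omega_coords. sa_param e p \<in> ?A}"
        then have p: "sa_param e p \<in> W_space" "R_W (sa_param e p) \<in> N" by simp_all
        have "R_W (sa_param e p) \<in> strip_slopes (sa_pt 0 p) \<union> strip_slopes (sa_pt 1 p) \<union> strip_slopes (sa_pt (-1) p)"
          using R_W_Least(1)[OF p(1)] unfolding slopes_sa_param[OF e] .
        then show "p \<in> (\<Union>k\<in>{0, 1, -1}. {p. \<exists>u\<in>strip_slopes (sa_pt k p). u \<in> N})" using p(2) by auto
      qed
    qed
    moreover have "{p \<in> sl_coords. sl_param e p \<in> ?A} \<in> null_sets lborel" if e: "e \<in> corners" for e
    proof (rule null_sets_subset)
      show "(\<Union>k\<in>{0, 1, -1}. {p. \<exists>u\<in>strip_slopes (sl_pt k p). u \<in> N}) \<in> null_sets lborel"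
        using null_sets_strip_slopes_sl[OF N] by (intro null_sets_UN') auto
      show "{p \<in> sl_coords. sl_param e p \<in> ?A} \<in> sets lborel" using sets_sl_param[OF A] by simp
      show "{p \<in> sl_coords. sl_param e p \<in> ?A} \<subseteq> (\<Union>k\<in>{0, 1, -1}. {p. \<exists>u\<in>strip_slopes (sl_pt k p). u \<in> N})"
      proof
        fix p assume "p \<in> {p \<in> sl_coords. sl_param e p \<in> ?A}"
        then have p: "sl_param e p \<in> W_space" "R_W (sl_param e p) \<in> N" by simp_all
        have "R_W (sl_param e p) \<in> strip_slopes (sl_pt 0 p) \<union> strip_slopes (sl_pt 1 p) \<union> strip_slopes (sl_pt (-1) p)"
          using R_W_Least(1)[OF p(1)] unfolding slopes_sl_param[OF e] .
        then show "p \<in> (\<Union>k\<in>{0, 1, -1}. {p. \<exists>u\<in>strip_slopes (sl_pt k p). u \<in> N})" using p(2) by auto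
      qed
    qed
    ultimately have "sa_mass ?A = 0" "sl_mass ?A = 0" unfolding sa_mass_eq sl_mass_eq
      by (auto intro!: sum.neutral null_setsD1 simp del: mem_Collect_eq)
    then show "emeasure m_W {x \<in> space m_W. R_W x \<in> N} = 0"
      unfolding m_W_space_sets emeasure_m_W[OF A] by simp
  qed
  let ?x = "measure lborel {p \<in> Omega_coords. clear3 t (\<lambda>k. sa_pt k p)}" and ?y = "measure lborel {p \<in> sl_coords. clear3 t (\<lambda>k. sl_pt k p)}"
  have "emeasure m_W {x \<in> space m_W. R_W x \<in> {t<..}} = (ennreal k * (ennreal ?x + ennreal ?y)) / ?T"
    unfolding m_W_space_sets emeasure_m_W[OF R_W_sets[of "{t<..}", simplified]] emeasure_m_W[OF R_W_sets[of "{t<..}"]]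
    by (subst emeasure_m_W[OF R_W_sets]) (simp_all only: mass_R_W_greater fin k(2) borel_open open_greaterThan)
  also have "\<dots> = ennreal (k * (?x + ?y)) / ?T" using k(1) by (simp add: ennreal_mult ennreal_plus)
  also have "\<dots> = ennreal (k * (?x + ?y) / (k * (measure lborel Omega_coords + measure lborel sl_coords)))"
    unfolding T using k(1) Tpos by (intro divide_ennreal) auto
  also have "k * (?x + ?y) / (k * (measure lborel Omega_coords + measure lborel sl_coords))
      = (?x + ?y) / (measure lborel Omega_coords + measure lborel sl_coords)" using k(1) by simp
  finally show "measure m_W {x \<in> space m_W. R_W x \<in> {t<..}} = (?x + ?y) / (measure lborel Omega_coords + measure lborel sl_coords)"
    by (simp add: measure_def)
qed

text \<open>This reduces the asymptotics of the tails to volumes of regions of coordinates.\<close>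

lemma tail_eqs:
  "tail (gap_density m_Omega R_Omega) t
      = measure lborel {p \<in> Omega_coords. clear t (sa_pt 1 p)} / measure lborel Omega_coords"
  "q \<ge> 1 \<Longrightarrow> tail (gap_density (m_tor q) R_Omega) t
      = measure lborel {p \<in> Delta. clear t (sl_pt 1 (fst p, snd p, 1 / real q, 0))} / measure lborel Delta"
  "tail (gap_density m_W R_W) t
      = (measure lborel {p \<in> Omega_coords. clear3 t (\<lambda>k. sa_pt k p)} + measure lborel {p \<in> sl_coords. clear3 t (\<lambda>k. sl_pt k p)})
        / (measure lborel Omega_coords + measure lborel sl_coords)"
  unfolding tail_def using law_m_Omega(1)[of "{t<..}"] law_m_Omega(2)[of t] law_m_tor(1)[of q "{t<..}"] law_m_tor(2)[of q t]
    law_m_W(1)[of "{t<..}"] law_m_W(2)[of t] by auto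

section \<open>Volume bounds for affine lattices\<close>

text \<open>The last term below \<open>1\<close> of an arithmetic progression.\<close>

lemma largest_step:
  fixes a x :: real
  assumes "a > 0"
  obtains m :: int where "1 - a < x + a * m" "x + a * m \<le> 1"
proof
  let ?m = "\<lfloor>(1 - x) / a\<rfloor>"
  define f where "f = real_of_int ?m"
  have "f \<le> (1 - x) / a" "(1 - x) / a < f + 1" unfolding f_def by linarith+
  then have "f * a \<le> 1 - x" "1 - x < (f + 1) * a"
    using assms by (simp_all add: pos_le_divide_eq pos_divide_less_eq)
  then show "1 - a < x + a * ?m" "x + a * ?m \<le> 1" unfolding f_def[symmetric] by (simp_all add: algebra_simps)
qed

lemma null_sets_hyperplane4:
  assumes "c0 \<noteq> 0 \<or> c1 \<noteq> 0 \<or> c2 \<noteq> 0 \<or> c3 \<noteq> (0::real)"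
  shows "{p. c0 * fst p + c1 * fst (snd p) + c2 * fst (snd (snd p)) + c3 * snd (snd (snd p)) = d} \<in> null_sets lborel"
proof (rule null_sets_lborel_if_negligible)
  have e: "{p. c0 * fst p + c1 * fst (snd p) + c2 * fst (snd (snd p)) + c3 * snd (snd (snd p)) = d} = {p. (c0, c1, c2, c3) \<bullet> p = d}"
    by (auto simp: inner_prod_def)
  show "{p. c0 * fst p + c1 * fst (snd p) + c2 * fst (snd (snd p)) + c3 * snd (snd (snd p)) = d} \<in> sets borel"
    unfolding e by (intro borel_closed closed_hyperplane)
  show "negligible {p. c0 * fst p + c1 * fst (snd p) + c2 * fst (snd (snd p)) + c3 * snd (snd (snd p)) = d}"
    unfolding e using assms by (intro negligible_hyperplane) (auto simp: zero_prod_def)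
qed

lemma emeasure_box4:
  assumes "a1 \<le> a2" "b1 \<le> b2" "c1 \<le> c2" "d1 \<le> d2"
  shows "emeasure lborel ({a1<..<a2} \<times> {b1<..<b2} \<times> {c1<..<c2} \<times> {d1<..<d2::real})
    = ennreal ((a2 - a1) * (b2 - b1) * (c2 - c1) * (d2 - d1))"
  using assms by (simp add: emeasure_lborel_Times borel_open open_Times ennreal_mult'' mult.assoc)

lemma emeasure_le_imp_measure_le:
  "emeasure M A \<le> ennreal c \<Longrightarrow> c \<ge> 0 \<Longrightarrow> measure M A \<le> c"
  unfolding measure_def using enn2real_leI by blast

lemma emeasure_cover5:
  assumes "A \<subseteq> B1 \<union> B2 \<union> B3 \<union> B4 \<union> B5" "B1 \<in> sets M" "B2 \<in> sets M" "B3 \<in> sets M" "B4 \<in> sets M" "B5 \<in> sets M"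
  shows "emeasure M A \<le> emeasure M B1 + emeasure M B2 + emeasure M B3 + emeasure M B4 + emeasure M B5"
proof -
  have "emeasure M A \<le> emeasure M (B1 \<union> B2 \<union> B3 \<union> B4 \<union> B5)" using assms by (intro emeasure_mono) auto
  also have "\<dots> \<le> emeasure M B1 + emeasure M B2 + emeasure M B3 + emeasure M B4 + emeasure M B5"
    using assms(2-) by (intro order_trans[OF emeasure_subadditive add_mono[OF order_trans[OF emeasure_subadditive add_mono[OF order_trans[OF emeasure_subadditive add_mono[OF emeasure_subadditive order_refl]] order_refl]] order_refl]]) auto
  finally show ?thesis .
qed

text \<open>In this box the rows of the lattice, at vertical distance \<open>1 / a > 2 t\<close>, are tilted with slope
  \<open>- s\<close>, which changes the height by less than \<open>t\<close> across the strip. So no row other than that of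
  \<open>(\<alpha>, 0)\<close> enters the triangle, and this row goes up only to the left, where it leaves the strip
  at once as \<open>\<alpha> < a\<close>.\<close>

lemma clear_sa_lower:
  assumes t: "t \<ge> 1" and p: "p \<in> {1 / (4 * t)<..<1 / (2 * t)} \<times> {1 - 1 / (4 * t)<..<1} \<times> {0<..<t} \<times> {0<..<1 / (4 * t)}"
  shows "p \<in> Omega_coords" "clear t (sa_pt 1 p)"
proof -
  obtain a b s \<alpha> where pe: "p = (a, b, s, \<alpha>)" by (cases p)
  have c: "1 / (4 * t) < a" "a < 1 / (2 * t)" "1 - 1 / (4 * t) < b" "b < 1" "0 < s" "s < t" "0 < \<alpha>" "\<alpha> < 1 / (4 * t)"
    using p unfolding pe by auto
  have "1 / (4 * t) \<le> 1 / 4" "1 / (2 * t) \<le> 1 / 2" "0 < 1 / (4 * t)" using t by (simp_all add: field_simps)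
  then have a: "0 < a" "a < 1" "1 - a < b" "0 < b" "\<alpha> < a" "\<alpha> \<le> 1" using c by linarith+
  have at: "2 * t * a < 1" using c(2) t by (simp add: field_simps)
  have at0: "0 < 1 / a - 2 * t" using at a(1) by (simp add: field_simps)
  have "s * (a * b) < 1"
  proof -
    have "s * (a * b) \<le> t * (a * 1)" using c a by (intro mult_mono) auto
    also have "\<dots> < 1" using at mult_pos_pos[of t a] a t by (simp add: mult.assoc)
    finally show ?thesis .
  qed
  then have "s < 1 / (a * b)" using a by (simp add: less_divide_eq)
  then show "p \<in> Omega_coords" unfolding pe Omega_coords_def Delta_def using a c by auto
  show "clear t (sa_pt 1 p)" unfolding clear_def
  proof (intro allI impI)
    fix m n :: int
    define j where "j = a * m + b * n"
    have pt: "sa_pt 1 p m n = (\<alpha> + j, n / a - s * j)" unfolding pe sa_pt_def j_def by simp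
    assume "in_strip (sa_pt 1 p m n)"
    then have st: "0 < \<alpha> + j" "\<alpha> + j \<le> 1" "0 < n / a - s * j" unfolding pt in_strip_def by simp_all
    have j: "j > - 1" "j < 1" using st a c by linarith+
    have sj: "s * j \<le> t" "s * j \<ge> - t"
    proof -
      have "\<bar>s * j\<bar> \<le> t * 1" unfolding abs_mult using c j by (intro mult_mono) auto
      then show "s * j \<le> t" "s * j \<ge> - t" by linarith+
    qed
    consider "n \<ge> 1" | "n = 0" | "n \<le> - 1" by linarith
    then show "t * fst (sa_pt 1 p m n) < snd (sa_pt 1 p m n)"
    proof cases
      case 1
      then have "1 / a \<le> n / a" using a by (intro divide_right_mono) auto
      then have "t < n / a - s * j" using sj at0 by linarith
      moreover have "t * (\<alpha> + j) \<le> t * 1" using st t by (intro mult_left_mono) auto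
      ultimately show ?thesis unfolding pt by simp
    next
      case 2
      then have "s * j < 0" using st by simp
      then have "j < 0" using c by (simp add: mult_less_0_iff)
      then have "a * m < 0" using 2 unfolding j_def by simp
      then have "m \<le> - 1" using a by (simp add: mult_less_0_iff)
      then have "a * m \<le> a * (- 1)" using a by (intro mult_left_mono) auto
      then have "\<alpha> + j < 0" using 2 a unfolding j_def by simp
      then show ?thesis using st by simp
    next
      case 3
      then have "n / a \<le> - 1 / a" using a by (intro divide_right_mono) auto
      then have "n / a \<le> - (1 / a)" by simp
      then show ?thesis using st sj at0 t by linarith
    qed
  qed
qed

lemma measure_sa_clear_lower:
  assumes t: "t \<ge> 1"
  shows "1 / 64 / t\<^sup>2 \<le> measure lborel {p \<in> Omega_coords. clear t (sa_pt 1 p)}"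
proof -
  let ?B = "{1 / (4 * t)<..<1 / (2 * t)} \<times> {1 - 1 / (4 * t)<..<1} \<times> {0<..<t} \<times> {0<..<1 / (4 * t)}"
  let ?S = "{p \<in> Omega_coords. clear t (sa_pt 1 p)}"
  have [measurable]: "Omega_coords \<in> sets borel" "{p. clear t (sa_pt 1 p)} \<in> sets borel"
    by (rule sets_Delta_coords, rule sets_clear) measurable
  have "?S = Omega_coords \<inter> {p. clear t (sa_pt 1 p)}" by auto
  also have "\<dots> \<in> sets borel" by measurable
  finally have S: "?S \<in> sets borel" .
  have "emeasure lborel ?S \<le> emeasure lborel Omega_coords" by (intro emeasure_mono) auto
  then have fin: "emeasure lborel ?S < \<infinity>" using emeasure_Omega_coords_finite by (rule le_less_trans)
  have "ennreal (1 / 64 / t\<^sup>2) = emeasure lborel ?B"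
    using t by (subst emeasure_box4) (simp_all add: field_simps power2_eq_square)
  also have "\<dots> \<le> emeasure lborel ?S" using S clear_sa_lower[OF t] by (intro emeasure_mono) auto
  also have "\<dots> = ennreal (measure lborel ?S)" using fin by (simp add: emeasure_eq_ennreal_measure)
  finally show ?thesis by (simp add: ennreal_le_iff)
qed

text \<open>If \<open>a\<close> or \<open>b\<close> is at most \<open>1 / 2\<close>, steps of this length in a row or column of the affine lattice
  lead to a point of the strip with \<open>x \<ge> 1 / 2\<close> and height of order \<open>1 / (a b)\<close>; missing the
  triangle bounds \<open>a\<close> or \<open>b\<close> by a multiple of \<open>1 / t\<close>. If both exceed \<open>1 / 2\<close>, the point
  with first coordinate \<open>\<alpha> - a + b\<close> (if \<open>\<alpha> \<le> a\<close>) or \<open>\<alpha> - a\<close> (if \<open>\<alpha> > a\<close>) has height at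
  most \<open>4\<close>, so this coordinate is at most \<open>4 / t\<close>. The exceptional value \<open>s = 0\<close> has measure \<open>0\<close>.\<close>

lemma clear_sa_upper:
  assumes p: "(a, b, s, \<alpha>) \<in> Omega_coords" and t: "t \<ge> 4" and clear: "clear t (sa_pt 1 (a, b, s, \<alpha>))"
  shows "a \<le> 1 / 2 \<and> a \<le> 10 / t \<or> b \<le> 1 / 2 \<and> b \<le> 10 / t \<or> s = 0 \<or>
    (a > 1 / 2 \<and> b > 1 / 2 \<and> (\<alpha> \<in> {a - b..a - b + 4 / t} \<or> \<alpha> \<in> {a..a + 4 / t}))"
proof -
  have c: "0 < a" "a \<le> 1" "1 - a < b" "b \<le> 1" "0 \<le> s" "s < 1 / (a * b)" "0 < \<alpha>" "\<alpha> \<le> 1" "0 < b"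
    using p unfolding Omega_coords_def Delta_def by auto
  have sab: "s * (a * b) < 1" using c by (simp add: less_divide_eq)
  have y1: "0 < 1 / a - s * b" "1 / a - s * b \<le> 1 / a"
  proof -
    have "1 / a - s * b = (1 - s * (a * b)) / a" using c by (simp add: field_simps)
    then show "0 < 1 / a - s * b" using sab c by simp
    show "1 / a - s * b \<le> 1 / a" using c by simp
  qed
  have y2: "0 \<le> s * a" "s * a \<le> 1 / b" using c sab by (simp_all add: field_simps)
  have cl: "t * (\<alpha> + (a * m + b * n)) < n / a - s * (a * m + b * n)"
    if "0 < \<alpha> + (a * m + b * n)" "\<alpha> + (a * m + b * n) \<le> 1" "0 < n / a - s * (a * m + b * n)" for m n :: int
    using clear that unfolding clear_def in_strip_def sa_pt_def by simp
  have up: "\<alpha> + b > 1 \<or> a < 10 / t \<and> b > 1 / 2" if "b > 1 / 2"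
  proof (rule disjCI)
    assume "\<not> (a < 10 / t \<and> b > 1 / 2)"
    then have "10 / t \<le> a" using that by simp
    then have ta: "10 \<le> a * t" using t by (simp add: divide_le_eq)
    show "\<alpha> + b > 1"
    proof (rule ccontr)
      assume "\<not> \<alpha> + b > 1"
      then have "t * (\<alpha> + b) < 1 / a - s * b" using cl[of 0 1] c y1 by simp
      moreover have "t * (1 / 2) \<le> t * (\<alpha> + b)" using that c t by (intro mult_left_mono) auto
      ultimately have "t / 2 < 1 / a" using y1 by linarith
      then show False using ta c by (simp add: field_simps)
    qed
  qed
  consider (A) "a \<le> 1 / 2" | (B) "b \<le> 1 / 2" | (C) "a > 1 / 2" "b > 1 / 2" by linarith
  then show ?thesis
  proof cases
    case A
    then have b: "b > 1 / 2" using c by linarith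
    obtain m :: int where m: "1 - a < \<alpha> + b + a * m" "\<alpha> + b + a * m \<le> 1" using largest_step[OF c(1)] by blast
    show ?thesis
    proof (cases "\<alpha> + b > 1")
      case False
      then show ?thesis using up[OF b] A by auto
    next
      case True
      then have "a * m < 0" using m by linarith
      have am: "- (a * m) \<le> 3 / 2" using m A c by linarith
      have y: "1 / a - s * (a * m + b) = (1 / a - s * b) + s * (- (a * m))" by (simp add: algebra_simps)
      have sam: "0 \<le> s * (- (a * m))" "s * (- (a * m)) \<le> 3 / a"
      proof -
        show "0 \<le> s * (- (a * m))" using \<open>a * m < 0\<close> c by (intro mult_nonneg_nonneg) auto
        have "s * (- (a * m)) \<le> 1 / (a * b) * (3 / 2)" using \<open>a * m < 0\<close> am c by (intro mult_mono) auto
        also have "\<dots> \<le> 3 / a" using b c by (simp add: field_simps)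
        finally show "s * (- (a * m)) \<le> 3 / a" .
      qed
      have "t * (\<alpha> + (a * m + b * 1)) < 1 / a - s * (a * m + b * 1)"
        using cl[of m 1] m A y1 sam unfolding y[symmetric] by (simp add: algebra_simps)
      moreover have "t * (1 / 2) \<le> t * (\<alpha> + (a * m + b * 1))" using m A t by (intro mult_left_mono) auto
      ultimately have "t / 2 < 1 / a + 3 / a" using y y1 sam by simp
      then have "a * t < 8" using c by (simp add: field_simps)
      then have "a \<le> 10 / t" using t by (simp add: le_divide_eq)
      then show ?thesis using A by simp
    qed
  next
    case B
    then have a: "a > 1 / 2" using c by linarith
    obtain n :: int where n: "1 - b < \<alpha> - a + b * n" "\<alpha> - a + b * n \<le> 1" using largest_step[OF c(9)] by blast
    have "b * n > 0" using n c a B by linarith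
    then have n1: "n \<ge> 1" using c by (simp add: zero_less_mult_iff)
    have bn: "b * n \<le> 2" using n c by linarith
    have y: "n / a - s * (a * (- 1) + b * n) = n * (1 / a - s * b) + s * a" by (simp add: algebra_simps)
    have ny: "0 < n * (1 / a - s * b)" "n * (1 / a - s * b) \<le> 4 / b"
    proof -
      show "0 < n * (1 / a - s * b)" using n1 y1 by simp
      have "n * (1 / a - s * b) \<le> n * (1 / a)" using n1 y1 by (intro mult_left_mono) auto
      also have "\<dots> \<le> 2 / b * 2"
      proof (rule mult_mono)
        show "real_of_int n \<le> 2 / b" using bn c by (simp add: le_divide_eq mult.commute)
        show "1 / a \<le> 2" using a by (simp add: field_simps)
      qed (use c a in auto)
      finally show "n * (1 / a - s * b) \<le> 4 / b" by simp
    qed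
    have "t * (\<alpha> + (a * of_int (- 1) + b * n)) < n / a - s * (a * of_int (- 1) + b * n)"
      using n B y ny y2 by (intro cl) (simp_all add: algebra_simps)
    moreover have "t * (1 / 2) \<le> t * (\<alpha> + (a * of_int (- 1) + b * n))" using n B t by (intro mult_left_mono) auto
    ultimately have "t / 2 < 4 / b + 1 / b" using y ny y2 by simp
    then have "b * t < 10" using c by (simp add: field_simps)
    then have "b \<le> 10 / t" using t by (simp add: le_divide_eq)
    then show ?thesis using B by simp
  next
    case C
    have y1': "1 / a - s * b \<le> 2" "s * a \<le> 2"
    proof -
      have "1 / a \<le> 2" "1 / b \<le> 2" using C by (simp_all add: field_simps)
      then show "1 / a - s * b \<le> 2" "s * a \<le> 2" using y1 y2 by linarith+
    qed
    have ab: "\<alpha> + b > 1"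
    proof (rule ccontr)
      assume "\<not> \<alpha> + b > 1"
      then have "t * (\<alpha> + b) < 1 / a - s * b" using cl[of 0 1] c y1 by simp
      moreover have "4 * (1 / 2) \<le> t * (\<alpha> + b)" using t C c by (intro mult_mono) auto
      ultimately show False using y1' by linarith
    qed
    show ?thesis
    proof (cases "\<alpha> \<le> a")
      case True
      have y: "1 / a - s * (a * (- 1) + b * 1) = (1 / a - s * b) + s * a" by (simp add: algebra_simps)
      have y0: "0 < 1 / a - s * (b - a)" using y y1 y2 by (simp add: algebra_simps)
      have "t * (\<alpha> + (a * of_int (- 1) + b * of_int 1)) < of_int 1 / a - s * (a * of_int (- 1) + b * of_int 1)"
        using True ab c y0 by (intro cl) auto
      then have "t * (\<alpha> - a + b) < 4" using y y1' by (simp add: algebra_simps)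
      then have "\<alpha> - a + b \<le> 4 / t" using t by (simp add: le_divide_eq mult.commute)
      then show ?thesis using C ab c by auto
    next
      case False
      show ?thesis
      proof (cases "s = 0")
        case False
        then have "s * a > 0" using c by simp
        then have "t * (\<alpha> + (a * of_int (- 1) + b * of_int 0)) < of_int 0 / a - s * (a * of_int (- 1) + b * of_int 0)"
          using \<open>\<not> \<alpha> \<le> a\<close> c by (intro cl) auto
        then have "t * (\<alpha> - a) < 4" using y1' by (simp add: algebra_simps)
        then have "\<alpha> - a \<le> 4 / t" using t by (simp add: le_divide_eq mult.commute)
        then show ?thesis using C \<open>\<not> \<alpha> \<le> a\<close> by auto
      qed simp
    qed
  qed
qed

text \<open>For each \<open>(a, b, s)\<close> the admitted \<open>\<alpha>\<close> form an interval of length \<open>e\<close>.\<close>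

lemma emeasure_band_le:
  fixes g :: "real \<Rightarrow> real \<Rightarrow> real"
  assumes g: "(\<lambda>p. g (fst p) (snd p)) \<in> borel_measurable borel" and e: "e \<ge> 0"
  defines "S \<equiv> {p :: real \<times> real \<times> real \<times> real. fst p \<in> {0..1} \<and> fst (snd p) \<in> {0..1} \<and> fst (snd (snd p)) \<in> {0..4} \<and>
      snd (snd (snd p)) \<in> {g (fst p) (fst (snd p))..g (fst p) (fst (snd p)) + e}}"
  shows "emeasure lborel S \<le> ennreal (4 * e)" "S \<in> sets borel"
proof -
  define G where "G = (\<lambda>p::real\<times>real\<times>real\<times>real. g (fst p) (fst (snd p)))"
  have [measurable]: "G \<in> borel_measurable borel" unfolding G_def
    using measurable_compose[of "\<lambda>p::real\<times>real\<times>real\<times>real. (fst p, fst (snd p))" borel borel "\<lambda>p. g (fst p) (snd p)"] g by simp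
  have "S = {p. 0 \<le> fst p \<and> fst p \<le> 1 \<and> 0 \<le> fst (snd p) \<and> fst (snd p) \<le> 1 \<and> 0 \<le> fst (snd (snd p)) \<and>
      fst (snd (snd p)) \<le> 4 \<and> G p \<le> snd (snd (snd p)) \<and> snd (snd (snd p)) \<le> G p + e}"
    unfolding S_def G_def by auto
  also have "\<dots> \<in> sets borel" by measurable
  finally show S: "S \<in> sets borel" .
  let ?i = "\<lambda>(a::real) (b::real) s. indicator {0..1} a * (indicator {0..1} b * (indicator {0..4::real} s * ennreal e))"
  have "emeasure lborel S = (\<integral>\<^sup>+p. indicator S p \<partial>lborel)" using S by simp
  also have "\<dots> = (\<integral>\<^sup>+a. \<integral>\<^sup>+b. \<integral>\<^sup>+r. indicator S (a, b, r) \<partial>lborel \<partial>lborel \<partial>lborel)"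
    by (rule nn_integral_lborel_triple) (rule borel_measurable_indicator[OF S])
  also have "\<dots> = (\<integral>\<^sup>+a. \<integral>\<^sup>+b. \<integral>\<^sup>+s. ?i a b s \<partial>lborel \<partial>lborel \<partial>lborel)"
  proof (rule nn_integral_cong, rule nn_integral_cong)
    fix a b :: real
    have S2: "{q. (b, q) \<in> {q. (a, q) \<in> S}} \<in> sets borel" by (rule slice_sets_borel(1)[OF slice_sets_borel(1)[OF S]])
    have "(\<integral>\<^sup>+r. indicator S (a, b, r) \<partial>lborel) = (\<integral>\<^sup>+r. indicator {q. (b, q) \<in> {q. (a, q) \<in> S}} r \<partial>lborel)"
      by (intro nn_integral_cong) (simp add: indicator_def)
    also have "\<dots> = (\<integral>\<^sup>+s. \<integral>\<^sup>+\<alpha>. indicator {q. (b, q) \<in> {q. (a, q) \<in> S}} (s, \<alpha>) \<partial>lborel \<partial>lborel)"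
      by (rule nn_integral_lborel_pair) (rule borel_measurable_indicator[OF S2])
    also have "\<dots> = (\<integral>\<^sup>+s. ?i a b s \<partial>lborel)"
    proof (rule nn_integral_cong)
      fix s :: real
      have "(\<integral>\<^sup>+\<alpha>. indicator {q. (b, q) \<in> {q. (a, q) \<in> S}} (s, \<alpha>) \<partial>lborel)
          = (\<integral>\<^sup>+\<alpha>. (indicator {0..1} a * (indicator {0..1} b * indicator {0..4} s)) * indicator {g a b..g a b + e} \<alpha> \<partial>lborel)"
        unfolding S_def by (intro nn_integral_cong) (auto simp: indicator_def)
      also have "\<dots> = (indicator {0..1} a * (indicator {0..1} b * indicator {0..4} s)) * ennreal e"
        using e by (subst nn_integral_cmult) auto
      finally show "(\<integral>\<^sup>+\<alpha>. indicator {q. (b, q) \<in> {q. (a, q) \<in> S}} (s, \<alpha>) \<partial>lborel) = ?i a b s" by (simp add: mult.assoc)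
    qed
    finally show "(\<integral>\<^sup>+r. indicator S (a, b, r) \<partial>lborel) = (\<integral>\<^sup>+s. ?i a b s \<partial>lborel)" .
  qed
  also have "\<dots> = ennreal e * 4"
    by (simp add: nn_integral_cmult nn_integral_multc mult_ac)
  also have "\<dots> = ennreal (4 * e)" using e ennreal_mult[OF e, of 4] by (simp add: mult.commute)
  finally show "emeasure lborel S \<le> ennreal (4 * e)" by simp
qed

lemma measure_sa_clear_upper:
  assumes t: "t \<ge> 4"
  shows "measure lborel {p \<in> Omega_coords. clear t (sa_pt 1 p)} \<le> 72 / t"
proof -
  let ?S = "{p \<in> Omega_coords. clear t (sa_pt 1 p)}"
  let ?E1 = "{p \<in> Omega_coords. fst p \<le> 1 / 2 \<and> fst p \<le> 10 / t}" and ?E2 = "{p \<in> Omega_coords. fst (snd p) \<le> 1 / 2 \<and> fst (snd p) \<le> 10 / t}"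
  let ?B = "\<lambda>g. {p. fst p \<in> {0..1} \<and> fst (snd p) \<in> {0..1} \<and> fst (snd (snd p)) \<in> {0..4} \<and>
      snd (snd (snd p)) \<in> {g (fst p) (fst (snd p))..g (fst p) (fst (snd p)) + 4 / t :: real}} :: (real \<times> real \<times> real \<times> real) set"
  let ?N = "{p::real\<times>real\<times>real\<times>real. fst (snd (snd p)) = 0}"
  have [measurable]: "Omega_coords \<in> sets borel" by (rule sets_Delta_coords)
  have S: "?E1 \<in> sets borel" "?E2 \<in> sets borel" "?N \<in> sets borel" by measurable
  have g: "(\<lambda>p::real\<times>real. fst p - snd p) \<in> borel_measurable borel" "(\<lambda>p::real\<times>real. fst p) \<in> borel_measurable borel" by measurable
  have e: "0 \<le> 4 / t" using t by simp
  note B1 = emeasure_band_le[of "\<lambda>a b. a - b", OF g(1) e] and B2 = emeasure_band_le[of "\<lambda>a b. a", OF g(2) e]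
  have N0: "emeasure lborel ?N = 0"
    using null_setsD1[OF null_sets_hyperplane4[of 0 0 1 0 0]] by simp
  \<comment> \<open>two cusps, two bands, and the null set \<open>s = 0\<close>\<close>
  have cover: "?S \<subseteq> ?E1 \<union> ?E2 \<union> ?B (\<lambda>a b. a - b) \<union> ?B (\<lambda>a b. a) \<union> ?N"
  proof
    fix p assume p: "p \<in> ?S"
    obtain a b s \<alpha> where pe: "p = (a, b, s, \<alpha>)" by (cases p)
    have "a \<le> 1 / 2 \<and> a \<le> 10 / t \<or> b \<le> 1 / 2 \<and> b \<le> 10 / t \<or> s = 0 \<or>
    (a > 1 / 2 \<and> b > 1 / 2 \<and> (\<alpha> \<in> {a - b..a - b + 4 / t} \<or> \<alpha> \<in> {a..a + 4 / t}))"
      using p t unfolding pe by (intro clear_sa_upper) auto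
    moreover have "a \<in> {0..1} \<and> b \<in> {0..1} \<and> s \<in> {0..4}" if "a > 1 / 2" "b > 1 / 2"
      using Omega_coords_bulk[of a b s \<alpha>] that p unfolding pe by auto
    moreover have "p \<in> Omega_coords" using p by simp
    ultimately show "p \<in> ?E1 \<union> ?E2 \<union> ?B (\<lambda>a b. a - b) \<union> ?B (\<lambda>a b. a) \<union> ?N"
      unfolding Un_iff mem_Collect_eq pe fst_conv snd_conv by argo
  qed
  define E1 E2 F1 F2 N where "E1 = ?E1" and "E2 = ?E2" and "F1 = ?B (\<lambda>a b. a - b)" and "F2 = ?B (\<lambda>a b. a)" and "N = ?N"
  note defs = E1_def E2_def F1_def F2_def N_def
  have "emeasure lborel ?S \<le> emeasure lborel E1 + emeasure lborel E2 + emeasure lborel F1 + emeasure lborel F2 + emeasure lborel N"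
  proof (rule emeasure_cover5)
    show "?S \<subseteq> E1 \<union> E2 \<union> F1 \<union> F2 \<union> N" unfolding defs by (rule cover)
    show "E1 \<in> sets lborel" "E2 \<in> sets lborel" "N \<in> sets lborel" unfolding sets_lborel defs by (fact S)+
    show "F1 \<in> sets lborel" unfolding sets_lborel F1_def by (rule B1(2))
    show "F2 \<in> sets lborel" unfolding sets_lborel F2_def by (rule B2(2))
  qed
  also have "\<dots> \<le> ennreal (2 * (10 / t)) + ennreal (2 * (10 / t)) + ennreal (4 * (4 / t)) + ennreal (4 * (4 / t)) + 0"
  proof (intro add_mono)
    show "emeasure lborel E1 \<le> ennreal (2 * (10 / t))" unfolding E1_def using S(1) t by (intro emeasure_Omega_coords_cusp_le) auto
    show "emeasure lborel E2 \<le> ennreal (2 * (10 / t))" unfolding E2_def using S(2) t by (intro emeasure_Omega_coords_cusp_le') auto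
    show "emeasure lborel F1 \<le> ennreal (4 * (4 / t))" unfolding F1_def by (rule B1(1))
    show "emeasure lborel F2 \<le> ennreal (4 * (4 / t))" unfolding F2_def by (rule B2(1))
    show "emeasure lborel N \<le> 0" unfolding N_def using N0 by simp
  qed
  also have "\<dots> = ennreal (72 / t)" using t by (simp add: ennreal_plus[symmetric] del: ennreal_plus)
  finally show ?thesis using t by (intro emeasure_le_imp_measure_le) auto
qed

section \<open>Volume bounds for torsion measures\<close>

lemma clear_tor_iff:
  fixes a b :: real
  shows "clear t (sl_pt 1 (a, b, 1 / real q, 0)) \<longleftrightarrow> (\<forall>(m::int) (n::int). 0 < a * (of_int m + 1 / q) + b * n
      \<and> a * (of_int m + 1 / q) + b * n \<le> 1 \<and> 0 < n / a
      \<longrightarrow> t * (a * (of_int m + 1 / q) + b * n) < n / a)"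
  unfolding clear_def in_strip_def sl_pt_def by simp

text \<open>The points in the row of \<open>(a / q, 0)\<close> have height \<open>0\<close> and all higher rows lie above \<open>1 / a > t\<close>.\<close>

lemma clear_tor_lower:
  assumes t: "t \<ge> 1" and p: "p \<in> {1 / (2 * t)<..<1 / t} \<times> {1 - 1 / (2 * t)<..<1}"
  shows "p \<in> Delta" "clear t (sl_pt 1 (fst p, snd p, 1 / real q, 0))"
proof -
  obtain a b where pe: "p = (a, b)" by (cases p)
  have c: "1 / (2 * t) < a" "a < 1 / t" "1 - 1 / (2 * t) < b" "b < 1" using p unfolding pe by auto
  have "0 < 1 / (2 * t)" "1 / t \<le> 1" using t by simp_all
  then have a: "0 < a" "a \<le> 1" "1 - a < b" using c by linarith+
  then show "p \<in> Delta" using c unfolding pe Delta_def by simp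
  have ta: "t < 1 / a" using c(2) a(1) t by (simp add: field_simps)
  show "clear t (sl_pt 1 (fst p, snd p, 1 / real q, 0))" unfolding pe fst_conv snd_conv clear_tor_iff
  proof (intro allI impI, elim conjE)
    fix m n :: int
    let ?x = "a * (m + 1 / q) + b * n"
    assume x: "?x \<le> 1" and n: "0 < n / a"
    have "n \<ge> 1" using n a by (simp add: zero_less_divide_iff)
    then have "1 / a \<le> n / a" using a by (intro divide_right_mono) auto
    moreover have "t * ?x \<le> t * 1" using x t by (intro mult_left_mono) auto
    ultimately show "t * ?x < n / a" using ta by linarith
  qed
qed

text \<open>The last point \<open>(x, 1 / a)\<close> of the first row inside the strip must satisfy \<open>t x < 1 / a\<close>. If
  \<open>a \<le> 1 / 2\<close> then \<open>x > 1 / 2\<close> and \<open>a\<close> is small. Otherwise \<open>1 - a < x < 2 / t\<close>, and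
  \<open>b = x + k a - a / q\<close> with \<open>0 \<le> k \<le> 2\<close> is close to \<open>k - 1 / q\<close>.\<close>

lemma clear_tor_upper:
  assumes q: "q \<ge> 1" and p: "(a, b) \<in> Delta" and t: "t > 0" and clear: "clear t (sl_pt 1 (a, b, 1 / real q, 0))"
  shows "(a, b) \<in> {0..2 / t} \<times> {1 - 2 / t..1} \<union>
    (\<Union>k\<in>{0, 1, 2}. {1 - 2 / t..1} \<times> {k - 1 / real q - 4 / t..k - 1 / real q + 4 / t})"
proof -
  have c: "0 < a" "a \<le> 1" "1 - a < b" "b \<le> 1" "0 < b" using p unfolding Delta_def by auto
  have q': "0 < 1 / real q" "1 / real q \<le> 1" using q by simp_all
  define r where "r = 1 / real q"
  have r: "0 < r" "r \<le> 1" using q' unfolding r_def by auto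
  obtain m :: int where m: "1 - a < a * r + b + a * m" "a * r + b + a * m \<le> 1" using largest_step[OF c(1)] by blast
  define x where "x = a * r + b + a * m"
  have x: "1 - a < x" "x \<le> 1" "0 < x" using m c unfolding x_def by auto
  have "t * (a * (m + r) + b * of_int 1) < of_int 1 / a"
    using clear[unfolded clear_tor_iff, folded r_def, rule_format, of m 1] x c unfolding x_def by (simp add: algebra_simps)
  then have tx: "t * x < 1 / a" unfolding x_def by (simp add: algebra_simps)
  show ?thesis
  proof (cases "a \<le> 1 / 2")
    case True
    then have "t * (1 / 2) \<le> t * x" using x t by (intro mult_left_mono) auto
    then have "t / 2 < 1 / a" using tx by linarith
    then have "a \<le> 2 / t" using c t by (simp add: field_simps)
    then show ?thesis using c by auto
  next
    case False
    then have "1 / a < 2" using c by (simp add: field_simps)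
    then have "t * x < 2" using tx by linarith
    then have xt: "x < 2 / t" using t by (simp add: less_divide_eq mult.commute)
    define d where "d = 1 - a"
    have d: "0 \<le> d" "d < 2 / t" using x xt c unfolding d_def by linarith+
    have "a * (- m) < 3 * a"
    proof -
      have "a * (- m) = a * r + b - x" unfolding x_def by simp
      also have "\<dots> < a * 1 + 1" using mult_left_mono[of r 1 a] r c x by linarith
      finally show ?thesis using False by linarith
    qed
    then have "(- real_of_int m) * a < 3 * a" by (simp add: mult.commute)
    then have "- real_of_int m < 3" by (rule mult_right_less_imp_less) (use c in simp)
    then have "- m < 3" by linarith
    moreover have "a * (- 1) < a * (- m)"
    proof -
      have "a * (- m) = a * r + b - x" unfolding x_def by simp
      then show ?thesis using x c mult_pos_pos[OF c(1) r(1)] by linarith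
    qed
    then have "(- 1) * a < (- real_of_int m) * a" by (simp add: mult.commute)
    then have "- 1 < - real_of_int m" by (rule mult_right_less_imp_less) (use c in simp)
    then have "- 1 < - m" by linarith
    ultimately have km: "- m \<in> {0, 1, 2}" by auto
    define k where "k = - m"
    have k: "k \<in> {0, 1, 2}" using km unfolding k_def .
    have b: "b = x + a * k - a * r" unfolding x_def k_def by simp
    have "b = (k - r) + (x - d * k + d * r)" unfolding b d_def by (simp add: algebra_simps)
    moreover have kr: "0 \<le> real_of_int k" "real_of_int k \<le> 2" using k by auto
    have "0 \<le> d * r" "d * r \<le> d * 1" using d r by (simp, intro mult_left_mono) auto
    moreover have "0 \<le> d * k" "d * k \<le> d * 2" using d kr by (simp, intro mult_left_mono) auto
    moreover have "4 / t = 2 * (2 / t)" by simp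
    ultimately have "k - r - 4 / t \<le> b" "b \<le> k - r + 4 / t" using x xt d by linarith+
    moreover have "1 - 2 / t \<le> a" using d unfolding d_def by linarith
    ultimately have box: "(a, b) \<in> {1 - 2 / t..1} \<times> {real_of_int k - r - 4 / t..real_of_int k - r + 4 / t}" using c by simp
    have "real_of_int k \<in> {0, 1, 2}" using k by auto
    then show ?thesis unfolding r_def[symmetric] using box by (intro UnI2) (rule UN_I)
  qed
qed

lemma measure_tor_bounds:
  assumes q: "q \<ge> 1" and t: "t \<ge> 1"
  defines "S \<equiv> {p \<in> Delta. clear t (sl_pt 1 (fst p, snd p, 1 / real q, 0))}"
  shows "1 / 4 / t\<^sup>2 \<le> measure lborel S" "measure lborel S \<le> 52 / t\<^sup>2"
proof -
  let ?P = "\<lambda>p. sl_pt 1 (fst p, snd p, 1 / real q, 0)"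
  have [measurable]: "Delta \<in> sets borel" "{p. clear t (?P p)} \<in> sets borel"
    by (rule sets_Delta_coords, rule sets_clear) (unfold sl_pt_def fst_conv snd_conv, measurable)
  have "S = Delta \<inter> {p. clear t (?P p)}" unfolding S_def by auto
  also have "\<dots> \<in> sets borel" by measurable
  finally have S: "S \<in> sets borel" .
  have "emeasure lborel S \<le> emeasure lborel Delta" unfolding S_def by (intro emeasure_mono) auto
  then have fin: "emeasure lborel S < \<infinity>" using emeasure_coords_finite(1) by (rule le_less_trans)
  have "ennreal (1 / 4 / t\<^sup>2) = emeasure lborel ({1 / (2 * t)<..<1 / t} \<times> {1 - 1 / (2 * t)<..<1})"
    using t by (simp add: emeasure_lborel_Times ennreal_mult[symmetric] field_simps power2_eq_square)
  also have "\<dots> \<le> emeasure lborel S"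
    using S clear_tor_lower[OF t] unfolding S_def by (intro emeasure_mono) auto
  also have "\<dots> = ennreal (measure lborel S)" using fin by (simp add: emeasure_eq_ennreal_measure)
  finally show "1 / 4 / t\<^sup>2 \<le> measure lborel S" by (simp add: ennreal_le_iff)
  \<comment> \<open>total area \<open>4 / t\<^sup>2 + 3 * 16 / t\<^sup>2\<close>\<close>
  let ?Z = "{0..2 / t} \<times> {1 - 2 / t..1}"
  let ?B = "\<lambda>k. {1 - 2 / t..1} \<times> {k - 1 / real q - 4 / t..k - 1 / real q + 4 / t}"
  have B: "emeasure lborel (?B k) = ennreal (16 / t\<^sup>2)" for k
  proof -
    have "emeasure lborel {1 - 2 / t..1} = ennreal (2 / t)" using t by (subst emeasure_lborel_Icc) simp_all
    moreover have "emeasure lborel {k - 1 / real q - 4 / t..k - 1 / real q + 4 / t} = ennreal (8 / t)"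
      using t by (subst emeasure_lborel_Icc) simp_all
    ultimately have "emeasure lborel (?B k) = ennreal (2 / t) * ennreal (8 / t)"
      by (subst emeasure_lborel_Times) simp_all
    also have "\<dots> = ennreal (16 / t\<^sup>2)" using t by (subst ennreal_mult[symmetric]) (simp_all add: power2_eq_square)
    finally show ?thesis .
  qed
  have cover: "S \<subseteq> ?Z \<union> ?B 0 \<union> ?B 1 \<union> ?B 2 \<union> {}"
  proof
    fix p assume "p \<in> S"
    then have "p \<in> ?Z \<union> (\<Union>k\<in>{0, 1, 2}. ?B k)"
      using clear_tor_upper[OF q, of "fst p" "snd p" t] t unfolding S_def by (simp only: mem_Collect_eq prod.collapse)
    then show "p \<in> ?Z \<union> ?B 0 \<union> ?B 1 \<union> ?B 2 \<union> {}" by simp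
  qed
  have "?Z \<in> sets lborel" "?B k \<in> sets lborel" for k by (auto intro!: borel_closed closed_Times)
  from emeasure_cover5[OF cover this(1) this(2) this(2) this(2)]
  have "emeasure lborel S \<le> emeasure lborel ?Z + emeasure lborel (?B 0) + emeasure lborel (?B 1) + emeasure lborel (?B 2) + 0" by simp
  also have "\<dots> = ennreal (4 / t\<^sup>2) + ennreal (16 / t\<^sup>2) + ennreal (16 / t\<^sup>2) + ennreal (16 / t\<^sup>2) + 0"
  proof -
    have "emeasure lborel ?Z = ennreal (2 / t) * ennreal (2 / t)"
      using t by (subst emeasure_lborel_Times) simp_all
    also have "\<dots> = ennreal (4 / t\<^sup>2)" using t by (subst ennreal_mult[symmetric]) (simp_all add: power2_eq_square)
    finally show ?thesis unfolding B by simp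
  qed
  also have "\<dots> = ennreal (52 / t\<^sup>2)" by (simp add: ennreal_plus[symmetric] del: ennreal_plus)
  finally show "measure lborel S \<le> 52 / t\<^sup>2" by (intro emeasure_le_imp_measure_le) auto
qed

section \<open>Cusp asymptotics for slit tori\<close>

text \<open>Dominated convergence, for regions that stay in a fixed bounded set and for which membership of
  almost every point stabilises.\<close>

lemma tendsto_integral_indicator:
  fixes F :: "real \<Rightarrow> 'a::euclidean_space set" and w :: "'a \<Rightarrow> real"
  assumes F: "\<And>t. F t \<in> sets borel" and G: "G \<in> sets borel" and K: "K \<in> sets borel" "bounded K"
    and w: "w \<in> borel_measurable borel" "\<And>q. q \<in> K \<Longrightarrow> \<bar>w q\<bar> \<le> M" and M: "M \<ge> 0"
    and dom: "\<And>t. t \<ge> T \<Longrightarrow> AE q in lborel. q \<in> F t \<longrightarrow> q \<in> K"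
    and lim: "AE q in lborel. \<forall>\<^sub>F t in at_top. q \<in> F t \<longleftrightarrow> q \<in> G"
  shows "((\<lambda>t. \<integral>q. indicator (F t) q * w q \<partial>lborel) \<longlongrightarrow> (\<integral>q. indicator G q * w q \<partial>lborel)) at_top"
proof (rule integral_dominated_convergence_at_top[where w = "\<lambda>q. indicator K q * M"])
  note [measurable] = F G K(1) w(1)
  show "(\<lambda>q. indicator G q * w q) \<in> borel_measurable lborel" by measurable
  show "(\<lambda>q. indicator (F t) q * w q) \<in> borel_measurable lborel" for t by measurable
  have "emeasure lborel K < \<infinity>" using K(2) by (rule emeasure_bounded_finite)
  then show "integrable lborel (\<lambda>q. indicator K q * M)"
    using K(1) by (intro integrable_mult_left integrable_real_indicator) auto
  show "AE q in lborel. ((\<lambda>t. indicator (F t) q * w q) \<longlongrightarrow> indicator G q * w q) at_top"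
    using lim
  proof eventually_elim
    case (elim q)
    have "\<forall>\<^sub>F t in at_top. indicator (F t) q * w q = indicator G q * w q"
      using elim by eventually_elim (simp add: indicator_def)
    then show ?case by (rule tendsto_eventually)
  qed
  show "\<forall>\<^sub>F t in at_top. AE q in lborel. norm (indicator (F t) q * w q) \<le> indicator K q * M"
    using eventually_ge_at_top[of T]
  proof eventually_elim
    case (elim t)
    show ?case using dom[OF elim]
    proof eventually_elim
      case (elim q)
      then show ?case using w(2)[of q] M by (auto simp: indicator_def)
    qed
  qed
qed

lemma AE_hyperplane4:
  "c0 \<noteq> 0 \<or> c1 \<noteq> 0 \<or> c2 \<noteq> 0 \<or> c3 \<noteq> (0::real) \<Longrightarrow>
    AE p in lborel. c0 * fst p + c1 * fst (snd p) + c2 * fst (snd (snd p)) + c3 * snd (snd (snd p)) \<noteq> d"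
  by (rule AE_I'[OF null_sets_hyperplane4[of c0 c1 c2 c3 d]]) auto

text \<open>Near the corner \<open>(1, 0)\<close> the coordinate \<open>\<alpha>\<close> can also be close to \<open>1\<close>.\<close>

definition reflect_last :: "real \<times> real \<times> real \<times> real \<Rightarrow> real \<times> real \<times> real \<times> real" where
  "reflect_last p = (fst p, fst (snd p), fst (snd (snd p)), 1 - snd (snd (snd p)))"

lemma measurable_reflect_last[measurable]: "reflect_last \<in> borel_measurable borel"
  unfolding reflect_last_def by measurable

lemma emeasure_reflect_last:
  assumes E: "E \<in> sets borel"
  shows "emeasure lborel E = emeasure lborel {p. reflect_last p \<in> E}"
proof -
  have S: "{q. reflect_last q \<in> E} \<in> sets borel"
    using measurable_sets_borel[OF measurable_reflect_last E] by (simp add: vimage_def)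
  define f :: "real \<times> real \<times> real \<times> real \<Rightarrow> ennreal" where "f = indicator E"
  have f[measurable]: "f \<in> borel_measurable borel" unfolding f_def by (rule borel_measurable_indicator[OF E])
  have "emeasure lborel E = (\<integral>\<^sup>+p. f p \<partial>lborel)" using E unfolding f_def by simp
  also have "\<dots> = (\<integral>\<^sup>+a. \<integral>\<^sup>+b. \<integral>\<^sup>+r. f (a, b, r) \<partial>lborel \<partial>lborel \<partial>lborel)" by (rule nn_integral_lborel_triple[OF f])
  also have "\<dots> = (\<integral>\<^sup>+a. \<integral>\<^sup>+b. \<integral>\<^sup>+r. f (reflect_last (a, b, r)) \<partial>lborel \<partial>lborel \<partial>lborel)"
  proof (rule nn_integral_cong, rule nn_integral_cong)
    fix a b :: real
    have "(\<integral>\<^sup>+r. f (a, b, r) \<partial>lborel) = (\<integral>\<^sup>+s. \<integral>\<^sup>+\<alpha>. f (a, b, s, \<alpha>) \<partial>lborel \<partial>lborel)"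
      by (rule nn_integral_lborel_pair) measurable
    also have "\<dots> = (\<integral>\<^sup>+s. \<integral>\<^sup>+\<alpha>. f (a, b, s, 1 - \<alpha>) \<partial>lborel \<partial>lborel)"
      using nn_integral_real_affine[of "\<lambda>\<alpha>. f (a, b, s, \<alpha>)" "-1" 1 for s] by simp
    also have "\<dots> = (\<integral>\<^sup>+r. f (reflect_last (a, b, r)) \<partial>lborel)"
      using nn_integral_lborel_pair[of "\<lambda>r. f (reflect_last (a, b, r))"] by (simp add: reflect_last_def)
    finally show "(\<integral>\<^sup>+r. f (a, b, r) \<partial>lborel) = (\<integral>\<^sup>+r. f (reflect_last (a, b, r)) \<partial>lborel)" .
  qed
  also have "\<dots> = (\<integral>\<^sup>+p. f (reflect_last p) \<partial>lborel)" by (rule nn_integral_lborel_triple[symmetric]) measurable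
  also have "\<dots> = (\<integral>\<^sup>+p. indicator {p. reflect_last p \<in> E} p \<partial>lborel)"
    unfolding f_def by (intro nn_integral_cong) (simp add: indicator_def)
  also have "\<dots> = emeasure lborel {p. reflect_last p \<in> E}" using S by simp
  finally show ?thesis .
qed

subsection \<open>Points in the strip near the cusps\<close>

lemma clear3_sa_iff:
  fixes a b s \<alpha> t :: real
  shows "clear3 t (\<lambda>k. sa_pt k (a, b, s, \<alpha>)) \<longleftrightarrow> (\<forall>k\<in>{0, 1, -1}. \<forall>(m::int) (n::int).
     0 < k * \<alpha> + (a * m + b * n) \<and> k * \<alpha> + (a * m + b * n) \<le> 1 \<and> 0 < n / a - s * (a * m + b * n) \<longrightarrow>
     t * (k * \<alpha> + (a * m + b * n)) < n / a - s * (a * m + b * n))"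
  unfolding clear3_def clear_def in_strip_def sa_pt_def by simp

lemma clear3_sl_iff:
  fixes a b x y t :: real
  shows "clear3 t (\<lambda>k. sl_pt k (a, b, x, y)) \<longleftrightarrow> (\<forall>k\<in>{0, 1, -1}. \<forall>(m::int) (n::int).
     0 < a * (of_int m + k * x) + b * (of_int n + k * y) \<and> a * (of_int m + k * x) + b * (of_int n + k * y) \<le> 1 \<and> 0 < (of_int n + k * y) / a \<longrightarrow>
     t * (a * (of_int m + k * x) + b * (of_int n + k * y)) < (of_int n + k * y) / a)"
  unfolding clear3_def clear_def in_strip_def sl_pt_def by simp

text \<open>In the cusp \<open>a \<rightarrow> 0\<close> the rows of the lattice have distance \<open>1 / a\<close>. Apart from the
  row of \<open>0\<close> itself all points lie high enough, and within that row only the point obtained by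
  subtracting \<open>(a, - s a)\<close> matters.\<close>

lemma clear3_cusp_a:
  assumes pos: "0 < a" "0 < s" "0 < t" "0 < \<alpha>" "\<alpha> < 1"
    and c: "(s * a + t * a) * (1 + \<alpha>) + t * a * \<alpha> < 1" "t * \<alpha> < t * a + s * a"
  shows "clear3 t (\<lambda>k. sa_pt k (a, b, s, \<alpha>))"
  unfolding clear3_sa_iff
proof (intro ballI allI impI, elim conjE)
  fix k :: real and m n :: int assume k: "k \<in> {0, 1, -1}"
  define j where "j = a * m + b * n"
  define \<sigma> A where "\<sigma> = s * a" and "A = t * a"
  have sA: "0 < \<sigma>" "0 < A" unfolding \<sigma>_def A_def using pos by auto
  assume "0 < k * \<alpha> + (a * m + b * n)" "k * \<alpha> + (a * m + b * n) \<le> 1" "0 < n / a - s * (a * m + b * n)"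
  then have st: "0 < k * \<alpha> + j" "k * \<alpha> + j \<le> 1" "0 < n / a - s * j" unfolding j_def by auto
  have k\<alpha>: "- \<alpha> \<le> k * \<alpha>" "k * \<alpha> \<le> \<alpha>" using k pos by auto
  have y: "a * (n / a - s * j) = n - \<sigma> * j" unfolding \<sigma>_def using pos by (simp add: field_simps)
  have y0: "0 < n - \<sigma> * j" using mult_pos_pos[OF pos(1) st(3)] unfolding y .
  have c1: "(\<sigma> + A) * (1 + \<alpha>) + A * \<alpha> < 1" using c(1) unfolding \<sigma>_def A_def .
  have "\<sigma> < 1" "A < 1"
  proof -
    have "(\<sigma> + A) * (1 + \<alpha>) = (\<sigma> + A) + (\<sigma> + A) * \<alpha>" by (simp add: algebra_simps)
    moreover have "0 < (\<sigma> + A) * \<alpha>" "0 < A * \<alpha>" using sA pos by simp_all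
    ultimately have "\<sigma> + A < 1" using c1 by linarith
    then show "\<sigma> < 1" "A < 1" using sA by linarith+
  qed
  have "A * (k * \<alpha> + j) < n - \<sigma> * j"
  proof -
    consider "n \<ge> 1" | "n = 0" | "n \<le> - 1" by linarith
    then show ?thesis
    proof cases
      case 1
      show ?thesis
      proof (cases "j \<ge> 0")
        case True
        have "(\<sigma> + A) * j \<le> (\<sigma> + A) * (1 + \<alpha>)" using st k\<alpha> sA by (intro mult_left_mono) auto
        moreover have "A * (k * \<alpha>) \<le> A * \<alpha>" using k\<alpha> sA by (intro mult_left_mono) auto
        ultimately show ?thesis using c1 1 by (simp add: algebra_simps)
      next
        case False
        have "A * (k * \<alpha> + j) \<le> A * 1" using st sA by (intro mult_left_mono) auto
        moreover have "\<sigma> * j \<le> 0" using False sA by (simp add: mult_nonneg_nonpos)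
        ultimately show ?thesis using \<open>A < 1\<close> 1 by linarith
      qed
    next
      case 2
      then have "\<sigma> * j < 0" using y0 by simp
      then have j0: "j < 0" using sA by (simp add: mult_less_0_iff)
      then have "k = 1" using st k pos by auto
      have "a * m < 0" using j0 2 unfolding j_def by simp
      then have "m \<le> - 1" using pos by (simp add: mult_less_0_iff)
      then have "a * m \<le> a * (- 1)" using pos by (intro mult_left_mono) auto
      then have "j \<le> - a" using 2 unfolding j_def by simp
      then have "(\<sigma> + A) * j \<le> (\<sigma> + A) * (- a)" using sA by (intro mult_left_mono) auto
      moreover have "A * \<alpha> < (\<sigma> + A) * a"
      proof -
        have "a * (t * \<alpha>) < a * (t * a + s * a)" using c(2) pos by (intro mult_strict_left_mono) auto
        then show ?thesis unfolding A_def \<sigma>_def by (simp add: algebra_simps)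
      qed
      ultimately show ?thesis using 2 \<open>k = 1\<close> by (simp add: algebra_simps)
    next
      case 3
      have "- 1 \<le> j" using st k\<alpha> pos by linarith
      then have "\<sigma> * (- 1) \<le> \<sigma> * j" using sA by (intro mult_left_mono) auto
      then show ?thesis using y0 3 \<open>\<sigma> < 1\<close> by linarith
    qed
  qed
  then have "a * (t * (k * \<alpha> + j)) < a * (n / a - s * j)" unfolding y A_def by (simp add: algebra_simps)
  then show "t * (k * \<alpha> + (a * m + b * n)) < n / a - s * (a * m + b * n)"
    unfolding j_def using pos mult_less_cancel_left_pos by blast
qed

text \<open>In the cusp \<open>b \<rightarrow> 0\<close> the points \<open>m (a, - s a) + n (b, 1 / a - s b)\<close> are best described by
  \<open>m\<close> and the horizontal coordinate \<open>j\<close>: their height times \<open>b\<close> is \<open>j u - m\<close> with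
  \<open>u = 1 / a - s b\<close>.\<close>

lemma height_times_b:
  fixes a b s :: real and m n :: int
  assumes "a \<noteq> 0"
  shows "b * (n / a - s * (a * m + b * n)) = (a * m + b * n) * (1 / a - s * b) - m"
  using assms by (simp add: field_simps)

lemma clear3_cusp_bI:
  fixes a b s \<alpha> t :: real
  assumes pos: "0 < a" "0 < b"
    and main: "\<And>k j (m::int) (n::int). k \<in> {0, 1, -1::real} \<Longrightarrow> j = a * of_int m + b * of_int n \<Longrightarrow> 0 < k * \<alpha> + j \<Longrightarrow> k * \<alpha> + j \<le> 1 \<Longrightarrow>
      m < j * (1 / a - s * b) \<Longrightarrow> m + t * b * (k * \<alpha>) < j * (1 / a - s * b - t * b)"
  shows "clear3 t (\<lambda>k. sa_pt k (a, b, s, \<alpha>))"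
  unfolding clear3_sa_iff
proof (intro ballI allI impI, elim conjE)
  fix k :: real and m n :: int assume k: "k \<in> {0, 1, -1}"
  define j where "j = a * m + b * n"
  assume "0 < k * \<alpha> + (a * m + b * n)" "k * \<alpha> + (a * m + b * n) \<le> 1" "0 < n / a - s * (a * m + b * n)"
  then have st: "0 < k * \<alpha> + j" "k * \<alpha> + j \<le> 1" "0 < n / a - s * j" unfolding j_def by auto
  have y: "b * (n / a - s * j) = j * (1 / a - s * b) - m" unfolding j_def using pos by (intro height_times_b) simp
  have "m < j * (1 / a - s * b)" using mult_pos_pos[OF pos(2) st(3)] unfolding y by simp
  from main[OF k j_def st(1,2) this]
  have "b * (t * (k * \<alpha> + j)) < b * (n / a - s * j)" unfolding y by (simp add: algebra_simps)
  then show "t * (k * \<alpha> + (a * m + b * n)) < n / a - s * (a * m + b * n)"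
    unfolding j_def using pos mult_less_cancel_left_pos by blast
qed

text \<open>Rows with \<open>m \<ge> 1\<close> lie below the horizontal axis within the strip since \<open>j \<le> 1 + \<alpha>\<close>, those with
  \<open>m < 0\<close> are high enough, and for \<open>m = 0\<close> the lowest point is \<open>(b, u)\<close>, most critically after
  translation by \<open>(\<alpha>, 0)\<close>.\<close>

lemma clear3_cusp_b_small_alpha:
  assumes pos: "0 < a" "0 < b" "0 < t" "0 < \<alpha>"
    and c: "t * \<alpha> < 1 / a - s * b - t * b" "(1 / a - s * b) * (1 + \<alpha>) < 1"
  shows "clear3 t (\<lambda>k. sa_pt k (a, b, s, \<alpha>))"
proof (rule clear3_cusp_bI[OF pos(1,2)])
  fix k j :: real and m n :: int
  assume k: "k \<in> {0, 1, -1}" and j: "j = a * m + b * n" and st: "0 < k * \<alpha> + j" "k * \<alpha> + j \<le> 1" "m < j * (1 / a - s * b)"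
  define u B where "u = 1 / a - s * b" and "B = t * b"
  have B: "0 < B" unfolding B_def using pos by simp
  have t\<alpha>: "0 < t * \<alpha>" using pos by simp
  have \<rho>: "0 < u - B" "t * \<alpha> < u - B" using c(1) t\<alpha> unfolding u_def B_def by linarith+
  have u: "0 < u" "u * (1 + \<alpha>) < 1" using \<rho> B c(2) unfolding u_def by auto
  have k\<alpha>: "- \<alpha> \<le> k * \<alpha>" "k * \<alpha> \<le> \<alpha>" using k pos by auto
  have Bk: "B * (k * \<alpha>) \<le> B * \<alpha>" using k\<alpha> B by (intro mult_left_mono) auto
  have ju: "m < j * u" using st(3) unfolding u_def .
  consider "m \<ge> 1" | "m = 0" | "m \<le> - 1" by linarith
  then have "m + B * (k * \<alpha>) < j * (u - B)"
  proof cases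
    case 1
    have "j * u \<le> (1 + \<alpha>) * u" using st k\<alpha> u by (intro mult_right_mono) auto
    moreover have "(1 + \<alpha>) * u = u * (1 + \<alpha>)" by (rule mult.commute)
    moreover have "real_of_int m \<ge> 1" using 1 by linarith
    ultimately show ?thesis using ju u by linarith
  next
    case 2
    then have "0 < j" using ju u by (simp add: zero_less_mult_iff)
    then have "n > 0" using 2 j pos by (simp add: zero_less_mult_iff)
    then have "b * 1 \<le> j" using 2 j pos by simp
    then have "b * (u - B) \<le> j * (u - B)" using \<rho> by (intro mult_right_mono) auto
    moreover have "b * (t * \<alpha>) < b * (u - B)" using \<rho> pos by (intro mult_strict_left_mono) auto
    moreover have "B * \<alpha> = b * (t * \<alpha>)" unfolding B_def by simp
    ultimately show ?thesis using 2 Bk by linarith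
  next
    case 3
    have "(- \<alpha>) * (u - B) \<le> j * (u - B)" using st k\<alpha> \<rho> by (intro mult_right_mono) auto
    moreover have "(- \<alpha>) * (u - B) = B * \<alpha> - u * \<alpha>" by (simp add: algebra_simps)
    moreover have "u * (1 + \<alpha>) = u + u * \<alpha>" by (simp add: algebra_simps)
    moreover have "real_of_int m \<le> - 1" using 3 by linarith
    ultimately show ?thesis using Bk u by linarith
  qed
  then show "m + t * b * (k * \<alpha>) < j * (1 / a - s * b - t * b)" unfolding u_def B_def .
qed

text \<open>For \<open>\<alpha>\<close> near \<open>1\<close> the translate by \<open>- \<alpha>\<close> brings points with \<open>j\<close> up to \<open>2\<close> into the strip. They
  lie below the horizontal axis for \<open>m \<ge> 1\<close> as long as \<open>2 u \<le> 1\<close>. In the translate by \<open>\<alpha>\<close> the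
  points with \<open>m = 0\<close> have \<open>j \<ge> b > 1 - \<alpha>\<close> and have left the strip.\<close>

lemma clear3_cusp_b_large_alpha:
  assumes pos: "0 < a" "0 < b" "0 < t" "0 < \<alpha>" "\<alpha> \<le> 1"
    and c: "0 < 1 / a - s * b - t * b" "1 / a - s * b \<le> 1 / 2" "1 - \<alpha> < b"
  shows "clear3 t (\<lambda>k. sa_pt k (a, b, s, \<alpha>))"
proof (rule clear3_cusp_bI[OF pos(1,2)])
  fix k j :: real and m n :: int
  assume k: "k \<in> {0, 1, -1}" and j: "j = a * m + b * n" and st: "0 < k * \<alpha> + j" "k * \<alpha> + j \<le> 1" "m < j * (1 / a - s * b)"
  define u B where "u = 1 / a - s * b" and "B = t * b"
  have B: "0 < B" unfolding B_def using pos by simp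
  have \<rho>: "0 < u - B" using c(1) unfolding u_def B_def .
  have u: "0 < u" "u \<le> 1 / 2" using \<rho> B c(2) unfolding u_def by auto
  have ju: "m < j * u" using st(3) unfolding u_def .
  have k\<alpha>: "- \<alpha> \<le> k * \<alpha>" using k pos by auto
  have "j * u \<le> 1"
  proof -
    have "j * u \<le> 2 * u" using st k\<alpha> pos u by (intro mult_right_mono) auto
    then show ?thesis using u by linarith
  qed
  then have m1: "m < 1" using ju by linarith
  have \<rho>\<alpha>: "\<alpha> * (u - B) + B * \<alpha> \<le> 1 / 2"
  proof -
    have "\<alpha> * (u - B) + B * \<alpha> = \<alpha> * u" by (simp add: algebra_simps)
    also have "\<dots> \<le> 1 * u" using pos u by (intro mult_right_mono) auto
    finally show ?thesis using u by simp
  qed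
  have "m + B * (k * \<alpha>) < j * (u - B)"
  proof (cases "k = 1")
    case True
    show ?thesis
    proof (cases "m = 0")
      case True
      then have "0 < j" using ju u by (simp add: zero_less_mult_iff)
      then have "n > 0" using True j pos by (simp add: zero_less_mult_iff)
      then have "b * 1 \<le> j" using True j pos by simp
      then show ?thesis using st c(3) \<open>k = 1\<close> by simp
    next
      case False
      then have "real_of_int m \<le> - 1" using m1 by linarith
      moreover have "(- \<alpha>) * (u - B) \<le> j * (u - B)" using st \<open>k = 1\<close> \<rho> by (intro mult_right_mono) auto
      ultimately show ?thesis using \<rho>\<alpha> \<open>k = 1\<close> by simp
    qed
  next
    case False
    then have k0: "k \<le> 0" using k by auto
    then have "k * \<alpha> \<le> 0" using pos by (simp add: mult_nonpos_nonneg)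
    then have "0 < j * (u - B)" "B * (k * \<alpha>) \<le> 0" using st \<rho> B by (simp_all add: mult_nonneg_nonpos)
    moreover have "real_of_int m \<le> 0" using m1 by linarith
    ultimately show ?thesis by linarith
  qed
  then show "m + t * b * (k * \<alpha>) < j * (1 / a - s * b - t * b)" unfolding u_def B_def .
qed

text \<open>Each statement expresses that one particular point misses the triangle: the lattice vector
  \<open>(b, 1 / a - s b)\<close>, its translate by \<open>\<alpha>\<close>, the point \<open>(\<alpha> - a, s a)\<close>, and finally
  \<open>(j - \<alpha>, y)\<close> in the translate by \<open>- \<alpha>\<close>, where \<open>(j, y)\<close> is the lattice point with \<open>m = 1\<close> and
  the given \<open>n\<close>.\<close>

lemma clear3_sa_necessary:
  assumes p: "(a, b, s, \<alpha>) \<in> Omega_coords" and clear: "clear3 t (\<lambda>k. sa_pt k (a, b, s, \<alpha>))"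
  shows "t * b < 1 / a - s * b" "\<alpha> + b \<le> 1 \<Longrightarrow> t * (\<alpha> + b) < 1 / a - s * b"
    "a < \<alpha> \<Longrightarrow> 0 < s \<Longrightarrow> t * (\<alpha> - a) < s * a"
    "\<And>n::int. \<alpha> < a + b * n \<Longrightarrow> a + b * n \<le> 1 + \<alpha> \<Longrightarrow> 1 < (a + b * n) * (1 / a - s * b) \<Longrightarrow>
      1 - t * b * \<alpha> < (a + b * n) * (1 / a - s * b - t * b)"
proof -
  have c: "0 < a" "a \<le> 1" "1 - a < b" "b \<le> 1" "0 \<le> s" "s < 1 / (a * b)" "0 < \<alpha>" "\<alpha> \<le> 1" "0 < b"
    using p unfolding Omega_coords_def Delta_def by auto
  have y1: "0 < 1 / a - s * b"
  proof -
    have "s * (a * b) < 1" using c by (simp add: less_divide_eq)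
    moreover have "1 / a - s * b = (1 - s * (a * b)) / a" using c by (simp add: field_simps)
    ultimately show ?thesis using c by simp
  qed
  note cl = clear[unfolded clear3_sa_iff, rule_format]
  show "t * b < 1 / a - s * b" using cl[of 0 0 1] c y1 by simp
  show "t * (\<alpha> + b) < 1 / a - s * b" if "\<alpha> + b \<le> 1" using cl[of 1 0 1] c y1 that by simp
  show "t * (\<alpha> - a) < s * a" if "a < \<alpha>" "0 < s" using cl[of 1 "-1" 0] c that by (simp add: algebra_simps)
  fix n :: int
  let ?j = "a + b * n"
  assume j: "\<alpha> < ?j" "?j \<le> 1 + \<alpha>" "1 < ?j * (1 / a - s * b)"
  have y: "b * (n / a - s * ?j) = ?j * (1 / a - s * b) - 1"
    using height_times_b[of a b n s 1] c by simp
  then have "0 < b * (n / a - s * ?j)" using j by simp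
  then have "0 < n / a - s * ?j" using c by (simp add: zero_less_mult_iff)
  then have "t * (?j - \<alpha>) < n / a - s * ?j" using cl[of "-1" 1 n] j by (simp add: algebra_simps)
  then have "b * (t * (?j - \<alpha>)) < b * (n / a - s * ?j)" using c by (intro mult_strict_left_mono) auto
  then show "1 - t * b * \<alpha> < ?j * (1 / a - s * b - t * b)" unfolding y by (simp add: algebra_simps)
qed

text \<open>The heights of the points in the strip are at least \<open>y / a\<close>, \<open>(1 - y) / a\<close> or \<open>1 / a\<close>, and the
  triangle has height \<open>t\<close>.\<close>

lemma clear3_sl_cusp_a:
  assumes pos: "0 < a" "0 < t" "0 < y" "y < 1" and c: "t * a < y" "t * a < 1 - y"
  shows "clear3 t (\<lambda>k. sl_pt k (a, b, x, y))"
  unfolding clear3_sl_iff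
proof (intro ballI allI impI, elim conjE)
  fix k :: real and m n :: int
  let ?X = "a * (of_int m + k * x) + b * (of_int n + k * y)" and ?Y = "of_int n + k * y"
  assume k: "k \<in> {0, 1, -1}" and X: "?X \<le> 1" and Y: "0 < ?Y / a"
  have Y0: "0 < ?Y" using Y pos by (simp add: zero_less_divide_iff)
  consider "k = 0" | "k = 1" | "k = -1" using k by auto
  then have "t * a < ?Y"
  proof cases
    case 1
    then have "n \<ge> 1" using Y0 by simp
    then show ?thesis using 1 c pos by simp
  next
    case 2
    then have "n > - 1" using Y0 pos by (simp; linarith)
    then have "real_of_int n \<ge> 0" by linarith
    then show ?thesis using 2 c by simp
  next
    case 3
    then have "n > 0" using Y0 pos by (simp; linarith)
    then have "real_of_int n \<ge> 1" by linarith
    then show ?thesis using 3 c by simp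
  qed
  then have "t < ?Y / a" using pos by (simp add: less_divide_eq)
  moreover have "t * ?X \<le> t * 1" using X pos by (intro mult_left_mono) auto
  ultimately show "t * ?X < ?Y / a" by linarith
qed

text \<open>The second and third statement use the last points in the strip of the rows through \<open>v\<close> and
  through the second column minus \<open>v\<close>.\<close>

lemma clear3_sl_necessary:
  assumes p: "(a, b, x, y) \<in> sl_coords" and clear: "clear3 t (\<lambda>k. sl_pt k (a, b, x, y))" and t: "t > 0"
  shows "t * b < 1 / a" "0 < y \<Longrightarrow> t * (1 - a) < y / a" "t * (1 - a) < (1 - y) / a"
    "0 < x \<Longrightarrow> 0 < y \<Longrightarrow> a * x + b * y \<le> 1 \<Longrightarrow> t * (a * x + b * y) < y / a"
proof -
  have c: "0 < a" "a \<le> 1" "1 - a < b" "b \<le> 1" "0 \<le> x" "x < 1" "0 \<le> y" "y < 1" "0 < b"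
    using p unfolding sl_coords_def Delta_def by auto
  note cl = clear[unfolded clear3_sl_iff, rule_format]
  show "t * b < 1 / a" using cl[of 0 0 1] c by simp
  show "t * (1 - a) < y / a" if "0 < y"
  proof -
    obtain m :: int where m: "1 - a < (a * x + b * y) + a * m" "(a * x + b * y) + a * m \<le> 1" using largest_step[OF c(1)] by blast
    have "t * (a * (of_int m + 1 * x) + b * (of_int 0 + 1 * y)) < (of_int 0 + 1 * y) / a"
      using m c that by (intro cl) (auto simp: algebra_simps)
    moreover have "t * (1 - a) \<le> t * (a * (of_int m + 1 * x) + b * (of_int 0 + 1 * y))"
      using m t by (intro mult_left_mono) (auto simp: algebra_simps)
    ultimately show ?thesis by simp
  qed
  show "t * (1 - a) < (1 - y) / a"
  proof -
    obtain m :: int where m: "1 - a < (b * (1 - y) - a * x) + a * m" "(b * (1 - y) - a * x) + a * m \<le> 1" using largest_step[OF c(1)] by blast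
    have "t * (a * (of_int m + (-1) * x) + b * (of_int 1 + (-1) * y)) < (of_int 1 + (-1) * y) / a"
      using m c by (intro cl) (auto simp: algebra_simps)
    moreover have "t * (1 - a) \<le> t * (a * (of_int m + (-1) * x) + b * (of_int 1 + (-1) * y))"
      using m t by (intro mult_left_mono) (auto simp: algebra_simps)
    ultimately show ?thesis by simp
  qed
  show "t * (a * x + b * y) < y / a" if "0 < x" "0 < y" "a * x + b * y \<le> 1"
  proof -
    have "0 < a * x + b * y" using that c by (simp add: add_pos_pos)
    then show ?thesis using cl[of 1 0 0] that c by simp
  qed
qed

subsection \<open>Limits of the rescaled cusp regions\<close>

lemma inverse_less_two: "1 / 2 < x \<Longrightarrow> 1 / x < (2::real)"
  by (simp add: divide_less_eq)

lemma tendsto_const_div_at_top: "((\<lambda>t::real. c / t) \<longlongrightarrow> 0) at_top"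
  by (rule tendsto_divide_0[OF tendsto_const filterlim_at_top_imp_at_infinity[OF filterlim_ident]])

lemma scaling_in_Omega_coordsD:
  assumes "t > 0" "scaling t (A, \<theta>, \<sigma>, \<beta>) \<in> Omega_coords"
  shows "0 < A" "0 \<le> \<theta>" "\<theta> < 1" "0 \<le> \<sigma>" "0 < \<beta>"
proof -
  define a where "a = A / t"
  have c: "0 < a" "1 - a < 1 - \<theta> * a" "1 - \<theta> * a \<le> 1" "0 \<le> \<sigma> * (t / A)" "0 < \<beta> / t"
    using assms(2) unfolding scaling_def Omega_coords_def Delta_def a_def by auto
  show A: "0 < A" using c(1) assms(1) unfolding a_def by (simp add: zero_less_divide_iff)
  show "0 \<le> \<theta>" using c(1,3) by (simp add: zero_le_mult_iff)
  have "\<theta> * a < 1 * a" using c(2) by linarith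
  then show "\<theta> < 1" by (rule mult_right_less_imp_less) (use c in simp)
  show "0 \<le> \<sigma>" using c(4) A assms(1) by (simp add: zero_le_mult_iff zero_le_divide_iff)
  show "0 < \<beta>" using c(5) assms(1) by (simp add: zero_less_divide_iff)
qed

lemma scaling_last: "snd (snd (snd (scaling t (A, \<theta>, \<sigma>, \<beta>)))) = \<beta> / t"
  unfolding scaling_def by simp

definition sa_clear :: "real \<Rightarrow> (real \<times> real \<times> real \<times> real) set" where
  "sa_clear t = {p \<in> Omega_coords. clear3 t (\<lambda>k. sa_pt k p)}"

definition sl_clear :: "real \<Rightarrow> (real \<times> real \<times> real \<times> real) set" where
  "sl_clear t = {p \<in> sl_coords. clear3 t (\<lambda>k. sl_pt k p)}"

lemma sets_sa_clear[measurable]: "sa_clear t \<in> sets borel" "sl_clear t \<in> sets borel"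
  unfolding sa_clear_def sl_clear_def by (rule sets_clear3_coords)+

text \<open>The preimages in blown-up coordinates of three parts of the region: the cusp \<open>a \<rightarrow> 0\<close>, and the cusp
  \<open>b \<rightarrow> 0\<close> with \<open>\<alpha>\<close> near \<open>0\<close> and near \<open>1\<close>. At \<open>a \<rightarrow> 0\<close> the coordinates are
  \<open>a = A / t\<close>, \<open>b = 1 - \<theta> a\<close>, \<open>s = \<sigma> / a\<close>, \<open>\<alpha> = \<beta> / t\<close>; at \<open>b \<rightarrow> 0\<close> they are
  \<open>b = B / t\<close>, \<open>a = 1 - \<theta> b\<close>, \<open>s = \<tau> / b\<close>, with \<open>\<alpha> = \<beta> / t\<close> or \<open>\<alpha> = 1 - \<beta> / t\<close>.\<close>

definition cusp_a :: "real \<Rightarrow> (real \<times> real \<times> real \<times> real) set" where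
  "cusp_a t = {q. scaling t q \<in> sa_clear t \<and> fst (scaling t q) \<le> 1 / 2}"

definition cusp_b_small :: "real \<Rightarrow> (real \<times> real \<times> real \<times> real) set" where
  "cusp_b_small t = {q. swap_ab (scaling t q) \<in> sa_clear t \<and> 1 / 2 < fst (swap_ab (scaling t q)) \<and> snd (snd (snd (scaling t q))) \<le> 1 / 2}"

definition cusp_b_large :: "real \<Rightarrow> (real \<times> real \<times> real \<times> real) set" where
  "cusp_b_large t = {q. reflect_last (swap_ab (scaling t q)) \<in> sa_clear t \<and> 1 / 2 < fst (swap_ab (scaling t q)) \<and> snd (snd (snd (scaling t q))) < 1 / 2}"

lemma sets_cusps: "cusp_a t \<in> sets borel" "cusp_b_small t \<in> sets borel" "cusp_b_large t \<in> sets borel"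
  unfolding cusp_a_def cusp_b_small_def cusp_b_large_def by measurable

text \<open>In the limit \<open>t \<rightarrow> \<infinity>\<close>, \<open>\<sigma> + A < 1\<close> says that the lattice vector \<open>(b, 1 / a - s b)\<close> misses
  the triangle and \<open>\<beta> < A + \<sigma>\<close> that \<open>(\<alpha> - a, s a)\<close> does.\<close>

definition limit_a :: "(real \<times> real \<times> real \<times> real) set" where
  "limit_a = {q. 0 < fst q \<and> 0 < fst (snd q) \<and> fst (snd q) < 1 \<and> 0 < fst (snd (snd q)) \<and> 0 < snd (snd (snd q))
  \<and> fst (snd (snd q)) + fst q < 1 \<and> snd (snd (snd q)) < fst q + fst (snd (snd q))}"

definition limit_b_small :: "(real \<times> real \<times> real \<times> real) set" where
  "limit_b_small = {q. 0 < fst q \<and> 0 < fst (snd q) \<and> fst (snd q) < 1 \<and> 0 < fst (snd (snd q)) \<and> 0 < snd (snd (snd q))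
  \<and> snd (snd (snd q)) + fst q + fst (snd (snd q)) < 1}"

definition limit_b_large :: "(real \<times> real \<times> real \<times> real) set" where
  "limit_b_large = {q. 0 < fst q \<and> 0 < fst (snd q) \<and> fst (snd q) < 1 \<and> 1 / 2 < fst (snd (snd q)) \<and> 0 < snd (snd (snd q))
  \<and> snd (snd (snd q)) < fst q \<and> fst q + fst (snd (snd q)) < 1}"

lemma sets_limits: "limit_a \<in> sets borel" "limit_b_small \<in> sets borel" "limit_b_large \<in> sets borel"
  unfolding limit_a_def limit_b_small_def limit_b_large_def by measurable

lemma cusp_a_bounded:
  assumes t: "t > 0" and q: "q \<in> cusp_a t" and s: "fst (snd (snd q)) \<noteq> 0"
  shows "q \<in> {0..2} \<times> {0..1} \<times> {0..2} \<times> {0..4}"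
proof -
  obtain A \<theta> \<sigma> \<beta> where qe: "q = (A, \<theta>, \<sigma>, \<beta>)" by (cases q)
  define a b where "a = A / t" and "b = 1 - \<theta> * a"
  have p: "scaling t q = (a, b, \<sigma> * (t / A), \<beta> / t)" unfolding qe scaling_def a_def b_def by simp
  have C: "(a, b, \<sigma> * (t / A), \<beta> / t) \<in> Omega_coords" "clear3 t (\<lambda>k. sa_pt k (a, b, \<sigma> * (t / A), \<beta> / t))" "a \<le> 1 / 2"
    using q unfolding cusp_a_def sa_clear_def mem_Collect_eq p fst_conv by blast+
  have d: "0 < A" "0 \<le> \<theta>" "\<theta> < 1" "0 \<le> \<sigma>" "0 < \<beta>"
    using scaling_in_Omega_coordsD[of t A \<theta> \<sigma> \<beta>] C(1) t unfolding p[symmetric] qe by auto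
  have \<sigma>: "0 < \<sigma>" using d s unfolding qe by simp
  have a: "0 < a" unfolding a_def using d t by simp
  have b: "1 / 2 < b" using C(1,3) unfolding Omega_coords_def Delta_def by simp
  have sa: "\<sigma> * (t / A) * a = \<sigma>" "t * a = A" unfolding a_def using d t by simp_all
  have "t * b < 1 / a - \<sigma> * (t / A) * b" by (rule clear3_sa_necessary(1)[OF C(1,2)])
  then have "a * (t * b + \<sigma> * (t / A) * b) < a * (1 / a)" using a by (intro mult_strict_left_mono) auto
  moreover have "a * (t * b + \<sigma> * (t / A) * b) = (A + \<sigma>) * b" 
  proof -
    have "a * (t * b + \<sigma> * (t / A) * b) = (t * a + \<sigma> * (t / A) * a) * b" by (simp add: algebra_simps)
    then show ?thesis unfolding sa .
  qed
  ultimately have "(A + \<sigma>) * b < 1" using a by simp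
  moreover have "(A + \<sigma>) * (1 / 2) \<le> (A + \<sigma>) * b" using b d by (intro mult_left_mono) auto
  ultimately have "(A + \<sigma>) * (1 / 2) < 1" by (rule le_less_trans[rotated])
  then have A\<sigma>: "A + \<sigma> < 2" by simp
  have "\<beta> \<le> 4"
  proof (cases "\<beta> \<le> A")
    case True
    then show ?thesis using A\<sigma> \<sigma> by linarith
  next
    case False
    then have "a < \<beta> / t" unfolding a_def using t by (simp add: divide_strict_right_mono)
    moreover have "0 < \<sigma> * (t / A)" using \<sigma> d t by simp
    ultimately have "t * (\<beta> / t - a) < \<sigma> * (t / A) * a" by (rule clear3_sa_necessary(3)[OF C(1,2)])
    then have "\<beta> - A < \<sigma>" unfolding sa using sa(2) t by (simp add: right_diff_distrib)
    then show ?thesis using A\<sigma> by linarith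
  qed
  then show ?thesis using A\<sigma> d \<sigma> unfolding qe by auto
qed

text \<open>Off the boundary of the limit region the sufficient and the necessary conditions agree for large
  \<open>t\<close>, since \<open>\<alpha>\<close> tends to \<open>0\<close> and \<open>b\<close> to \<open>1\<close>. The exceptional values of the coordinates form null
  sets.\<close>

lemma cusp_a_limit:
  assumes q: "q = (A, \<theta>, \<sigma>, \<beta>)" and ne: "A \<noteq> 0" "\<theta> \<noteq> 0" "\<sigma> \<noteq> 0" "\<sigma> + A \<noteq> 1" "\<beta> \<noteq> A + \<sigma>"
  shows "\<forall>\<^sub>F t in at_top. q \<in> cusp_a t \<longleftrightarrow> q \<in> limit_a"
proof -
  define b where "b t = 1 - \<theta> * (A / t)" for t
  have p: "scaling t q = (A / t, b t, \<sigma> * (t / A), \<beta> / t)" for t unfolding q scaling_def b_def by simp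
  note z = tendsto_const_div_at_top
  show ?thesis
  proof (cases "0 < A \<and> 0 < \<theta> \<and> \<theta> < 1 \<and> 0 < \<sigma> \<and> 0 < \<beta>")
    case False
    have "\<forall>\<^sub>F t in at_top. q \<notin> cusp_a t" using eventually_gt_at_top[of 0]
    proof eventually_elim
      case (elim t)
      show ?case
      proof
        assume "q \<in> cusp_a t"
        then have "scaling t (A, \<theta>, \<sigma>, \<beta>) \<in> Omega_coords" unfolding cusp_a_def sa_clear_def q by simp
        from scaling_in_Omega_coordsD[OF elim this] show False using False ne by auto
      qed
    qed
    moreover have "q \<notin> limit_a" using False unfolding limit_a_def q by auto
    ultimately show ?thesis by simp
  next
    case True
    then have pos: "0 < A" "0 < \<theta>" "\<theta> < 1" "0 < \<sigma>" "0 < \<beta>" by auto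
    have sa: "\<sigma> * (t / A) * (A / t) = \<sigma>" "t * (A / t) = A" if "t > 0" for t using pos that by simp_all
    show ?thesis
    proof (cases "\<sigma> + A < 1 \<and> \<beta> < A + \<sigma>")
      case True
      then have G: "q \<in> limit_a" using pos unfolding limit_a_def q by simp
      have "((\<lambda>t. (\<sigma> + A) * (1 + \<beta> / t) + A * (\<beta> / t)) \<longlongrightarrow> (\<sigma> + A) * (1 + 0) + A * 0) at_top"
        by (intro tendsto_intros z)
      then have ev: "\<forall>\<^sub>F t in at_top. (\<sigma> + A) * (1 + \<beta> / t) + A * (\<beta> / t) < 1"
        by (rule order_tendstoD) (use True in simp)
      have "\<forall>\<^sub>F t in at_top. q \<in> cusp_a t"
        using ev eventually_gt_at_top[of "max (2 * A) (max 1 \<beta>)"]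
      proof eventually_elim
        case (elim t)
        then have t: "t > 0" "2 * A < t" "\<beta> < t" by auto
        have at: "0 < A / t" "A / t \<le> 1 / 2" using t pos by (simp_all add: field_simps)
        have bt: "1 - A / t < b t" "b t \<le> 1"
        proof -
          have "\<theta> * (A / t) < 1 * (A / t)" using pos at by (intro mult_strict_right_mono) auto
          then show "1 - A / t < b t" unfolding b_def by simp
          have "0 \<le> \<theta> * (A / t)" using pos at by (intro mult_nonneg_nonneg) auto
          then show "b t \<le> 1" unfolding b_def by linarith
        qed
        have \<beta>t: "0 < \<beta> / t" "\<beta> / t < 1" using t pos by simp_all
        have s: "0 < \<sigma> * (t / A)" using pos t by simp
        have b0: "0 < b t" using bt at by linarith
        have "\<sigma> * (t / A) < 1 / (A / t * b t)"
        proof -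
          have "\<sigma> * (t / A) * (A / t * b t) = \<sigma> * b t" using sa(1)[OF t(1)] by (metis mult.assoc)
          also have "\<dots> \<le> \<sigma> * 1" using bt pos by (intro mult_left_mono) auto
          also have "\<dots> < 1" using True pos by simp
          finally have f: "\<sigma> * (t / A) * (A / t * b t) < 1" .
          have "0 < A / t * b t" using at b0 by (intro mult_pos_pos) auto
          then show ?thesis using f by (simp only: pos_less_divide_eq)
        qed
        moreover have "A / t \<le> 1" using at by linarith
        ultimately have C: "scaling t q \<in> Omega_coords" unfolding p Omega_coords_def Delta_def mem_Collect_eq prod.case
          using at(1) bt \<beta>t s by (intro conjI) (assumption | linarith)+
        have "clear3 t (\<lambda>k. sa_pt k (A / t, b t, \<sigma> * (t / A), \<beta> / t))"
        proof (rule clear3_cusp_a)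
          show "(\<sigma> * (t / A) * (A / t) + t * (A / t)) * (1 + \<beta> / t) + t * (A / t) * (\<beta> / t) < 1"
            unfolding sa[OF t(1)] by (rule elim(1))
          show "t * (\<beta> / t) < t * (A / t) + \<sigma> * (t / A) * (A / t)" unfolding sa[OF t(1)] using True t by simp
        qed (use at s t \<beta>t in auto)
        then show ?case using C at unfolding cusp_a_def sa_clear_def mem_Collect_eq p fst_conv by blast
      qed
      then show ?thesis using G by simp
    next
      case False
      then have nG: "q \<notin> limit_a" unfolding limit_a_def q by auto
      have "\<forall>\<^sub>F t in at_top. q \<notin> cusp_a t"
      proof (cases "\<sigma> + A > 1")
        case True
        have "((\<lambda>t. (A + \<sigma>) * (1 - \<theta> * (A / t))) \<longlongrightarrow> (A + \<sigma>) * (1 - \<theta> * 0)) at_top" by (intro tendsto_intros z)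
        then have "\<forall>\<^sub>F t in at_top. 1 < (A + \<sigma>) * (1 - \<theta> * (A / t))" by (rule order_tendstoD) (use True in simp)
        then show ?thesis using eventually_gt_at_top[of 0]
        proof eventually_elim
          case (elim t)
          show ?case
          proof
            assume "q \<in> cusp_a t"
            then have C: "(A / t, b t, \<sigma> * (t / A), \<beta> / t) \<in> Omega_coords" "clear3 t (\<lambda>k. sa_pt k (A / t, b t, \<sigma> * (t / A), \<beta> / t))"
              unfolding cusp_a_def sa_clear_def mem_Collect_eq p fst_conv by blast+
            have at: "0 < A / t" using pos elim by simp
            have "t * b t < 1 / (A / t) - \<sigma> * (t / A) * b t" by (rule clear3_sa_necessary(1)[OF C])
            then have "(A / t) * (t * b t + \<sigma> * (t / A) * b t) < (A / t) * (1 / (A / t))" using at by (intro mult_strict_left_mono) auto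
            moreover have "(A / t) * (t * b t + \<sigma> * (t / A) * b t) = (t * (A / t) + \<sigma> * (t / A) * (A / t)) * b t" by (simp add: algebra_simps)
            moreover have "(A / t) * (1 / (A / t)) = 1" using pos elim(2) by simp
            ultimately have "(A + \<sigma>) * b t < 1" unfolding sa[OF elim(2)] by linarith
            then show False using elim unfolding b_def by simp
          qed
        qed
      next
        case False
        then have \<beta>: "\<beta> > A + \<sigma>" using \<open>\<not> (\<sigma> + A < 1 \<and> \<beta> < A + \<sigma>)\<close> ne by auto
        show ?thesis using eventually_gt_at_top[of 0]
        proof eventually_elim
          case (elim t)
          show ?case
          proof
            assume "q \<in> cusp_a t"
            then have C: "(A / t, b t, \<sigma> * (t / A), \<beta> / t) \<in> Omega_coords" "clear3 t (\<lambda>k. sa_pt k (A / t, b t, \<sigma> * (t / A), \<beta> / t))"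
              unfolding cusp_a_def sa_clear_def mem_Collect_eq p fst_conv by blast+
            have "A / t < \<beta> / t" using \<beta> pos elim by (simp add: divide_strict_right_mono)
            moreover have "0 < \<sigma> * (t / A)" using pos elim by simp
            ultimately have "t * (\<beta> / t - A / t) < \<sigma> * (t / A) * (A / t)" by (rule clear3_sa_necessary(3)[OF C])
            then have "\<beta> - A < \<sigma>" unfolding sa[OF elim] using elim by (simp add: right_diff_distrib)
            then show False using \<beta> by simp
          qed
        qed
      qed
      then show ?thesis using nG by simp
    qed
  qed
qed

text \<open>Coordinates at the other cusp, \<open>b = B / t\<close> and \<open>s b = \<tau>\<close>; the restriction on \<open>\<alpha>\<close> is
  added later, as \<open>\<alpha>\<close> can be close to \<open>0\<close> or to \<open>1\<close>.\<close>

lemma swapped_scaling: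
  fixes \<theta> \<tau> \<beta> :: real
  assumes t: "t > 0" and B: "0 < B"
  defines "a \<equiv> 1 - \<theta> * (B / t)"
  shows "swap_ab (scaling t (B, \<theta>, \<tau>, \<beta>)) = (a, B / t, \<tau> * (t / B), \<beta> / t)"
    "\<tau> * (t / B) * (B / t) = \<tau>" "t * (B / t) = B"
    "0 < \<theta> \<Longrightarrow> \<theta> < 1 \<Longrightarrow> 0 < \<tau> \<Longrightarrow> \<tau> < 1 \<Longrightarrow> 2 * B < t \<Longrightarrow> 0 < x \<Longrightarrow> x \<le> 1 \<Longrightarrow> (a, B / t, \<tau> * (t / B), x) \<in> Omega_coords"
    "0 < \<theta> \<Longrightarrow> \<theta> < 1 \<Longrightarrow> 2 * B < t \<Longrightarrow> 1 / 2 < a \<and> a < 1"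
proof -
  show "swap_ab (scaling t (B, \<theta>, \<tau>, \<beta>)) = (a, B / t, \<tau> * (t / B), \<beta> / t)"
    unfolding swap_ab_def scaling_def a_def by simp
  show e: "\<tau> * (t / B) * (B / t) = \<tau>" "t * (B / t) = B" using t B by simp_all
  have a: "1 / 2 < a \<and> a < 1 \<and> 1 - B / t < a" if "0 < \<theta>" "\<theta> < 1" "2 * B < t"
  proof -
    have "0 < B / t" "B / t < 1 / 2" using t B that by (simp_all add: field_simps)
    moreover have "\<theta> * (B / t) < 1 * (B / t)" using that t B by (intro mult_strict_right_mono) auto
    moreover have "0 < \<theta> * (B / t)" using that t B by simp
    ultimately show ?thesis unfolding a_def by linarith
  qed
  then show "1 / 2 < a \<and> a < 1" if "0 < \<theta>" "\<theta> < 1" "2 * B < t" using that by blast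
  show "(a, B / t, \<tau> * (t / B), x) \<in> Omega_coords" if h: "0 < \<theta>" "\<theta> < 1" "0 < \<tau>" "\<tau> < 1" "2 * B < t" "0 < x" "x \<le> 1"
  proof -
    have b: "0 < B / t" "B / t < 1 / 2" using t B h by (simp_all add: field_simps)
    have "\<tau> * (t / B) * (a * (B / t)) = \<tau> * a" using e(1) by (metis mult.assoc mult.commute)
    also have "\<tau> * a < 1 * 1" using a h by (intro mult_strict_mono) auto
    finally have f: "\<tau> * (t / B) * (a * (B / t)) < 1" by (simp only: mult_1)
    have "0 < a * (B / t)" using a h b by (intro mult_pos_pos) auto
    then have "\<tau> * (t / B) < 1 / (a * (B / t))" using f by (simp only: pos_less_divide_eq)
    moreover have "0 < \<tau> * (t / B)" using h t B by simp
    moreover have "B / t \<le> 1" using b by linarith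
    ultimately show ?thesis unfolding Omega_coords_def Delta_def using a h by auto
  qed
qed

lemma cusp_b_small_bounded:
  assumes t: "t \<ge> 4" and q: "q \<in> cusp_b_small t"
  shows "q \<in> {0..2} \<times> {0..1} \<times> {0..2} \<times> {0..2}"
proof -
  obtain B \<theta> \<tau> \<beta> where qe: "q = (B, \<theta>, \<tau>, \<beta>)" by (cases q)
  have S: "scaling t (B, \<theta>, \<tau>, \<beta>) \<in> Omega_coords"
    using q swap_ab_Omega_coords unfolding cusp_b_small_def sa_clear_def qe by auto
  have t0: "t > 0" using t by simp
  note d = scaling_in_Omega_coordsD[OF t0 S]
  define a where "a = 1 - \<theta> * (B / t)"
  note p = swapped_scaling(1)[OF t0 d(1), of \<theta> \<tau> \<beta>, folded a_def] swapped_scaling(2)[OF t0 d(1), of \<tau>] swapped_scaling(3)[OF t0 d(1)]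
  have C: "(a, B / t, \<tau> * (t / B), \<beta> / t) \<in> Omega_coords" "clear3 t (\<lambda>k. sa_pt k (a, B / t, \<tau> * (t / B), \<beta> / t))" "1 / 2 < a" "\<beta> / t \<le> 1 / 2"
    using q unfolding cusp_b_small_def sa_clear_def mem_Collect_eq qe p(1) scaling_last fst_conv by blast+
  have "1 / a < 2" using C(3) by (rule inverse_less_two)
  have "t * (B / t) < 1 / a - \<tau> * (t / B) * (B / t)" by (rule clear3_sa_necessary(1)[OF C(1,2)])
  then have B: "B + \<tau> < 2" unfolding p(2,3) using \<open>1 / a < 2\<close> by linarith
  have "B / t \<le> 1 / 2" using B d t by (simp add: divide_le_eq)
  then have "\<beta> / t + B / t \<le> 1" using C(4) by linarith
  then have "t * (\<beta> / t + B / t) < 1 / a - \<tau> * (t / B) * (B / t)" by (rule clear3_sa_necessary(2)[OF C(1,2)])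
  then have "\<beta> + B < 2" unfolding p(2) distrib_left p(3) using \<open>1 / a < 2\<close> t0 d by simp
  then show ?thesis using B d unfolding qe by auto
qed

text \<open>Here \<open>a\<close> tends to \<open>1\<close>, so \<open>u = 1 / a - s b\<close> tends to \<open>1 - \<tau>\<close>, and the critical point
  \<open>(\<alpha> + b, u)\<close> turns into the condition \<open>\<beta> + B < 1 - \<tau>\<close>.\<close>

lemma cusp_b_small_limit:
  assumes q: "q = (B, \<theta>, \<tau>, \<beta>)" and ne: "\<theta> \<noteq> 0" "\<tau> \<noteq> 0" "\<beta> + B + \<tau> \<noteq> 1"
  shows "\<forall>\<^sub>F t in at_top. q \<in> cusp_b_small t \<longleftrightarrow> q \<in> limit_b_small"
proof -
  define a where "a t = 1 - \<theta> * (B / t)" for t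
  note z = tendsto_const_div_at_top
  show ?thesis
  proof (cases "0 < B \<and> 0 < \<theta> \<and> \<theta> < 1 \<and> 0 < \<tau> \<and> 0 < \<beta>")
    case False
    have "\<forall>\<^sub>F t in at_top. q \<notin> cusp_b_small t" using eventually_gt_at_top[of 0]
    proof eventually_elim
      case (elim t)
      show ?case
      proof
        assume "q \<in> cusp_b_small t"
        then have "scaling t (B, \<theta>, \<tau>, \<beta>) \<in> Omega_coords" 
          using swap_ab_Omega_coords unfolding cusp_b_small_def sa_clear_def q by auto
        from scaling_in_Omega_coordsD[OF elim this] show False using False ne by auto
      qed
    qed
    moreover have "q \<notin> limit_b_small" using False unfolding limit_b_small_def q by auto
    ultimately show ?thesis by simp
  next
    case True
    then have pos: "0 < B" "0 < \<theta>" "\<theta> < 1" "0 < \<tau>" "0 < \<beta>" by auto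
    note p = swapped_scaling(1)[OF _ pos(1), of _ \<theta> \<tau> \<beta>, folded a_def] swapped_scaling(2)[OF _ pos(1), of _ \<tau>] swapped_scaling(3)[OF _ pos(1)]
    have a1: "(a \<longlongrightarrow> 1 - \<theta> * 0) at_top" unfolding a_def[abs_def] by (intro tendsto_intros z)
    have u: "((\<lambda>t. 1 / a t - \<tau>) \<longlongrightarrow> 1 / (1 - \<theta> * 0) - \<tau>) at_top" by (intro tendsto_intros a1) simp
    show ?thesis
    proof (cases "\<beta> + B + \<tau> < 1")
      case True
      then have G: "q \<in> limit_b_small" using pos unfolding limit_b_small_def q by simp
      have "((\<lambda>t. (1 / a t - \<tau>) * (1 + \<beta> / t)) \<longlongrightarrow> (1 / (1 - \<theta> * 0) - \<tau>) * (1 + 0)) at_top"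
        by (intro tendsto_mult[OF u] tendsto_intros z)
      then have ev: "\<forall>\<^sub>F t in at_top. (1 / a t - \<tau>) * (1 + \<beta> / t) < 1" by (rule order_tendstoD) (use pos in simp)
      have "\<forall>\<^sub>F t in at_top. q \<in> cusp_b_small t"
        using ev eventually_gt_at_top[of "max (2 * B) (max 1 (2 * \<beta>))"]
      proof eventually_elim
        case (elim t)
        then have t: "t > 0" "2 * B < t" "2 * \<beta> < t" by auto
        have at: "1 / 2 < a t" "a t < 1" using swapped_scaling(5)[OF t(1) pos(1) pos(2,3) t(2)] unfolding a_def by auto
        have \<beta>t: "0 < \<beta> / t" "\<beta> / t \<le> 1 / 2" using t pos by (simp_all add: field_simps)
        have C: "(a t, B / t, \<tau> * (t / B), \<beta> / t) \<in> Omega_coords"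
          unfolding a_def by (rule swapped_scaling(4)[OF t(1) pos(1)]) (use pos True t \<beta>t in auto)
        have "1 \<le> 1 / a t" using at by simp
        have "clear3 t (\<lambda>k. sa_pt k (a t, B / t, \<tau> * (t / B), \<beta> / t))"
        proof (rule clear3_cusp_b_small_alpha)
          show "t * (\<beta> / t) < 1 / a t - \<tau> * (t / B) * (B / t) - t * (B / t)"
            unfolding p(2,3)[OF t(1)] using True t \<open>1 \<le> 1 / a t\<close> by simp
          show "(1 / a t - \<tau> * (t / B) * (B / t)) * (1 + \<beta> / t) < 1" unfolding p(2)[OF t(1)] by (rule elim(1))
        qed (use at pos t \<beta>t in auto)
        then show ?case unfolding cusp_b_small_def sa_clear_def mem_Collect_eq q p(1)[OF t(1)] scaling_last fst_conv
          using C at \<beta>t by blast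
      qed
      then show ?thesis using G by simp
    next
      case False
      then have nG: "q \<notin> limit_b_small" and g: "\<beta> + B + \<tau> > 1" using ne unfolding limit_b_small_def q by auto
      have "\<forall>\<^sub>F t in at_top. 1 / a t - \<tau> < \<beta> + B" using u by (rule order_tendstoD) (use g in simp)
      then have "\<forall>\<^sub>F t in at_top. q \<notin> cusp_b_small t"
        using eventually_gt_at_top[of "max 1 (2 * B)"]
      proof eventually_elim
        case (elim t)
        then have t: "t > 0" "2 * B < t" by auto
        show ?case
        proof
          assume "q \<in> cusp_b_small t"
          then have C: "(a t, B / t, \<tau> * (t / B), \<beta> / t) \<in> Omega_coords" "clear3 t (\<lambda>k. sa_pt k (a t, B / t, \<tau> * (t / B), \<beta> / t))" "\<beta> / t \<le> 1 / 2"
            unfolding cusp_b_small_def sa_clear_def mem_Collect_eq q p(1)[OF t(1)] scaling_last fst_conv by blast+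
          have "B / t \<le> 1 / 2" using t by (simp add: divide_le_eq)
          then have "\<beta> / t + B / t \<le> 1" using C(3) by linarith
          then have "t * (\<beta> / t + B / t) < 1 / a t - \<tau> * (t / B) * (B / t)" by (rule clear3_sa_necessary(2)[OF C(1,2)])
          then have "\<beta> + B < 1 / a t - \<tau>" unfolding p(2)[OF t(1)] distrib_left p(3)[OF t(1)] using t by simp
          then show False using elim by simp
        qed
      qed
      then show ?thesis using nG by simp
    qed
  qed
qed

lemma cusp_b_large_coords:
  assumes t: "t > 0" and q: "(B, \<theta>, \<tau>, \<beta>) \<in> cusp_b_large t"
  defines "a \<equiv> 1 - \<theta> * (B / t)"
  shows "0 < B" "0 \<le> \<theta>" "\<theta> < 1" "0 \<le> \<tau>" "0 \<le> \<beta>"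
    "(a, B / t, \<tau> * (t / B), 1 - \<beta> / t) \<in> Omega_coords" "clear3 t (\<lambda>k. sa_pt k (a, B / t, \<tau> * (t / B), 1 - \<beta> / t))"
    "1 / 2 < a" "\<beta> / t < 1 / 2"
proof -
  have p: "swap_ab (scaling t (B, \<theta>, \<tau>, \<beta>)) = (a, B / t, \<tau> * (t / B), \<beta> / t)"
    "snd (snd (snd (scaling t (B, \<theta>, \<tau>, \<beta>)))) = \<beta> / t"
    unfolding swap_ab_def scaling_def a_def by simp_all
  show C: "(a, B / t, \<tau> * (t / B), 1 - \<beta> / t) \<in> Omega_coords" "clear3 t (\<lambda>k. sa_pt k (a, B / t, \<tau> * (t / B), 1 - \<beta> / t))"
    "1 / 2 < a" "\<beta> / t < 1 / 2"
    using q unfolding cusp_b_large_def sa_clear_def mem_Collect_eq p reflect_last_def fst_conv snd_conv by blast+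
  then have "(a, B / t, \<tau> * (t / B), 1) \<in> Omega_coords" unfolding Omega_coords_def by auto
  then have "scaling t (B, \<theta>, \<tau>, t) \<in> Omega_coords"
    using swap_ab_Omega_coords[of "scaling t (B, \<theta>, \<tau>, t)"] t unfolding swap_ab_def scaling_def a_def by simp
  from scaling_in_Omega_coordsD[OF t this] show "0 < B" "0 \<le> \<theta>" "\<theta> < 1" "0 \<le> \<tau>" by auto
  have "1 - \<beta> / t \<le> 1" using C(1) unfolding Omega_coords_def by simp
  then show "0 \<le> \<beta>" using t by (simp add: zero_le_divide_iff)
qed

text \<open>For \<open>\<beta> \<ge> B\<close> the point \<open>(\<alpha> + b, 1 / a - s b)\<close> would lie in the strip, with first coordinate at
  least \<open>1 / 2\<close> and height less than \<open>2\<close>.\<close>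

lemma cusp_b_large_less:
  assumes t: "t \<ge> 4" and q: "(B, \<theta>, \<tau>, \<beta>) \<in> cusp_b_large t"
  shows "\<beta> < B"
proof (rule ccontr)
  have t0: "t > 0" using t by simp
  note c = cusp_b_large_coords[OF t0 q]
  let ?a = "1 - \<theta> * (B / t)"
  note p = swapped_scaling(2)[OF t0 c(1), of \<tau>] swapped_scaling(3)[OF t0 c(1)]
  assume "\<not> \<beta> < B"
  then have "B / t \<le> \<beta> / t" using t0 by (simp add: divide_right_mono)
  then have "1 - \<beta> / t + B / t \<le> 1" by simp
  then have "t * (1 - \<beta> / t + B / t) < 1 / ?a - \<tau> * (t / B) * (B / t)" by (rule clear3_sa_necessary(2)[OF c(6,7)])
  moreover have "1 / ?a < 2" using c(8) by (rule inverse_less_two)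
  moreover have "1 / 2 \<le> 1 - \<beta> / t + B / t" using c(9) divide_pos_pos[OF c(1) t0] by linarith
  then have "4 * (1 / 2) \<le> t * (1 - \<beta> / t + B / t)" using t by (intro mult_mono) auto
  ultimately show False unfolding p(1) using c(4) by linarith
qed

lemma cusp_b_large_bounded:
  assumes t: "t \<ge> 4" and q: "q \<in> cusp_b_large t"
  shows "q \<in> {0..2} \<times> {0..1} \<times> {0..2} \<times> {0..2}"
proof -
  obtain B \<theta> \<tau> \<beta> where qe: "q = (B, \<theta>, \<tau>, \<beta>)" by (cases q)
  have t0: "t > 0" using t by simp
  note c = cusp_b_large_coords[OF t0 q[unfolded qe]]
  have "1 / (1 - \<theta> * (B / t)) < 2" using c(8) by (rule inverse_less_two)
  moreover have "t * (B / t) < 1 / (1 - \<theta> * (B / t)) - \<tau> * (t / B) * (B / t)" by (rule clear3_sa_necessary(1)[OF c(6,7)])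
  ultimately have "B + \<tau> < 2" unfolding swapped_scaling(2,3)[OF t0 c(1)] by linarith
  then show ?thesis using c cusp_b_large_less[OF t q[unfolded qe]] unfolding qe by auto
qed

text \<open>For \<open>\<tau> > 1 / 2\<close> the condition besides \<open>\<beta> < B\<close> is \<open>B + \<tau> < 1\<close>, from the lattice vector
  \<open>(b, 1 / a - s b)\<close>. For \<open>\<tau> < 1 / 2\<close> the limit is empty: the points with \<open>m = 1\<close> in the translate
  by \<open>- \<alpha>\<close> have horizontal spacing \<open>b \<rightarrow> 0\<close>, they are in the strip and above the axis for
  \<open>1 / (1 - \<tau>) < j < 2\<close> in the limit, and in the triangle for \<open>j\<close> near the lower bound.\<close>

lemma cusp_b_large_limit:
  assumes q: "q = (B, \<theta>, \<tau>, \<beta>)" and ne: "\<theta> \<noteq> 0" "\<tau> \<noteq> 0" "\<beta> \<noteq> 0" "B + \<tau> \<noteq> 1" "\<tau> \<noteq> 1 / 2"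
  shows "\<forall>\<^sub>F t in at_top. q \<in> cusp_b_large t \<longleftrightarrow> q \<in> limit_b_large"
proof (cases "0 < B \<and> 0 < \<theta> \<and> \<theta> < 1 \<and> 0 < \<tau> \<and> 0 < \<beta> \<and> \<beta> < B")
  case False
  have "\<forall>\<^sub>F t in at_top. q \<notin> cusp_b_large t" using eventually_ge_at_top[of 4]
  proof eventually_elim
    case (elim t)
    then have t0: "t > 0" by simp
    show ?case
    proof
      assume "q \<in> cusp_b_large t"
      then have h: "(B, \<theta>, \<tau>, \<beta>) \<in> cusp_b_large t" unfolding q .
      from cusp_b_large_coords(1-5)[OF t0 h] cusp_b_large_less[OF elim h] show False using False ne by linarith
    qed
  qed
  moreover have "q \<notin> limit_b_large" using False unfolding limit_b_large_def q by auto
  ultimately show ?thesis by simp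
next
  case True
  then have pos: "0 < B" "0 < \<theta>" "\<theta> < 1" "0 < \<tau>" "0 < \<beta>" "\<beta> < B" by auto
  define a where "a t = 1 - \<theta> * (B / t)" for t
  note z = tendsto_const_div_at_top
  note p = swapped_scaling(1)[OF _ pos(1), of _ \<theta> \<tau> \<beta>, folded a_def] swapped_scaling(2)[OF _ pos(1), of _ \<tau>] swapped_scaling(3)[OF _ pos(1)]
  have a1: "(a \<longlongrightarrow> 1 - \<theta> * 0) at_top" unfolding a_def[abs_def] by (intro tendsto_intros z)
  have "((\<lambda>t. 1 / a t - \<tau>) \<longlongrightarrow> 1 / (1 - \<theta> * 0) - \<tau>) at_top" by (intro tendsto_intros a1) simp
  then have u: "((\<lambda>t. 1 / a t - \<tau>) \<longlongrightarrow> 1 - \<tau>) at_top" by simp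
  show ?thesis
  proof (cases "1 / 2 < \<tau> \<and> B + \<tau> < 1")
    case True
    then have G: "q \<in> limit_b_large" using pos unfolding limit_b_large_def q by simp
    have ev: "\<forall>\<^sub>F t in at_top. 1 / a t - \<tau> < 1 / 2" "\<forall>\<^sub>F t in at_top. 1 / a t - \<tau> > B"
      by (rule order_tendstoD[OF u], use True in simp)+
    have "\<forall>\<^sub>F t in at_top. q \<in> cusp_b_large t"
      using ev eventually_gt_at_top[of "max 1 (2 * B)"]
    proof eventually_elim
      case (elim t)
      then have t: "t > 0" "2 * B < t" "2 * \<beta> < t" using pos by auto
      have at: "1 / 2 < a t" using swapped_scaling(5)[OF t(1) pos(1) pos(2,3) t(2)] unfolding a_def by auto
      have \<beta>t: "0 < \<beta> / t" "\<beta> / t < 1 / 2" using t pos by (simp_all add: field_simps)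
      have C: "(a t, B / t, \<tau> * (t / B), 1 - \<beta> / t) \<in> Omega_coords"
        unfolding a_def by (rule swapped_scaling(4)[OF t(1) pos(1)]) (use pos True t \<beta>t in auto)
      have "clear3 t (\<lambda>k. sa_pt k (a t, B / t, \<tau> * (t / B), 1 - \<beta> / t))"
      proof (rule clear3_cusp_b_large_alpha)
        show "0 < 1 / a t - \<tau> * (t / B) * (B / t) - t * (B / t)" unfolding p(2,3)[OF t(1)] using elim by simp
        show "1 / a t - \<tau> * (t / B) * (B / t) \<le> 1 / 2" unfolding p(2)[OF t(1)] using elim by simp
        have "\<beta> / t < B / t" using pos t by (intro divide_strict_right_mono) auto
        then show "1 - (1 - \<beta> / t) < B / t" by linarith
        show "0 < B / t" "0 < 1 - \<beta> / t" "1 - \<beta> / t \<le> 1" using pos t \<beta>t by auto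
      qed (use at t in auto)
      then show ?case unfolding cusp_b_large_def sa_clear_def mem_Collect_eq q p(1)[OF t(1)] scaling_last reflect_last_def fst_conv snd_conv
        using C at \<beta>t by blast
    qed
    then show ?thesis using G by simp
  next
    case False
    then have nG: "q \<notin> limit_b_large" unfolding limit_b_large_def q by auto
    have "\<forall>\<^sub>F t in at_top. q \<notin> cusp_b_large t"
    proof (cases "B + \<tau> > 1")
      case True
      have "\<forall>\<^sub>F t in at_top. 1 / a t - \<tau> < B" by (rule order_tendstoD[OF u]) (use True in simp)
      then show ?thesis using eventually_gt_at_top[of 0]
      proof eventually_elim
        case (elim t)
        show ?case
        proof
          assume "q \<in> cusp_b_large t"
          then have h: "(B, \<theta>, \<tau>, \<beta>) \<in> cusp_b_large t" unfolding q .
          note c = cusp_b_large_coords[OF elim(2) h, folded a_def]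
          have "t * (B / t) < 1 / a t - \<tau> * (t / B) * (B / t)" by (rule clear3_sa_necessary(1)[OF c(6,7)])
          then show False unfolding p(2,3)[OF elim(2)] using elim by simp
        qed
      qed
    next
      case False
      then have \<tau>: "\<tau> < 1 / 2" "B + \<tau> < 1" using ne \<open>\<not> (1 / 2 < \<tau> \<and> B + \<tau> < 1)\<close> by auto
      define \<rho> where "\<rho> = 1 - \<tau> - B"
      have \<rho>: "0 < \<rho>" unfolding \<rho>_def using \<tau> by simp
      have "1 / (1 - \<tau>) < 2" using \<tau> by (simp add: divide_less_eq)
      moreover have "1 / (1 - \<tau>) < (1 - B) / \<rho>"
      proof -
        have "0 < B * \<tau>" using pos by simp
        then have "1 * \<rho> < (1 - B) * (1 - \<tau>)" unfolding \<rho>_def by (simp add: algebra_simps)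
        then show ?thesis using \<tau> \<rho> by (simp add: divide_less_eq less_divide_eq)
      qed
      \<comment> \<open>\<open>j > 1 / (1 - \<tau>)\<close> puts the point above the axis, the other bounds put it into the strip and the triangle\<close>
      ultimately obtain j where j: "1 / (1 - \<tau>) < j" "j < min 2 ((1 - B) / \<rho>)" using dense[of "1 / (1 - \<tau>)" "min 2 ((1 - B) / \<rho>)"] by auto
      have j1: "1 < j" "1 < j * (1 - \<tau>)" "j < 2" "j * \<rho> < 1 - B"
      proof -
        show "1 < j * (1 - \<tau>)" using j \<tau> by (simp add: divide_less_eq)
        have "1 \<le> 1 / (1 - \<tau>)" using \<tau> pos by simp
        then show "1 < j" using j by linarith
        show "j < 2" "j * \<rho> < 1 - B" using j \<rho> by (simp_all add: less_divide_eq)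
      qed
      have "((\<lambda>t. j - B / t) \<longlongrightarrow> j - 0) at_top" by (intro tendsto_intros z)
      then have ev1: "\<forall>\<^sub>F t in at_top. 1 < j - B / t" by (rule order_tendstoD) (use j1 in simp)
      have "((\<lambda>t. 2 - \<beta> / t) \<longlongrightarrow> 2 - 0) at_top" by (intro tendsto_intros z)
      then have ev2: "\<forall>\<^sub>F t in at_top. j < 2 - \<beta> / t" by (rule order_tendstoD) (use j1 in simp)
      have "((\<lambda>t. (j - B / t) * (1 / a t - \<tau>)) \<longlongrightarrow> (j - 0) * (1 - \<tau>)) at_top" by (intro tendsto_mult[OF _ u] tendsto_intros z)
      then have ev3: "\<forall>\<^sub>F t in at_top. 1 < (j - B / t) * (1 / a t - \<tau>)" by (rule order_tendstoD) (use j1 in simp)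
      have "((\<lambda>t. 1 - B * (1 - \<beta> / t) - j * (1 / a t - \<tau> - B)) \<longlongrightarrow> 1 - B * (1 - 0) - j * (1 - \<tau> - B)) at_top"
        by (intro tendsto_diff tendsto_mult u tendsto_const z)
      then have ev4: "\<forall>\<^sub>F t in at_top. 0 < 1 - B * (1 - \<beta> / t) - j * (1 / a t - \<tau> - B)"
        by (rule order_tendstoD) (use j1 \<rho>_def in simp)
      have ev5: "\<forall>\<^sub>F t in at_top. 1 / a t - \<tau> > B" by (rule order_tendstoD[OF u]) (use \<tau> in simp)
      show ?thesis using ev1 ev2 ev3 ev4 ev5 eventually_gt_at_top[of 0]
      proof eventually_elim
        case (elim t)
        show ?case
        proof
          assume "q \<in> cusp_b_large t"
          then have h: "(B, \<theta>, \<tau>, \<beta>) \<in> cusp_b_large t" unfolding q .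
          note c = cusp_b_large_coords[OF elim(6) h, folded a_def]
          have b: "0 < B / t" using pos elim by simp
          \<comment> \<open>the last point with \<open>m = 1\<close> up to \<open>j\<close>, which converges to \<open>j\<close> as \<open>t \<rightarrow> \<infinity>\<close>\<close>
          define n where "n = \<lfloor>(j - a t) / (B / t)\<rfloor>"
          have "n \<le> (j - a t) / (B / t)" "(j - a t) / (B / t) < n + 1" unfolding n_def by linarith+
          then have "n * (B / t) \<le> j - a t" "j - a t < (n + 1) * (B / t)"
            using b by (simp_all only: pos_le_divide_eq pos_divide_less_eq)
          then have x: "a t + B / t * n \<le> j" "j - B / t < a t + B / t * n" by (simp_all add: algebra_simps)
          have u0: "0 < 1 / a t - \<tau>" "0 < 1 / a t - \<tau> - B" using elim pos by linarith+
          have "1 - t * (B / t) * (1 - \<beta> / t) < (a t + B / t * n) * (1 / a t - \<tau> * (t / B) * (B / t) - t * (B / t))"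
          proof (rule clear3_sa_necessary(4)[OF c(6,7)])
            have "0 \<le> \<beta> / t" using pos elim by simp
            then show "1 - \<beta> / t < a t + B / t * n" using x elim by linarith
            show "a t + B / t * n \<le> 1 + (1 - \<beta> / t)" using x elim by linarith
            have "(j - B / t) * (1 / a t - \<tau>) \<le> (a t + B / t * n) * (1 / a t - \<tau>)" using x u0 by (intro mult_right_mono) auto
            then show "1 < (a t + B / t * n) * (1 / a t - \<tau> * (t / B) * (B / t))" unfolding p(2)[OF elim(6)] using elim by linarith
          qed
          then have "1 - B * (1 - \<beta> / t) < (a t + B / t * n) * (1 / a t - \<tau> - B)" unfolding p(2,3)[OF elim(6)] .
          also have "\<dots> \<le> j * (1 / a t - \<tau> - B)" using x u0 by (intro mult_right_mono) auto
          finally show False using elim by linarith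
        qed
      qed
    qed
    then show ?thesis using nG by simp
  qed
qed

lemma measure_scaling:
  assumes E: "E \<in> sets borel" "\<And>p. p \<in> E \<Longrightarrow> fst p > 0" and t: "t > 0"
  shows "measure lborel E = 1 / t\<^sup>2 * measure lborel {q. scaling t q \<in> E}"
  unfolding measure_def by (subst emeasure_scaling[OF E t]) (auto simp: enn2real_mult)

lemma tendsto_measure_dominated:
  fixes F :: "real \<Rightarrow> 'a::euclidean_space set"
  assumes F: "\<And>t. F t \<in> sets borel" and G: "G \<in> sets borel" and K: "K \<in> sets borel" "bounded K"
    and dom: "\<And>t. t \<ge> T \<Longrightarrow> AE q in lborel. q \<in> F t \<longrightarrow> q \<in> K"
    and lim: "AE q in lborel. \<forall>\<^sub>F t in at_top. q \<in> F t \<longleftrightarrow> q \<in> G"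
  shows "((\<lambda>t. measure lborel (F t)) \<longlongrightarrow> measure lborel G) at_top"
  using tendsto_integral_indicator[OF F G K _ _ zero_le_one dom lim, of "\<lambda>_. 1"] by simp

text \<open>Each of the three parts is transported to the corner \<open>(0, 1)\<close> by symmetries that preserve the
  volume, and blown up there.\<close>

lemma measure_sa_clear_eq:
  assumes t: "t > 0"
  shows "t\<^sup>2 * measure lborel (sa_clear t)
    = measure lborel (cusp_a t) + measure lborel (cusp_b_small t) + measure lborel (cusp_b_large t)"
proof -
  let ?S = "sa_clear t"
  define S1 where "S1 = {p \<in> ?S. fst p \<le> 1 / 2}"
  define S2 where "S2 = {p \<in> ?S. 1 / 2 < fst p \<and> snd (snd (snd p)) \<le> 1 / 2}"
  define S3 where "S3 = {p \<in> ?S. 1 / 2 < fst p \<and> 1 / 2 < snd (snd (snd p))}"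
  have m: "S1 \<in> sets borel" "S2 \<in> sets borel" "S3 \<in> sets borel" unfolding S1_def S2_def S3_def by measurable
  have sub: "S1 \<subseteq> Omega_coords" "S2 \<subseteq> Omega_coords" "S3 \<subseteq> Omega_coords"
    unfolding S1_def S2_def S3_def sa_clear_def by blast+
  have pos: "0 < fst p \<and> 0 < fst (snd p)" if "p \<in> Omega_coords" for p
    using that unfolding Omega_coords_def Delta_def by auto
  have fin: "emeasure lborel S \<noteq> \<infinity>" if "S \<subseteq> Omega_coords" for S
  proof -
    have "emeasure lborel S \<le> emeasure lborel Omega_coords" using that sets_Delta_coords by (intro emeasure_mono) auto
    then show ?thesis using emeasure_Omega_coords_finite by (auto simp: top_unique)
  qed
  have "?S = (S1 \<union> S2) \<union> S3" unfolding S1_def S2_def S3_def by auto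
  moreover have "measure lborel ((S1 \<union> S2) \<union> S3) = measure lborel (S1 \<union> S2) + measure lborel S3"
    by (rule measure_Union) (use m fin sub in \<open>auto simp: S1_def S2_def S3_def\<close>)
  moreover have "measure lborel (S1 \<union> S2) = measure lborel S1 + measure lborel S2"
    by (rule measure_Union) (use m fin sub in \<open>auto simp: S1_def S2_def S3_def\<close>)
  moreover have "measure lborel S1 = 1 / t\<^sup>2 * measure lborel (cusp_a t)"
  proof -
    have "{q. scaling t q \<in> S1} = cusp_a t" unfolding S1_def cusp_a_def by blast
    then show ?thesis using measure_scaling[OF m(1) _ t] pos sub by (metis subsetD)
  qed
  moreover have "measure lborel S2 = 1 / t\<^sup>2 * measure lborel (cusp_b_small t)"
  proof -
    have P: "{p. swap_ab p \<in> S2} \<in> sets borel"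
      using measurable_sets_borel[OF measurable_swap_ab m(2)] by (simp add: vimage_def)
    have "fst p > 0" if "p \<in> {p. swap_ab p \<in> S2}" for p
      using pos[of "swap_ab p"] that sub unfolding swap_ab_def by auto
    from measure_scaling[OF P this t]
    have "measure lborel {p. swap_ab p \<in> S2} = 1 / t\<^sup>2 * measure lborel {q. scaling t q \<in> {p. swap_ab p \<in> S2}}" .
    moreover have "{q. scaling t q \<in> {p. swap_ab p \<in> S2}} = cusp_b_small t"
      unfolding S2_def cusp_b_small_def by (auto simp: swap_ab_def)
    moreover have "measure lborel S2 = measure lborel {p. swap_ab p \<in> S2}"
      unfolding measure_def using emeasure_swap_ab[OF m(2)] by simp
    ultimately show ?thesis by simp
  qed
  moreover have "measure lborel S3 = 1 / t\<^sup>2 * measure lborel (cusp_b_large t)"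
  proof -
    have R: "{p. reflect_last p \<in> S3} \<in> sets borel"
      using measurable_sets_borel[OF measurable_reflect_last m(3)] by (simp add: vimage_def)
    have P: "{p. swap_ab p \<in> {p. reflect_last p \<in> S3}} \<in> sets borel"
      using measurable_sets_borel[OF measurable_swap_ab R] by (simp add: vimage_def)
    have "fst p > 0" if "p \<in> {p. swap_ab p \<in> {p. reflect_last p \<in> S3}}" for p
      using pos[of "reflect_last (swap_ab p)"] that sub unfolding swap_ab_def reflect_last_def by auto
    from measure_scaling[OF P this t]
    have "measure lborel {p. swap_ab p \<in> {p. reflect_last p \<in> S3}} = 1 / t\<^sup>2 * measure lborel {q. scaling t q \<in> {p. swap_ab p \<in> {p. reflect_last p \<in> S3}}}" .
    moreover have "{q. scaling t q \<in> {p. swap_ab p \<in> {p. reflect_last p \<in> S3}}} = cusp_b_large t"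
      unfolding S3_def cusp_b_large_def by (auto simp: swap_ab_def reflect_last_def)
    moreover have "measure lborel S3 = measure lborel {p. swap_ab p \<in> {p. reflect_last p \<in> S3}}"
      unfolding measure_def emeasure_reflect_last[OF m(3)] emeasure_swap_ab[OF R] by simp
    ultimately show ?thesis by simp
  qed
  ultimately have "measure lborel ?S = 1 / t\<^sup>2 * (measure lborel (cusp_a t) + measure lborel (cusp_b_small t) + measure lborel (cusp_b_large t))"
    by (simp add: distrib_left)
  then show ?thesis using t by simp
qed

lemma bounded_box4: "bounded ({0..c0} \<times> {0..c1} \<times> {0..c2} \<times> {0..c3::real} :: (real \<times> real \<times> real \<times> real) set)"
  by (intro bounded_Times bounded_closed_interval)

lemma borel_box4: "({0..c0} \<times> {0..c1} \<times> {0..c2} \<times> {0..c3::real} :: (real \<times> real \<times> real \<times> real) set) \<in> sets borel"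
  by (intro borel_closed closed_Times) auto

lemma AE_coordinate4:
  fixes c :: real
  shows "AE p :: real \<times> real \<times> real \<times> real in lborel. fst p \<noteq> c" "AE p :: real \<times> real \<times> real \<times> real in lborel. fst (snd p) \<noteq> c"
    "AE p :: real \<times> real \<times> real \<times> real in lborel. fst (snd (snd p)) \<noteq> c" "AE p :: real \<times> real \<times> real \<times> real in lborel. snd (snd (snd p)) \<noteq> c"
  using AE_hyperplane4[of 1 0 0 0 c] AE_hyperplane4[of 0 1 0 0 c] AE_hyperplane4[of 0 0 1 0 c] AE_hyperplane4[of 0 0 0 1 c] by simp_all

lemma tendsto_sa_clear:
  "((\<lambda>t. t\<^sup>2 * measure lborel (sa_clear t)) \<longlongrightarrow>
     measure lborel limit_a + measure lborel limit_b_small + measure lborel limit_b_large) at_top"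
proof -
  note h = AE_coordinate4
  have "((\<lambda>t. measure lborel (cusp_a t)) \<longlongrightarrow> measure lborel limit_a) at_top"
  proof (rule tendsto_measure_dominated[OF sets_cusps(1) sets_limits(1) borel_box4 bounded_box4, where T = 1])
    show "AE q in lborel. q \<in> cusp_a t \<longrightarrow> q \<in> {0..2} \<times> {0..1} \<times> {0..2} \<times> {0..4}" if "t \<ge> 1" for t
      using h(3)[of 0] by eventually_elim (use cusp_a_bounded[of t] that in auto)
    show "AE q in lborel. \<forall>\<^sub>F t in at_top. q \<in> cusp_a t \<longleftrightarrow> q \<in> limit_a"
      using h(1)[of 0] h(2)[of 0] h(3)[of 0] AE_hyperplane4[of 1 0 1 0 1, OF disjI1[OF one_neq_zero]] AE_hyperplane4[of 1 0 1 "-1" 0, OF disjI1[OF one_neq_zero]]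
    proof eventually_elim
      case (elim q)
      show ?case
        by (rule cusp_a_limit[of q "fst q" "fst (snd q)" "fst (snd (snd q))" "snd (snd (snd q))"]) (use elim in auto)
    qed
  qed
  moreover have "((\<lambda>t. measure lborel (cusp_b_small t)) \<longlongrightarrow> measure lborel limit_b_small) at_top"
  proof (rule tendsto_measure_dominated[OF sets_cusps(2) sets_limits(2) borel_box4 bounded_box4, where T = 4])
    show "AE q in lborel. q \<in> cusp_b_small t \<longrightarrow> q \<in> {0..2} \<times> {0..1} \<times> {0..2} \<times> {0..2}" if "t \<ge> 4" for t
      using cusp_b_small_bounded[OF that] by (intro AE_I2) blast
    show "AE q in lborel. \<forall>\<^sub>F t in at_top. q \<in> cusp_b_small t \<longleftrightarrow> q \<in> limit_b_small"
      using h(2)[of 0] h(3)[of 0] AE_hyperplane4[of 1 0 1 1 1, OF disjI1[OF one_neq_zero]]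
    proof eventually_elim
      case (elim q)
      show ?case
        by (rule cusp_b_small_limit[of q "fst q" "fst (snd q)" "fst (snd (snd q))" "snd (snd (snd q))"]) (use elim in auto)
    qed
  qed
  moreover have "((\<lambda>t. measure lborel (cusp_b_large t)) \<longlongrightarrow> measure lborel limit_b_large) at_top"
  proof (rule tendsto_measure_dominated[OF sets_cusps(3) sets_limits(3) borel_box4 bounded_box4, where T = 4])
    show "AE q in lborel. q \<in> cusp_b_large t \<longrightarrow> q \<in> {0..2} \<times> {0..1} \<times> {0..2} \<times> {0..2}" if "t \<ge> 4" for t
      using cusp_b_large_bounded[OF that] by (intro AE_I2) blast
    show "AE q in lborel. \<forall>\<^sub>F t in at_top. q \<in> cusp_b_large t \<longleftrightarrow> q \<in> limit_b_large"
      using h(2)[of 0] h(3)[of 0] h(4)[of 0] AE_hyperplane4[of 1 0 1 0 1, OF disjI1[OF one_neq_zero]] h(3)[of "1 / 2"]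
    proof eventually_elim
      case (elim q)
      show ?case
        by (rule cusp_b_large_limit[of q "fst q" "fst (snd q)" "fst (snd (snd q))" "snd (snd (snd q))"]) (use elim in auto)
    qed
  qed
  ultimately have "((\<lambda>t. measure lborel (cusp_a t) + measure lborel (cusp_b_small t) + measure lborel (cusp_b_large t)) \<longlongrightarrow>
     measure lborel limit_a + measure lborel limit_b_small + measure lborel limit_b_large) at_top"
    by (intro tendsto_add)
  moreover have "\<forall>\<^sub>F t in at_top. measure lborel (cusp_a t) + measure lborel (cusp_b_small t) + measure lborel (cusp_b_large t) = t\<^sup>2 * measure lborel (sa_clear t)"
    using eventually_gt_at_top[of 0] by eventually_elim (simp only: measure_sa_clear_eq)
  ultimately show ?thesis by (rule Lim_transform_eventually)
qed

text \<open>The only positive contribution needed for the limit to be nonzero.\<close>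

lemma measure_limit_a_pos: "measure lborel limit_a > 0"
proof -
  have "limit_a \<subseteq> {0..1} \<times> {0..1} \<times> {0..1} \<times> {0..1}" unfolding limit_a_def by auto
  then have "emeasure lborel limit_a < \<infinity>" by (intro emeasure_bounded_finite bounded_subset[OF bounded_box4])
  moreover have "emeasure lborel limit_a > 0"
  proof (rule emeasure_open_pos)
    show "open limit_a" unfolding limit_a_def
      by (intro open_Collect_conj open_Collect_less continuous_intros)
    show "(1 / 4, 1 / 2, 1 / 4, 1 / 4) \<in> limit_a" unfolding limit_a_def by simp
  qed (auto simp: sets_limits)
  ultimately show ?thesis by (simp add: measure_def enn2real_positive_iff)
qed

subsection \<open>Slits over a short lattice vector\<close>

text \<open>For slits over a short lattice vector only \<open>(a, b)\<close> degenerates, while \<open>(x, y)\<close> stays in the unit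
  square. The Jacobian is \<open>A / t\<^sup>2\<close>, which leaves the weight \<open>A\<close> in the limit.\<close>

definition shear :: "real \<Rightarrow> real \<times> real \<times> 'c \<Rightarrow> real \<times> real \<times> 'c" where
  "shear t q = (fst q / t, 1 - fst (snd q) * (fst q / t), snd (snd q))"

lemma measurable_shear[measurable]:
  "shear t \<in> borel_measurable (borel :: (real \<times> real \<times> 'c::second_countable_topology) measure)"
  unfolding shear_def by measurable

lemma measure_shear:
  fixes E :: "(real \<times> real \<times> 'c::euclidean_space) set"
  assumes E: "E \<in> sets borel" "\<And>p. p \<in> E \<Longrightarrow> fst p > 0" and t: "t > 0"
  shows "measure lborel E = 1 / t\<^sup>2 * (\<integral>q. indicator {q. shear t q \<in> E} q * fst q \<partial>lborel)"
proof -
  let ?F = "{q. shear t q \<in> E}"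
  have F: "?F \<in> sets borel"
    using measurable_sets_borel[OF measurable_shear E(1)] by (simp add: vimage_def)
  have pos: "fst q > 0" if "q \<in> ?F" for q
    using E(2)[of "shear t q"] that t unfolding shear_def by (simp add: zero_less_divide_iff)
  have z: "indicator E p = (0::ennreal)" if "fst p \<le> 0" for p
    using E(2)[of p] that by (cases "p \<in> E") simp_all
  have "emeasure lborel E = (\<integral>\<^sup>+p. indicator E p \<partial>lborel)" using E by simp
  also have "\<dots> = (\<integral>\<^sup>+q. ennreal (fst q / t\<^sup>2) * indicator E (shear t q) \<partial>lborel)"
    unfolding shear_def by (rule nn_integral_scale_shear[OF borel_measurable_indicator[OF E(1)] t z])
  also have "\<dots> = (\<integral>\<^sup>+q. ennreal (1 / t\<^sup>2 * (indicator ?F q * fst q)) \<partial>lborel)"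
    by (intro nn_integral_cong) (simp add: indicator_def)
  finally have e: "emeasure lborel E = (\<integral>\<^sup>+q. ennreal (1 / t\<^sup>2 * (indicator ?F q * fst q)) \<partial>lborel)" .
  have "(\<integral>q. 1 / t\<^sup>2 * (indicator ?F q * fst q) \<partial>lborel) = enn2real (emeasure lborel E)"
    unfolding e
  proof (rule integral_eq_nn_integral)
    show "(\<lambda>q. 1 / t\<^sup>2 * (indicator ?F q * fst q)) \<in> borel_measurable lborel" using F by measurable
    show "AE q in lborel. 0 \<le> 1 / t\<^sup>2 * (indicator ?F q * fst q)"
      using pos by (intro AE_I2) (auto simp: indicator_def less_imp_le)
  qed
  then show ?thesis unfolding measure_def by simp
qed

definition sl_cusp_a :: "real \<Rightarrow> (real \<times> real \<times> real \<times> real) set" where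
  "sl_cusp_a t = {q. shear t q \<in> sl_clear t \<and> fst (shear t q) \<le> 1 / 2}"

definition sl_cusp_b :: "real \<Rightarrow> (real \<times> real \<times> real \<times> real) set" where
  "sl_cusp_b t = {q. swap_ab (shear t q) \<in> sl_clear t \<and> 1 / 2 < fst (swap_ab (shear t q))}"

text \<open>The lowest points in the strip have heights \<open>y / a\<close> and \<open>(1 - y) / a\<close> and, in the limit
  \<open>a \<rightarrow> 0\<close>, first coordinate \<open>1\<close>.\<close>

definition sl_limit_a :: "(real \<times> real \<times> real \<times> real) set" where
  "sl_limit_a = {q. 0 < fst q \<and> 0 < fst (snd q) \<and> fst (snd q) < 1
  \<and> 0 < fst (snd (snd q)) \<and> fst (snd (snd q)) < 1 \<and> 0 < snd (snd (snd q)) \<and> snd (snd (snd q)) < 1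
  \<and> fst q < snd (snd (snd q)) \<and> fst q < 1 - snd (snd (snd q))}"

lemma sets_sl_cusps: "sl_cusp_a t \<in> sets borel" "sl_cusp_b t \<in> sets borel" "sl_limit_a \<in> sets borel"
  unfolding sl_cusp_a_def sl_cusp_b_def sl_limit_a_def by measurable

lemma sl_cusp_aD:
  assumes t: "t > 0" and q: "(A, \<theta>, x, y) \<in> sl_cusp_a t"
  defines "a \<equiv> A / t"
  shows "0 < A" "0 \<le> \<theta>" "\<theta> < 1" "0 \<le> x" "x < 1" "0 \<le> y" "y < 1" "a \<le> 1 / 2"
    "(a, 1 - \<theta> * a, x, y) \<in> sl_coords" "clear3 t (\<lambda>k. sl_pt k (a, 1 - \<theta> * a, x, y))"
proof -
  have p: "shear t (A, \<theta>, x, y) = (a, 1 - \<theta> * a, x, y)" unfolding shear_def a_def by simp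
  show C: "(a, 1 - \<theta> * a, x, y) \<in> sl_coords" "clear3 t (\<lambda>k. sl_pt k (a, 1 - \<theta> * a, x, y))" "a \<le> 1 / 2"
    using q unfolding sl_cusp_a_def sl_clear_def mem_Collect_eq p fst_conv by blast+
  have c: "0 < a" "1 - a < 1 - \<theta> * a" "1 - \<theta> * a \<le> 1" "0 \<le> x" "x < 1" "0 \<le> y" "y < 1"
    using C(1) unfolding sl_coords_def Delta_def by auto
  then show "0 \<le> x" "x < 1" "0 \<le> y" "y < 1" by blast+
  show "0 < A" using c(1) t unfolding a_def by (simp add: zero_less_divide_iff)
  show "0 \<le> \<theta>" using c(1,3) by (simp add: zero_le_mult_iff)
  have "\<theta> * a < 1 * a" using c(2) by linarith
  then show "\<theta> < 1" by (rule mult_right_less_imp_less) (use c in simp)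
qed

lemma sl_cusp_a_bounded:
  assumes t: "t > 0" and q: "q \<in> sl_cusp_a t"
  shows "q \<in> {0..2} \<times> {0..1} \<times> {0..1} \<times> {0..1}"
proof -
  obtain A \<theta> x y where qe: "q = (A, \<theta>, x, y)" by (cases q)
  note c = sl_cusp_aD[OF t q[unfolded qe]]
  have a: "0 < A / t" using c(1) t by simp
  have "1 - A / t < 1 - \<theta> * (A / t)" using c(9) unfolding sl_coords_def Delta_def mem_Collect_eq prod.case by blast
  then have b: "1 / 2 < 1 - \<theta> * (A / t)" using c(8) by linarith
  have "t * (1 - \<theta> * (A / t)) < 1 / (A / t)" by (rule clear3_sl_necessary(1)[OF c(9,10) t])
  moreover have "t * (1 / 2) \<le> t * (1 - \<theta> * (A / t))" using b t by (intro mult_left_mono) auto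
  ultimately have "t * (1 / 2) < 1 / (A / t)" by (rule le_less_trans[rotated])
  then have "A * (1 / 2) < 1" using c(1) t by (simp add: field_simps)
  then show ?thesis using c unfolding qe by auto
qed

lemma sl_cusp_a_limit:
  assumes q: "q = (A, \<theta>, x, y)" and ne: "\<theta> \<noteq> 0" "x \<noteq> 0" "y \<noteq> 0" "A \<noteq> y" "A \<noteq> 1 - y"
  shows "\<forall>\<^sub>F t in at_top. q \<in> sl_cusp_a t \<longleftrightarrow> q \<in> sl_limit_a"
proof (cases "0 < A \<and> 0 < \<theta> \<and> \<theta> < 1 \<and> 0 < x \<and> x < 1 \<and> 0 < y \<and> y < 1")
  case False
  have "\<forall>\<^sub>F t in at_top. q \<notin> sl_cusp_a t" using eventually_gt_at_top[of 0]
  proof eventually_elim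
    case (elim t)
    show ?case
    proof
      assume "q \<in> sl_cusp_a t"
      from sl_cusp_aD(1-7)[OF elim this[unfolded q]] show False using False ne by linarith
    qed
  qed
  moreover have "q \<notin> sl_limit_a" using False unfolding sl_limit_a_def q by auto
  ultimately show ?thesis by simp
next
  case True
  then have pos: "0 < A" "0 < \<theta>" "\<theta> < 1" "0 < x" "x < 1" "0 < y" "y < 1" by auto
  show ?thesis
  proof (cases "A < y \<and> A < 1 - y")
    case True
    have "\<forall>\<^sub>F t in at_top. q \<in> sl_cusp_a t" using eventually_gt_at_top[of "2 * A"]
    proof eventually_elim
      case (elim t)
      then have t: "t > 0" using pos by simp
      have a: "0 < A / t" "A / t \<le> 1 / 2" "A / t \<le> 1" "t * (A / t) = A" using elim t pos by (simp_all add: field_simps)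
      have "\<theta> * (A / t) < 1 * (A / t)" by (rule mult_strict_right_mono[OF pos(3) a(1)])
      moreover have "0 < \<theta> * (A / t)" by (rule mult_pos_pos[OF pos(2) a(1)])
      ultimately have b: "1 - A / t < 1 - \<theta> * (A / t)" "1 - \<theta> * (A / t) \<le> 1" by linarith+
      have p: "shear t q = (A / t, 1 - \<theta> * (A / t), x, y)" unfolding shear_def q by simp
      have "(A / t, 1 - \<theta> * (A / t), x, y) \<in> sl_coords" unfolding sl_coords_def Delta_def mem_Collect_eq prod.case
        using a b pos by (intro conjI) (assumption | simp)+
      moreover have "clear3 t (\<lambda>k. sl_pt k (A / t, 1 - \<theta> * (A / t), x, y))"
        by (rule clear3_sl_cusp_a) (unfold a(4), use a t pos True in auto)
      ultimately show ?case unfolding sl_cusp_a_def sl_clear_def mem_Collect_eq p fst_conv using a(2) by blast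
    qed
    moreover have "q \<in> sl_limit_a" using pos True unfolding sl_limit_a_def q by simp
    ultimately show ?thesis by simp
  next
    case False
    define d where "d = (if A > y then y else 1 - y)"
    have d: "d < A" using False ne unfolding d_def by auto
    have "((\<lambda>t. A * (1 - A / t)) \<longlongrightarrow> A * (1 - 0)) at_top" by (intro tendsto_intros tendsto_const_div_at_top)
    then have "\<forall>\<^sub>F t in at_top. d < A * (1 - A / t)" by (rule order_tendstoD) (use d in simp)
    then have "\<forall>\<^sub>F t in at_top. q \<notin> sl_cusp_a t" using eventually_gt_at_top[of 0]
    proof eventually_elim
      case (elim t)
      show ?case
      proof
        assume "q \<in> sl_cusp_a t"
        note c = sl_cusp_aD[OF elim(2) this[unfolded q]]
        have "t * (1 - A / t) < d / (A / t)"
          using clear3_sl_necessary(2)[OF c(9,10) elim(2) pos(6)] clear3_sl_necessary(3)[OF c(9,10) elim(2)] unfolding d_def by simp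
        moreover have "0 < A / t" "A / t \<noteq> 0" using pos elim by simp_all
        ultimately have "t * (1 - A / t) * (A / t) < d" by (simp only: pos_less_divide_eq)
        moreover have "t * (1 - A / t) * (A / t) = A * (1 - A / t)" using elim by simp
        ultimately show False using elim by linarith
      qed
    qed
    moreover have "q \<notin> sl_limit_a" using False unfolding sl_limit_a_def q by auto
    ultimately show ?thesis by simp
  qed
qed

lemma sl_cusp_bD:
  assumes t: "t > 0" and q: "(B, \<theta>, x, y) \<in> sl_cusp_b t"
  defines "a \<equiv> 1 - \<theta> * (B / t)"
  shows "0 < B" "0 \<le> \<theta>" "\<theta> < 1" "0 \<le> x" "x < 1" "0 \<le> y" "y < 1" "1 / 2 < a" "a \<le> 1"
    "(a, B / t, x, y) \<in> sl_coords" "clear3 t (\<lambda>k. sl_pt k (a, B / t, x, y))"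
proof -
  have p: "swap_ab (shear t (B, \<theta>, x, y)) = (a, B / t, x, y)" unfolding shear_def swap_ab_def a_def by simp
  show C: "(a, B / t, x, y) \<in> sl_coords" "clear3 t (\<lambda>k. sl_pt k (a, B / t, x, y))" "1 / 2 < a"
    using q unfolding sl_cusp_b_def sl_clear_def mem_Collect_eq p fst_conv by blast+
  have c: "a \<le> 1" "1 - a < B / t" "0 \<le> x" "x < 1" "0 \<le> y" "y < 1"
    using C(1) unfolding sl_coords_def Delta_def by auto
  then show "0 \<le> x" "x < 1" "0 \<le> y" "y < 1" "a \<le> 1" by blast+
  have b: "0 < B / t" using c by linarith
  then show "0 < B" using t by (simp add: zero_less_divide_iff)
  have "0 \<le> \<theta> * (B / t)" "\<theta> * (B / t) < 1 * (B / t)" using c(1,2) unfolding a_def by linarith+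
  then show "0 \<le> \<theta>" "\<theta> < 1" using b zero_le_mult_iff[of \<theta> "B / t"] mult_right_less_imp_less[of \<theta> "B / t" 1] by auto
qed

lemma sl_cusp_b_bounded:
  assumes t: "t > 0" and q: "q \<in> sl_cusp_b t"
  shows "q \<in> {0..2} \<times> {0..1} \<times> {0..1} \<times> {0..1}"
proof -
  obtain B \<theta> x y where qe: "q = (B, \<theta>, x, y)" by (cases q)
  note c = sl_cusp_bD[OF t q[unfolded qe]]
  have "t * (B / t) < 1 / (1 - \<theta> * (B / t))" by (rule clear3_sl_necessary(1)[OF c(10,11) t])
  moreover have "1 / (1 - \<theta> * (B / t)) < 2" using c(8) by (rule inverse_less_two)
  ultimately have "B < 2" using t by simp
  then show ?thesis using c unfolding qe by auto
qed

text \<open>As \<open>b \<rightarrow> 0\<close> and \<open>a \<rightarrow> 1\<close>, the point \<open>v = (a x + b y, y / a)\<close> has a fixed position inside the strip and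
  lies in the triangle for large \<open>t\<close>. So this cusp does not contribute.\<close>

lemma sl_cusp_b_limit:
  assumes q: "q = (B, \<theta>, x, y)" and ne: "x \<noteq> 0" "y \<noteq> 0"
  shows "\<forall>\<^sub>F t in at_top. q \<notin> sl_cusp_b t"
proof (cases "0 < x \<and> x < 1 \<and> 0 < y")
  case False
  show ?thesis using eventually_gt_at_top[of 0]
  proof eventually_elim
    case (elim t)
    show ?case
    proof
      assume "q \<in> sl_cusp_b t"
      from sl_cusp_bD(4-7)[OF elim this[unfolded q]] show False using False ne by linarith
    qed
  qed
next
  case True
  have "((\<lambda>t. x + B / t * y) \<longlongrightarrow> x + 0 * y) at_top" by (intro tendsto_intros tendsto_const_div_at_top)
  then have "\<forall>\<^sub>F t in at_top. x + B / t * y < 1" by (rule order_tendstoD) (use True in simp)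
  then show ?thesis using eventually_gt_at_top[of "max 0 (4 / x)"]
  proof eventually_elim
    case (elim t)
    then have "4 / x < t" by simp
    moreover have "0 < 4 / x" using True by simp
    ultimately have t: "t > 0" "4 < t * x" using True by (linarith, simp add: pos_divide_less_eq)
    show ?case
    proof
      assume "q \<in> sl_cusp_b t"
      note c = sl_cusp_bD[OF t(1) this[unfolded q]]
      let ?a = "1 - \<theta> * (B / t)"
      have "?a * x \<le> 1 * x" using c(9) True by (intro mult_right_mono) auto
      then have "?a * x + B / t * y \<le> 1" using elim by linarith
      with True have "t * (?a * x + B / t * y) < y / ?a" by (intro clear3_sl_necessary(4)[OF c(10,11) t(1)]) auto
      also have "y / ?a = y * (1 / ?a)" by simp
      also have "\<dots> \<le> 1 * 2"
      proof (rule mult_mono)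
        show "1 / ?a \<le> 2" using inverse_less_two[OF c(8)] by linarith
        show "0 \<le> 1 / ?a" by (rule divide_nonneg_pos) (use c(8) in linarith)+
      qed (use c(7) in auto)
      finally have "t * (?a * x + B / t * y) < 2" by simp
      moreover have "0 \<le> B / t * y" using c True t by simp
      moreover have "1 / 2 * x \<le> ?a * x" using c(8) True by (intro mult_right_mono) auto
      ultimately have "t * (1 / 2 * x) < 2" using t by (smt (verit) mult_left_mono)
      then show False using t by simp
    qed
  qed
qed

lemma tendsto_sl_clear:
  "((\<lambda>t. t\<^sup>2 * measure lborel (sl_clear t)) \<longlongrightarrow> (\<integral>q. indicator sl_limit_a q * fst q \<partial>lborel)) at_top"
proof -
  let ?K = "{0..2} \<times> {0..1} \<times> {0..1} \<times> {0..1} :: (real \<times> real \<times> real \<times> real) set"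
  note h = AE_coordinate4(2-4)
  have f: "fst \<in> borel_measurable (borel :: (real \<times> real \<times> real \<times> real) measure)" by measurable
  have w: "\<bar>fst q\<bar> \<le> 2" if "q \<in> ?K" for q using that by auto
  have la: "((\<lambda>t. \<integral>q. indicator (sl_cusp_a t) q * fst q \<partial>lborel) \<longlongrightarrow> (\<integral>q. indicator sl_limit_a q * fst q \<partial>lborel)) at_top"
  proof (rule tendsto_integral_indicator[OF sets_sl_cusps(1,3) borel_box4 bounded_box4 f w, where T = 1])
    show "AE q in lborel. q \<in> sl_cusp_a t \<longrightarrow> q \<in> ?K" if "t \<ge> 1" for t
      using sl_cusp_a_bounded[of t] that by (intro AE_I2) auto
    show "AE q in lborel. \<forall>\<^sub>F t in at_top. q \<in> sl_cusp_a t \<longleftrightarrow> q \<in> sl_limit_a"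
      using h(1)[of 0] h(2)[of 0] h(3)[of 0] AE_hyperplane4[of 1 0 0 "-1" 0, OF disjI1[OF one_neq_zero]] AE_hyperplane4[of 1 0 0 1 1, OF disjI1[OF one_neq_zero]]
    proof eventually_elim
      case (elim q)
      show ?case
        by (rule sl_cusp_a_limit[of q "fst q" "fst (snd q)" "fst (snd (snd q))" "snd (snd (snd q))"]) (use elim in auto)
    qed
  qed auto
  have lb: "((\<lambda>t. \<integral>q. indicator (sl_cusp_b t) q * fst q \<partial>lborel) \<longlongrightarrow> (\<integral>q. indicator ({} :: (real \<times> real \<times> real \<times> real) set) q * fst q \<partial>lborel)) at_top"
  proof (rule tendsto_integral_indicator[OF sets_sl_cusps(2) _ borel_box4 bounded_box4 f w, where T = 1])
    show "AE q in lborel. q \<in> sl_cusp_b t \<longrightarrow> q \<in> ?K" if "t \<ge> 1" for t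
      using sl_cusp_b_bounded[of t] that by (intro AE_I2) auto
    show "AE q in lborel. \<forall>\<^sub>F t in at_top. q \<in> sl_cusp_b t \<longleftrightarrow> q \<in> {}"
      using h(2)[of 0] h(3)[of 0]
    proof eventually_elim
      case (elim q)
      show ?case
        using sl_cusp_b_limit[of q "fst q" "fst (snd q)" "fst (snd (snd q))" "snd (snd (snd q))"] elim by simp
    qed
  qed auto
  have eq: "(\<integral>q. indicator (sl_cusp_a t) q * fst q \<partial>lborel) + (\<integral>q. indicator (sl_cusp_b t) q * fst q \<partial>lborel) = t\<^sup>2 * measure lborel (sl_clear t)"
    if t: "t > 0" for t
  proof -
    let ?S = "sl_clear t"
    define S1 where "S1 = {p \<in> ?S. fst p \<le> 1 / 2}"
    define S2 where "S2 = {p \<in> ?S. 1 / 2 < fst p}"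
    have m: "S1 \<in> sets borel" "S2 \<in> sets borel" unfolding S1_def S2_def by measurable
    have sub: "S1 \<subseteq> sl_coords" "S2 \<subseteq> sl_coords" unfolding S1_def S2_def sl_clear_def by blast+
    have pos: "0 < fst p \<and> 0 < fst (snd p)" if "p \<in> sl_coords" for p
      using that unfolding sl_coords_def Delta_def by auto
    have fin: "emeasure lborel S \<noteq> \<infinity>" if "S \<subseteq> sl_coords" for S
    proof -
      have "emeasure lborel S \<le> emeasure lborel sl_coords" using that sets_Delta_coords by (intro emeasure_mono) auto
      then show ?thesis using emeasure_coords_finite(2) by (auto simp: top_unique)
    qed
    have "?S = S1 \<union> S2" unfolding S1_def S2_def by auto
    moreover have "measure lborel (S1 \<union> S2) = measure lborel S1 + measure lborel S2"
      by (rule measure_Union) (use m fin sub in \<open>auto simp: S1_def S2_def\<close>)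
    moreover have "measure lborel S1 = 1 / t\<^sup>2 * (\<integral>q. indicator (sl_cusp_a t) q * fst q \<partial>lborel)"
    proof -
      have "{q. shear t q \<in> S1} = sl_cusp_a t" unfolding S1_def sl_cusp_a_def by blast
      then show ?thesis using measure_shear[OF m(1) _ t] pos sub by (metis subsetD)
    qed
    moreover have "measure lborel S2 = 1 / t\<^sup>2 * (\<integral>q. indicator (sl_cusp_b t) q * fst q \<partial>lborel)"
    proof -
      have P: "{p. swap_ab p \<in> S2} \<in> sets borel"
        using measurable_sets_borel[OF measurable_swap_ab m(2)] by (simp add: vimage_def)
      have "fst p > 0" if "p \<in> {p. swap_ab p \<in> S2}" for p
        using pos[of "swap_ab p"] that sub unfolding swap_ab_def by auto
      note measure_shear[OF P this t]
      moreover have "{q. shear t q \<in> {p. swap_ab p \<in> S2}} = sl_cusp_b t" unfolding S2_def sl_cusp_b_def by blast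
      moreover have "measure lborel S2 = measure lborel {p. swap_ab p \<in> S2}"
        unfolding measure_def using emeasure_swap_ab[OF m(2)] by simp
      ultimately show ?thesis by simp
    qed
    ultimately show ?thesis using t by (simp add: distrib_left)
  qed
  have "((\<lambda>t. (\<integral>q. indicator (sl_cusp_a t) q * fst q \<partial>lborel) + (\<integral>q. indicator (sl_cusp_b t) q * fst q \<partial>lborel))
      \<longlongrightarrow> (\<integral>q. indicator sl_limit_a q * fst q \<partial>lborel)) at_top"
    using tendsto_add[OF la lb] by simp
  moreover have "\<forall>\<^sub>F t in at_top. (\<integral>q. indicator (sl_cusp_a t) q * fst q \<partial>lborel) + (\<integral>q. indicator (sl_cusp_b t) q * fst q \<partial>lborel)
      = t\<^sup>2 * measure lborel (sl_clear t)"
    using eventually_gt_at_top[of 0] by eventually_elim (rule eq)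
  ultimately show ?thesis by (rule Lim_transform_eventually)
qed

section \<open>Statistics of gaps\<close>

lemma asymptotic_tail_W: "asymptotic (tail (gap_density m_W R_W)) (\<lambda>t. 1 / t\<^sup>2)"
proof -
  let ?L = "(measure lborel limit_a + measure lborel limit_b_small + measure lborel limit_b_large + (\<integral>q. indicator sl_limit_a q * fst q \<partial>lborel))"
  let ?M = "measure lborel Omega_coords + measure lborel sl_coords"
  have M: "?M > 0" using measure_Omega_clear_less[of 1] measure_nonneg[of lborel "{p \<in> Omega_coords. clear 1 (sa_pt 1 p)}"]
    measure_nonneg[of lborel sl_coords] by linarith
  have "(\<integral>q. indicator sl_limit_a q * fst q \<partial>lborel) \<ge> 0"
    by (intro integral_nonneg_AE AE_I2) (auto simp: sl_limit_a_def indicator_def)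
  then have L: "?L > 0" using measure_limit_a_pos measure_nonneg[of lborel limit_b_small] measure_nonneg[of lborel limit_b_large] by linarith
  have "((\<lambda>t. (t\<^sup>2 * measure lborel (sa_clear t) + t\<^sup>2 * measure lborel (sl_clear t)) / ?M) \<longlongrightarrow> ?L / ?M) at_top"
    using M by (intro tendsto_divide tendsto_add tendsto_sa_clear tendsto_sl_clear tendsto_const) simp
  moreover have "tail (gap_density m_W R_W) t / (1 / t\<^sup>2) = (t\<^sup>2 * measure lborel (sa_clear t) + t\<^sup>2 * measure lborel (sl_clear t)) / ?M" for t
    unfolding tail_eqs(3) sa_clear_def sl_clear_def by (simp add: algebra_simps add_divide_distrib)
  ultimately have "((\<lambda>t. tail (gap_density m_W R_W) t / (1 / t\<^sup>2)) \<longlongrightarrow> ?L / ?M) at_top" by simp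
  then show ?thesis unfolding asymptotic_def using divide_pos_pos[OF L M] by blast
qed

lemma comparable_tail_tor:
  assumes q: "q \<ge> 1"
  shows "comparable (tail (gap_density (m_tor q) R_Omega)) (\<lambda>t. 1 / t\<^sup>2)"
proof -
  let ?D = "measure lborel Delta"
  have D: "?D > 0" using emeasure_Delta_pos emeasure_coords_finite(1) by (simp add: measure_def enn2real_positive_iff)
  have "\<forall>\<^sub>F t in at_top. 1 / 4 / ?D \<le> tail (gap_density (m_tor q) R_Omega) t / (1 / t\<^sup>2) \<and> tail (gap_density (m_tor q) R_Omega) t / (1 / t\<^sup>2) \<le> 52 / ?D"
    using eventually_ge_at_top[of 1]
  proof eventually_elim
    case (elim t)
    let ?S = "measure lborel {p \<in> Delta. clear t (sl_pt 1 (fst p, snd p, 1 / real q, 0))}"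
    have b: "1 / 4 \<le> ?S * t\<^sup>2" "?S * t\<^sup>2 \<le> 52"
      using measure_tor_bounds[OF q elim] elim by (simp_all add: divide_le_eq le_divide_eq)
    have "tail (gap_density (m_tor q) R_Omega) t / (1 / t\<^sup>2) = (?S * t\<^sup>2) / ?D" unfolding tail_eqs(2)[OF q] by simp
    then show ?case using divide_right_mono[OF b(1), of ?D] divide_right_mono[OF b(2), of ?D] D by simp
  qed
  then show ?thesis unfolding comparable_def using D by (intro exI[of _ "1 / 4 / ?D"] exI[of _ "52 / ?D"] conjI) auto
qed

lemma tail_Omega_bigo:
  "(\<lambda>t. 1 / t\<^sup>2) \<in> O[at_top](tail (gap_density m_Omega R_Omega))"
  "tail (gap_density m_Omega R_Omega) \<in> O[at_top](\<lambda>t. 1 / t)"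
proof -
  let ?M = "measure lborel Omega_coords" and ?S = "\<lambda>t. measure lborel {p \<in> Omega_coords. clear t (sa_pt 1 p)}"
  have M: "?M > 0" using measure_Omega_clear_less[of 1] measure_nonneg[of lborel "{p \<in> Omega_coords. clear 1 (sa_pt 1 p)}"] by linarith
  show "(\<lambda>t. 1 / t\<^sup>2) \<in> O[at_top](tail (gap_density m_Omega R_Omega))"
  proof (rule bigoI)
    show "\<forall>\<^sub>F t in at_top. norm (1 / t\<^sup>2) \<le> (64 * ?M) * norm (tail (gap_density m_Omega R_Omega) t)"
      using eventually_ge_at_top[of 1]
    proof eventually_elim
      case (elim t)
      have "1 / t\<^sup>2 \<le> 64 * ?S t" using measure_sa_clear_lower[OF elim] by simp
      moreover have "(64 * ?M) * norm (tail (gap_density m_Omega R_Omega) t) = 64 * ?S t" unfolding tail_eqs(1) using M by simp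
      ultimately show ?case by simp
    qed
  qed
  show "tail (gap_density m_Omega R_Omega) \<in> O[at_top](\<lambda>t. 1 / t)"
  proof (rule bigoI)
    show "\<forall>\<^sub>F t in at_top. norm (tail (gap_density m_Omega R_Omega) t) \<le> (72 / ?M) * norm (1 / t)"
      using eventually_ge_at_top[of 4]
    proof eventually_elim
      case (elim t)
      have "?S t / ?M \<le> (72 / t) / ?M" using measure_sa_clear_upper[OF elim] M by (intro divide_right_mono) auto
      then show ?case unfolding tail_eqs(1) using M elim by (simp add: mult.commute)
    qed
  qed
qed

lemma gap_proportion_Omega:
  assumes law: "\<And>B. B \<in> sets borel \<Longrightarrow> (LINT x:B|lborel. gap_density \<mu> R_Omega x) = measure \<mu> {x \<in> space \<mu>. R_Omega x \<in> B}"
    and R: "R_Omega \<in> borel_measurable \<mu>" and x: "\<Lambda> \<in> Omega" "generic \<mu> C R_Omega T_Omega \<Lambda>"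
    and I: "is_interval I" "I \<in> sets borel"
  shows "gap_proportion \<Lambda> I (LINT x:I|lborel. gap_density \<mu> R_Omega x)"
  unfolding law[OF I(2)]
  using gaps_Omega[OF x(1)] x(2) I(1) measurable_sets[OF R I(2)]
  by (intro generic_imp_gap_proportion) (auto simp: vimage_def Int_def conj_commute)

lemma gap_proportion_W:
  assumes x: "\<omega> \<in> W_space" "generic m_W C R_W T_W \<omega>" and I: "is_interval I" "I \<in> sets borel"
  shows "gap_proportion (holonomy \<omega>) I (LINT x:I|lborel. gap_density m_W R_W x)"
  unfolding law_m_W(1)[OF I(2)]
  using gaps_W[OF x(1)] x(2) I(1) measurable_sets[OF borel_measurable_R_W I(2)]
  by (intro generic_imp_gap_proportion) (auto simp: vimage_def Int_def conj_commute)

lemma support_at_zero_Omega: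
  assumes e: "\<epsilon> > 0"
  shows "(LINT x:{0<..<\<epsilon>}|lborel. gap_density m_Omega R_Omega x) > 0"
proof -
  have "measure m_Omega {x \<in> space m_Omega. R_Omega x \<in> {\<epsilon> / 2<..}} < 1"
    unfolding law_m_Omega(2) using measure_Omega_clear_less[of "\<epsilon> / 2"] e measure_nonneg[of lborel "{p \<in> Omega_coords. clear (\<epsilon> / 2) (sa_pt 1 p)}"]
    by (simp add: divide_less_eq)
  moreover have "R_Omega x > 0" if "x \<in> space m_Omega" for x
    using that R_Omega_Least(2)[of x] by (simp add: m_Omega_def space_Omega_borel)
  ultimately show ?thesis unfolding law_m_Omega(1)[OF borel_open[OF open_greaterThanLessThan]]
    by (intro support_at_zero law_m_Omega(3-5) e)
qed

lemma support_at_zero_W: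
  assumes e: "\<epsilon> > 0"
  shows "(LINT x:{0<..<\<epsilon>}|lborel. gap_density m_W R_W x) > 0"
proof -
  let ?t = "\<epsilon> / 2" and ?M = "measure lborel Omega_coords + measure lborel sl_coords"
  have "measure lborel {p \<in> Omega_coords. clear3 ?t (\<lambda>k. sa_pt k p)} \<le> measure lborel {p \<in> Omega_coords. clear ?t (sa_pt 1 p)}"
  proof (rule measure_mono_fmeasurable)
    have S: "{p. clear ?t (sa_pt 1 p)} \<in> sets borel" by (rule sets_clear) measurable
    have "{p \<in> Omega_coords. clear ?t (sa_pt 1 p)} = Omega_coords \<inter> {p. clear ?t (sa_pt 1 p)}" by auto
    then have m: "{p \<in> Omega_coords. clear ?t (sa_pt 1 p)} \<in> sets lborel" using S sets_Delta_coords(2) by simp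
    have "emeasure lborel {p \<in> Omega_coords. clear ?t (sa_pt 1 p)} \<le> emeasure lborel Omega_coords"
      using sets_Delta_coords(2) by (intro emeasure_mono) auto
    then show "{p \<in> Omega_coords. clear ?t (sa_pt 1 p)} \<in> fmeasurable lborel"
      using m emeasure_Omega_coords_finite by (intro fmeasurableI) auto
  qed (use sets_clear3_coords(1) in \<open>auto simp: clear3_def\<close>)
  moreover have "measure lborel {p \<in> sl_coords. clear3 ?t (\<lambda>k. sl_pt k p)} \<le> measure lborel sl_coords"
    using sets_clear3_coords(2) sets_Delta_coords emeasure_coords_finite(2)
    by (intro measure_mono_fmeasurable fmeasurableI) auto
  moreover have "measure lborel {p \<in> Omega_coords. clear ?t (sa_pt 1 p)} < measure lborel Omega_coords"
    by (rule measure_Omega_clear_less) (use e in simp)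
  moreover have "?M > 0" using calculation(3) measure_nonneg[of lborel "{p \<in> Omega_coords. clear ?t (sa_pt 1 p)}"]
    measure_nonneg[of lborel sl_coords] by linarith
  ultimately have "measure m_W {x \<in> space m_W. R_W x \<in> {?t<..}} < 1"
    unfolding law_m_W(2) by (simp add: divide_less_eq)
  moreover have "R_W x > 0" if "x \<in> space m_W" for x
    using that R_W_Least(2)[of x] by (simp add: m_W_space_sets)
  ultimately show ?thesis unfolding law_m_W(1)[OF borel_open[OF open_greaterThanLessThan]]
    by (intro support_at_zero law_m_W(3-4) borel_measurable_R_W e)
qed

theorem theorem4p4:
  fixes g f :: "real \<Rightarrow> real" and gq :: "nat \<Rightarrow> real \<Rightarrow> real"
  defines "g \<equiv> gap_density m_Omega R_Omega"
    and "gq \<equiv> (\<lambda>q. gap_density (m_tor q) R_Omega)"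
    and "f \<equiv> gap_density m_W R_W"
  shows
    "((\<lambda>t. 1 / t\<^sup>2) \<in> O[at_top](tail g) \<and> tail g \<in> O[at_top](\<lambda>t. 1 / t) \<and>
        (\<forall>\<Lambda>\<in>Omega. generic m_Omega Omega_test R_Omega T_Omega \<Lambda> \<longrightarrow>
           (\<forall>t\<ge>0. gap_proportion \<Lambda> {t<..} (tail g t))))
     \<and> (\<forall>\<epsilon>>0. (LINT x:{0<..<\<epsilon>}|lborel. g x) > 0 \<and>
        (\<forall>\<Lambda>\<in>Omega. generic m_Omega Omega_test R_Omega T_Omega \<Lambda> \<longrightarrow>
           gap_proportion \<Lambda> {0<..<\<epsilon>} (LINT x:{0<..<\<epsilon>}|lborel. g x)))
     \<and> (\<forall>q\<ge>1. comparable (tail (gq q)) (\<lambda>t. 1 / t\<^sup>2) \<and>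
        (\<forall>\<Lambda>\<in>Omega. generic (m_tor q) Omega_test R_Omega T_Omega \<Lambda> \<longrightarrow>
           (\<forall>t\<ge>0. gap_proportion \<Lambda> {t<..} (tail (gq q) t))))
     \<and> (asymptotic (tail f) (\<lambda>t. 1 / t\<^sup>2) \<and>
        (\<forall>\<omega>\<in>W_space. generic m_W W_test R_W T_W \<omega> \<longrightarrow>
           (\<forall>t\<ge>0. gap_proportion (holonomy \<omega>) {t<..} (tail f t))))
     \<and> (\<forall>\<epsilon>>0. (LINT x:{0<..<\<epsilon>}|lborel. f x) > 0 \<and>
        (\<forall>\<omega>\<in>W_space. generic m_W W_test R_W T_W \<omega> \<longrightarrow>
           gap_proportion (holonomy \<omega>) {0<..<\<epsilon>} (LINT x:{0<..<\<epsilon>}|lborel. f x)))"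
proof -
  have ray: "is_interval {t<..}" "{t<..} \<in> sets borel" and seg: "is_interval {0<..<t}" "{0<..<t} \<in> sets borel" for t :: real
    by (simp_all add: is_interval_1 is_interval_io is_interval_oo)
  show ?thesis
    unfolding g_def gq_def f_def
  proof (intro conjI allI ballI impI)
    fix \<Lambda> and t :: real assume x: "\<Lambda> \<in> Omega" "generic m_Omega Omega_test R_Omega T_Omega \<Lambda>"
    note gap = gap_proportion_Omega[OF law_m_Omega(1,5) x]
    show "gap_proportion \<Lambda> {t<..} (tail (gap_density m_Omega R_Omega) t)" unfolding tail_def by (rule gap[OF _ ray])
    show "gap_proportion \<Lambda> {0<..<t} (LINT x:{0<..<t}|lborel. gap_density m_Omega R_Omega x)" by (rule gap[OF _ seg])
  next
    fix q :: nat and \<Lambda> and t :: real assume x: "1 \<le> q" "\<Lambda> \<in> Omega" "generic (m_tor q) Omega_test R_Omega T_Omega \<Lambda>"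
    show "gap_proportion \<Lambda> {t<..} (tail (gap_density (m_tor q) R_Omega) t)"
      unfolding tail_def by (rule gap_proportion_Omega[OF law_m_tor(1,3)[OF x(1)] x(2,3) ray])
  next
    fix \<omega> and t :: real assume x: "\<omega> \<in> W_space" "generic m_W W_test R_W T_W \<omega>"
    show "gap_proportion (holonomy \<omega>) {t<..} (tail (gap_density m_W R_W) t)" unfolding tail_def by (rule gap_proportion_W[OF x ray])
    show "gap_proportion (holonomy \<omega>) {0<..<t} (LINT x:{0<..<t}|lborel. gap_density m_W R_W x)" by (rule gap_proportion_W[OF x seg])
  qed (fact tail_Omega_bigo support_at_zero_Omega support_at_zero_W asymptotic_tail_W | (rule comparable_tail_tor, assumption) | (rule support_at_zero_Omega support_at_zero_W, assumption))+
qed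

end
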